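(* Let $X$ be a compact metric space, $F=(f_t)_{t\in\mathbb{R}}$ a continuous flow on $X$, and $\phi\colon X\to\mathbb{R}$ continuous. Suppose there are $\delta,\varepsilon>0$ with $\varepsilon>40\delta$ such that $P^\perp_{\exp}(\phi,\varepsilon)<P(\phi)$ and there exists $\mathcal{D}\subset X\times\mathbb{R}^+$ which admits a decomposition $(\mathcal{P},\mathcal{G},\mathcal{S})$ such that: (I$'$) for every $M\in\mathbb{R}^+$, $\mathcal{G}^M$ has tail (W)-specification at scale $\delta$; (II) $\phi$ has the Bowen property at scale $\varepsilon$ on $\mathcal{G}$; (III$'$) $P(\mathcal{D}^c\cup[\mathcal{P}]\cup[\mathcal{S}],\phi,\delta,\varepsilon)<P(\phi)$. Then $(X,F,\phi)$ has a unique equilibrium state.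
   Context: $\mathbb{R}^+=[0,\infty)$; $d$ the metric. $d_t(x,y)=\sup_{s\in[0,t]}d(f_sx,f_sy)$, $B_t(x,\delta)=\{y:d_t(x,y)<\delta\}$; $E$ is $(t,\delta)$-separated if $d_t(x,y)>\delta$ for distinct $x,y\in E$. Pairs $(x,t)\in X\times\mathbb{R}^+$ are orbit segments ($(x,0)$ empty); $\mathcal{C}_t=\{x:(x,t)\in\mathcal{C}\}$; $\mathcal{D}^c=(X\times\mathbb{R}^+)\setminus\mathcal{D}$. $\Phi_\varepsilon(x,t)=\sup_{y\in B_t(x,\varepsilon)}\int_0^t\phi(f_sy)\,ds$; $\Lambda(\mathcal{C},\phi,\delta,\varepsilon,t)=\sup\{\sum_{x\in E}e^{\Phi_\varepsilon(x,t)}:E\subset\mathcal{C}_t\ (t,\delta)\text{-separated}\}$; $P(\mathcal{C},\phi,\delta,\varepsilon)=\limsup_{t\to\infty}\frac1t\log\Lambda(\mathcal{C},\phi,\delta,\varepsilon,t)$; $P(\phi)$ is the topological pressure. An equilibrium state is an $F$-invariant Borel probability measure maximizing $h_\mu(f_1)+\int\phi\,d\mu$. $\Gamma_\varepsilon(x)=\{y:d(f_tx,f_ty)\le\varepsilon\ \forall t\in\mathbb{R}\}$, $\mathrm{NE}(\varepsilon)=\{x:\Gamma_\varepsilon(x)\not\subset\{f_tx:t\in\mathbb{R}\}\}$, $P^\perp_{\exp}(\phi,\varepsilon)=\sup\{h_\mu(f_1)+\int\phi\,d\mu:\mu\text{ ergodic }F\text{-invariant},\ \mu(\mathrm{NE}(\varepsilon))>0\}$.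 Decomposition for $\mathcal{D}$: $\mathcal{P},\mathcal{G},\mathcal{S}\subset X\times\mathbb{R}^+$ and $p,g,s:\mathcal{D}\to\mathbb{R}^+$ with $t=p+g+s$, $(x,p)\in\mathcal{P}$, $(f_px,g)\in\mathcal{G}$, $(f_{p+g}x,s)\in\mathcal{S}$ for every $(x,t)\in\mathcal{D}$; standing assumption $X\times\{0\}\subset\mathcal{P}\cap\mathcal{G}\cap\mathcal{S}$. $\mathcal{G}^M=\{(x,t)\in\mathcal{D}:p(x,t)\le M,\ s(x,t)\le M\}$. $[\mathcal{C}]=\{(x,n)\in X\times\mathbb{N}:(f_{-s}x,n+s+t)\in\mathcal{C}\text{ for some }s,t\in[0,1]\}$. (W)-specification at scale $\delta$ for $\mathcal{G}'\subset X\times\mathbb{R}^+$: there is $\tau>0$ such that for every $\{(x_i,t_i)\}_{i=1}^k\subset\mathcal{G}'$ there are $y$ and $\tau_1,\dots,\tau_{k-1}\in[0,\tau]$ with $d_{t_j}(f_{s_{j-1}+\tau_{j-1}}y,x_j)<\delta$ for all $j$, where $s_j=\sum_{i\le j}t_i+\sum_{i\le j-1}\tau_i$, $s_0=\tau_0=0$; and if two collections agree in their first $j$ entries, their gluing times agree for indices $<j$. Tail (W)-specification at scale $\delta$: there is $T_0>0$ such that $\mathcal{G}'\cap(X\times[T_0,\infty))$ has (W)-specification at scale $\delta$. Bowen property at scale $\varepsilon$ on $\mathcal{C}$: there is $K$ with $\sup_{y\in B_t(x,\varepsilon)}|\int_0^t\phi(f_sx)ds-\int_0^t\phi(f_sy)ds|\le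 K$ for all $(x,t)\in\mathcal{C}$. *)

theory Defs
  imports "HOL-Probability.Probability"
begin

text \<open>The compact metric space X is the universe of a type 'a; a flow is
f :: real => 'a => 'a with f t = f_t.\<close>

definition continuous_flow :: "(real \<Rightarrow> 'a::metric_space \<Rightarrow> 'a) \<Rightarrow> bool" where
  "continuous_flow f \<longleftrightarrow>
     continuous_on UNIV (\<lambda>(t, x). f t x) \<and>
     (\<forall>x. f 0 x = x) \<and> (\<forall>s t x. f (s + t) x = f s (f t x))"

definition bowen_dist :: "(real \<Rightarrow> 'a::metric_space \<Rightarrow> 'a) \<Rightarrow> real \<Rightarrow> 'a \<Rightarrow> 'a \<Rightarrow> real" where
  "bowen_dist f t x y = Sup ((\<lambda>s. dist (f s x) (f s y)) ` {0..t})"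

definition bowen_ball :: "(real \<Rightarrow> 'a::metric_space \<Rightarrow> 'a) \<Rightarrow> real \<Rightarrow> 'a \<Rightarrow> real \<Rightarrow> 'a set" where
  "bowen_ball f t x r = {y. bowen_dist f t x y < r}"

definition separated :: "(real \<Rightarrow> 'a::metric_space \<Rightarrow> 'a) \<Rightarrow> real \<Rightarrow> real \<Rightarrow> 'a set \<Rightarrow> bool" where
  "separated f t \<delta> E \<longleftrightarrow> (\<forall>x\<in>E. \<forall>y\<in>E. x \<noteq> y \<longrightarrow> bowen_dist f t x y > \<delta>)"

definition birkhoff_int :: "(real \<Rightarrow> 'a \<Rightarrow> 'a) \<Rightarrow> ('a \<Rightarrow> real) \<Rightarrow> 'a \<Rightarrow> real \<Rightarrow> real" where
  "birkhoff_int f \<phi> x t = integral {0..t} (\<lambda>s. \<phi> (f s x))"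

definition Phi_eps :: "(real \<Rightarrow> 'a::metric_space \<Rightarrow> 'a) \<Rightarrow> ('a \<Rightarrow> real) \<Rightarrow> real \<Rightarrow> 'a \<Rightarrow> real \<Rightarrow> real" where
  "Phi_eps f \<phi> \<epsilon> x t = Sup ((\<lambda>y. birkhoff_int f \<phi> y t) ` bowen_ball f t x \<epsilon>)"

definition slice :: "('a \<times> real) set \<Rightarrow> real \<Rightarrow> 'a set" where
  "slice C t = {x. (x, t) \<in> C}"

text \<open>Partition sums: supremum over (t,delta)-separated subsets E of C_t
 (such sets are finite since X is compact) of the sum of exp(Phi(x,t)).\<close>
definition Lambda_gen :: "(real \<Rightarrow> 'a::metric_space \<Rightarrow> 'a) \<Rightarrow> ('a \<Rightarrow> real \<Rightarrow> real) \<Rightarrow>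
    ('a \<times> real) set \<Rightarrow> real \<Rightarrow> real \<Rightarrow> ereal" where
  "Lambda_gen f \<Phi> C \<delta> t =
     Sup {ereal (\<Sum>x\<in>E. exp (\<Phi> x t)) | E. finite E \<and> E \<subseteq> slice C t \<and> separated f t \<delta> E}"

definition Lambda :: "(real \<Rightarrow> 'a::metric_space \<Rightarrow> 'a) \<Rightarrow> ('a \<times> real) set \<Rightarrow> ('a \<Rightarrow> real) \<Rightarrow>
    real \<Rightarrow> real \<Rightarrow> real \<Rightarrow> ereal" where
  "Lambda f C \<phi> \<delta> \<epsilon> t = Lambda_gen f (Phi_eps f \<phi> \<epsilon>) C \<delta> t"

definition elog :: "ereal \<Rightarrow> ereal" where
  "elog x = (if x \<le> 0 then -\<infinity> else if x = \<infinity> then \<infinity> else ereal (ln (real_of_ereal x)))"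

definition growth_rate :: "(real \<Rightarrow> ereal) \<Rightarrow> ereal" where
  "growth_rate L = Limsup at_top (\<lambda>t::real. elog (L t) / ereal t)"

definition pressure_C :: "(real \<Rightarrow> 'a::metric_space \<Rightarrow> 'a) \<Rightarrow> ('a \<times> real) set \<Rightarrow> ('a \<Rightarrow> real) \<Rightarrow>
    real \<Rightarrow> real \<Rightarrow> ereal" where
  "pressure_C f C \<phi> \<delta> \<epsilon> = growth_rate (Lambda f C \<phi> \<delta> \<epsilon>)"

definition top_pressure :: "(real \<Rightarrow> 'a::metric_space \<Rightarrow> 'a) \<Rightarrow> ('a \<Rightarrow> real) \<Rightarrow> ereal" where
  "top_pressure f \<phi> =
     Lim (at_right (0::real))
       (\<lambda>\<delta>. growth_rate (Lambda_gen f (birkhoff_int f \<phi>) (UNIV \<times> {0..}) \<delta>))"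

definition invariant_measure :: "(real \<Rightarrow> 'a::metric_space \<Rightarrow> 'a) \<Rightarrow> 'a measure \<Rightarrow> bool" where
  "invariant_measure f \<mu> \<longleftrightarrow>
     sets \<mu> = sets borel \<and> prob_space \<mu> \<and>
     (\<forall>t. f t \<in> measurable \<mu> \<mu> \<and> distr \<mu> \<mu> (f t) = \<mu>)"

definition ergodic_measure :: "(real \<Rightarrow> 'a::metric_space \<Rightarrow> 'a) \<Rightarrow> 'a measure \<Rightarrow> bool" where
  "ergodic_measure f \<mu> \<longleftrightarrow> invariant_measure f \<mu> \<and>
     (\<forall>A\<in>sets \<mu>. (\<forall>t. f t -` A = A) \<longrightarrow> measure \<mu> A = 0 \<or> measure \<mu> A = 1)"

definition meas_partition :: "'a measure \<Rightarrow> 'a set set \<Rightarrow> bool" where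
  "meas_partition \<mu> \<xi> \<longleftrightarrow> finite \<xi> \<and> \<xi> \<subseteq> sets \<mu> \<and> \<Union>\<xi> = space \<mu> \<and>
     (\<forall>A\<in>\<xi>. \<forall>B\<in>\<xi>. A \<noteq> B \<longrightarrow> A \<inter> B = {})"

definition plogp :: "real \<Rightarrow> real" where
  "plogp x = (if x = 0 then 0 else x * ln x)"

definition part_entropy :: "'a measure \<Rightarrow> 'a set set \<Rightarrow> real" where
  "part_entropy \<mu> \<xi> = - (\<Sum>A\<in>\<xi>. plogp (measure \<mu> A))"

text \<open>Join of T^{-i} xi for i < n, where T = f_1, so T^i = f_i.\<close>
definition join_part :: "(real \<Rightarrow> 'a \<Rightarrow> 'a) \<Rightarrow> 'a set set \<Rightarrow> nat \<Rightarrow> 'a set set" where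
  "join_part f \<xi> n = {(\<Inter>i<n. f (real i) -` a i) | a. \<forall>i<n. a i \<in> \<xi>}"

definition part_entropy_rate :: "(real \<Rightarrow> 'a \<Rightarrow> 'a) \<Rightarrow> 'a measure \<Rightarrow> 'a set set \<Rightarrow> real" where
  "part_entropy_rate f \<mu> \<xi> = lim (\<lambda>n. part_entropy \<mu> (join_part f \<xi> (Suc n)) / real (Suc n))"

definition ks_entropy :: "(real \<Rightarrow> 'a \<Rightarrow> 'a) \<Rightarrow> 'a measure \<Rightarrow> ereal" where
  "ks_entropy f \<mu> = Sup {ereal (part_entropy_rate f \<mu> \<xi>) | \<xi>. meas_partition \<mu> \<xi>}"

definition free_energy :: "(real \<Rightarrow> 'a \<Rightarrow> 'a) \<Rightarrow> ('a \<Rightarrow> real) \<Rightarrow> 'a measure \<Rightarrow> ereal" where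
  "free_energy f \<phi> \<mu> = ks_entropy f \<mu> + ereal (integral\<^sup>L \<mu> \<phi>)"

definition equilibrium_state :: "(real \<Rightarrow> 'a::metric_space \<Rightarrow> 'a) \<Rightarrow> ('a \<Rightarrow> real) \<Rightarrow> 'a measure \<Rightarrow> bool" where
  "equilibrium_state f \<phi> \<mu> \<longleftrightarrow> invariant_measure f \<mu> \<and>
     (\<forall>\<nu>. invariant_measure f \<nu> \<longrightarrow> free_energy f \<phi> \<nu> \<le> free_energy f \<phi> \<mu>)"

definition Gamma_eps :: "(real \<Rightarrow> 'a::metric_space \<Rightarrow> 'a) \<Rightarrow> real \<Rightarrow> 'a \<Rightarrow> 'a set" where
  "Gamma_eps f \<epsilon> x = {y. \<forall>t. dist (f t x) (f t y) \<le> \<epsilon>}"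

definition NE :: "(real \<Rightarrow> 'a::metric_space \<Rightarrow> 'a) \<Rightarrow> real \<Rightarrow> 'a set" where
  "NE f \<epsilon> = {x. \<not> Gamma_eps f \<epsilon> x \<subseteq> range (\<lambda>t. f t x)}"

text \<open>mu(NE) > 0 is read as positive outer measure (NE(eps) is universally measurable,
 so this agrees with the completed measure).\<close>
definition positive_outer :: "'a measure \<Rightarrow> 'a set \<Rightarrow> bool" where
  "positive_outer \<mu> N \<longleftrightarrow> \<not> (\<exists>A\<in>sets \<mu>. N \<subseteq> A \<and> emeasure \<mu> A = 0)"

definition P_perp_exp :: "(real \<Rightarrow> 'a::metric_space \<Rightarrow> 'a) \<Rightarrow> ('a \<Rightarrow> real) \<Rightarrow> real \<Rightarrow> ereal" where
  "P_perp_exp f \<phi> \<epsilon> =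
     Sup {free_energy f \<phi> \<mu> | \<mu>. ergodic_measure f \<mu> \<and> positive_outer \<mu> (NE f \<epsilon>)}"

definition orbit_segments :: "('a \<times> real) set" where
  "orbit_segments = UNIV \<times> {0..}"

definition decomposition ::
  "(real \<Rightarrow> 'a \<Rightarrow> 'a) \<Rightarrow> ('a \<times> real) set \<Rightarrow> ('a \<times> real) set \<Rightarrow> ('a \<times> real) set \<Rightarrow> ('a \<times> real) set \<Rightarrow>
   ('a \<times> real \<Rightarrow> real) \<Rightarrow> ('a \<times> real \<Rightarrow> real) \<Rightarrow> ('a \<times> real \<Rightarrow> real) \<Rightarrow> bool" where
  "decomposition f D P G S p g s \<longleftrightarrow>
     D \<subseteq> orbit_segments \<and> P \<subseteq> orbit_segments \<and> G \<subseteq> orbit_segments \<and> S \<subseteq> orbit_segments \<and>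
     UNIV \<times> {0} \<subseteq> P \<inter> G \<inter> S \<and>
     (\<forall>(x, t)\<in>D. p (x, t) \<ge> 0 \<and> g (x, t) \<ge> 0 \<and> s (x, t) \<ge> 0 \<and>
        t = p (x, t) + g (x, t) + s (x, t) \<and>
        (x, p (x, t)) \<in> P \<and>
        (f (p (x, t)) x, g (x, t)) \<in> G \<and>
        (f (p (x, t) + g (x, t)) x, s (x, t)) \<in> S)"

definition G_M :: "('a \<times> real) set \<Rightarrow> ('a \<times> real \<Rightarrow> real) \<Rightarrow> ('a \<times> real \<Rightarrow> real) \<Rightarrow> real \<Rightarrow> ('a \<times> real) set" where
  "G_M D p s M = {(x, t) \<in> D. p (x, t) \<le> M \<and> s (x, t) \<le> M}"

text \<open>[C], viewed inside X x R+ via the inclusion N into R.\<close>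
definition bracket :: "(real \<Rightarrow> 'a \<Rightarrow> 'a) \<Rightarrow> ('a \<times> real) set \<Rightarrow> ('a \<times> real) set" where
  "bracket f C = {(x, real n) | x n. \<exists>s\<in>{0..1}. \<exists>t\<in>{0..1}. (f (- s) x, real n + s + t) \<in> C}"

text \<open>(W)-specification at scale delta. A finite collection is a list xs of orbit
 segments; Tau xs i is the gluing time tau_{i+1} (0-based index i).\<close>
definition W_spec :: "(real \<Rightarrow> 'a::metric_space \<Rightarrow> 'a) \<Rightarrow> ('a \<times> real) set \<Rightarrow> real \<Rightarrow> bool" where
  "W_spec f G' \<delta> \<longleftrightarrow> (\<exists>\<tau>>0. \<exists>Tau :: ('a \<times> real) list \<Rightarrow> nat \<Rightarrow> real.
     (\<forall>xs. set xs \<subseteq> G' \<longrightarrow>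
        (\<forall>i. i + 1 < length xs \<longrightarrow> Tau xs i \<in> {0..\<tau>}) \<and>
        (\<exists>y. \<forall>j<length xs.
           bowen_dist f (snd (xs ! j))
             (f ((\<Sum>i<j. snd (xs ! i)) + (\<Sum>i<j. Tau xs i)) y) (fst (xs ! j)) < \<delta>)) \<and>
     (\<forall>xs ys j. set xs \<subseteq> G' \<and> set ys \<subseteq> G' \<and> j \<le> length xs \<and> j \<le> length ys \<and>
        take j xs = take j ys \<longrightarrow> (\<forall>i. i + 1 < j \<longrightarrow> Tau xs i = Tau ys i)))"

definition tail_W_spec :: "(real \<Rightarrow> 'a::metric_space \<Rightarrow> 'a) \<Rightarrow> ('a \<times> real) set \<Rightarrow> real \<Rightarrow> bool" where
  "tail_W_spec f G' \<delta> \<longleftrightarrow> (\<exists>T0>0. W_spec f (G' \<inter> (UNIV \<times> {T0..})) \<delta>)"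

definition bowen_property :: "(real \<Rightarrow> 'a::metric_space \<Rightarrow> 'a) \<Rightarrow> ('a \<Rightarrow> real) \<Rightarrow> real \<Rightarrow> ('a \<times> real) set \<Rightarrow> bool" where
  "bowen_property f \<phi> \<epsilon> C \<longleftrightarrow> (\<exists>K. \<forall>(x, t)\<in>C. \<forall>y\<in>bowen_ball f t x \<epsilon>.
     \<bar>birkhoff_int f \<phi> x t - birkhoff_int f \<phi> y t\<bar> \<le> K)"

end

theory Submission
  imports Defs
begin

text \<open>
  The gap between the pressure and the free energy of non-expansive measures makes every ergodic measure \<open>m\<close> of large free
  energy almost expansive, so that covers of \<open>d\<^sub>t\<close>-mesh \<open>\<epsilon>\<close> already bound its free energy. Gluing segments of \<open>G\<^sup>M\<close>
  bounds the partition sums of \<open>G\<^sup>M\<close> by a multiple of \<open>exp (t P)\<close>, and since prefixes and suffixes have smaller pressure the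
  same bound holds for the whole space, with an arbitrarily small proportion outside \<open>G\<^sup>M\<close>. A limit of weighted separated
  sets is then an equilibrium state \<open>\<mu>\<close>. Two distinct ergodic equilibrium states live on complementary invariant sets; each
  is seen by a definite proportion of \<open>G\<^sup>M\<close>, and gluing the one part to the other gives the transition from one invariant
  set to the other, within a bounded set of delays, a \<open>\<mu>\<close>-measure bounded below, which contradicts invariance.
\<close>


text \<open>All estimates are made at multiples of \<open>\<delta>\<close> below the one scale
  \<open>\<epsilon>\<close> at which expansiveness and the Bowen property are available. Shadowing
  costs \<open>\<delta>\<close>; following the glued orbit by a point of a
  \<open>5*\<delta>\<close>-spanning set raises the error to \<open>6*\<delta>\<close>; words are
  therefore told apart at \<open>13*\<delta>\<close>, and balls of that radius give covers of mesh
  \<open>26*\<delta>\<close>. The potential is controlled on good segments only, so partition sums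
  over arbitrary segments cannot be compared between scales. Weighted covers serve instead: each
  member carries its own bound for the Birkhoff integral, unions add weights and concatenations
  multiply them. In the uniqueness part the obstacle is that the invariant set separating two
  ergodic measures is merely Borel, while weak limits see closed sets. It is replaced by compact
  cores: a point that shadows a core point of the other side forever is non-expansive, so by
  compactness most points of one measure are separated from that core within a bounded time, and
  closed neighbourhoods of long good segments lie on the correct side up to small mass.\<close>

abbreviation (input) "cts == continuous_on UNIV"

abbreviation (input) "ind == indicator"

section \<open>Positive functionals on a compact metric space\<close>

text \<open>Positive normalised linear functionals on continuous functions. The type admits all
  functions, but the laws are imposed on continuous ones only, so values at discontinuous arguments
  carry no information.\<close>

definition state_on :: "(('a::topological_space=>real)=>real)=>bool" where
 "state_on L \<longleftrightarrow>
  (ALL g h. cts g --> cts h --> L (%x. g x+h x) = L g+L h) &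
  (ALL c g. cts g --> L (%x. c * g x) = c * L g) &
  (ALL g. cts g --> (ALL x. 0<=g x) --> 0<=L g) &
  L (%_. 1) = 1"

context
 fixes L :: "('a::metric_space=>real)=>real"
 assumes L: "state_on L"
begin

lemma state_add: "cts g ==> cts h ==> L (%x. g x+h x) = L g+L h"
 and state_cmult: "cts g ==> L (%x. c * g x) = c * L g"
 and state_nonneg: "cts g ==> (!!x. 0<=g x) ==> 0<=L g"
 and state_one: "L (%_. 1) = 1" using L unfolding state_on_def by blast+

lemma state_const: "L (%_. c) = c" using state_cmult[of "%_. 1" c] state_one by simp

lemma state_diff:
 assumes "cts g" "cts h"
 shows "L (%x. g x-h x) = L g-L h"
proof -
 have "L (%x. g x+(-1) * h x) = L g+L (%x. (-1) * h x)" by (rule state_add) (use assms in \<open>auto intro!: continuous_intros\<close>)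
 thus ?thesis using state_cmult[OF assms(2),of "-1"] by simp
qed

lemma state_mono:
 assumes "cts g" "cts h" "!!x. g x<=h x"
 shows "L g<=L h"
proof -
 have "0<=L (%x. h x-g x)" by (rule state_nonneg) (use assms in \<open>auto intro!: continuous_intros\<close>)
 thus ?thesis using state_diff[OF assms(2,1)] by simp
qed

lemma state_sum:
 assumes "finite I" "!!i. i\<in>I ==> cts (g i)"
 shows "L (%x. SUM i:I. g i x) = (SUM i:I. L (g i))" using assms
proof (induction I rule: finite_induct)
 case empty
 thus ?case using state_const[of 0] by simp
next
 case (insert i I)
 have "L (%x. g i x+(SUM i:I. g i x)) = L (g i)+L (%x. SUM i:I. g i x)"
  by (rule state_add) (use insert in \<open>auto intro!: continuous_intros\<close>)
 thus ?case using insert by simp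
qed

lemma state_abs_le:
 assumes "cts g" "!!x. \<bar>g x\<bar><=c"
 shows "\<bar>L g\<bar><=c"
proof -
 have "L g<=L (%_. c)" "L (%_. -c)<=L g"
  by (rule state_mono; use assms abs_le_D1 abs_le_D2 minus_le_iff in \<open>force intro!: continuous_intros\<close>)+
 thus ?thesis using state_const by auto
qed

text \<open>The inner mass of the Riesz construction. Competitors only have to lie below the
  indicator of \<open>U\<close>; cutting them off at a small height \<open>e\<close> later supplies
  the compactness that a condition on supports would give.\<close>

definition open_mass :: "'a set=>ennreal" where
 "open_mass U = (SUP g\<in>{g. cts g&(ALL x. 0<=g x&g x<=ind U x)}. ennreal (L g))"

definition outer_mass :: "'a set=>ennreal" where
 "outer_mass A = (INF U\<in>{U. open U&A\<subseteq>U}. open_mass U)"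

lemma open_mass_upper:
 "cts g ==> (!!x. 0<=g x) ==> (!!x. g x<=ind U x) ==> ennreal (L g) <= open_mass U"
 unfolding open_mass_def by (rule SUP_upper) auto

lemma open_mass_least:
 assumes "!!g. cts g ==> (!!x. 0<=g x) ==> (!!x. g x<=ind U x) ==> ennreal (L g)<=c"
 shows "open_mass U<=c" unfolding open_mass_def by (rule SUP_least) (use assms in auto)

lemma open_mass_mono: "U\<subseteq>V ==> open_mass U <= open_mass V"
 by (rule open_mass_least, rule open_mass_upper, assumption, assumption, rule order_trans, assumption)
  (auto simp: indicator_def)

lemma outer_mass_open: "open U ==> outer_mass U = open_mass U" unfolding outer_mass_def
 by (rule antisym[OF INF_lower INF_greatest]) (auto intro: open_mass_mono)

lemma open_mass_empty: "open_mass {} = 0"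
proof -
 have "open_mass {}<=0"
 proof (rule open_mass_least)
  fix g :: "'a=>real" assume "cts g" "!!x. 0<=g x" "!!x. g x<=ind {} (x::'a)"
  hence "g x = 0" for x using antisym[of "g x" 0] by simp
  hence "g = (%_. 0)" by auto
  thus "ennreal (L g)<=0" using state_const[of 0] by simp
 qed
 thus ?thesis by simp
qed

lemma open_mass_UNIV: "open_mass UNIV = 1"
proof (rule antisym)
 show "open_mass UNIV<=1"
 proof (rule open_mass_least)
  fix g :: "'a=>real" assume g: "cts g" "!!x. 0<=g x" "!!x. g x<=ind UNIV (x::'a)"
  hence "L g<=L (%_. 1)" by (intro state_mono) auto
  thus "ennreal (L g)<=1" using state_one by simp
 qed
 show "1 <= open_mass UNIV" using open_mass_upper[of "%_. 1" UNIV] state_one by simp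
qed

lemma outer_mass_mono: "A\<subseteq>B ==> outer_mass A <= outer_mass B" unfolding outer_mass_def by (rule INF_superset_mono) auto

lemma outer_mass_le_1: "outer_mass A<=1" using outer_mass_mono[of A UNIV] outer_mass_open[of UNIV] open_mass_UNIV by simp

end

section \<open>Continuous functions subordinate to open covers\<close>

lemma bump_function:
 fixes x :: "'a::metric_space"
 assumes "r > 0"
 obtains b :: "'a=>real" where "cts b" "!!y. 0<=b y" "!!y. b y<=1"
  "!!y. dist x y < r ==> b y = 1" "!!y. dist x y>=2 * r ==> b y = 0"
proof
 show "cts (%y. max 0 (min 1 (2-dist x y/r)))" using assms by (auto intro!: continuous_intros)
qed (use assms in \<open>auto simp: field_simps max_def min_def\<close>)

text \<open>A partition of unity without normalisation: a sum at least 1 on \<open>K\<close> is all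
  that domination arguments use. Bumps are grouped by the index of the open set that contains the
  ball of doubled radius.\<close>

lemma compact_cover_functions:
 fixes K :: "'a::metric_space set"
 assumes "compact K" "!!i. open (U i)" "K\<subseteq>(\<Union>i. U i)"
 obtains I h where "finite I" "!!i. cts (h i)" "!!i x. 0<=h i x"
  "!!i x. h i x<=ind (U i) x" "!!x. x\<in>K ==> 1<=(SUM i:I. h i x :: real)"
proof -
 have "ALL x:K. EX i r. r > 0&x\<in>U i&ball x (2 * r)\<subseteq>U i"
 proof
  fix x assume "x\<in>K"
  then obtain i where i: "x\<in>U i" using assms(3) by auto
  then obtain e where "e > 0" "ball x e\<subseteq>U i" using assms(2) open_contains_ball by blast
  thus "EX i r. r > 0&x\<in>U i&ball x (2 * r)\<subseteq>U i" using i by (intro exI[of _ i] exI[of _ "e/2"]) auto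
 qed
 then obtain ix rx where ir: "!!x. x\<in>K ==> rx x > 0&x\<in>U (ix x)&ball x (2 * rx x)\<subseteq>U (ix x)" by metis
 have "ALL x:K. EX b::'a=>real. cts b&(ALL y. 0<=b y&b y<=1&(dist x y < rx x --> b y = 1)&(dist x y>=2 * rx x --> b y = 0))"
 proof
  fix x assume "x\<in>K"
  with ir have "rx x > 0" by auto
  from bump_function[OF this,of x] show "EX b::'a=>real. cts b&(ALL y. 0<=b y&b y<=1&(dist x y < rx x --> b y = 1)&(dist x y>=2 * rx x --> b y = 0))"
   by metis
 qed
 then obtain b where b: "!!x. x\<in>K ==> cts (b x)&(ALL y. 0<=b x y&b x y<=(1::real)&(dist x y < rx x --> b x y = 1)&(dist x y>=2 * rx x --> b x y = 0))"
  by metis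
 obtain F where F: "F\<subseteq>K" "finite F" "K\<subseteq>(\<Union>x\<in>F. ball x (rx x))" using compactE_image[OF assms(1),of K "%x. ball x (rx x)"] ir
  by (metis (no_types, lifting) UN_I centre_in_ball open_ball subsetI)
 define h where "h i y = min 1 (SUM x:{x\<in>F. ix x = i}. b x y)" for i y
 have bF: "!!x y. x\<in>F ==> 0<=b x y" using b F(1) by auto
 show thesis
 proof (rule that[of "ix ` F" h])
  show "finite (ix ` F)" using F by auto
  show "cts (h i)" for i unfolding h_def using b F(1) by (auto intro!: continuous_intros)
  show "0<=h i x" for i x unfolding h_def using bF by (auto intro!: sum_nonneg)
  show "h i y<=ind (U i) y" for i y
  proof (cases "y\<in>U i")
   case False
   hence "b x y = 0" if "x\<in>F" "ix x = i" for x using ir[of x] b[of x] that F(1) by (auto simp: subset_eq not_less[symmetric])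
   thus ?thesis unfolding h_def by (simp add: False)
  qed (auto simp: h_def)
  fix y assume "y\<in>K"
  then obtain x where x: "x\<in>F" "dist x y < rx x" using F by auto
  have "1 = b x y" using b[of x] x F(1) by auto
  also have "\<dots><=(SUM x':{x'\<in>F. ix x' = ix x}. b x' y)" by (rule member_le_sum) (use x F bF in auto)
  finally have "h (ix x) y = 1" by (auto simp: h_def)
  moreover have "h (ix x) y<=(SUM i:ix ` F. h i y)" by (rule member_le_sum) (use x F bF in \<open>auto simp: h_def intro!: sum_nonneg\<close>)
  ultimately show "1<=(SUM i:ix ` F. h i y)" by simp
 qed
qed

section \<open>Caratheodory extension of a state\<close>

context
 fixes L :: "('a::metric_space=>real)=>real"
 assumes L: "state_on L" and comp: "compact (UNIV :: 'a set)"
begin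

lemma compact_superlevel: "cts g ==> compact {x::'a. (e::real)<=g x}"
 using comp closed_Collect_le[of "%_. e" g] compact_Int_closed[of UNIV] by auto

text \<open>A competitor \<open>g\<close> is below \<open>e\<close> off the compact set where
  \<open>e<=g\<close>, and finitely many functions below the indicators of the \<open>U i\<close>
  dominate it on that set. Hence \<open>g\<close> lies below \<open>e\<close> plus a finite sum of
  competitors for the \<open>U i\<close>.\<close>

lemma open_mass_countable_subadd:
 assumes U: "!!i. open (U i)"
 shows "open_mass L (\<Union>i::nat. U i)<=(\<Sum>i. open_mass L (U i))"
proof (rule open_mass_least[OF L])
 fix g :: "'a=>real" assume g: "cts g" "!!x. 0<=g x" "!!x. g x<=ind (\<Union>i. U i) (x::'a)"
 show "ennreal (L g)<=(\<Sum>i. open_mass L (U i))"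
 proof (rule ennreal_le_epsilon)
  fix e :: real assume e: "0 < e"
  have "{x. e<=g x}\<subseteq>(\<Union>i. U i)"
  proof
   fix x assume "x\<in>{x. e<=g x}"
   hence "g x > 0" using e by auto
   thus "x\<in>(\<Union>i. U i)" using g(3)[of x] by (cases "x\<in>(\<Union>i. U i)") (auto simp del: UN_iff)
  qed
  from compact_cover_functions[OF compact_superlevel[OF g(1),of e] U this] obtain I h
   where h: "finite I" "!!i. cts (h i)" "!!i x. 0<=h i x"
    "!!i x. h i x<=ind (U i) x" "!!x. x\<in>{x. e<=g x} ==> 1<=(SUM i:I. h i x :: real)" by metis
  have le: "g x<=e+(SUM i:I. h i x)" for x
  proof (cases "e<=g x")
   case True
   have "g x<=1" using g(3)[of x] by (rule order_trans) (simp add: indicator_def)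
   thus ?thesis using h(5)[of x] True e by auto
  next
   case False
   thus ?thesis using sum_nonneg[of I "%i. h i x"] h(3) by auto
  qed
  have "L g<=L (%x. e+(SUM i:I. h i x))" by (rule state_mono[OF L]) (use g h le in \<open>auto intro!: continuous_intros\<close>)
  also have "\<dots> = e+(SUM i:I. L (h i))" using h by (subst state_add[OF L]) (auto intro!: continuous_intros simp: state_const[OF L] state_sum[OF L])
  finally have "ennreal (L g)<=ennreal (e+(SUM i:I. L (h i)))" by (rule ennreal_leI)
  also have "\<dots> = (SUM i:I. ennreal (L (h i)))+ennreal e"
   using e h state_nonneg[OF L] by (subst ennreal_plus) (auto intro!: sum_nonneg simp: sum_ennreal add.commute)
  also have "(SUM i:I. ennreal (L (h i)))<=(SUM i:I. open_mass L (U i))" by (rule sum_mono) (use h open_mass_upper[OF L] in auto)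
  also have "\<dots><=(\<Sum>i. open_mass L (U i))" by (rule sum_le_suminf) (use h in auto)
  finally show "ennreal (L g)<=(\<Sum>i. open_mass L (U i))+ennreal e" by (simp add: add_right_mono)
 qed
qed

lemma outer_mass_space: "outer_measure_space (Pow UNIV) (outer_mass L)" unfolding outer_measure_space_def
proof (intro conjI)
 show "positive (Pow UNIV) (outer_mass L)" using outer_mass_open[OF L,of "{}"] open_mass_empty[OF L] by (simp add: positive_def)
 show "increasing (Pow UNIV) (outer_mass L)" using outer_mass_mono[OF L] by (simp add: increasing_def)
 show "countably_subadditive (Pow UNIV) (outer_mass L)"
 proof (unfold countably_subadditive_def, intro allI impI)
  fix A :: "nat=>'a set"
  show "outer_mass L (\<Union>i. A i)<=(\<Sum>n. outer_mass L (A n))"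
  proof (rule ennreal_le_epsilon)
   fix e :: real assume e: "0 < e" and fin: "(\<Sum>n. outer_mass L (A n)) < top"
   have "ALL n. EX U. open U&A n\<subseteq>U & open_mass L U <= outer_mass L (A n)+e * (1/2)^Suc n"
   proof
    fix n
    have "outer_mass L (A n) < top" using outer_mass_le_1[OF L,of "A n"] by (auto simp: top_unique less_top[symmetric])
    hence "outer_mass L (A n) < outer_mass L (A n)+e * (1/2)^Suc n" using e by (auto simp: less_top)
    hence "EX U:{U. open U&A n\<subseteq>U}. open_mass L U < outer_mass L (A n)+e * (1/2)^Suc n"
     unfolding outer_mass_def[OF L,of "A n"] INF_less_iff .
    thus "EX U. open U&A n\<subseteq>U & open_mass L U <= outer_mass L (A n)+e * (1/2)^Suc n" by (auto intro: less_imp_le)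
   qed
   then obtain U where U: "!!n. open (U n)" "!!n. A n\<subseteq>U n"
    "!!n. open_mass L (U n) <= outer_mass L (A n)+e * (1/2)^Suc n" by metis
   have "outer_mass L (\<Union>i. A i) <= outer_mass L (\<Union>i. U i)" by (rule outer_mass_mono[OF L]) (use U in auto)
   also have "\<dots> = open_mass L (\<Union>i. U i)" by (rule outer_mass_open[OF L]) (use U in auto)
   also have "\<dots><=(\<Sum>i. open_mass L (U i))" by (rule open_mass_countable_subadd) (use U in auto)
   also have "\<dots><=(\<Sum>n. outer_mass L (A n)+e * (1/2)^Suc n)" by (intro suminf_le allI U) auto
   also have "... = (\<Sum>n. outer_mass L (A n))+(\<Sum>n. ennreal e * ennreal ((1/2) ^ Suc n))" using \<open>0 < e\<close> by (subst suminf_add[symmetric])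
            (auto simp del: ennreal_suminf_cmult simp add: ennreal_mult[symmetric])
   also have "\<dots> = (\<Sum>n. outer_mass L (A n))+e" unfolding ennreal_suminf_cmult by (subst suminf_ennreal_eq[OF zero_le_power power_half_series]) auto
   finally show "outer_mass L (\<Union>i. A i)<=(\<Sum>n. outer_mass L (A n))+e" .
  qed
 qed
qed

lemma outer_mass_subadd: "outer_mass L (A\<union>B) <= outer_mass L A + outer_mass L B"
proof -
 define F where "F i = (if i = 0 then A else if i = (1::nat) then B-A else {})" for i
 have "outer_mass L (\<Union>i. F i)<=(\<Sum>i. outer_mass L (F i))"
 proof -
  have "disjoint_family F" by (auto simp: disjoint_family_on_def F_def)
  thus ?thesis using outer_mass_space unfolding outer_measure_space_def countably_subadditive_def by auto
 qed
 also have "(\<Union>i. F i) = A\<union>B" by (auto simp: F_def split: if_splits)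
 also have "(\<Sum>i. outer_mass L (F i)) = outer_mass L A + outer_mass L (B-A)"
  using outer_mass_open[OF L,of "{}"] open_mass_empty[OF L] by (subst suminf_finite[of "{0,1}"]) (auto simp: F_def)
 also have "\<dots> <= outer_mass L A + outer_mass L B" by (intro add_left_mono outer_mass_mono[OF L]) auto
 finally show ?thesis .
qed

text \<open>Let \<open>V\<close> be open around \<open>A\<close> and \<open>g\<close> a competitor
  for the intersection of \<open>V\<close> and \<open>U\<close>. The part \<open>W\<close> of
  \<open>V\<close> where \<open>g < e\<close> is open and contains \<open>A-U\<close>, and a
  competitor for \<open>W\<close> added to the positive part of \<open>g-e\<close> is still a
  competitor for \<open>V\<close>. Linearity then bounds \<open>L g\<close> plus the mass of
  \<open>W\<close> by the mass of \<open>V\<close> up to \<open>e\<close>.\<close>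

lemma open_in_lambda_system:
 assumes "open U"
 shows "U\<in>lambda_system UNIV (Pow UNIV) (outer_mass L)"
proof -
 have "outer_mass L (A\<inter>U) + outer_mass L (A-U) <= outer_mass L A" for A unfolding outer_mass_def[OF L,of A]
 proof (rule INF_greatest)
  fix V assume V: "V\<in>{U. open U&A\<subseteq>U}"
  have *: "ennreal (L g) + outer_mass L (A-U) <= open_mass L V"
   if g: "cts g" "!!x. 0<=g x" "!!x. g x<=ind (V\<inter>U) (x::'a)" for g
  proof (rule ennreal_le_epsilon)
   fix e :: real assume e: "0 < e"
   define W where "W = V\<inter>{x. g x < e}"
   have oW: "open W" unfolding W_def using V g(1) by (auto intro!: open_Int open_Collect_less)
   have "A-U\<subseteq>W"
   proof
    fix x assume "x\<in>A-U"
    thus "x\<in>W" using V g(3)[of x] e by (auto simp: W_def indicator_def)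
   qed
   hence 1: "outer_mass L (A-U) <= open_mass L W" using outer_mass_mono[OF L] outer_mass_open[OF L oW] by metis
   have "open_mass L W<=(open_mass L V+e)-ennreal (L g)"
   proof (rule open_mass_least[OF L])
    fix h :: "'a=>real" assume h: "cts h" "!!x. 0<=h x" "!!x. h x<=ind W (x::'a)"
    have "L (%x. max 0 (g x-e)+h x) = L (%x. max 0 (g x-e))+L h"
     by (rule state_add[OF L]) (use g h in \<open>auto intro!: continuous_intros\<close>)
    moreover have "L (%x. g x-e)<=L (%x. max 0 (g x-e))" by (rule state_mono[OF L]) (use g h in \<open>auto intro!: continuous_intros\<close>)
    moreover have "L (%x. g x-e) = L g-e" using state_diff[OF L g(1),of "%_. e"] state_const[OF L] by simp
    ultimately have "L g+L h<=L (%x. max 0 (g x-e)+h x)+e" by linarith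
    moreover have "ennreal (L (%x. max 0 (g x-e)+h x)) <= open_mass L V"
    proof (rule open_mass_upper[OF L])
     show "cts (%x. max 0 (g x-e)+h x)" using g h by (auto intro!: continuous_intros)
     show "0<=max 0 (g x-e)+h x" for x using h(2)[of x] by auto
     show "max 0 (g x-e)+h x<=ind V x" for x
     proof (cases "g x < e")
      case True
      thus ?thesis using h(3)[of x] by (cases "x\<in>V") (auto simp: W_def)
     next
      case False
      thus ?thesis using h(3)[of x] g(3)[of x] e by (cases "x\<in>V"; cases "x\<in>U") (auto simp: W_def)
     qed
    qed
    ultimately have "ennreal (L g+L h) <= open_mass L V+e"
     by (smt (verit) e ennreal_leI ennreal_plus add_right_mono order_trans L h g state_nonneg add_nonneg_nonneg continuous_on_add ennreal_plus_if)
    thus "ennreal (L h)<=(open_mass L V+e)-ennreal (L g)" using state_nonneg[OF L] g h by (simp add: ennreal_le_minus_iff ennreal_plus add.commute)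
   qed
   moreover have "ennreal (L g) <= open_mass L V+e"
   proof -
    have "ennreal (L g) <= open_mass L V" by (rule open_mass_upper[OF L g(1,2)]) (use g(3) in \<open>auto intro: order_trans[OF g(3)] simp: indicator_def\<close>)
    thus ?thesis by (simp add: add_increasing2)
   qed
   ultimately show "ennreal (L g) + outer_mass L (A-U) <= open_mass L V+e"
    using 1 by (metis (no_types, lifting) add.commute add_left_mono ennreal_diff_add_assoc dual_order.trans diff_add_cancel_ennreal)
  qed
  have "open_mass L (V\<inter>U) + outer_mass L (A-U) <= open_mass L V" unfolding open_mass_def[OF L,of "V\<inter>U"]
   by (subst ennreal_SUP_add_left[symmetric]) (use * in \<open>auto intro!: SUP_least exI[of _ "%_. 0"]\<close>)
  moreover have "outer_mass L (A\<inter>U) <= open_mass L (V\<inter>U)"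
   using outer_mass_mono[OF L,of "A\<inter>U" "V\<inter>U"] outer_mass_open[OF L open_Int,of V U] V assms
   by (metis (no_types, lifting) Int_mono mem_Collect_eq order_refl)
  ultimately show "outer_mass L (A\<inter>U) + outer_mass L (A-U) <= open_mass L V" by (meson add_right_mono order_trans)
 qed
 thus ?thesis unfolding algebra.lambda_system_eq[OF algebra_Pow] using outer_mass_subadd by (auto intro!: antisym simp: Int_commute Diff_eq[symmetric]
   simp: Compl_eq_Diff_UNIV[symmetric]) (metis Int_Diff_Un Int_commute)
qed


section \<open>The representing measure and its integral\<close>

definition riesz_measure :: "'a measure" where
 "riesz_measure = measure_of UNIV (sets borel) (outer_mass L)"

lemma sets_riesz_measure [simp]: "sets riesz_measure = sets borel" unfolding riesz_measure_def by (metis sets.sets_measure_of_eq space_borel)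

lemma emeasure_riesz_measure:
 assumes "A\<in>sets borel"
 shows "emeasure riesz_measure A = outer_mass L A"
proof -
 have ms: "measure_space UNIV (lambda_system UNIV (Pow UNIV) (outer_mass L)) (outer_mass L)"
  using sigma_algebra.caratheodory_lemma[OF sigma_algebra_Pow outer_mass_space] by simp
 have "sets (borel::'a measure)\<subseteq>lambda_system UNIV (Pow UNIV) (outer_mass L)"
 proof -
  have "sigma_algebra UNIV (lambda_system UNIV (Pow UNIV) (outer_mass L))" using ms by (simp add: measure_space_def)
  moreover have "Collect open\<subseteq>lambda_system UNIV (Pow UNIV) (outer_mass L)" using open_in_lambda_system by blast
  ultimately have "sigma_sets UNIV (Collect open)\<subseteq>lambda_system UNIV (Pow UNIV) (outer_mass L)" by (rule sigma_algebra.sigma_sets_subset)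
  thus ?thesis unfolding borel_def by simp
 qed
 hence "measure_space UNIV (sets borel) (outer_mass L)" using measure_down[OF ms sets.sigma_algebra_axioms[of "borel::'a measure", simplified]] by simp
 thus ?thesis unfolding riesz_measure_def using assms by (intro emeasure_measure_of_sigma) (auto simp: measure_space_def)
qed

lemma prob_space_riesz_measure: "prob_space riesz_measure"
proof
 have "space riesz_measure = UNIV" using sets_eq_imp_space_eq[OF sets_riesz_measure] by simp
 thus "emeasure riesz_measure (space riesz_measure) = 1" using emeasure_riesz_measure[of UNIV] outer_mass_open[OF L,of UNIV] open_mass_UNIV[OF L] by simp
qed

lemma state_le_measure_open:
 assumes "open U" "cts g" "!!x. 0<=g x" "!!x. g x<=ind U x"
 shows "L g<=measure riesz_measure U"
proof -
 interpret prob_space riesz_measure by (rule prob_space_riesz_measure)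
 have "ennreal (L g)<=emeasure riesz_measure U" using open_mass_upper[OF L assms(2-4)] emeasure_riesz_measure[of U] outer_mass_open[OF L] assms(1) by simp
 thus ?thesis by (simp add: emeasure_eq_measure)
qed

lemma integrable_riesz_continuous:
 fixes g :: "'a=>real"
 assumes "cts g" shows "integrable riesz_measure g"
proof -
 interpret prob_space riesz_measure by (rule prob_space_riesz_measure)
 obtain B where "!!x. \<bar>g x\<bar><=B" using compact_imp_bounded[OF compact_continuous_image[OF assms comp]] by (auto simp: bounded_iff)
 thus ?thesis by (intro integrable_const_bound[of _ B])
   (use assms in \<open>auto simp: borel_measurable_continuous_onI measurable_cong_sets[OF sets_riesz_measure refl]\<close>)
qed

text \<open>Slice g into layers of height 1/n.\<close>
lemma state_le_integral_unit:
 assumes g: "cts g" "!!x. 0<=g x" "!!x. g x<=1"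
 shows "L g<=integral\<^sup>L riesz_measure g"
proof (rule field_le_epsilon)
 fix e :: real assume e: "0 < e"
 interpret prob_space riesz_measure by (rule prob_space_riesz_measure)
 have sp[simp]: "space riesz_measure = UNIV" using sets_eq_imp_space_eq[OF sets_riesz_measure] by simp
 obtain n :: nat where n: "n > 0" "1/real n < e" using e by (metis nat_approx_posE zero_less_Suc)
 define G where "G i x = max 0 (min (1/n) (g x-real i/n))" for i x
 have cG: "cts (G i)" for i unfolding G_def using g by (auto intro!: continuous_intros)
 have mU: "measure riesz_measure {x. a < g x}>=0" for a by simp
 have mset[measurable]: "{x. a < g x}\<in>sets riesz_measure" for a using open_Collect_less[of "%_. a" g] g by auto
 have gsum: "g x = (\<Sum>i<n. G i x)" for x
 proof -
  have "(\<Sum>i<k. G i x) = min (g x) (k/n)" for k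
  proof (induction k)
   case 0 thus ?case using g(2)[of x] by auto
  next
   case (Suc k)
   have "min (g x) (real k/n)+max 0 (min (1/n) (g x-k/n)) = min (g x) (k/n+1/n)"
   proof -
    have "0 < 1/real n" using n by simp
    thus ?thesis by linarith
   qed
   thus ?case using Suc by (simp add: G_def add_divide_distrib add.commute)
  qed
  from this[of n] show ?thesis using n g(3)[of x] by simp
 qed
 have LG: "L (G i)<=measure riesz_measure {x. i/n < g x}/n" for i
 proof -
  have "n * L (G i) = L (%x. n * G i x)" using state_cmult[OF L cG] by simp
  also have "\<dots><=measure riesz_measure {x. i/n < g x}"
  proof (rule state_le_measure_open)
   show "open {x. i/n < g x}" using open_Collect_less[of "%_. i/n" g] g by auto
   show "cts (%x. n * G i x)" using cG by (auto intro!: continuous_intros)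
   show "0<=n * G i x" for x by (simp add: G_def)
   have "n * G i x<=n * (1/n)" for x by (intro mult_left_mono) (auto simp: G_def)
   hence "n * G i x<=1" for x using n by simp
   moreover have "G i x = 0" if "g x<=i/n" for x using that n by (auto simp: G_def)
   ultimately show "n * G i x<=ind {x. i/n < g x} x" for x by (cases "i/n < g x") auto
  qed
  finally show ?thesis using n by (simp add: field_simps)
 qed
 have IG: "measure riesz_measure {x. Suc i/n < g x}/n<=integral\<^sup>L riesz_measure (G i)" for i
 proof -
  have "integral\<^sup>L riesz_measure (%x. (1/n) * ind {x. Suc i/n < g x} x)<=integral\<^sup>L riesz_measure (G i)"
  proof (rule integral_mono)
   show "integrable riesz_measure (G i)" by (rule integrable_riesz_continuous) (rule cG)
   show "(1/n) * ind {x. Suc i/n < g x} x<=G i x" for x using n by (auto simp: G_def indicator_def field_simps)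
   show "integrable riesz_measure (%x. (1/n) * ind {x. Suc i/n < g x} x)"
    by (intro integrable_mult_right integrable_real_indicator mset) (simp add: emeasure_eq_measure)
  qed
  thus ?thesis by simp
 qed
 have "L g = (\<Sum>i<n. L (G i))" using state_sum[OF L,of "{..<n}" G] cG gsum by (metis (no_types, lifting) ext finite_lessThan)
 also have "\<dots><=(\<Sum>i<n. measure riesz_measure {x. i/n < g x}/n)" by (rule sum_mono) (rule LG)
 also have "\<dots><=(\<Sum>i<Suc n. measure riesz_measure {x. i/n < g x}/n)" by simp
 \<comment> \<open>The upper bound for the functional on slice \<open>i+1\<close> is the lower bound
   for the integral of slice \<open>i\<close>. The two sums thus differ by the bottom slice alone,
   which costs at most \<open>1/n\<close>.\<close>
 also have "\<dots> = measure riesz_measure {x. 0/n < g x}/n+(\<Sum>i<n. measure riesz_measure {x. Suc i/n < g x}/n)" by (subst sum.lessThan_Suc_shift) simp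
 also have "\<dots><=1/n+(\<Sum>i<n. integral\<^sup>L riesz_measure (G i))" by (intro add_mono sum_mono IG divide_right_mono) auto
 also have "(\<Sum>i<n. integral\<^sup>L riesz_measure (G i)) = integral\<^sup>L riesz_measure (%x. \<Sum>i<n. G i x)"
  by (rule Bochner_Integration.integral_sum[symmetric], rule integrable_riesz_continuous) (rule cG)
 also have "\<dots> = integral\<^sup>L riesz_measure g" by (simp only: gsum[symmetric])
 finally show "L g<=integral\<^sup>L riesz_measure g+e" using n by linarith
qed

text \<open>One inequality suffices: an affine change of scale carries any continuous function into
  the unit interval, and the inequality for \<open>- g\<close> is the reverse inequality for
  \<open>g\<close>.\<close>

lemma riesz_integral:
 assumes "cts g"
 shows "integral\<^sup>L riesz_measure g = L g"
proof -
 interpret prob_space riesz_measure by (rule prob_space_riesz_measure)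
 have le: "L h<=integral\<^sup>L riesz_measure h" if h: "cts h" for h
 proof -
  obtain B where B: "B > 0" "!!x. \<bar>h x\<bar><=B" using compact_imp_bounded[OF compact_continuous_image[OF h comp]]
   unfolding bounded_pos by (auto simp: image_iff)
  define k where "k x = (1/(2 * B))*(h x+B)" for x
  have ck: "cts k" unfolding k_def using h B(1) by (auto intro!: continuous_intros)
  have "L k<=integral\<^sup>L riesz_measure k"
  proof (rule state_le_integral_unit[OF ck])
   show "0<=k x" "k x<=1" for x using B(1) B(2)[of x] by (auto simp: k_def field_simps)
  qed
  moreover have "L k = (1/(2 * B))*(L h+B)"
   unfolding k_def using h B state_cmult[OF L,of "%x. h x+B" "1/(2*B)"] state_add[OF L h,of "%_. B"] state_const[OF L]
   by (simp add: continuous_on_add)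
  moreover have "integral\<^sup>L riesz_measure k = (1/(2 * B))*(integral\<^sup>L riesz_measure h+B)"
   unfolding k_def using integrable_riesz_continuous[OF h] prob_space by simp
  ultimately show ?thesis using B(1) by (simp add: divide_le_cancel)
 qed
 have "L (%x. - g x)<=integral\<^sup>L riesz_measure (%x. - g x)" by (rule le) (use assms in \<open>auto intro!: continuous_intros\<close>)
 thus ?thesis using le[OF assms] state_cmult[OF L assms,of "-1"] by simp
qed

end

theorem riesz_representation:
 fixes L :: "('a::metric_space=>real)=>real"
 assumes "compact (UNIV :: 'a set)" "state_on L"
 obtains \<mu> where "sets \<mu> = sets borel" "prob_space \<mu>"
  "!!g. cts g ==> integral\<^sup>L \<mu> g = L g"
 using sets_riesz_measure[OF assms(2,1)] prob_space_riesz_measure[OF assms(2,1)] riesz_integral[OF assms(2,1)] by blast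


section \<open>Borel probability measures on a compact metric space\<close>

lemma urysohn_compact:
 fixes K :: "'a::metric_space set"
 assumes "compact K" "open V" "K\<subseteq>V"
 obtains g :: "'a=>real" where "cts g" "!!x. 0<=g x" "!!x. g x<=1"
  "!!x. x\<in>K ==> g x = 1" "!!x. x\<notin>V ==> g x = 0"
proof -
 obtain I :: "nat set" and h where h: "finite I" "!!i. cts (h i)" "!!i x. 0<=h i x"
    "!!i x. h i x<=ind V x" "!!x. x\<in>K ==> 1<=(SUM i:I. h i x :: real)"
  using compact_cover_functions[OF assms(1),of "%_. V"] assms(2,3) by auto
 have "h i x = 0" if "x\<notin>V" for i x using h(3)[of i x] h(4)[of i x] that by simp
 thus thesis by (intro that[of "%x. min 1 (SUM i:I. h i x)"]) (use h in \<open>auto intro!: continuous_intros sum_nonneg\<close>)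
qed

text \<open>Weak compactness of states by Tychonoff's theorem. The limit is taken along a filter
  finer than \<open>sequentially\<close> instead of a subsequence, so no countable dense family of
  continuous functions enters.\<close>

lemma state_cluster:
 fixes L :: "nat=>('a::metric_space=>real)=>real"
 assumes comp: "compact (UNIV :: 'a set)" and L: "!!k. state_on (L k)"
 obtains G \<Lambda> where "G<=sequentially" "G~=bot" "state_on \<Lambda>"
  "!!g. cts g ==> ((%k. L k g) \<longlongrightarrow> \<Lambda> g) G"
proof -
 have "EX B. ALL x. \<bar>g x\<bar><=B" if "cts g" for g :: "'a=>real"
  using compact_imp_bounded[OF compact_continuous_image[OF that comp]] by (auto simp: bounded_iff)
 then obtain B where B: "!!g x. cts g ==> \<bar>g x\<bar><=B (g :: 'a=>real)" by metis
 \<comment> \<open>Values at discontinuous functions are uncontrolled; setting them to 0 places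
   every \<open>M k\<close> in a product of compact intervals.\<close>
 define M where "M k g = (if cts g then L k g else 0)" for k g
 define K where "K = (\<Pi>\<^sub>E g\<in>UNIV. {- \<bar>B g\<bar>.. \<bar>B g\<bar>})"
 have "compactin (product_topology (%_. euclidean) UNIV) K" unfolding K_def by (subst compactin_PiE) auto
 hence cK: "compact K" by (simp add: euclidean_product_topology)
 have MK: "M k\<in>K" for k
 proof -
  have "\<bar>M k g\<bar><=\<bar>B g\<bar>" for g using state_abs_le[OF L,of g "B g" k] B[of g] by (auto simp: M_def)
  hence "- \<bar>B g\<bar><=M k g&M k g<=\<bar>B g\<bar>" for g using abs_le_iff[of "M k g" "\<bar>B g\<bar>"] by (simp add: minus_le_iff)
  thus ?thesis by (auto simp: K_def PiE_def)
 qed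
 obtain \<Lambda> where \<Lambda>: "inf (nhds \<Lambda>) (filtermap M sequentially)~=bot"
  using cK[unfolded compact_filter, rule_format,of "filtermap M sequentially"] MK by (auto simp: eventually_filtermap filtermap_bot_iff)
 define G where "G = inf sequentially (filtercomap M (nhds \<Lambda>))"
 have G1: "G<=sequentially" by (simp add: G_def)
 have G2: "G~=bot"
 proof
  assume "G = bot"
  hence "eventually (%_. False) (inf sequentially (filtercomap M (nhds \<Lambda>)))" by (simp add: G_def)
  then obtain Q R where Q: "eventually Q sequentially" and R: "eventually R (filtercomap M (nhds \<Lambda>))"
   and QR: "!!x. Q x ==> R x ==> False" unfolding eventually_inf by blast
  from R obtain S where S: "eventually S (nhds \<Lambda>)" "!!x. S (M x) ==> R x" unfolding eventually_filtercomap by blast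
  have "eventually (%y. \<not> S y) (filtermap M sequentially)" unfolding eventually_filtermap using Q by eventually_elim (use QR S in auto)
  with S(1) have "eventually (%_. False) (inf (nhds \<Lambda>) (filtermap M sequentially))" unfolding eventually_inf by blast
  thus False using \<Lambda> trivial_limit_def by blast
 qed
 have lim: "(M \<longlongrightarrow> \<Lambda>) G" unfolding filterlim_iff_le_filtercomap by (simp add: G_def)
 have lim_g: "((%k. M k g) \<longlongrightarrow> \<Lambda> g) G" for g
 proof -
  have cont: "cts (%F. F g :: real)" by (rule continuous_on_product_coordinates)
  show ?thesis
  proof (rule topological_tendstoI)
   fix S :: "real set" assume S: "open S" "\<Lambda> g\<in>S"
   have "open ((%F. F g) -` S)" using cont S(1) by (metis continuous_on_open_vimage open_UNIV inf_top.right_neutral)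
   from topological_tendstoD[OF lim this] S(2) show "\<forall>\<^sub>F k in G. M k g\<in>S" by auto
  qed
 qed
 have lim_L: "((%k. L k g) \<longlongrightarrow> \<Lambda> g) G" if "cts g" for g using lim_g[of g] that by (simp add: M_def)
 have "state_on \<Lambda>" unfolding state_on_def
 proof (intro conjI allI impI)
  fix g h :: "'a=>real" and c :: real assume g: "cts g"
  show "\<Lambda> (%x. c * g x) = c * \<Lambda> g"
  proof (rule tendsto_unique[OF G2 lim_L])
   show "((%k. L k (%x. c * g x)) \<longlongrightarrow> c * \<Lambda> g) G" using tendsto_mult_left[OF lim_L[OF g],of c] state_cmult[OF L g] by simp
  qed (use g in \<open>auto intro!: continuous_intros\<close>)
  assume h: "cts h"
  show "\<Lambda> (%x. g x+h x) = \<Lambda> g+\<Lambda> h"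
  proof (rule tendsto_unique[OF G2 lim_L])
   show "((%k. L k (%x. g x+h x)) \<longlongrightarrow> \<Lambda> g+\<Lambda> h) G"
    using tendsto_add[OF lim_L[OF g] lim_L[OF h]] state_add[OF L g h] by simp
  qed (use g h in \<open>auto intro!: continuous_intros\<close>)
 next
  fix g :: "'a=>real" assume g: "cts g" "ALL x. 0<=g x"
  show "0<=\<Lambda> g" by (rule tendsto_lowerbound[OF lim_L[OF g(1)] _ G2]) (use state_nonneg[OF L] g in auto)
 next
  show "\<Lambda> (%_. 1) = 1" using tendsto_unique[OF G2 lim_L[of "%_. 1"],of 1] state_one[OF L] by auto
 qed
 with G1 G2 lim_L show thesis using that by blast
qed

lemma sets_eq_borel_space: "sets \<mu> = sets (borel :: 'a::topological_space measure) ==> space \<mu> = UNIV" using sets_eq_imp_space_eq by fastforce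

lemma integrable_continuous_compact:
 fixes g :: "'a::metric_space=>real"
 assumes "compact (UNIV :: 'a set)" "sets \<mu> = sets borel" "finite_measure \<mu>" "cts g"
 shows "integrable \<mu> g"
proof -
 interpret finite_measure \<mu> by fact
 obtain B where "!!x. \<bar>g x\<bar><=B" using compact_imp_bounded[OF compact_continuous_image[OF assms(4,1)]] by (auto simp: bounded_iff)
 thus ?thesis by (intro integrable_const_bound[of _ B])
   (use assms in \<open>auto simp: borel_measurable_continuous_onI measurable_cong_sets[OF assms(2) refl]\<close>)
qed

lemma closed_indicator_limit:
 fixes K :: "'a::metric_space set"
 assumes "closed K"
 obtains h :: "nat=>'a=>real" where "!!n. cts (h n)" "!!n x. 0<=h n x" "!!n x. h n x<=1"
  "!!n x. ind K x<=h n x" "!!x. (%n. h n x) \<longlonglongrightarrow> ind K x"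
proof (cases "K = {}")
 case True
 thus ?thesis by (intro that[of "%_ _. 0"]) auto
next
 case False
 define h where "h n x = max 0 (1-real n * infdist x K)" for n x
 show ?thesis
 proof (rule that[of h])
  show "cts (h n)" for n unfolding h_def by (auto intro!: continuous_intros)
  show "0<=h n x" "h n x<=1" "ind K x<=h n x" for n x by (auto simp: h_def indicator_def infdist_nonneg)
  show "(%n. h n x) \<longlonglongrightarrow> ind K x" for x
  proof (cases "x\<in>K")
   case False
   hence d: "infdist x K > 0" using in_closed_iff_infdist_zero[OF assms \<open>K ~= {}\<close>] infdist_nonneg[of x K] by (metis less_eq_real_def)
   obtain N :: nat where N: "N * infdist x K > 1" using d reals_Archimedean3 by blast
   hence "h n x = 0" if "n>=N" for n
   proof -
    have "N * infdist x K<=n * infdist x K" using that d by (intro mult_right_mono) auto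
    thus ?thesis using N by (simp add: h_def max_def)
   qed
   thus ?thesis using False by (auto intro!: tendsto_eventually exI[of _ N] simp: eventually_sequentially)
  qed (auto simp: h_def)
 qed
qed

lemma measure_closed_limit:
 fixes \<mu> :: "'a::metric_space measure"
 assumes "sets \<mu> = sets borel" "finite_measure \<mu>"
  and h: "!!n. cts (h n)" "!!n x. 0<=h n x" "!!n x. h n x<=(1::real)"
  "!!x. (%n. h n x) \<longlonglongrightarrow> ind K x" and "K\<in>sets borel"
 shows "(%n. integral\<^sup>L \<mu> (h n)) \<longlonglongrightarrow> measure \<mu> K"
proof -
 interpret finite_measure \<mu> by fact
 have "(%n. integral\<^sup>L \<mu> (h n)) \<longlonglongrightarrow> integral\<^sup>L \<mu> (ind K)"
  by (rule integral_dominated_convergence[where w = "%_. 1"])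
   (use assms in \<open>auto simp: borel_measurable_continuous_onI measurable_cong_sets[OF assms(1) refl]\<close>)
 thus ?thesis using assms(1,7) by simp
qed

lemma finite_measure_eqI_continuous:
 fixes M N :: "'a::metric_space measure"
 assumes "sets M = sets borel" "sets N = sets borel" "finite_measure M" "finite_measure N"
  and eq: "!!g. cts g ==> (!!x. 0<=g x&g x<=1) ==> integral\<^sup>L M g = integral\<^sup>L N (g :: 'a=>real)"
 shows "M = N"
proof (rule measure_eqI_generator_eq[where E = "Collect closed" and \<Omega> = UNIV and A = "%_. UNIV"])
 interpret M: finite_measure M by fact
 interpret N: finite_measure N by fact
 fix K :: "'a set" assume "K\<in>Collect closed"
 hence K: "closed K" by simp
 from closed_indicator_limit[OF K] obtain h :: "nat=>'a=>real" where
  h: "!!n. cts (h n)" "!!n x. 0<=h n x" "!!n x. h n x<=1"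
   "!!x. (%n. h n x) \<longlonglongrightarrow> ind K x" by metis
 have "(%n. integral\<^sup>L M (h n)) \<longlonglongrightarrow> measure M K" "(%n. integral\<^sup>L N (h n)) \<longlonglongrightarrow> measure N K"
  by (rule measure_closed_limit; use assms h K in auto)+
 moreover have "integral\<^sup>L M (h n) = integral\<^sup>L N (h n)" for n using eq h by simp
 ultimately have "measure M K = measure N K" using LIMSEQ_unique by simp
 thus "emeasure M K = emeasure N K" by (simp add: M.emeasure_eq_measure N.emeasure_eq_measure)
qed (use assms in \<open>auto simp: borel_eq_closed Int_stable_def finite_measure.emeasure_finite\<close>)

text \<open>A Borel probability measure is the Riesz measure of its own integral, and the Riesz
  measure is an infimum over open sets by construction.\<close>

lemma borel_outer_regular:
 fixes \<mu> :: "'a::metric_space measure"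
 assumes comp: "compact (UNIV :: 'a set)" and \<mu>: "sets \<mu> = sets borel" "prob_space \<mu>" and A: "A\<in>sets borel" and "e > 0"
 obtains U where "open U" "A\<subseteq>U" "measure \<mu> U < measure \<mu> A+e"
proof -
 interpret prob_space \<mu> by fact
 have int: "integrable \<mu> g" if "cts g" for g :: "'a=>real" using integrable_continuous_compact[OF comp \<mu>(1) _ that] finite_measure_axioms by simp
 have st: "state_on (integral\<^sup>L \<mu>)" unfolding state_on_def using int prob_space by auto
 have "\<mu> = riesz_measure (integral\<^sup>L \<mu>)"
 proof (rule finite_measure_eqI_continuous)
  show "finite_measure (riesz_measure (integral\<^sup>L \<mu>))" using prob_space_riesz_measure[OF st comp] prob_space.finite_measure by blast
 qed (use \<mu> finite_measure_axioms riesz_integral[OF st comp] sets_riesz_measure[OF st comp] in auto)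
 hence em: "emeasure \<mu> B = outer_mass (integral\<^sup>L \<mu>) B" if "B\<in>sets borel" for B using emeasure_riesz_measure[OF st comp that] by simp
 have "outer_mass (integral\<^sup>L \<mu>) A < ennreal (measure \<mu> A+e)"
  unfolding em[OF A,symmetric] using \<open>e > 0\<close> by (simp add: emeasure_eq_measure ennreal_less_iff)
 then obtain U where "open U" "A\<subseteq>U" "open_mass (integral\<^sup>L \<mu>) U < ennreal (measure \<mu> A+e)"
  unfolding outer_mass_def[OF st] INF_less_iff by auto
 thus thesis
 proof (intro that)
  assume U: "open U" "open_mass (integral\<^sup>L \<mu>) U < ennreal (measure \<mu> A+e)"
  hence "ennreal (measure \<mu> U) < ennreal (measure \<mu> A+e)" using em[of U] outer_mass_open[OF st,of U] by (simp add: emeasure_eq_measure)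
  thus "measure \<mu> U < measure \<mu> A+e" by (simp add: ennreal_less_iff)
 qed
qed

lemma borel_inner_regular:
 fixes \<mu> :: "'a::metric_space measure"
 assumes comp: "compact (UNIV :: 'a set)" and \<mu>: "sets \<mu> = sets borel" "prob_space \<mu>" and A: "A\<in>sets borel" and "e > 0"
 obtains K where "compact K" "K\<subseteq>A" "measure \<mu> (A-K) < e"
proof -
 interpret prob_space \<mu> by fact
 have sp: "space \<mu> = UNIV" using sets_eq_borel_space[OF \<mu>(1)] .
 obtain U where U: "open U" "- A\<subseteq>U" "measure \<mu> U < measure \<mu> (- A)+e"
  using borel_outer_regular[OF comp \<mu> _ \<open>e > 0\<close>, of "- A"] A by auto
 have "measure \<mu> (U-(- A)) = measure \<mu> U-measure \<mu> (- A)" by (rule finite_measure_Diff) (use U A \<mu> in auto)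
 moreover have "A-(- U) = U-(- A)" by auto
 moreover have "compact (- U)" using compact_Int_closed[OF comp,of "- U"] U by auto
 ultimately show thesis using that[of "- U"] U by auto
qed

section \<open>Entropy of simple functions\<close>

text \<open>Entropy of the partition into level sets of \<open>X\<close>. With functions in place of
  set partitions, a join is a pair or a list of functions and refinement is functional
  dependence.\<close>

definition ent :: "'a measure=>('a=>'b)=>real" where
 "ent M X = - (SUM v:X ` space M. plogp (measure M (X -` {v}\<inter>space M)))"

lemma plogp_0 [simp]: "plogp 0 = 0" and plogp_1 [simp]: "plogp 1 = 0" by (simp_all add: plogp_def)

lemma plogp_nonpos: "0<=p ==> p<=1 ==> plogp p<=0" by (auto simp: plogp_def mult_le_0_iff)

lemma plogp_mono_ln: "0<=p ==> p<=q ==> plogp p<=p * ln q" by (auto simp: plogp_def)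

text \<open>The finite Gibbs inequality, from \<open>ln z<=z-1\<close> with
  \<open>z = exp (a i) * s/(p i * Z)\<close>. It is phrased for weights of arbitrary total mass, so
  that it applies to parts of a partition: to a fibre in \<open>ent_pair_le\<close>, to one of two
  families of cells in \<open>gibbs_cover\<close>.\<close>

lemma log_sum_exp:
 fixes p a :: "'i=>real"
 assumes I: "finite I" "I~={}" and p: "!!i. i\<in>I ==> 0<=p i"
 shows "(SUM i:I. - plogp (p i)+p i * a i) <= - plogp (SUM i:I. p i)+(SUM i:I. p i) * ln (SUM i:I. exp (a i))"
proof (cases "(SUM i:I. p i) = 0")
 case True
 hence "p i = 0" if "i\<in>I" for i using that I p by (simp add: sum_nonneg_eq_0_iff)
 thus ?thesis by simp
next
 case False
 define s Z where "s = (SUM i:I. p i)" and "Z = (SUM i:I. exp (a i))"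
 have s: "s > 0" using False p sum_nonneg[of I p] by (simp add: s_def)
 have Z: "Z > 0" unfolding Z_def using I by (intro sum_pos) auto
 have "- plogp (p i)+p i * a i+p i * ln s-p i * ln Z<=exp (a i) * s/Z-p i" if "i\<in>I" for i
 proof (cases "p i = 0")
  case True
  thus ?thesis using s Z by simp
 next
  case False
  hence pi: "p i > 0" using p[OF that] by simp
  have "ln (exp (a i) * s/(p i * Z))<=exp (a i) * s/(p i * Z)-1" by (rule ln_le_minus_one) (use pi s Z in simp)
  hence "p i * ln (exp (a i) * s/(p i * Z))<=p i * (exp (a i) * s/(p i * Z)-1)" using pi by (intro mult_left_mono) auto
  also have "\<dots> = exp (a i) * s/Z-p i" using pi by (simp add: field_simps)
  also have "ln (exp (a i) * s/(p i * Z)) = a i+ln s-ln (p i)-ln Z" using pi s Z by (simp add: ln_div ln_mult)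
  finally show ?thesis using False by (simp add: plogp_def algebra_simps)
 qed
 hence "(SUM i:I. - plogp (p i)+p i * a i+p i * ln s-p i * ln Z)<=(SUM i:I. exp (a i) * s/Z-p i)" by (rule sum_mono)
 also have "\<dots> = (SUM i:I. exp (a i)) * s/Z-s" by (simp add: sum_subtractf sum_distrib_right sum_divide_distrib s_def)
 also have "\<dots> = 0" using Z by (simp add: Z_def)
 finally have "(SUM i:I. - plogp (p i)+p i * a i)+s * ln s-s * ln Z<=0" by (simp add: sum.distrib sum_subtractf s_def sum_distrib_right)
 thus ?thesis using s by (simp add: plogp_def s_def Z_def)
qed

context prob_space
begin

abbreviation "pr X v == prob (X -` {v}\<inter>space M)"

lemma ent_superset:
 assumes "finite V" "X ` space M\<subseteq>V"
 shows "ent M X = - (SUM v:V. plogp (pr X v))"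
proof -
 have "pr X v = 0" if "v\<notin>X ` space M" for v
 proof -
  have "X -` {v}\<inter>space M = {}" using that by auto
  thus ?thesis by (metis measure_empty)
 qed
 hence "(SUM v:V. plogp (pr X v)) = (SUM v:X ` space M. plogp (pr X v))" by (intro sum.mono_neutral_right) (use assms in auto)
 thus ?thesis by (simp add: ent_def)
qed

lemma ent_nonneg: "0<=ent M X" unfolding ent_def by (simp add: sum_nonpos plogp_nonpos)

lemma simple_vimage [measurable]:
 "simple_function M X ==> X -` V\<inter>space M\<in>sets M" by (rule simple_functionD)

lemma pr_marginal:
 assumes X: "simple_function M X" and Y: "simple_function M Y" and "finite V" "Y ` space M\<subseteq>V"
 shows "pr X u = (SUM v:V. pr (%x. (X x,Y x)) (u,v))"
proof -
 have "pr X u = prob (\<Union>v\<in>V. (%x. (X x,Y x)) -` {(u,v)}\<inter>space M)" by (rule arg_cong[where f=prob]) (use assms(4) in auto)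
 also have "\<dots> = (SUM v:V. pr (%x. (X x,Y x)) (u,v))" by (rule finite_measure_finite_Union)
   (use assms simple_function_Pair[OF X Y] in \<open>auto simp: disjoint_family_on_def intro!: simple_vimage\<close>)
 finally show ?thesis .
qed

lemma pr_pair_swap: "pr (%x. (X x,Y x)) (u,v) = pr (%x. (Y x,X x)) (v,u)" by (rule arg_cong[where f=prob]) auto

lemma pr_sum: assumes X: "simple_function M X" and "finite V" "X ` space M\<subseteq>V" shows "(SUM v:V. pr X v) = 1"
proof -
 have "1 = prob (\<Union>v\<in>V. X -` {v}\<inter>space M)" unfolding prob_space[symmetric] by (rule arg_cong[where f=prob]) (use assms(3) in auto)
 also have "\<dots> = (SUM v:V. pr X v)" by (rule finite_measure_finite_Union)
   (use assms in \<open>auto simp: disjoint_family_on_def intro!: simple_vimage\<close>)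
 finally show ?thesis by simp
qed

lemma ent_pair:
 assumes "simple_function M X" "simple_function M Y"
 shows "ent M (%x. (X x,Y x)) = - (SUM u:X ` space M. SUM v:Y ` space M. plogp (pr (%x. (X x,Y x)) (u,v)))"
 by (subst ent_superset[of "X ` space M\<times>Y ` space M"])
  (use assms[THEN simple_functionD(1)] in \<open>auto simp: sum.cartesian_product split_def\<close>)

text \<open>On the fibre \<open>X = v\<close> the variable \<open>Y\<close> takes at most
  \<open>card (W v)\<close> values, so its conditional entropy there is at most the logarithm of
  that number.\<close>

lemma ent_pair_le:
 assumes X: "simple_function M X" and Y: "simple_function M Y"
  and W: "!!v. v\<in>X ` space M ==> finite (W v)" "!!x. x\<in>space M ==> Y x\<in>W (X x)"
 shows "ent M (%x. (X x,Y x))<=ent M X+(SUM v:X ` space M. pr X v * ln (card (W v)))"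
proof -
 have fin: "finite (X ` space M)" "finite (Y ` space M)" using X Y simple_functionD by auto
 have "- (SUM w:Y ` space M. plogp (pr (%x. (X x,Y x)) (v,w))) <= - plogp (pr X v)+pr X v * ln (card (W v))"
  if v: "v\<in>X ` space M" for v
 proof -
  have z: "pr (%x. (X x,Y x)) (v,w) = 0" if "w\<notin>W v" for w
  proof -
   have "(%x. (X x,Y x)) -` {(v,w)}\<inter>space M = {}" using that W(2) by auto
   thus ?thesis by (metis measure_empty)
  qed
  have z': "w\<in>W v" if "plogp (pr (%x. (X x,Y x)) (v,w))~=0" for w using z[of w] that by (metis plogp_0)
  let ?S = "W v\<inter>Y ` space M"
  obtain x where x: "x\<in>space M" "v = X x" using v by auto
  have ne: "?S~={}" using W(2)[OF x(1)] x by auto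
  have "- (SUM w:Y ` space M. plogp (pr (%x. (X x,Y x)) (v,w))) = (SUM w:?S. - plogp (pr (%x. (X x,Y x)) (v,w))+pr (%x. (X x,Y x)) (v,w)*0)"
   unfolding sum_negf[symmetric] by (intro sum.mono_neutral_cong_right) (use fin z' in auto)
  also have "\<dots> <= - plogp (SUM w:?S. pr (%x. (X x,Y x)) (v,w))+(SUM w:?S. pr (%x. (X x,Y x)) (v,w)) * ln (SUM w:?S. exp 0)"
   by (rule log_sum_exp) (use ne fin in auto)
  also have "(SUM w:?S. pr (%x. (X x,Y x)) (v,w)) = pr X v"
   unfolding pr_marginal[OF X Y fin(2) order_refl] by (intro sum.mono_neutral_left) (use fin z in auto)
  also have "pr X v * ln (SUM w:?S. exp 0)<=pr X v * ln (card (W v))"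
   using ne fin W(1)[OF v] by (intro mult_left_mono ln_mono) (auto simp: card_gt_0_iff intro!: card_mono)
  finally show ?thesis by simp
 qed
 hence "(SUM v:X ` space M. - (SUM w:Y ` space M. plogp (pr (%x. (X x,Y x)) (v,w))))
  <= (SUM v:X ` space M. - plogp (pr X v)+pr X v * ln (card (W v)))" by (rule sum_mono)
 thus ?thesis unfolding ent_pair[OF X Y] by (simp add: sum.distrib sum_subtractf ent_def sum_negf)
qed

lemma ent_const: "ent M (%_. c) = 0"
proof -
 have "(%_. c) ` space M = {c}" using not_empty by auto
 thus ?thesis by (simp add: ent_def prob_space)
qed

text \<open>A joint probability is at most its marginal, which bounds \<open>ent M X\<close> by the
  entropy of the pair; the pair in turn is an injective recoding of \<open>Y\<close>.\<close>

lemma ent_determined: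
 assumes X: "simple_function M X" and Y: "simple_function M Y"
  and det: "!!x y. x\<in>space M ==> y\<in>space M ==> Y x = Y y ==> X x = X y"
 shows "ent M X<=ent M Y"
proof -
 have fin: "finite (X ` space M)" "finite (Y ` space M)" using X Y simple_functionD by auto
 let ?q = "%u v. pr (%x. (X x,Y x)) (u,v)"
 have "plogp (?q u v)<=?q u v * ln (pr X u)" for u v by (rule plogp_mono_ln) (auto intro!: finite_measure_mono simple_vimage X)
 hence "(SUM u:X ` space M. SUM v:Y ` space M. plogp (?q u v))<=(SUM u:X ` space M. SUM v:Y ` space M. ?q u v * ln (pr X u))"
  by (intro sum_mono)
 also have "\<dots> = (SUM u:X ` space M. plogp (pr X u))" unfolding sum_distrib_right[symmetric] pr_marginal[OF X Y fin(2) order_refl,symmetric]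
  by (auto simp: plogp_def intro!: sum.cong)
 finally have "ent M X<=ent M (%x. (X x,Y x))" by (simp add: ent_pair[OF X Y]) (simp add: ent_def)
 also have "ent M (%x. (X x,Y x)) = ent M Y"
 proof -
  obtain g where g: "!!x. x\<in>space M ==> X x = g (Y x)"
  proof
   fix x assume "x\<in>space M"
   thus "X x = X (SOME y. y\<in>space M&Y y = Y x)" using det[of x] someI[of "%y. y\<in>space M&Y y = Y x" x] by metis
  qed
  have "(%x. (X x,Y x)) ` space M = (%v. (g v,v)) ` Y ` space M" using g by auto
  moreover have "inj_on (%v. (g v,v)) (Y ` space M)" by (auto simp: inj_on_def)
  moreover have "(%x. (X x,Y x)) -` {(g v,v)}\<inter>space M = Y -` {v}\<inter>space M" for v using g by auto
  ultimately show ?thesis unfolding ent_def by (simp add: sum.reindex)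
 qed
 finally show ?thesis .
qed

lemma ent_cong_determined:
 assumes "simple_function M X" "simple_function M Y"
  "!!x y. x\<in>space M ==> y\<in>space M ==> Y x = Y y \<longleftrightarrow> X x = X y"
 shows "ent M X = ent M Y" by (rule antisym; rule ent_determined) (use assms in auto)

text \<open>Nonnegativity of the conditional mutual information of \<open>X\<close> and
  \<open>Y\<close> given \<open>Z\<close>: the joint law \<open>p\<close> is compared with the
  conditionally independent law \<open>q * r/t\<close>. Both have total mass 1, and
  \<open>key\<close> is \<open>ln z<=z-1\<close> for their quotient.\<close>

lemma ent_strong_subadd:
 assumes X: "simple_function M X" and Y: "simple_function M Y" and Z: "simple_function M Z"
 shows "ent M (%x. (X x,Y x,Z x))+ent M Z<=ent M (%x. (X x,Z x))+ent M (%x. (Y x,Z x))"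
proof -
 note YZ = simple_function_Pair[OF Y Z] and XZ = simple_function_Pair[OF X Z]
 have fin: "finite (X ` space M)" "finite (Y ` space M)" "finite (Z ` space M)" using X Y Z simple_functionD by auto
 let ?A = "X ` space M" and ?B = "Y ` space M" and ?C = "Z ` space M"
 define p where "p a b c = pr (%x. (X x,Y x,Z x)) (a,b,c)" for a b c
 define q r t where "q a c = pr (%x. (X x,Z x)) (a,c)" and "r b c = pr (%x. (Y x,Z x)) (b,c)" and "t c = pr Z c" for a b c
 have nn: "p a b c>=0" "q a c>=0" "r b c>=0" "t c>=0" for a b c by (auto simp: p_def q_def r_def t_def)
 have mono: "p a b c<=q a c" "p a b c<=r b c" "p a b c<=t c" for a b c
  unfolding p_def q_def r_def t_def by (auto intro!: finite_measure_mono simple_vimage XZ YZ Z)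
 have m1: "q a c = (SUM b:?B. p a b c)" for a c
 proof -
  have "pr (%x. (X x,Z x)) (a,c) = (SUM b:?B. pr (%x. ((X x,Z x),Y x)) ((a,c),b))" by (rule pr_marginal[OF XZ Y fin(2) order_refl])
  moreover have "pr (%x. ((X x,Z x),Y x)) ((a,c),b) = p a b c" for b unfolding p_def by (rule arg_cong[where f=prob]) auto
  ultimately show ?thesis by (simp add: q_def)
 qed
 have m2: "r b c = (SUM a:?A. p a b c)" for b c
 proof -
  have "pr (%x. (Y x,Z x)) (b,c) = (SUM a:?A. pr (%x. ((Y x,Z x),X x)) ((b,c),a))" by (rule pr_marginal[OF YZ X fin(1) order_refl])
  moreover have "pr (%x. ((Y x,Z x),X x)) ((b,c),a) = p a b c" for a unfolding p_def by (rule arg_cong[where f=prob]) auto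
  ultimately show ?thesis by (simp add: r_def)
 qed
 have m3: "t c = (SUM a:?A. q a c)" for c unfolding t_def q_def pr_marginal[OF Z X fin(1) order_refl] by (simp add: pr_pair_swap[of Z])
 have m4: "t c = (SUM b:?B. r b c)" for c unfolding t_def r_def pr_marginal[OF Z Y fin(2) order_refl] by (simp add: pr_pair_swap[of Z])
 have e1: "ent M (%x. (X x,Y x,Z x)) = - (SUM a:?A. SUM b:?B. SUM c:?C. plogp (p a b c))"
  unfolding p_def by (subst ent_superset[of "?A\<times>?B\<times>?C"]) (use fin in \<open>auto simp: sum.cartesian_product split_def\<close>)
 have e2: "ent M (%x. (X x,Z x)) = - (SUM a:?A. SUM b:?B. SUM c:?C. p a b c * ln (q a c))"
 proof -
  have "(SUM a:?A. SUM b:?B. SUM c:?C. p a b c * ln (q a c)) = (SUM a:?A. SUM c:?C. SUM b:?B. p a b c * ln (q a c))"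
   by (intro sum.cong refl) (rule sum.swap)
  also have "\<dots> = (SUM a:?A. SUM c:?C. plogp (q a c))" unfolding sum_distrib_right[symmetric] m1[symmetric] by (auto simp: plogp_def intro!: sum.cong)
  finally show ?thesis unfolding ent_pair[OF X Z] q_def by simp
 qed
 have e3: "ent M (%x. (Y x,Z x)) = - (SUM a:?A. SUM b:?B. SUM c:?C. p a b c * ln (r b c))"
 proof -
  have "(SUM a:?A. SUM b:?B. SUM c:?C. p a b c * ln (r b c)) = (SUM b:?B. SUM c:?C. SUM a:?A. p a b c * ln (r b c))"
   by (subst sum.swap) (intro sum.cong refl, rule sum.swap)
  also have "\<dots> = (SUM b:?B. SUM c:?C. plogp (r b c))" unfolding sum_distrib_right[symmetric] m2[symmetric] by (auto simp: plogp_def intro!: sum.cong)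
  finally show ?thesis unfolding ent_pair[OF Y Z] r_def by simp
 qed
 have e4: "ent M Z = - (SUM a:?A. SUM b:?B. SUM c:?C. p a b c * ln (t c))"
 proof -
  have "(SUM a:?A. SUM b:?B. SUM c:?C. p a b c * ln (t c)) = (SUM a:?A. SUM c:?C. SUM b:?B. p a b c * ln (t c))"
   by (intro sum.cong refl) (rule sum.swap)
  also have "\<dots> = (SUM c:?C. SUM a:?A. SUM b:?B. p a b c * ln (t c))" by (rule sum.swap)
  also have "\<dots> = (SUM c:?C. plogp (t c))" unfolding sum_distrib_right[symmetric] m1[symmetric] m3[symmetric] by (auto simp: plogp_def intro!: sum.cong)
  finally show ?thesis unfolding ent_def t_def by simp
 qed
 have key: "p a b c * ln (q a c)+p a b c * ln (r b c)-plogp (p a b c)-p a b c * ln (t c)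
   <= q a c * r b c/t c-p a b c" for a b c
 proof (cases "p a b c = 0")
  case True
  thus ?thesis using nn by simp
 next
  case False
  hence pos: "p a b c > 0" "q a c > 0" "r b c > 0" "t c > 0" using nn(1)[of a b c] mono[of a b c] by linarith+
  have "ln (q a c * r b c/(p a b c * t c))<=q a c * r b c/(p a b c * t c)-1" by (rule ln_le_minus_one) (use pos in simp)
  hence "p a b c * ln (q a c * r b c/(p a b c * t c))<=p a b c * (q a c * r b c/(p a b c * t c)-1)" using pos by (intro mult_left_mono) auto
  also have "\<dots> = q a c * r b c/t c-p a b c" using pos by (simp add: field_simps)
  also have "ln (q a c * r b c/(p a b c * t c)) = ln (q a c)+ln (r b c)-ln (p a b c)-ln (t c)" using pos by (simp add: ln_div ln_mult)
  finally show ?thesis using False by (simp add: plogp_def algebra_simps)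
 qed
 have "(SUM a:?A. SUM b:?B. SUM c:?C. p a b c * ln (q a c)+p a b c * ln (r b c)-plogp (p a b c)-p a b c * ln (t c))
  <= (SUM a:?A. SUM b:?B. SUM c:?C. q a c * r b c/t c-p a b c)" by (intro sum_mono key)
 also have "\<dots> = (SUM a:?A. SUM b:?B. SUM c:?C. q a c * r b c/t c)-(SUM a:?A. SUM b:?B. SUM c:?C. p a b c)"
  by (simp add: sum_subtractf)
 also have "(SUM a:?A. SUM b:?B. SUM c:?C. q a c * r b c/t c) = (SUM c:?C. SUM a:?A. SUM b:?B. q a c * r b c/t c)"
  by (subst (2) sum.swap) (intro sum.cong refl, rule sum.swap)
 also have "\<dots> = (SUM c:?C. t c)"
 proof (intro sum.cong refl)
  fix c
  have "(SUM a:?A. SUM b:?B. q a c * r b c/t c) = (SUM a:?A. q a c)*(SUM b:?B. r b c)/t c" by (simp add: sum_product sum_divide_distrib)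
  thus "(SUM a:?A. SUM b:?B. q a c * r b c/t c) = t c" using m3[of c] m4[of c] by simp
 qed
 also have "\<dots> = 1" unfolding t_def by (rule pr_sum[OF Z fin(3) order_refl])
 also have "(SUM a:?A. SUM b:?B. SUM c:?C. p a b c) = (SUM a:?A. SUM c:?C. q a c)" unfolding m1 by (intro sum.cong refl) (rule sum.swap)
 also have "\<dots> = (SUM c:?C. t c)" unfolding m3 by (rule sum.swap)
 also have "\<dots> = 1" unfolding t_def by (rule pr_sum[OF Z fin(3) order_refl])
 finally show ?thesis unfolding e1 e2 e3 e4 by (simp add: sum.distrib sum_subtractf)
qed

lemma ent_subadd:
 assumes X: "simple_function M X" and Y: "simple_function M Y"
 shows "ent M (%x. (X x,Y x))<=ent M X+ent M Y"
proof -
 have Z: "simple_function M (%_. ())" by simp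
 have "ent M (%x. (X x,Y x)) = ent M (%x. (X x,Y x,()))" "ent M X = ent M (%x. (X x,()))" "ent M Y = ent M (%x. (Y x,()))"
  by (rule ent_cong_determined; use X Y Z in \<open>auto intro!: simple_function_Pair\<close>)+
 thus ?thesis using ent_strong_subadd[OF X Y Z] ent_const[of "()"] by simp
qed

lemma ent_le_card:
 assumes X: "simple_function M X" and V: "finite V" "X ` space M\<subseteq>V"
 shows "ent M X<=ln (card V)"
proof -
 have ne: "V~={}" using V not_empty by auto
 have "(SUM v:V. - plogp (pr X v)+pr X v * 0) <= - plogp (SUM v:V. pr X v)+(SUM v:V. pr X v) * ln (SUM v:V. exp 0)"
  by (rule log_sum_exp) (use V ne in auto)
 thus ?thesis using pr_sum[OF X V] ent_superset[OF V] by (simp add: sum_negf)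
qed

section \<open>Conditional entropy\<close>

definition cent :: "('a=>'b)=>('a=>'c)=>real" where
 "cent X Y = ent M (%x. (X x,Y x))-ent M Y"

lemma cent_pair_le:
 assumes "simple_function M X" "simple_function M Y" "simple_function M Z"
 shows "cent (%x. (X x,Y x)) Z<=cent X Z+cent Y Z"
proof -
 have "ent M (%x. ((X x,Y x),Z x)) = ent M (%x. (X x,Y x,Z x))"
  by (rule ent_cong_determined) (use assms in \<open>auto intro!: simple_function_Pair\<close>)
 thus ?thesis using ent_strong_subadd[OF assms] by (simp add: cent_def)
qed

text \<open>Conditioning on more information lowers entropy: as \<open>Z\<close> is a function of
  \<open>Y\<close>, adjoining it to \<open>Y\<close> changes nothing, and strong subadditivity
  applies.\<close>

lemma cent_antimono:
 assumes X: "simple_function M X" and Y: "simple_function M Y" and Z: "simple_function M Z"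
  and det: "!!x y. x\<in>space M ==> y\<in>space M ==> Y x = Y y ==> Z x = Z y"
 shows "cent X Y<=cent X Z"
proof -
 have "ent M (%x. (X x,Y x)) = ent M (%x. (X x,Y x,Z x))"
  by (rule ent_cong_determined, intro simple_function_Pair X Y, intro simple_function_Pair X Y Z, simp only: prod.inject)
   (use det in blast)
 moreover have "ent M Y = ent M (%x. (Y x,Z x))" by (rule ent_cong_determined, rule Y, intro simple_function_Pair Y Z, simp only: prod.inject)
   (use det in blast)
 ultimately show ?thesis using ent_strong_subadd[OF X Y Z] by (simp add: cent_def)
qed

end

lemma fekete:
 fixes a :: "nat=>real"
 assumes sub: "!!m n. a (m+n)<=a m+a n" and nn: "!!n. 0<=a n"
 shows "(%n. a n/n) \<longlonglongrightarrow> (INF n\<in>{1..}. a n/n)"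
proof -
 define l where "l = (INF n\<in>{1..}. a n/real n)"
 have bdd: "bdd_below ((%n. a n/real n) ` {1..})" using nn by (intro bdd_belowI[of _ 0]) auto
 have low: "l<=a n/n" if "n>=1" for n unfolding l_def using bdd that by (intro cINF_lower) auto
 have mult: "a (k * m+r)<=k * a m+a r" for k m r
 proof (induction k)
  case (Suc k)
  have "a (Suc k * m+r)<=a m+a (k * m+r)" using sub[of m "k * m+r"] by (simp add: add.assoc)
  thus ?case using Suc by (simp add: algebra_simps)
 qed simp
 show ?thesis unfolding l_def[symmetric]
 proof (rule LIMSEQ_I)
  fix e :: real assume e: "e > 0"
  obtain m where m: "m>=1" "a m/m < l+e/2"
  proof -
   have "l < l+e/2" using e by simp
   thus thesis using that unfolding l_def by (subst (asm) cINF_less_iff) (use bdd in auto)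
  qed
  define C where "C = (\<Sum>r<m. a r)"
  have C: "a r<=C" if "r < m" for r unfolding C_def using that nn by (intro member_le_sum) auto
  obtain N :: nat where N: "C/(e/2) < N" using reals_Archimedean2 by blast
  show "EX no. ALL n>=no. norm (a n/n-l) < e"
  proof (intro exI[of _ "max 1 N"] allI impI)
   fix n assume n: "n>=max 1 N"
   have "a n = a (n div m * m+n mod m)" by simp
   also have "\<dots><=(n div m) * a m+C" using mult[of "n div m" m "n mod m"] C[of "n mod m"] m by auto
   also have "(n div m) * a m<=(n/m) * a m" using nn of_nat_div_le_of_nat by (intro mult_right_mono) auto
   finally have "a n<=n * (a m/m)+C" by simp
   hence "a n/n<=a m/m+C/n" using n by (simp add: field_simps)
   moreover have "C/n < e/2"
   proof -
    have "C < real N * (e/2)" using N e by (simp only: pos_divide_less_eq half_gt_zero_iff)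
    also have "\<dots><=real n * (e/2)" using n e by (intro mult_right_mono) auto
    finally have "C < real n * (e/2)" .
    thus ?thesis using n by (simp add: field_simps)
   qed
   ultimately have "a n/n < l+e" using m by linarith
   thus "norm (a n/n-l) < e" using low[of n] n by simp
  qed
 qed
qed

section \<open>Entropy of invariant measures\<close>

definition nm :: "(real=>'a=>'a)=>('a=>'b)=>real list=>'a=>'b list" where
 "nm f c ts x = map (%t. c (f t x)) ts"

definition times :: "nat=>real list" where "times n = map real [0..<n]"

text \<open>The entropy rate as an infimum rather than a limit, so that it lies below every
  finite-time quotient; \<open>hrate_lim\<close> identifies it with the limit.\<close>

definition hrate :: "(real=>'a=>'a)=>'a measure=>('a=>'b)=>real" where
 "hrate f \<mu> c = (INF n\<in>{1..}. ent \<mu> (nm f c (times n))/n)"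

lemma simple_function_map:
 "(!!t. t\<in>set ts ==> simple_function M (c t)) ==> simple_function M (%x. map (%t. c t x) ts)"
proof (induction ts)
 case (Cons t ts)
 have "simple_function M (%x. c t x # map (%t. c t x) ts)"
  by (rule simple_function_compose2[of M "c t" "%x. map (%t. c t x) ts" "(#)"]) (use Cons in auto)
 thus ?case by simp
qed simp

locale inv_flow =
 fixes f :: "real=>'a::metric_space=>'a" and \<mu> :: "'a measure"
 assumes flow: "continuous_flow f" and inv: "invariant_measure f \<mu>"
begin

abbreviation (input) "simple == simple_function \<mu>"

sublocale prob_space \<mu> using inv by (simp add: invariant_measure_def)

lemma sets_eq [simp]: "sets \<mu> = sets borel" using inv by (simp add: invariant_measure_def)

lemma space_eq [simp]: "space \<mu> = UNIV" using sets_eq by (rule sets_eq_borel_space)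

lemma flow_0: "f 0 x = x" and flow_add: "f (s+t) x = f s (f t x)" using flow by (auto simp: continuous_flow_def)

lemma flow_measurable: "f t\<in>measurable \<mu> \<mu>" and distr_flow: "distr \<mu> \<mu> (f t) = \<mu>" using inv by (auto simp: invariant_measure_def)

lemma prob_flow: "A\<in>sets borel ==> prob (f t -` A) = prob A" using measure_distr[OF flow_measurable,of A t] distr_flow[of t] by simp

lemma simple_flow: "simple c ==> simple (%x. c (f t x))" by (rule simple_function_comp[OF flow_measurable])

lemma simple_nm: "simple c ==> simple (nm f c ts)" unfolding nm_def by (rule simple_function_map) (rule simple_flow)

lemma ent_flow:
 assumes c: "simple c" shows "ent \<mu> (%x. c (f t x)) = ent \<mu> c"
proof -
 have "finite (range c)" using simple_functionD(1)[OF c] by simp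
 moreover have "c -` {v}\<in>sets borel" for v using simple_functionD(2)[OF c,of "{v}"] by simp
 moreover have "(%x. c (f t x)) -` {v} = f t -` (c -` {v})" for v by auto
 ultimately show ?thesis using ent_superset[of "range c" "%x. c (f t x)"] prob_flow by (auto simp: ent_def)
qed

lemma nm_shift: "nm f c (map (%t. t+r) ts) x = nm f c ts (f r x)" by (auto simp: nm_def flow_add)

lemma ent_nm_shift: "simple c ==> ent \<mu> (nm f c (map (%t. t+r) ts)) = ent \<mu> (nm f c ts)"
 using ent_flow[OF simple_nm] by (simp add: nm_shift[abs_def])

lemma ent_nm_append:
 assumes "simple c" shows "ent \<mu> (nm f c (ts @ us))<=ent \<mu> (nm f c ts)+ent \<mu> (nm f c us)"
proof -
 have "ent \<mu> (nm f c (ts @ us))<=ent \<mu> (%x. (nm f c ts x,nm f c us x))"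
  by (rule ent_determined) (auto intro!: simple_function_Pair simple_nm assms, auto simp: nm_def)
 also have "\<dots><=ent \<mu> (nm f c ts)+ent \<mu> (nm f c us)" by (rule ent_subadd) (auto intro!: simple_nm assms)
 finally show ?thesis .
qed

lemma times_add: "times (m+n) = times m @ map (%t. t+real m) (times n)" by (rule nth_equalityI) (auto simp: times_def nth_append)

lemma hrate_lim:
 assumes "simple c"
 shows "(%n. ent \<mu> (nm f c (times n))/n) \<longlonglongrightarrow> hrate f \<mu> c" unfolding hrate_def
proof (rule fekete)
 show "ent \<mu> (nm f c (times (m+n)))<=ent \<mu> (nm f c (times m))+ent \<mu> (nm f c (times n))" for m n
  using ent_nm_append[OF assms,of "times m" "map (%t. t+real m) (times n)"] ent_nm_shift[OF assms,of "real m" "times n"] by (simp add: times_add)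
qed (rule ent_nonneg)

lemma hrate_le: "n>=1 ==> hrate f \<mu> c<=ent \<mu> (nm f c (times n))/n"
 unfolding hrate_def by (rule cINF_lower) (auto intro!: bdd_belowI[of _ 0] simp: ent_nonneg)

definition atom :: "'a set set=>'a=>'a set" where "atom \<xi> x = (THE A. A\<in>\<xi>&x\<in>A)"

lemma atom:
 assumes "meas_partition \<mu> \<xi>"
 shows "atom \<xi> x\<in>\<xi>" "x\<in>atom \<xi> x" "A\<in>\<xi> ==> x\<in>A ==> atom \<xi> x = A"
proof -
 have "\<exists>!A. A\<in>\<xi>&x\<in>A" proof -
  have "x\<in>\<Union>\<xi>" using assms by (simp add: meas_partition_def)
  moreover have "A = B" if "A\<in>\<xi>" "B\<in>\<xi>" "x\<in>A" "x\<in>B" for A B using assms that unfolding meas_partition_def by blast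
  ultimately show ?thesis by blast
 qed
 note ex = this
 from theI'[OF ex] show "atom \<xi> x\<in>\<xi>" "x\<in>atom \<xi> x" unfolding atom_def by simp_all
 show "atom \<xi> x = A" if "A\<in>\<xi>" "x\<in>A" unfolding atom_def using the1_equality[OF ex] that by simp
qed

lemma simple_atom: assumes "meas_partition \<mu> \<xi>" shows "simple (atom \<xi>)" unfolding simple_function_def
proof
 have "range (atom \<xi>)\<subseteq>\<xi>" using atom[OF assms] by auto
 thus "finite (atom \<xi> ` space \<mu>)" using assms finite_subset by (auto simp: meas_partition_def)
 show "ALL A:atom \<xi> ` space \<mu>. atom \<xi> -` {A}\<inter>space \<mu>\<in>sets \<mu>"
 proof
  fix A assume "A\<in>atom \<xi> ` space \<mu>"
  hence A: "A\<in>\<xi>" using atom[OF assms] by auto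
  hence "atom \<xi> -` {A}\<inter>space \<mu> = A" using atom[OF assms] by auto
  thus "atom \<xi> -` {A}\<inter>space \<mu>\<in>sets \<mu>" using A assms by (auto simp: meas_partition_def)
 qed
qed

text \<open>The join is a set of sets, so distinct words with empty cells collapse to one element.
  Empty cells contribute nothing to the entropy, and on words with nonempty cells the passage from
  words to cells is injective.\<close>

lemma part_entropy_join:
 assumes \<xi>: "meas_partition \<mu> \<xi>"
 shows "part_entropy \<mu> (join_part f \<xi> n) = ent \<mu> (nm f (atom \<xi>) (times n))"
proof -
 let ?N = "nm f (atom \<xi>) (times n)"
 define F where "F ws = (\<Inter>i<n. f (real i) -` (ws ! i))" for ws :: "'a set list"
 let ?W = "{ws. set ws\<subseteq>\<xi>&length ws = n}"
 have finW: "finite ?W" using \<xi> by (intro finite_lists_length_eq) (auto simp: meas_partition_def)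
 have FN: "?N -` {ws} = F ws" if "ws\<in>?W" for ws
 proof (intro set_eqI iffI)
  fix x assume "x\<in>?N -` {ws}"
  hence ws: "ws = ?N x" by auto
  have "ws ! i = atom \<xi> (f i x)" if "i < n" for i unfolding ws using that by (simp add: nm_def times_def)
  thus "x\<in>F ws" using atom(2)[OF \<xi>] by (auto simp: F_def)
 next
  fix x assume x: "x\<in>F ws"
  have "?N x = ws"
  proof (rule nth_equalityI)
   show "length (?N x) = length ws" using that by (simp add: nm_def times_def)
   fix i assume "i < length (?N x)"
   hence i: "i < n" by (simp add: nm_def times_def)
   have "f i x\<in>ws ! i" using x i by (auto simp: F_def)
   moreover have "ws ! i\<in>\<xi>" using that i by auto
   ultimately show "?N x ! i = ws ! i" using i atom(3)[OF \<xi>] by (simp add: nm_def times_def)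
  qed
  thus "x\<in>?N -` {ws}" by simp
 qed
 have join: "join_part f \<xi> n = F ` ?W"
 proof (intro set_eqI iffI)
  fix A assume "A\<in>join_part f \<xi> n"
  then obtain a where a: "A = (\<Inter>i<n. f (real i) -` a i)" "ALL i<n. a i\<in>\<xi>" by (auto simp: join_part_def)
  have "A = F (map a [0..<n])" using a by (auto simp: F_def)
  moreover have "map a [0..<n]\<in>?W" using a by auto
  ultimately show "A\<in>F ` ?W" by blast
 next
  fix A assume "A\<in>F ` ?W"
  then obtain ws where "A = F ws" "set ws\<subseteq>\<xi>" "length ws = n" by auto
  thus "A\<in>join_part f \<xi> n" unfolding join_part_def F_def by (auto intro!: exI[of _ "%i. ws ! i"])
 qed
 have inj: "inj_on F {ws\<in>?W. F ws~={}}"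
 proof (rule inj_onI)
  fix ws us assume a: "ws\<in>{ws\<in>?W. F ws~={}}" "us\<in>{ws\<in>?W. F ws~={}}" "F ws = F us"
  then obtain x where "x\<in>F ws" by auto
  hence "x\<in>?N -` {ws}" "x\<in>?N -` {us}" using a FN by auto
  thus "ws = us" by auto
 qed
 have "(SUM A:F ` ?W. plogp (prob A)) = (SUM A:F ` {ws\<in>?W. F ws~={}}. plogp (prob A))" by (rule sum.mono_neutral_right) (use finW in auto)
 also have "\<dots> = (SUM ws:{ws\<in>?W. F ws~={}}. plogp (prob (F ws)))" by (rule sum.reindex[OF inj,unfolded comp_def])
 also have "\<dots> = (SUM ws:?W. plogp (prob (F ws)))" by (rule sum.mono_neutral_left) (use finW in auto)
 also have "\<dots> = (SUM ws:?W. plogp (pr ?N ws))" by (intro sum.cong refl) (auto simp: FN)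
 also have "\<dots> = - ent \<mu> ?N" by (subst ent_superset[OF finW]) (use atom[OF \<xi>] in \<open>auto simp: nm_def times_def\<close>)
 finally show ?thesis by (simp add: part_entropy_def join)
qed

lemma part_entropy_rate_eq:
 assumes "meas_partition \<mu> \<xi>"
 shows "part_entropy_rate f \<mu> \<xi> = hrate f \<mu> (atom \<xi>)" unfolding part_entropy_rate_def part_entropy_join[OF assms]
 using LIMSEQ_Suc[OF hrate_lim[OF simple_atom[OF assms]]] by (simp add: limI)

lemma hrate_le_ks:
 assumes c: "simple c"
 shows "ereal (hrate f \<mu> c)<=ks_entropy f \<mu>"
proof -
 define \<xi> where "\<xi> = (%v. c -` {v}) ` range c"
 have \<xi>: "meas_partition \<mu> \<xi>"
 proof -
  have fin: "finite (range c)" using simple_functionD(1)[OF c] by simp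
  have "c -` {v}\<in>sets \<mu>" for v using simple_functionD(2)[OF c,of "{v}"] by simp
  with fin show ?thesis unfolding meas_partition_def \<xi>_def space_eq
  proof (intro conjI)
   show "finite ((%v. c -` {v}) ` range c)" using fin by (rule finite_imageI)
  qed auto
 qed
 have at: "atom \<xi> x = c -` {c x}" for x by (rule atom(3)[OF \<xi>]) (auto simp: \<xi>_def)
 have "ent \<mu> (nm f (atom \<xi>) ts) = ent \<mu> (nm f c ts)" for ts
 proof (rule ent_cong_determined)
  have "atom \<xi> x = atom \<xi> y \<longleftrightarrow> c x = c y" for x y using at by auto
  thus "nm f c ts x = nm f c ts y \<longleftrightarrow> nm f (atom \<xi>) ts x = nm f (atom \<xi>) ts y" for x y by (auto simp: nm_def)
 qed (auto intro!: simple_nm c simple_atom \<xi>)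
 hence "hrate f \<mu> c = hrate f \<mu> (atom \<xi>)" by (simp add: hrate_def)
 hence "ereal (hrate f \<mu> c) = ereal (part_entropy_rate f \<mu> \<xi>)" using part_entropy_rate_eq[OF \<xi>] by simp
 thus ?thesis unfolding ks_entropy_def using \<xi> by (auto intro!: Sup_upper)
qed

text \<open>Functions with values in \<open>'a set\<close> suffice, because a partition is encoded
  by the map \<open>atom\<close> that sends a point to its cell.\<close>

lemma ks_entropy_le:
 assumes "!!c :: 'a=>'a set. simple c ==> ereal (hrate f \<mu> c)<=z"
 shows "ks_entropy f \<mu><=z" unfolding ks_entropy_def
proof (rule Sup_least)
 fix h assume "h\<in>{ereal (part_entropy_rate f \<mu> \<xi>) |\<xi>. meas_partition \<mu> \<xi>}"
 then obtain \<xi> where \<xi>: "meas_partition \<mu> \<xi>" "h = ereal (part_entropy_rate f \<mu> \<xi>)" by blast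
 thus "h<=z" using assms[OF simple_atom[OF \<xi>(1)]] part_entropy_rate_eq[OF \<xi>(1)] by simp
qed

end


section \<open>Continuous flows on compact spaces\<close>

locale compact_flow =
 fixes f :: "real=>'a::metric_space=>'a"
 assumes comp: "compact (UNIV :: 'a set)" and cflow: "continuous_flow f"
begin

abbreviation (input) "birk == birkhoff_int f"

abbreviation (input) "near t r x y == ALL s:{0..t}. dist (f s x) (f s y)<=r"

lemma f_0 [simp]: "f 0 x = x" and f_add: "f (s+t) x = f s (f t x)" using cflow by (auto simp: continuous_flow_def)

lemma f_commute: "f s (f t x) = f t (f s x)" by (metis f_add add.commute)

lemma f_inverse [simp]: "f (- t) (f t x) = x" "f t (f (- t) x) = x" by (metis f_add f_0 add.left_inverse, metis f_add f_0 add.right_inverse)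

lemma f_joint: "continuous_on A (%(t,x). f t x)" using cflow continuous_on_subset by (auto simp: continuous_flow_def)

lemma f_continuous_compose:
 assumes "continuous_on A u" "continuous_on A v"
 shows "continuous_on A (%z. f (u z) (v z))"
proof -
 have "continuous_on A ((%(t,x). f t x) \<circ> (%z. (u z,v z)))"
  by (rule continuous_on_compose) (use assms f_joint in \<open>auto intro!: continuous_intros\<close>)
 thus ?thesis by (simp add: comp_def)
qed

lemma f_continuous: "continuous_on A (f t)" using f_continuous_compose[of A "%_. t" "%x. x"] by (simp add: continuous_on_id)

lemma f_orbit_continuous: "continuous_on A (%t. f t x)" using f_continuous_compose[of A "%t. t" "%_. x"] by (simp add: continuous_on_id)

lemma continuous_flow_fun: "cts g ==> cts (%x. g (f t x))" using continuous_on_compose2[OF _ f_continuous[of UNIV t]] by auto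

lemma continuous_orbit_fun: "cts g ==> continuous_on A (%t. g (f t x))" using continuous_on_compose2[OF _ f_orbit_continuous[of A x]] by auto

lemma bounded_fun:
 fixes g :: "'a=>real"
 assumes "cts g"
 obtains B where "B > 0" "!!x. \<bar>g x\<bar><=B" using compact_imp_bounded[OF compact_continuous_image[OF assms comp]]
 unfolding bounded_pos by (auto simp: image_iff)

lemma f_uniform_joint:
 assumes "e > 0"
 obtains d where "d > 0" "!!s t (x::'a) y. \<bar>s\<bar><=T ==> \<bar>t\<bar><=T ==> dist (t,y) (s,x) < d ==> dist (f t y) (f s x) < e"
proof -
 have "uniformly_continuous_on ({-T..T}\<times>UNIV) (%(t,x). f t x)"
  by (rule compact_uniformly_continuous[OF f_joint]) (use comp in \<open>auto intro: compact_Times\<close>)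
 hence "EX d>0. ALL p:{-T..T}\<times>UNIV. ALL q:{-T..T}\<times>UNIV. dist q p < d --> dist (case q of (t,x)=>f t x) (case p of (t,x)=>f t x) < e"
  using assms unfolding uniformly_continuous_on_def by blast
 then obtain d where d: "d > 0" and *: "ALL p:{-T..T}\<times>UNIV. ALL q:{-T..T}\<times>UNIV. dist q p < d --> dist (case q of (t,x)=>f t x) (case p of (t,x)=>f t x) < e"
  by blast
 show thesis
 proof (rule that[OF d])
  fix s t and x y :: 'a assume "\<bar>s\<bar><=T" "\<bar>t\<bar><=T" "dist (t,y) (s,x) < d"
  thus "dist (f t y) (f s x) < e" using *[rule_format,of "(s,x)" "(t,y)"] by (simp add: abs_le_iff minus_le_iff)
 qed
qed

lemma f_uniform:
 assumes "e > 0"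
 obtains d where "d > 0" "!!(x::'a) y s. dist x y < d ==> \<bar>s\<bar><=T ==> dist (f s x) (f s y) < e"
proof -
 from f_uniform_joint[OF assms,of T] obtain d where d: "d > 0"
  "!!s t (x::'a) y. \<bar>s\<bar><=T ==> \<bar>t\<bar><=T ==> dist (t,y) (s,x) < d ==> dist (f t y) (f s x) < e" by blast
 show thesis by (rule that[OF d(1)], rule d(2)) (auto simp: dist_Pair_Pair)
qed

lemma f_small_time:
 assumes "e > 0"
 obtains \<kappa> where "\<kappa> > 0" "!!(x::'a) r. \<bar>r\<bar><=\<kappa> ==> dist (f r x) x < e"
proof -
 from f_uniform_joint[OF assms,of 1] obtain d where d: "d > 0"
  "!!s t (x::'a) y. \<bar>s\<bar><=1 ==> \<bar>t\<bar><=1 ==> dist (t,y) (s,x) < d ==> dist (f t y) (f s x) < e" by blast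
 show thesis
 proof (rule that[of "min 1 (d/2)"])
  fix x :: 'a and r assume "\<bar>r\<bar><=min 1 (d/2)"
  hence "\<bar>r\<bar><=1" "\<bar>r\<bar> < d" using d(1) by auto
  thus "dist (f r x) x < e" using d(2)[of 0 r x x] by (auto simp: dist_Pair_Pair)
 qed (use d in auto)
qed

subsection \<open>The Bowen metric\<close>

lemma bowen_image: "0<=t ==> compact ((%s. dist (f s x) (f s y)) ` {0..t})" "0<=t ==> (%s. dist (f s x) (f s y)) ` {0..t}~={}"
 by (auto intro!: compact_continuous_image continuous_intros f_orbit_continuous)

lemma bowen_dist_le: "0<=t ==> bowen_dist f t x y<=r \<longleftrightarrow> (near t r x y)" unfolding bowen_dist_def
 using bowen_image[of t x y] by (subst cSup_le_iff) (auto intro: bounded_imp_bdd_above compact_imp_bounded)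

text \<open>The supremum over the compact time interval is attained, which preserves the strict
  inequality.\<close>

lemma bowen_dist_less: "0<=t ==> bowen_dist f t x y < r \<longleftrightarrow> (ALL s:{0..t}. dist (f s x) (f s y) < r)"
proof
 assume t: "0<=t" and *: "ALL s:{0..t}. dist (f s x) (f s y) < r"
 obtain m where m: "m\<in>(%s. dist (f s x) (f s y)) ` {0..t}" "ALL a:(%s. dist (f s x) (f s y)) ` {0..t}. a<=m"
  using compact_attains_sup[OF bowen_image[OF t]] by blast
 hence "bowen_dist f t x y<=m" using t by (subst bowen_dist_le) auto
 also have "m < r" using m(1) * by auto
 finally show "bowen_dist f t x y < r" .
next
 assume t: "0<=t" and "bowen_dist f t x y < r"
 thus "ALL s:{0..t}. dist (f s x) (f s y) < r" using bowen_dist_le[of t x y "bowen_dist f t x y"] by (auto intro: le_less_trans)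
qed

lemma bowen_ball_iff: "0<=t ==> y\<in>bowen_ball f t x r \<longleftrightarrow> (ALL s:{0..t}. dist (f s x) (f s y) < r)"
 by (simp add: bowen_ball_def bowen_dist_less)

lemma separated_iff: "0<=t ==> separated f t r E \<longleftrightarrow> (ALL x:E. ALL y:E. (near t r x y) --> x = y)"
 unfolding separated_def not_le[symmetric] by (simp only: bowen_dist_le) blast

lemma closed_bowen: "closed {y. ALL s:S. dist (f s x) (f s y)<=r}"
proof -
 have "closed {y. dist (f s x) (f s y)<=r}" for s by (intro closed_Collect_le continuous_intros f_continuous)
 hence "closed (\<Inter>s\<in>S. {y. dist (f s x) (f s y)<=r})" by auto
 also have "(\<Inter>s\<in>S. {y. dist (f s x) (f s y)<=r}) = {y. ALL s:S. dist (f s x) (f s y)<=r}" by auto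
 finally show ?thesis .
qed

lemma finite_net:
 assumes "e > 0"
 obtains F where "finite F" "!!x::'a. EX q:F. dist q x < e"
proof -
 obtain F where F: "finite F" "UNIV\<subseteq>(\<Union>q\<in>F. ball (q::'a) e)" using comp assms unfolding compact_eq_totally_bounded by blast
 have "EX q:F. dist q x < e" for x
 proof -
  have "x\<in>(\<Union>q\<in>F. ball q e)" using F(2) by blast
  thus ?thesis by simp
 qed
 with F(1) show thesis by (rule that)
qed

text \<open>A (t,r)-separated set meets each ball of the following finite cover at most once.\<close>
lemma finite_separated_bound:
 assumes "r > 0"
 obtains N :: nat where "!!t E. 0<=t ==> t<=T ==> separated f t r E ==> finite E&card E<=N"
proof -
 from f_uniform[OF assms,of T] obtain d where d: "d > 0"
  "!!(x::'a) y s. dist x y < d ==> \<bar>s\<bar><=T ==> dist (f s x) (f s y) < r" by blast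
 obtain F where F: "finite F" "!!x::'a. EX q:F. dist q x < d/2" using finite_net[of "d/2"] d(1) by auto
 have "ALL x. EX q:F. dist q x < d/2" using F by auto
 then obtain c where c: "!!x. c x\<in>F" "!!x. dist (c x) x < d/2" by metis
 show thesis
 proof (rule that[of "card F"])
  fix t E assume t: "0<=t" "t<=T" and E: "separated f t r E"
  have "inj_on c E"
  proof (rule inj_onI)
   fix x y assume xy: "x\<in>E" "y\<in>E" "c x = c y"
   have "dist x y < d" using c(2)[of x] c(2)[of y] xy(3) dist_triangle3[of x y "c x"] by auto
   hence "near t r x y" using d(2) t by (auto intro!: less_imp_le)
   thus "x = y" using E xy t by (simp add: separated_iff)
  qed
  moreover have "c ` E\<subseteq>F" using c by auto
  ultimately show "finite E&card E<=card F" using F(1) by (meson card_inj_on_le inj_on_finite)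
 qed
qed

text \<open>Separated sets have bounded cardinality, so one of maximal cardinality exists, and
  maximality makes it spanning. Starting from a prescribed \<open>E0\<close> keeps the weight of a
  set that is already large.\<close>

lemma maximal_separated:
 assumes "r > 0" "0<=t" "E0\<subseteq>A" "separated f t r E0"
 obtains E where "E0\<subseteq>E" "E\<subseteq>A" "finite E" "separated f t r E"
  "!!x. x\<in>A ==> EX y:E. near t r y x"
proof -
 obtain N :: nat where N: "!!E. separated f t r E ==> finite E&card E<=N"
 proof -
  from finite_separated_bound[OF assms(1),of t] obtain N :: nat
   where "!!u E. 0<=u ==> u<=t ==> separated f u r E ==> finite E&card E<=N" by blast
  from this[OF assms(2) order_refl] show thesis by (rule that)
 qed
 let ?P = "%E. E0\<subseteq>E&E\<subseteq>A&separated f t r E"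
 have "?P E0" using assms by auto
 moreover have "ALL E. ?P E --> card E < Suc N" using N by (auto simp: less_Suc_eq_le)
 ultimately obtain E where E: "?P E" "ALL E'. ?P E' --> card E'<=card E" using ex_has_greatest_nat[of ?P E0 card "Suc N"] by auto
 show thesis
 proof (rule that[of E])
  show "finite E" using N E by blast
  fix x assume x: "x\<in>A"
  show "EX y:E. near t r y x"
  proof (rule ccontr)
   assume *: "\<not> ?thesis"
   have "separated f t r (insert x E)" using E(1) * assms(2) unfolding separated_iff[OF assms(2)] by (auto simp: dist_commute)
   moreover have "E0\<subseteq>insert x E" "insert x E\<subseteq>A" using E(1) x by auto
   ultimately have "card (insert x E)<=card E" using E(2) by blast
   moreover have "x\<notin>E" using * assms by auto
   ultimately show False using \<open>finite E\<close> by simp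
  qed
 qed (use E in auto)
qed

subsection \<open>Birkhoff integrals\<close>

lemma birkhoff_integrable:
 fixes g :: "'a=>real"
 assumes "cts g" shows "(%s. g (f s x)) integrable_on {a..b}" by (rule integrable_continuous_interval) (rule continuous_orbit_fun[OF assms])

lemma birkhoff_continuous:
 fixes g :: "'a=>real"
 assumes "cts g" shows "cts (%x. birk g x t)"
proof -
 have "cts (%x. integral (cbox 0 t) (%s. g (f s x)))"
 proof (rule integral_continuous_on_param)
  have "continuous_on (UNIV\<times>cbox 0 t) (%p. g (f (snd p) (fst p)))"
   by (rule continuous_on_compose2[OF assms f_continuous_compose]) (auto intro!: continuous_intros)
  thus "continuous_on (UNIV\<times>cbox 0 t) (%(x,s). g (f s x))" by (simp add: split_def)
 qed
 thus ?thesis by (simp add: birkhoff_int_def)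
qed

lemma birkhoff_0 [simp]: "birk g x 0 = 0" by (simp add: birkhoff_int_def)

lemma integral_flow_shift:
 fixes g :: "'a=>real"
 assumes "cts g" "a<=b"
 shows "integral {a..b} (%s. g (f s (f r x))) = integral {a+r..b+r} (%s. g (f s x))" using integral_shift_Icc_real[of a b "%s. g (f s x)" r]
 by (simp add: f_add[symmetric] comp_def add.commute)

lemma birkhoff_shift:
 fixes g :: "'a=>real"
 assumes "cts g" "0<=t"
 shows "birk g (f r x) t = integral {r..r+t} (%s. g (f s x))" using integral_flow_shift[OF assms,of r x] by (simp add: birkhoff_int_def add.commute)

lemma birkhoff_add:
 fixes g :: "'a=>real"
 assumes g: "cts g" and "0<=s" "0<=t"
 shows "birk g x (s+t) = birk g x s+birk g (f s x) t"
proof -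
 have "integral {0..s+t} (%u. g (f u x)) = integral {0..s} (%u. g (f u x))+integral {s..s+t} (%u. g (f u x))"
  by (rule Henstock_Kurzweil_Integration.integral_combine[symmetric]) (use assms birkhoff_integrable[OF g] in auto)
 thus ?thesis using birkhoff_shift[OF g assms(3),of s x] by (simp add: birkhoff_int_def)
qed

lemma integral_abs_le:
 fixes g :: "'a=>real"
 assumes g: "cts g" and B: "!!x. \<bar>g x\<bar><=B" and "a<=b"
 shows "\<bar>integral {a..b} (%s. g (f s x))\<bar><=B * (b-a)"
 using integral_bound[OF assms(3) continuous_orbit_fun[OF g],of x B] B by (auto simp: abs_le_iff)

lemma birkhoff_abs_le:
 fixes g :: "'a=>real"
 assumes "cts g" "!!x. \<bar>g x\<bar><=B" "0<=t"
 shows "\<bar>birk g x t\<bar><=B * t" using integral_abs_le[OF assms(1,2,3)] by (simp add: birkhoff_int_def)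

lemma birkhoff_linear:
 fixes g h :: "'a=>real"
 assumes g: "cts g" and h: "cts h"
 shows "birk (%x. g x+h x) x t = birk g x t+birk h x t"
  "birk (%x. c * g x) x t = c * birk g x t" unfolding birkhoff_int_def
 using birkhoff_integrable[OF g] birkhoff_integrable[OF h] by (auto simp: Henstock_Kurzweil_Integration.integral_add)

lemma birkhoff_mono:
 fixes g h :: "'a=>real"
 assumes g: "cts g" and h: "cts h" and "!!x. g x<=h x"
 shows "birk g x t<=birk h x t" unfolding birkhoff_int_def using birkhoff_integrable[OF g] birkhoff_integrable[OF h] assms(3) by (intro integral_le) auto

subsection \<open>Invariant measures\<close>

lemma invariant_measureI:
 fixes \<mu> :: "'a measure"
 assumes \<mu>: "sets \<mu> = sets borel" "prob_space \<mu>"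
  and inv: "!!g t. cts g ==> integral\<^sup>L \<mu> (%x. g (f t x)) = integral\<^sup>L \<mu> (g :: 'a=>real)"
 shows "invariant_measure f \<mu>" unfolding invariant_measure_def
proof (intro conjI allI)
 interpret prob_space \<mu> by fact
 fix t
 show m: "f t\<in>measurable \<mu> \<mu>" using borel_measurable_continuous_onI[OF f_continuous[of UNIV t]] \<mu>(1) by (simp cong: measurable_cong_sets)
 show "distr \<mu> \<mu> (f t) = \<mu>"
 proof (rule finite_measure_eqI_continuous)
  show "finite_measure (distr \<mu> \<mu> (f t))" using finite_measure_distr[OF m] .
  fix g :: "'a=>real" assume g: "cts g"
  have "g\<in>borel_measurable \<mu>" using borel_measurable_continuous_onI[OF g] \<mu>(1) by (simp cong: measurable_cong_sets)
  thus "integral\<^sup>L (distr \<mu> \<mu> (f t)) g = integral\<^sup>L \<mu> g" using integral_distr[OF m,of g] inv[OF g,of t] by simp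
 qed (use \<mu> finite_measure_axioms in auto)
qed fact+

end

lemma eq_from_close:
 fixes a b :: real
 assumes "!!e. e > 0 ==> \<bar>a-b\<bar><=e" shows "a = b" using assms[of "\<bar>a-b\<bar>/2"] by (cases "a = b") auto

locale compact_inv_flow = compact_flow f + inv_flow f \<mu> for f :: "real=>'a::metric_space=>'a" and \<mu>
begin

lemma meas_borel: "g\<in>borel_measurable borel ==> g\<in>borel_measurable \<mu>" by (simp cong: measurable_cong_sets)

lemma continuous_measurable: "cts (g :: 'a=>real) ==> g\<in>borel_measurable \<mu>"
 by (rule meas_borel) (rule borel_measurable_continuous_onI)

lemma integrable_continuous: "cts (g :: 'a=>real) ==> integrable \<mu> g"
 using integrable_continuous_compact[OF comp sets_eq finite_measure_axioms] by simp

lemma integral_flow: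
 fixes g :: "'a=>real"
 assumes "g\<in>borel_measurable borel"
 shows "integral\<^sup>L \<mu> (%x. g (f t x)) = integral\<^sup>L \<mu> g"
 using integral_distr[OF flow_measurable,of g t] distr_flow[of t] meas_borel[OF assms] by simp

text \<open>Additivity in the time variable replaces Fubini's theorem.\<close>
lemma integral_birkhoff_invariant:
 fixes g :: "'a=>real"
 assumes g: "cts g" and A: "A\<in>sets borel" "!!t. f t -` A = A"
 shows "(LINT x|\<mu>. ind A x * birk g x (real n)) = n * (LINT x|\<mu>. ind A x * g x)"
proof -
 define I where "I t = (LINT x|\<mu>. ind A x * birk g x t)" for t
 have Ai: "ind A (f t x) = (ind A x :: real)" for t x using A(2)[of t] by (auto simp: indicator_def)
 have int: "integrable \<mu> (%x. ind A x * h x)" if "cts h" for h :: "'a=>real"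
  using integrable_mult_indicator[OF _ integrable_continuous[OF that],of A] A by simp
 have add: "I (s+t) = I s+I t" if "0<=s" "0<=t" for s t
 proof -
  have "I (s+t) = (LINT x|\<mu>. ind A x * birk g x s+ind A x * birk g (f s x) t)" unfolding I_def by (simp add: birkhoff_add[OF g that] algebra_simps)
  also have "\<dots> = I s+(LINT x|\<mu>. ind A x * birk g (f s x) t)" unfolding I_def by (rule Bochner_Integration.integral_add)
    (auto intro!: int birkhoff_continuous g continuous_flow_fun[of "%x. birk g x t"])
  also have "(LINT x|\<mu>. ind A x * birk g (f s x) t) = (LINT x|\<mu>. ind A (f s x) * birk g (f s x) t)" by (simp add: Ai)
  also have "\<dots> = I t" unfolding I_def by (rule integral_flow[where g = "%x. ind A x * birk g x t"])
    (use A borel_measurable_continuous_onI[OF birkhoff_continuous[OF g]] in auto)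
  finally show ?thesis .
 qed
 have mult: "I (real k * t) = k * I t" if "0<=t" for k t
 proof (induction k)
  case 0
  thus ?case by (simp add: I_def)
 next
  case (Suc k)
  thus ?case using add[OF that,of "real k * t"] that by (simp add: algebra_simps)
 qed
 let ?J = "(LINT x|\<mu>. ind A x * g x)"
 \<comment> \<open>\<open>I 1\<close> is cut into \<open>m\<close> equal pieces; over a time step
   \<open>1/m\<close> the orbit barely moves, so \<open>m * birk g x (1/m)\<close> is uniformly
   close to \<open>g x\<close>.\<close>
 have close: "\<bar>I 1 - ?J\<bar><=e" if e: "e > 0" for e
 proof -
  obtain d where d: "d > 0" "!!x y. dist y x < d ==> dist (g y) (g x) < e"
   using compact_uniformly_continuous[OF g comp] e unfolding uniformly_continuous_on_def by auto
  obtain \<kappa> where \<kappa>: "\<kappa> > 0" "!!x r. \<bar>r\<bar><=\<kappa> ==> dist (f r x) x < d" using f_small_time[OF d(1)] by blast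
  obtain n0 where n0: "1/real (Suc n0) < \<kappa>" using nat_approx_posE[OF \<kappa>(1)] .
  define m where "m = real (Suc n0)"
  have m: "m > 0" "1/m<=\<kappa>" using n0 by (auto simp: m_def)
  have pt: "\<bar>m * birk g x (1/m)-g x\<bar><=e" for x
  proof -
   have "birk g x (1/m)-g x/m = integral {0..1/m} (%s. g (f s x)-g x)" unfolding birkhoff_int_def using birkhoff_integrable[OF g] m
    by (subst Henstock_Kurzweil_Integration.integral_diff) auto
   also have "\<bar>\<dots>\<bar><=e * (1/m-0)"
   proof (rule integral_bound[where 'a = real,unfolded real_norm_def])
    show "continuous_on {0..1/m} (%s. g (f s x)-g x)" by (intro continuous_intros continuous_orbit_fun g)
    show "\<bar>g (f s x)-g x\<bar><=e" if "s\<in>{0..1/m}" for s using d(2)[OF \<kappa>(2)[of s x]] that m by (auto simp: dist_real_def intro!: less_imp_le)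
   qed (use m in auto)
   finally have "\<bar>birk g x (1/m)-g x/m\<bar><=e/m" by simp
   hence "m * \<bar>birk g x (1/m)-g x/m\<bar><=e" using m by (simp add: field_simps)
   thus ?thesis using m by (simp add: abs_mult_pos' right_diff_distrib)
  qed
  have "I 1 = m * I (1/m)" using mult[of "1/m" "Suc n0"] m by (simp add: m_def)
  also have "\<dots> - ?J = (LINT x|\<mu>. ind A x * (m * birk g x (1/m)-g x))" unfolding I_def using int[OF birkhoff_continuous[OF g,of "1/m"]] int[OF g]
   by (simp add: right_diff_distrib mult.left_commute)
  also have "\<bar>\<dots>\<bar><=(LINT x|\<mu>. e)"
   using pt by (intro integral_abs_bound[THEN order_trans] integral_mono' ) (auto simp: indicator_def e less_imp_le)
  finally show ?thesis using prob_space by simp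
 qed
 have "I 1 = ?J" by (rule eq_from_close) (rule close)
 moreover have "I (real n) = real n * I 1" using mult[of 1 n] by (simp only: mult_1_right zero_le_one)
 ultimately show ?thesis unfolding I_def by (simp only:)
qed

lemma integral_birkhoff:
 fixes g :: "'a=>real"
 assumes g: "cts g"
 shows "(LINT x|\<mu>. birk g x (real n)) = n * (LINT x|\<mu>. g x)" using integral_birkhoff_invariant[OF g,of UNIV n] by simp

end


section \<open>Ergodic decomposition\<close>

lemma (in inv_flow) prob_UNIV [simp]: "prob UNIV = 1" using prob_space by simp

lemma convergent_of_summable_diff:
 fixes a :: "nat=>real"
 assumes "summable (%k. a (Suc k)-a k)" shows "convergent a"
proof -
 have "(%n. \<Sum>k<n. a (Suc k)-a k) \<longlonglongrightarrow> (\<Sum>k. a (Suc k)-a k)" using assms by (rule summable_LIMSEQ)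
 hence "(%n. a n-a 0) \<longlonglongrightarrow> (\<Sum>k. a (Suc k)-a k)" by (simp only: sum_lessThan_telescope)
 hence "(%n. (a n-a 0)+a 0) \<longlonglongrightarrow> (\<Sum>k. a (Suc k)-a k)+a 0" by (intro tendsto_intros)
 thus ?thesis by (auto simp: convergent_def)
qed

lemma abs_mid_le:
 fixes z :: real
 assumes "z = (a+b)/2" "\<bar>a\<bar><=u" "\<bar>b\<bar><=v" "w = u+v" "0<=u" "0<=v"
 shows "\<bar>z\<bar><=w"
proof -
 have "2 * z = a+b" using assms(1) by simp
 thus ?thesis using assms(2-6) unfolding abs_le_iff by linarith
qed

context compact_flow
begin

definition avg :: "('a=>real)=>nat=>'a=>real" where
 "avg g n x = birk g x (real n)/real n"

lemma avg_continuous: "cts g ==> cts (avg g n)" unfolding avg_def[abs_def] by (cases "n = 0") (auto intro!: continuous_intros birkhoff_continuous)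

lemma avg_abs_le:
 assumes "cts g" "!!x. \<bar>g x\<bar><=B"
 shows "\<bar>avg g n x\<bar><=B"
proof (cases "n = 0")
 case True
 have "0<=B" using assms(2)[of x] by linarith
 thus ?thesis using True by (simp add: avg_def)
next
 case False
 thus ?thesis using birkhoff_abs_le[OF assms,of "real n" x] by (simp add: avg_def field_simps abs_divide)
qed

lemma birkhoff_flow_close:
 fixes g :: "'a=>real"
 assumes g: "cts g" and B: "!!x. \<bar>g x\<bar><=B" and "0<=t"
 shows "\<bar>birk g (f r x) t-birk g x t\<bar><=2 * B * \<bar>r\<bar>"
proof -
 have *: "\<bar>birk g (f r x) t-birk g x t\<bar><=2 * B * r" if "0<=r" for r x
 proof -
  have "birk g x r+birk g (f r x) t = birk g x t+birk g (f t x) r"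
   using birkhoff_add[OF g that assms(3),of x] birkhoff_add[OF g assms(3) that,of x] by (simp add: add.commute)
  moreover have "\<bar>birk g x r\<bar><=B * r" "\<bar>birk g (f t x) r\<bar><=B * r" using birkhoff_abs_le[OF g B that] by auto
  ultimately show ?thesis by linarith
 qed
 show ?thesis
 proof (cases "0<=r")
  case True
  thus ?thesis using *[of r x] by simp
 next
  case False
  thus ?thesis using *[of "-r" "f r x"] by (simp add: abs_minus_commute)
 qed
qed

lemma birkhoff_sum:
 fixes g :: "'a=>real"
 assumes g: "cts g"
 shows "birk g x (real n) = (\<Sum>i<n. birk g (f (real i) x) 1)"
proof (induction n)
 case (Suc n)
 have "birk g x (real n+1) = birk g x (real n)+birk g (f (real n) x) 1" by (rule birkhoff_add[OF g]) auto
 thus ?case using Suc by (simp add: add.commute)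
qed simp

text \<open>Interchanging the two sums turns the average of short averages into a mean of
  \<open>n\<close> shifted copies of the long average; each shift is by less than \<open>n\<close>
  time units and moves the Birkhoff integral by at most \<open>2 * B * n\<close>.\<close>

lemma avg_avg:
 fixes g :: "'a=>real"
 assumes g: "cts g" and B: "!!x. \<bar>g x\<bar><=B" and n: "n>=1" and N: "N>=1"
 shows "\<bar>(\<Sum>i<N. avg g n (f (real i) x))/N-avg g N x\<bar><=2 * B * n/N"
proof -
 have "(\<Sum>i<N. birk g (f (real i) x) (real n)) = (\<Sum>i<N. \<Sum>j<n. birk g (f (real i) (f (real j) x)) 1)" by (simp add: birkhoff_sum[OF g,of _ n] f_commute)
 also have "\<dots> = (\<Sum>j<n. birk g (f (real j) x) (real N))" by (subst sum.swap) (simp add: birkhoff_sum[OF g,of _ N])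
 finally have eq: "(\<Sum>i<N. birk g (f (real i) x) (real n))-n * birk g x (real N)
  = (\<Sum>j<n. birk g (f (real j) x) (real N)-birk g x (real N))" by (simp add: sum_subtractf)
 have B0: "0<=B" using B[of x] by linarith
 have "\<bar>\<Sum>j<n. birk g (f (real j) x) (real N)-birk g x (real N)\<bar>
  <= (\<Sum>j<n. \<bar>birk g (f (real j) x) (real N)-birk g x (real N)\<bar>)" by (rule sum_abs)
 also have "\<dots><=(\<Sum>j<n. 2 * B * n)"
 proof (rule sum_mono)
  fix j assume "j\<in>{..<n}"
  hence "2 * B * \<bar>real j\<bar><=2 * B * n" using B0 by (intro mult_left_mono) auto
  thus "\<bar>birk g (f (real j) x) (real N)-birk g x (real N)\<bar><=2 * B * n" using birkhoff_flow_close[OF g B,of "real N" "real j" x] by linarith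
 qed
 finally have le: "\<bar>(\<Sum>i<N. birk g (f (real i) x) (real n))-n * birk g x (real N)\<bar><=n * (2 * B * n)" using eq by simp
 have "(\<Sum>i<N. avg g n (f (real i) x))/N-avg g N x
   = ((\<Sum>i<N. birk g (f (real i) x) (real n))-n * birk g x (real N))/(n * N)" using n N by (simp add: avg_def sum_divide_distrib[symmetric] field_simps)
 also have "\<bar>\<dots>\<bar><=n * (2 * B * n)/(n * N)" unfolding abs_divide abs_mult abs_of_nat using le by (intro divide_right_mono) auto
 also have "\<dots> = 2 * B * n/N" using n by simp
 finally show ?thesis .
qed

text \<open>Partitions of unity subordinate to finite nets.\<close>
lemma countable_uniform_approximation:
 obtains p :: "nat=>'a=>real" where "!!j. cts (p j)"
  "!!g e. cts g ==> e > 0 ==> \<exists>(Q::'a set) i c. finite Q&(ALL x. \<bar>g x-(SUM q:Q. c q * p (i q) x)\<bar><=e)"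
proof -
 have "EX F. finite F&(ALL x::'a. EX q:F. dist q x < 1/real (Suc k))" for k
 proof -
  have "1/real (Suc k) > 0" by simp
  from finite_net[OF this] show ?thesis by blast
 qed
 then obtain F where F: "!!k. finite (F k)" "!!k (x::'a). EX q:F k. dist q x < 1/real (Suc k)" by metis
 define b where "b k q x = max 0 (1/real (Suc k)-dist q x)" for k and q x :: 'a
 define s where "s k x = (SUM q:F k. b k q x)" for k x
 define P where "P k q x = b k q x/s k x" for k q x
 have b0: "b k q x>=0" for k q x by (simp add: b_def)
 have s0: "s k x > 0" for k x
 proof -
  obtain q where "q\<in>F k" "dist q x < 1/real (Suc k)" using F(2) by blast
  thus ?thesis unfolding s_def using b0 F(1) by (intro sum_pos2[of _ q]) (auto simp: b_def)
 qed
 have cb: "cts (b k q)" for k q unfolding b_def[abs_def] by (intro continuous_intros)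
 have cs: "cts (s k)" for k unfolding s_def[abs_def] by (intro continuous_intros cb)
 have "s k x~=0" for k x using s0[of k x] by simp
 hence cP: "cts (P k q)" for k q unfolding P_def[abs_def] by (intro continuous_intros cb cs) auto
 have sP: "(SUM q:F k. P k q x) = 1" for k x unfolding P_def sum_divide_distrib[symmetric] s_def[symmetric] using s0[of k x] by simp
 define R where "R = (\<Union>k. P k ` F k)"
 have Rc: "countable R" unfolding R_def using F(1) by (intro countable_UN) (auto intro: countable_finite)
 have "F 0~={}" using F(2)[of 0] by auto
 hence Rne: "R~={}" by (auto simp: R_def)
 show thesis
 proof (rule that[of "from_nat_into R"])
  show "cts (from_nat_into R j)" for j using from_nat_into[OF Rne,of j] cP by (auto simp: R_def)
  fix g :: "'a=>real" and e :: real assume g: "cts g" and e: "e > 0"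
  obtain d where d: "d > 0" "!!x y. dist y x < d ==> dist (g y) (g x) < e"
   using compact_uniformly_continuous[OF g comp] e unfolding uniformly_continuous_on_def by auto
  obtain k where k: "1/real (Suc k) < d" using nat_approx_posE[OF d(1)] .
  have ex: "P k q\<in>R" if "q\<in>F k" for q using that by (auto simp: R_def)
  have "\<bar>g x-(SUM q:F k. g q * P k q x)\<bar><=e" for x
  proof -
   have "g x-(SUM q:F k. g q * P k q x) = (SUM q:F k. (g x-g q) * P k q x)" by (simp add: left_diff_distrib sum_subtractf sum_distrib_left[symmetric] sP)
   also have "\<bar>\<dots>\<bar><=(SUM q:F k. \<bar>(g x-g q) * P k q x\<bar>)" by (rule sum_abs)
   also have "\<dots><=(SUM q:F k. e * P k q x)"
   proof (rule sum_mono)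
    fix q assume "q\<in>F k"
    have P0: "P k q x>=0" using b0 s0[of k x] by (simp add: P_def)
    show "\<bar>(g x-g q) * P k q x\<bar><=e * P k q x"
    proof (cases "dist x q < d")
     case True
     hence "\<bar>g x-g q\<bar><=e" using d(2)[of x q] by (simp add: dist_real_def)
     thus ?thesis using P0 by (simp add: abs_mult mult_right_mono)
    next
     case False
     hence "P k q x = 0" using k by (simp add: P_def b_def dist_commute)
     thus ?thesis by simp
    qed
   qed
   also have "\<dots> = e" by (simp add: sum_distrib_left[symmetric] sP)
   finally show ?thesis .
  qed
  moreover have "(SUM q:F k. g q * P k q x) = (SUM q:F k. g q * from_nat_into R (to_nat_on R (P k q)) x)" for x
   using from_nat_into_to_nat_on[OF Rc] ex by (intro sum.cong refl) auto
  ultimately show "\<exists>(Q::'a set) i c. finite Q&(ALL x. \<bar>g x-(SUM q:Q. c q * from_nat_into R (i q) x)\<bar><=e)"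
   using F(1) by (intro exI[of _ "F k"] exI[of _ "%q. to_nat_on R (P k q)"] exI[of _ g]) auto
 qed
qed

end

section \<open>The mean ergodic theorem\<close>

context compact_inv_flow
begin

lemma integral_avg:
 "cts g ==> A\<in>sets borel ==> (!!t. f t -` A = A) ==> n>=1 ==>
  (LINT x|\<mu>. ind A x * avg g n x) = (LINT x|\<mu>. ind A x * g x)" using integral_birkhoff_invariant[of g A n] by (simp add: avg_def)

text \<open>Averaging along the orbit does not increase the mean square: convexity of the square
  pointwise, then invariance of the measure. The term with \<open>\<eta>\<close> pays for replacing
  the average of \<open>q\<close> by \<open>avg g N\<close>.\<close>

lemma integral_sq_avg_le:
 fixes g q :: "'a=>real"
 assumes g: "cts g" and q: "cts q" and B: "!!x. \<bar>g x\<bar><=B" "!!x. \<bar>q x\<bar><=B"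
  and N: "N>=1" and close: "!!x. \<bar>(\<Sum>i<N. q (f (real i) x))/N-avg g N x\<bar><=\<eta>"
 shows "(LINT x|\<mu>. (avg g N x)\<^sup>2)<=(LINT x|\<mu>. (q x)\<^sup>2)+2 * B * \<eta>"
proof -
 have cq: "cts (%x. (q (f (real i) x))\<^sup>2)" for i by (intro continuous_intros continuous_flow_fun q)
 have pt: "(avg g N x)\<^sup>2<=(\<Sum>i<N. (q (f (real i) x))\<^sup>2)/N+2 * B * \<eta>" for x
 proof -
  let ?m = "(\<Sum>i<N. q (f (real i) x))/N"
  have "\<bar>\<Sum>i<N. q (f (real i) x)\<bar><=(\<Sum>i<N. B)" by (rule order_trans[OF sum_abs sum_mono]) (rule B)
  hence m: "\<bar>?m\<bar><=B" using N by (simp add: field_simps)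
  have a: "\<bar>avg g N x\<bar><=B" by (rule avg_abs_le[OF g B(1)])
  have "(avg g N x)\<^sup>2 - ?m\<^sup>2 = (avg g N x+?m)*(avg g N x - ?m)" by (simp add: power2_eq_square algebra_simps)
  also have "\<dots><=\<bar>avg g N x+?m\<bar>*\<bar>avg g N x - ?m\<bar>" by (metis abs_ge_self abs_mult)
  also have "\<dots><=(2 * B)*\<eta>"
  proof (rule mult_mono)
   show "\<bar>avg g N x+?m\<bar><=2 * B" using m a unfolding abs_le_iff by linarith
   show "\<bar>avg g N x - ?m\<bar><=\<eta>" using close[of x] by (simp only: abs_minus_commute)
   show "0<=2 * B" using a by linarith
  qed simp
  finally have "(avg g N x)\<^sup>2<=?m\<^sup>2+2 * B * \<eta>" by simp
  also have "?m\<^sup>2<=((\<Sum>i<N. (q (f (real i) x))\<^sup>2) * card {..<N})/(real N)\<^sup>2"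
   unfolding power_divide by (intro divide_right_mono sum_squared_le_sum_of_squares) auto
  also have "\<dots> = (\<Sum>i<N. (q (f (real i) x))\<^sup>2)/N" using N by (simp add: power2_eq_square)
  finally show ?thesis by simp
 qed
 have "(LINT x|\<mu>. (avg g N x)\<^sup>2)<=(LINT x|\<mu>. (\<Sum>i<N. (q (f (real i) x))\<^sup>2)/N+2 * B * \<eta>)"
  by (rule integral_mono[OF _ _ pt]; rule integrable_continuous) (use N in \<open>auto intro!: continuous_intros avg_continuous g cq\<close>)
 also have "\<dots> = (\<Sum>i<N. (LINT x|\<mu>. (q (f (real i) x))\<^sup>2))/N+2 * B * \<eta>" using integrable_continuous[OF cq] by (simp add: prob_space)
 also have "\<dots> = (\<Sum>i<N. (LINT x|\<mu>. (q x)\<^sup>2))/N+2 * B * \<eta>"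
  using integral_flow[of "%x. (q x)\<^sup>2"] borel_measurable_continuous_onI[OF q] by simp
 also have "\<dots> = (LINT x|\<mu>. (q x)\<^sup>2)+2 * B * \<eta>" using N by simp
 finally show ?thesis .
qed

text \<open>The mean squares of the averages approach their infimum \<open>c\<close>. The midpoint
  of two averages has mean square at least \<open>c\<close> as well, because averaging it further
  almost gives a long average of \<open>g\<close>; the parallelogram identity then makes the
  averages Cauchy.\<close>

theorem mean_ergodic:
 fixes g :: "'a=>real"
 assumes g: "cts g" and e: "e > 0"
 obtains N where "!!n m. n>=N ==> m>=N ==> (LINT x|\<mu>. (avg g n x-avg g m x)\<^sup>2)<=e"
proof -
 from bounded_fun[OF g] obtain B where B: "B > 0" "!!x. \<bar>g x\<bar><=B" by blast
 define I where "I n = (LINT x|\<mu>. (avg g n x)\<^sup>2)" for n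
 define c where "c = (INF n\<in>{1..}. I n)"
 have I0: "I n>=0" for n unfolding I_def by simp
 hence bdd: "bdd_below (I ` {1..})" by (intro bdd_belowI[of _ 0]) auto
 have cI: "c<=I n" if "n>=1" for n unfolding c_def using bdd that by (intro cINF_lower) auto
 have ca: "cts (avg g n)" for n by (rule avg_continuous[OF g])
 have step: "I N<=I n+4 * B\<^sup>2 * n/N" if "n>=1" "N>=1" for n N
  using integral_sq_avg_le[OF g ca B(2) avg_abs_le[OF g B(2)] that(2) avg_avg[OF g B(2) that]] by (simp add: I_def power2_eq_square algebra_simps)
 have mid: "c<=(LINT x|\<mu>. ((avg g n x+avg g m x)/2)\<^sup>2)" if n: "n>=1" and m: "m>=1" for n m
 proof (rule field_le_epsilon)
  fix \<delta> :: real assume \<delta>: "\<delta> > 0"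
  obtain N0 :: nat where N0: "4 * B\<^sup>2*(n+m)/\<delta> < N0" using reals_Archimedean2 by blast
  define N where "N = Suc N0"
  have N: "N>=1" by (simp add: N_def)
  have "c<=I N" by (rule cI[OF N])
  also have "I N<=(LINT x|\<mu>. ((avg g n x+avg g m x)/2)\<^sup>2)+2 * B * (2 * B * (n+m)/N)" unfolding I_def
  proof (rule integral_sq_avg_le[OF g _ B(2) _ N])
   show "cts (%x. (avg g n x+avg g m x)/2)" by (intro continuous_intros ca) auto
   show "\<bar>(avg g n x+avg g m x)/2\<bar><=B" for x
    using avg_abs_le[OF g B(2),of n x] avg_abs_le[OF g B(2),of m x] unfolding abs_le_iff by (auto simp: field_simps)
   fix x
   have "(\<Sum>i<N. (avg g n (f (real i) x)+avg g m (f (real i) x))/2)/N-avg g N x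
    = (((\<Sum>i<N. avg g n (f (real i) x))/N-avg g N x)+((\<Sum>i<N. avg g m (f (real i) x))/N-avg g N x))/2"
    using N by (simp add: sum.distrib sum_divide_distrib[symmetric] field_simps)
   moreover have "\<bar>(\<Sum>i<N. avg g n (f (real i) x))/N-avg g N x\<bar><=2 * B * n/N"
    "\<bar>(\<Sum>i<N. avg g m (f (real i) x))/N-avg g N x\<bar><=2 * B * m/N" using avg_avg[OF g B(2) n N] avg_avg[OF g B(2) m N] by auto
   moreover have "2 * B * (n+m)/N = 2 * B * n/N+2 * B * m/N" by (simp add: algebra_simps add_divide_distrib)
   moreover have "0<=2 * B * n/N" "0<=2 * B * m/N" using B by auto
   ultimately show "\<bar>(\<Sum>i<N. (avg g n (f (real i) x)+avg g m (f (real i) x))/2)/N-avg g N x\<bar><=2 * B * (n+m)/N" by (rule abs_mid_le)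
  qed
  also have "2 * B * (2 * B * (n+m)/N)<=\<delta>"
  proof -
   have "4 * B\<^sup>2*(n+m) < N0*\<delta>" using N0 \<delta> by (simp only: pos_divide_less_eq)
   also have "\<dots><=N * \<delta>" using \<delta> by (intro mult_right_mono) (auto simp: N_def)
   finally have "4 * B\<^sup>2*(n+m)<=N * \<delta>" by simp
   hence "4 * B\<^sup>2*(n+m)/N<=\<delta>" using N by (simp only: divide_le_eq) (simp add: mult.commute)
   thus ?thesis by (simp add: power2_eq_square algebra_simps)
  qed
  finally show "c<=(LINT x|\<mu>. ((avg g n x+avg g m x)/2)\<^sup>2)+\<delta>" by simp
 qed
 obtain n0 where n0: "n0>=1" "I n0 < c+e/8"
 proof -
  have "c < c+e/8" using e by simp
  thus thesis using that unfolding c_def by (subst (asm) cINF_less_iff) (use bdd in auto)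
 qed
 obtain N0 :: nat where N0: "4 * B\<^sup>2 * n0/(e/8) < N0" using reals_Archimedean2 by blast
 show thesis
 proof (rule that[of "Suc N0"])
  fix n m assume n: "n>=Suc N0" and m: "m>=Suc N0"
  have small: "I k<=c+e/4" if "k>=Suc N0" for k
  proof -
   have "4 * B\<^sup>2 * n0 < N0*(e/8)" using N0 e by (simp add: pos_divide_less_eq)
   also have "\<dots><=k * (e/8)" using e that by (intro mult_right_mono) auto
   finally have "4 * B\<^sup>2 * n0/k<=e/8" using that by (simp add: divide_le_eq mult.commute)
   thus ?thesis using step[OF n0(1),of k] that n0(2) by simp
  qed
  have int: "integrable \<mu> (%x. (avg g n x)\<^sup>2)" for n by (rule integrable_continuous) (intro continuous_intros ca)
  have int2: "integrable \<mu> (%x. ((avg g n x+avg g m x)/2)\<^sup>2)" by (rule integrable_continuous) (intro continuous_intros ca, auto)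
  have "(LINT x|\<mu>. (avg g n x-avg g m x)\<^sup>2) = (LINT x|\<mu>. 2*(avg g n x)\<^sup>2+2*(avg g m x)\<^sup>2-4*((avg g n x+avg g m x)/2)\<^sup>2)"
   by (rule Bochner_Integration.integral_cong) (auto simp: power2_eq_square field_simps)
  also have "\<dots> = 2 * I n+2 * I m-4*(LINT x|\<mu>. ((avg g n x+avg g m x)/2)\<^sup>2)" using int int2 by (simp add: I_def)
  also have "\<dots><=e" using mid[of n m] small[OF n] small[OF m] n m by simp
  finally show "(LINT x|\<mu>. (avg g n x-avg g m x)\<^sup>2)<=e" .
 qed
qed

lemma integral_sq_bound:
 fixes h :: "'a=>real"
 assumes h: "integrable \<mu> h" "integrable \<mu> (%x. (h x)\<^sup>2)"
 shows "(LINT x|\<mu>. h x)\<^sup>2<=(LINT x|\<mu>. (h x)\<^sup>2)"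
proof -
 let ?c = "(LINT x|\<mu>. h x)"
 have "0<=(LINT x|\<mu>. (h x - ?c)\<^sup>2)" by (intro integral_nonneg_AE) simp
 also have "\<dots> = (LINT x|\<mu>. (h x)\<^sup>2-2*?c * h x+?c\<^sup>2)" by (rule Bochner_Integration.integral_cong) (auto simp: power2_eq_square algebra_simps)
 also have "\<dots> = (LINT x|\<mu>. (h x)\<^sup>2) - ?c\<^sup>2" using h by (simp add: prob_space power2_eq_square)
 finally show ?thesis by simp
qed


lemma integrable_bounded:
 fixes h :: "'a=>real"
 assumes "h\<in>borel_measurable borel" "!!x. \<bar>h x\<bar><=B"
 shows "integrable \<mu> h" by (rule integrable_const_bound[of _ B]) (use assms meas_borel in auto)

text \<open>Mean convergence yields almost sure convergence along a subsequence: \<open>r\<close>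
  grows fast enough for the increments to be summable in mean. One \<open>r\<close> serves all
  \<open>p j\<close>, since stage \<open>k\<close> handles the indices \<open>j<=k\<close>.\<close>

lemma averages_converge_ae:
 fixes p :: "nat=>'a=>real"
 assumes p: "!!j. cts (p j)"
 obtains r :: "nat=>nat" where "strict_mono r" "AE x in \<mu>. ALL j. convergent (%k. avg (p j) (r k) x)"
proof -
 have ca: "cts (avg (p j) n)" for j n by (rule avg_continuous[OF p])
 have "EX N. ALL j<=k. ALL n>=N. ALL m>=N. (LINT x|\<mu>. \<bar>avg (p j) n x-avg (p j) m x\<bar>)<=(1/2)^k" for k
 proof -
  have "EX N. ALL n>=N. ALL m>=N. (LINT x|\<mu>. \<bar>avg (p j) n x-avg (p j) m x\<bar>)<=(1/2)^k" for j
  proof -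
   have "((1/2::real)^k)\<^sup>2 > 0" by simp
   from mean_ergodic[OF p[of j] this] obtain N
    where N: "!!n m. n>=N ==> m>=N ==> (LINT x|\<mu>. (avg (p j) n x-avg (p j) m x)\<^sup>2)<=((1/2)^k)\<^sup>2" by blast
   have "(LINT x|\<mu>. \<bar>avg (p j) n x-avg (p j) m x\<bar>)<=(1/2)^k" if "n>=N" "m>=N" for n m
   proof (rule power2_le_imp_le)
    have "(LINT x|\<mu>. \<bar>avg (p j) n x-avg (p j) m x\<bar>)\<^sup>2<=(LINT x|\<mu>. \<bar>avg (p j) n x-avg (p j) m x\<bar>\<^sup>2)"
     by (rule integral_sq_bound; rule integrable_continuous; intro continuous_intros ca)
    also have "\<dots><=((1/2)^k)\<^sup>2" using N[OF that] by simp
    finally show "(LINT x|\<mu>. \<bar>avg (p j) n x-avg (p j) m x\<bar>)\<^sup>2<=((1/2)^k)\<^sup>2" .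
   qed simp
   thus ?thesis by blast
  qed
  then obtain N where N: "!!j n m. n>=N j ==> m>=N j ==> (LINT x|\<mu>. \<bar>avg (p j) n x-avg (p j) m x\<bar>)<=(1/2)^k"
   by metis
  have "N j<=(\<Sum>j\<le>k. N j)" if "j<=k" for j using that by (intro member_le_sum) auto
  thus ?thesis using N by (intro exI[of _ "\<Sum>j\<le>k. N j"]) (meson order_trans)
 qed
 then obtain N where N: "!!k j n m. j<=k ==> n>=N k ==> m>=N k ==> (LINT x|\<mu>. \<bar>avg (p j) n x-avg (p j) m x\<bar>)<=(1/2)^k"
  by metis
 define r where "r k = k+(\<Sum>i\<le>k. N i)" for k
 have r_mono: "strict_mono r" unfolding strict_mono_Suc_iff by (simp add: r_def)
 have rN: "N k<=r k" "N k<=r (Suc k)" for k using member_le_sum[of k "{..k}" N] by (auto simp: r_def)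
 have ae: "AE x in \<mu>. convergent (%k. avg (p j) (r k) x)" for j
 proof -
  \<comment> \<open>The shift by \<open>j\<close> starts the series where stage \<open>k+j\<close>
    already controls \<open>p j\<close>.\<close>
  define d where "d k x = \<bar>avg (p j) (r (Suc (k+j))) x-avg (p j) (r (k+j)) x\<bar>" for k x
  have cd: "cts (d k)" for k unfolding d_def[abs_def] by (intro continuous_intros ca)
  have [measurable]: "d k\<in>borel_measurable \<mu>" for k by (rule continuous_measurable[OF cd])
  have d1: "(LINT x|\<mu>. d k x)<=(1/2)^k" for k
  proof -
   have "(LINT x|\<mu>. d k x)<=(1/2)^(k+j)" unfolding d_def by (rule N) (use rN in auto)
   also have "\<dots><=(1/2)^k" by (intro power_decreasing) auto
   finally show ?thesis .
  qed
  have "(\<integral>\<^sup>+x. (\<Sum>k. ennreal (d k x)) \<partial>\<mu>) = (\<Sum>k. \<integral>\<^sup>+x. ennreal (d k x) \<partial>\<mu>)"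
   by (rule nn_integral_suminf) measurable
  also have "\<dots> = (\<Sum>k. ennreal (LINT x|\<mu>. d k x))" by (intro suminf_cong nn_integral_eq_integral integrable_continuous cd) (simp add: d_def)
  also have "\<dots><=(\<Sum>k. ennreal ((1/2)^k))" by (intro suminf_le ennreal_leI d1) auto
  also have "\<dots> = ennreal (\<Sum>k. (1/2)^k)" by (rule suminf_ennreal2) (auto intro: summable_geometric)
  also have "\<dots> < \<infinity>" by simp
  finally have "AE x in \<mu>. (\<Sum>k. ennreal (d k x))~=\<infinity>" by (intro nn_integral_PInf_AE) auto
  thus ?thesis
  proof eventually_elim
   case (elim x)
   hence "summable (%k. d k x)" by (intro summable_suminf_not_top) (auto simp: d_def)
   hence "summable (%k. avg (p j) (r (Suc (k+j))) x-avg (p j) (r (k+j)) x)" unfolding d_def by (rule summable_rabs_cancel)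
   hence "convergent (%n. avg (p j) (r (n+j)) x)" using convergent_of_summable_diff[of "%k. avg (p j) (r (k+j)) x"] by simp
   thus ?case using convergent_ignore_initial_segment[of "%k. avg (p j) (r k) x" j] by simp
  qed
 qed
 have "AE x in \<mu>. ALL j. convergent (%k. avg (p j) (r k) x)" using ae by (simp add: AE_all_countable)
 with r_mono show thesis by (rule that)
qed

end


lemma abs_diff_aux:
 fixes a b u w z e :: real
 assumes "a-b = u-w" "\<bar>u\<bar><=e/2" "\<bar>w\<bar><=1*\<bar>z\<bar>" "\<bar>z\<bar><=e/2" "b = 0"
 shows "\<bar>a-0\<bar><=e" using assms by linarith

context compact_flow
begin

lemma compact_inv_flowI: "invariant_measure f m ==> compact_inv_flow f m"
 using compact_flow_axioms cflow by (auto intro!: compact_inv_flow.intro inv_flow.intro)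

text \<open>The test on the family p suffices by linearity and uniform approximation.\<close>
lemma ergodicI:
 fixes p :: "nat=>'a=>real"
 assumes m: "invariant_measure f m" and p: "!!j. cts (p j)"
  and dense: "!!g e. cts g ==> e > 0 ==> \<exists>(Q::'a set) i c. finite Q&(ALL x. \<bar>g x-(SUM q:Q. c q * p (i q) x)\<bar><=e)"
  and var: "!!j. EX s :: nat=>nat. (ALL k. s k>=1)&(%k. (LINT x|m. (avg (p j) (s k) x)\<^sup>2)-(LINT x|m. p j x)\<^sup>2) \<longlonglongrightarrow> 0"
 shows "ergodic_measure f m" unfolding ergodic_measure_def
proof (intro conjI ballI impI)
 interpret m: compact_inv_flow f m using m by (rule compact_inv_flowI)
 fix A assume A0: "A\<in>sets m" and "ALL t. f t -` A = A"
 hence A: "A\<in>sets borel" "!!t. f t -` A = A" by auto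
 have intA: "integrable m (%x. ind A x * g x)" if "cts g" for g :: "'a=>real"
  using integrable_mult_indicator[OF A0 m.integrable_continuous[OF that]] by simp
 \<comment> \<open>The covariance of the indicator of \<open>A\<close> with \<open>g\<close>.
   Replacing \<open>g\<close> by its averages leaves it unchanged as \<open>A\<close> is invariant,
   so it is bounded by their standard deviation.\<close>
 define D where "D g = (LINT x|m. ind A x * g x)-measure m A * (LINT x|m. g x)" for g
 have Dp: "D (p j) = 0" for j
 proof -
  obtain s :: "nat=>nat" where s: "!!k. s k>=1" "(%k. (LINT x|m. (avg (p j) (s k) x)\<^sup>2)-(LINT x|m. p j x)\<^sup>2) \<longlonglongrightarrow> 0"
   using var by blast
  let ?l = "(LINT x|m. p j x)"
  have "(D (p j))\<^sup>2<=(LINT x|m. (avg (p j) (s k) x)\<^sup>2) - ?l\<^sup>2" for k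
  proof -
   have ca: "cts (avg (p j) (s k))" by (rule avg_continuous[OF p])
   have l: "(LINT x|m. avg (p j) (s k) x) = ?l" using m.integral_avg[OF p,of UNIV "s k"] s(1)[of k] by simp
   have "D (p j) = (LINT x|m. ind A x * avg (p j) (s k) x)-measure m A * ?l" unfolding D_def using m.integral_avg[OF p A s(1)] by simp
   also have "\<dots> = (LINT x|m. ind A x * (avg (p j) (s k) x - ?l))" using intA[OF ca] A0 by (simp add: right_diff_distrib m.emeasure_eq_measure)
   finally have De: "D (p j) = (LINT x|m. ind A x * (avg (p j) (s k) x - ?l))" .
   have "(D (p j))\<^sup>2<=(LINT x|m. (ind A x * (avg (p j) (s k) x - ?l))\<^sup>2)"
   proof -
    have sq: "(%x. (ind A x * (avg (p j) (s k) x - ?l))\<^sup>2) = (%x. ind A x * (avg (p j) (s k) x - ?l)\<^sup>2)" by (auto simp: indicator_def)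
    have "cts (%x. avg (p j) (s k) x - ?l)" "cts (%x. (avg (p j) (s k) x - ?l)\<^sup>2)" by (intro continuous_intros ca)+
    hence "integrable m (%x. ind A x * (avg (p j) (s k) x - ?l))" "integrable m (%x. (ind A x * (avg (p j) (s k) x - ?l))\<^sup>2)"
     unfolding sq by - (intro intA; assumption)+
    from m.integral_sq_bound[OF this] show ?thesis using De by simp
   qed
   also have "\<dots><=(LINT x|m. (avg (p j) (s k) x - ?l)\<^sup>2)"
    by (rule integral_mono') (auto simp: indicator_def intro!: m.integrable_continuous continuous_intros ca)
   also have "\<dots> = (LINT x|m. (avg (p j) (s k) x)\<^sup>2-2*?l * avg (p j) (s k) x+?l\<^sup>2)"
    by (rule Bochner_Integration.integral_cong) (auto simp: power2_eq_square algebra_simps)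
   also have "\<dots> = (LINT x|m. (avg (p j) (s k) x)\<^sup>2)-2*?l * ?l+?l\<^sup>2"
    using m.integrable_continuous[OF ca] m.integrable_continuous[of "%x. (avg (p j) (s k) x)\<^sup>2"] ca l by (simp add: continuous_intros)
   finally show ?thesis by (simp add: power2_eq_square)
  qed
  hence "(D (p j))\<^sup>2<=0" by (intro LIMSEQ_le_const[OF s(2)]) auto
  thus ?thesis by simp
 qed
 have Dg: "D g = 0" if g: "cts g" for g :: "'a=>real"
 proof (rule eq_from_close)
  fix e :: real assume e: "e > 0"
  then obtain Q :: "'a set" and i c where Q: "finite Q" "!!x. \<bar>g x-(SUM q:Q. c q * p (i q) x)\<bar><=e/2" using dense[OF g,of "e/2"] by auto
  define h where "h x = (SUM q:Q. c q * p (i q) x)" for x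
  have ch: "cts h" unfolding h_def[abs_def] by (intro continuous_intros p)
  have "D h = (SUM q:Q. c q * D (p (i q)))"
  proof -
   have "(LINT x|m. ind A x * h x) = (LINT x|m. (SUM q:Q. c q * (ind A x * p (i q) x)))" by (simp add: h_def sum_distrib_left mult.left_commute)
   also have "\<dots> = (SUM q:Q. c q * (LINT x|m. ind A x * p (i q) x))" using intA[OF p] by (simp add: Bochner_Integration.integral_sum)
   moreover have "(LINT x|m. h x) = (SUM q:Q. c q * (LINT x|m. p (i q) x))"
    unfolding h_def using m.integrable_continuous[OF p] by (simp add: Bochner_Integration.integral_sum)
   ultimately show ?thesis unfolding D_def by (simp add: sum_distrib_left sum_subtractf right_diff_distrib mult.left_commute)
  qed
  hence Dh: "D h = 0" using Dp by simp
  have gh: "\<bar>g x-h x\<bar><=e/2" for x using Q(2) by (simp add: h_def)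
  have c1: "cts (%x. g x-h x)" by (intro continuous_intros g ch)
  show "\<bar>D g-0\<bar><=e"
  proof (rule abs_diff_aux)
   show "D g-D h = (LINT x|m. ind A x * (g x-h x))-measure m A * (LINT x|m. g x-h x)"
    unfolding D_def using intA[OF g] intA[OF ch] m.integrable_continuous[OF g] m.integrable_continuous[OF ch] by (simp add: right_diff_distrib)
   have "\<bar>(LINT x|m. ind A x * (g x-h x))\<bar><=(LINT x|m. e/2)"
    using gh e by (intro integral_abs_bound[THEN order_trans] integral_mono') (auto simp: indicator_def)
   thus "\<bar>(LINT x|m. ind A x * (g x-h x))\<bar><=e/2" by simp
   have "\<bar>(LINT x|m. g x-h x)\<bar><=(LINT x|m. e/2)" using gh e by (intro integral_abs_bound[THEN order_trans] integral_mono') auto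
   thus "\<bar>(LINT x|m. g x-h x)\<bar><=e/2" by simp
   show "\<bar>measure m A * (LINT x|m. g x-h x)\<bar><=1*\<bar>(LINT x|m. g x-h x)\<bar>" unfolding abs_mult by (intro mult_right_mono) auto
  qed (rule Dh)
 qed
 \<comment> \<open>Vanishing covariance with all continuous functions makes these two measures
   equal; evaluated at \<open>A\<close> this says that \<open>measure m A\<close> is its own
   square.\<close>
 have "density m (%x. ennreal (ind A x)) = density m (%_. ennreal (measure m A))"
 proof (rule finite_measure_eqI_continuous)
  show "finite_measure (density m (%x. ennreal (ind A x)))"
  proof (rule finite_measureI)
   have "emeasure (density m (%x. ennreal (ind A x))) UNIV = (\<integral>\<^sup>+x. ennreal (ind A x) * ind UNIV x \<partial>m)"
    by (rule emeasure_density) (use A0 in \<open>auto intro!: borel_measurable_indicator\<close>)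
   also have "\<dots> = emeasure m A" using A0 by (simp add: ennreal_indicator)
   finally show "emeasure (density m (%x. ennreal (ind A x))) (space (density m (%x. ennreal (ind A x))))~=\<infinity>"
    by (simp add: m.emeasure_eq_measure)
  qed
  show "finite_measure (density m (%_. ennreal (measure m A)))" by (auto intro!: finite_measureI simp: emeasure_density_const ennreal_mult_eq_top_iff)
  fix g :: "'a=>real" assume g: "cts g"
  show "integral\<^sup>L (density m (%x. ennreal (ind A x))) g = integral\<^sup>L (density m (%_. ennreal (measure m A))) g"
  proof -
   have [measurable]: "(ind A :: 'a=>real)\<in>borel_measurable m" "g\<in>borel_measurable m"
    using A0 m.continuous_measurable[OF g] by (auto intro: borel_measurable_indicator)
   show ?thesis using Dg[OF g] by (simp add: integral_real_density D_def)
  qed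
 qed auto
 hence "emeasure (density m (%x. ennreal (ind A x))) A = emeasure (density m (%_. ennreal (measure m A))) A" by simp
 moreover have "emeasure (density m (%x. ennreal (ind A x))) A = (\<integral>\<^sup>+x. ennreal (ind A x) * ind A x \<partial>m)"
  by (rule emeasure_density) (use A0 in \<open>auto intro!: borel_measurable_indicator\<close>)
 moreover have "\<dots> = (\<integral>\<^sup>+x. ind A x \<partial>m)" by (rule nn_integral_cong) (auto simp: indicator_def)
 moreover have "\<dots> = ennreal (measure m A)" using A0 by (simp add: m.emeasure_eq_measure)
 moreover have "emeasure (density m (%_. ennreal (measure m A))) A = ennreal (measure m A * measure m A)"
  using A0 by (simp add: emeasure_density_const m.emeasure_eq_measure ennreal_mult)
 ultimately have "ennreal (measure m A) = ennreal (measure m A * measure m A)" by simp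
 hence "measure m A * (measure m A-1) = 0" by (simp add: algebra_simps)
 thus "measure m A = 0 \<or> measure m A = 1" by simp
qed fact

end

section \<open>Disintegration into ergodic components\<close>

context compact_inv_flow
begin

text \<open>The component of \<open>x\<close> represents the limit of its time averages along
  \<open>r\<close>. It is constant on orbits, and the disintegration is localised to every invariant
  set. Components are ergodic almost surely because the variances of the time averages under
  \<open>\<nu> x\<close> tend to 0 in the mean, hence almost surely along a further subsequence for
  each \<open>p j\<close>; this is the criterion \<open>ergodicI\<close>.\<close>

theorem ergodic_kernel:
 obtains \<nu> :: "'a=>'a measure" where "!!x. invariant_measure f (\<nu> x)" "!!x t. \<nu> (f t x) = \<nu> x"
  "!!g :: 'a=>real. cts g ==> (%x. integral\<^sup>L (\<nu> x) g)\<in>borel_measurable (borel :: 'a measure)"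
  "!!(g :: 'a=>real) A. cts g ==> A\<in>sets borel ==> (!!t. f t -` A = A) ==>
   (LINT x|\<mu>. ind A x * g x) = (LINT x|\<mu>. ind A x * integral\<^sup>L (\<nu> x) g)"
  "AE x in \<mu>. ergodic_measure f (\<nu> x)"
proof -
 obtain p :: "nat=>'a=>real" where p: "!!j. cts (p j)"
  and dense: "!!g e. cts g ==> e > 0 ==> \<exists>(Q::'a set) i c. finite Q&(ALL x. \<bar>g x-(SUM q:Q. c q * p (i q) x)\<bar><=e)"
  by (rule countable_uniform_approximation) blast
 obtain r :: "nat=>nat" where r: "strict_mono r" and conv_ae: "AE x in \<mu>. ALL j. convergent (%k. avg (p j) (r k) x)"
  by (rule averages_converge_ae[OF p])
 have r_ge: "r k>=k" for k using strict_mono_imp_increasing[OF r] .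
 have ca: "cts g ==> cts (avg g n)" for g n by (rule avg_continuous)
 define X where "X = {x. ALL j. convergent (%k. avg (p j) (r k) x)}"
 have X_meas: "X\<in>sets borel"
 proof -
  have [measurable]: "avg (p j) n\<in>borel_measurable borel" for j n by (rule borel_measurable_continuous_onI[OF ca[OF p]])
  have "{x\<in>space borel. Cauchy (%k. avg (p j) (r k) x)}\<in>sets borel" for j by measurable
  hence "(\<Inter>j. {x. Cauchy (%k. avg (p j) (r k) x)})\<in>sets borel" by auto
  also have "(\<Inter>j. {x. Cauchy (%k. avg (p j) (r k) x)}) = X" by (auto simp: X_def Cauchy_convergent_iff)
  finally show ?thesis .
 qed
 have conv: "convergent (%k. avg g (r k) x)" if x: "x\<in>X" and g: "cts g" for g x unfolding Cauchy_convergent_iff[symmetric]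
 proof (rule CauchyI)
  fix e :: real assume e: "e > 0"
  then obtain Q :: "'a set" and i c where Q: "finite Q" "!!x. \<bar>g x-(SUM q:Q. c q * p (i q) x)\<bar><=e/4" using dense[OF g,of "e/4"] by auto
  define h where "h x = (SUM q:Q. c q * p (i q) x)" for x
  have ch: "cts h" unfolding h_def[abs_def] by (intro continuous_intros p)
  have havg: "avg h n x = (SUM q:Q. c q * avg (p (i q)) n x)" for n
  proof -
   have "birk h x t = (SUM q:Q. c q * birk (p (i q)) x t)" for t unfolding birkhoff_int_def h_def using Q(1) by (subst Henstock_Kurzweil_Integration.integral_sum)
      (auto intro!: integrable_continuous_interval continuous_intros continuous_orbit_fun[OF p])
   thus ?thesis by (simp add: avg_def sum_divide_distrib)
  qed
  have close: "\<bar>avg g n x-avg h n x\<bar><=e/4" for n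
  proof -
   have "avg g n x-avg h n x = avg (%x. g x-h x) n x" using birkhoff_linear[OF g,of "%x. - 1 * h x"] birkhoff_linear(2)[OF ch ch,of "-1"] ch
    by (simp add: avg_def diff_divide_distrib continuous_intros)
   thus ?thesis using avg_abs_le[of "%x. g x-h x" "e/4" n x] Q(2) g ch by (simp add: h_def continuous_intros)
  qed
  have "convergent (%k. avg h (r k) x)" unfolding havg using x by (intro convergent_sum convergent_mult convergent_const) (auto simp: X_def)
  hence "Cauchy (%k. avg h (r k) x)" by (simp add: Cauchy_convergent_iff)
  then obtain M where M: "!!m n. m>=M ==> n>=M ==> norm (avg h (r m) x-avg h (r n) x) < e/2"
   using CauchyD[of _ "e/2"] e by (metis half_gt_zero)
  show "EX M. ALL m>=M. ALL n>=M. norm (avg g (r m) x-avg g (r n) x) < e"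
  proof (intro exI[of _ M] allI impI)
   fix m n assume "m>=M" "n>=M"
   hence "\<bar>avg h (r m) x-avg h (r n) x\<bar> < e/2" using M by simp
   thus "norm (avg g (r m) x-avg g (r n) x) < e" using close[of "r m"] close[of "r n"] unfolding real_norm_def by linarith
  qed
 qed
 define l where "l x g = lim (%k. avg g (r k) x)" for x g
 have l: "(%k. avg g (r k) x) \<longlonglongrightarrow> l x g" if "x\<in>X" "cts g" for x g using conv[OF that] by (simp add: l_def convergent_LIMSEQ_iff)
 have lstate: "state_on (l x)" if x: "x\<in>X" for x unfolding state_on_def
 proof (intro conjI allI impI)
  fix g h :: "'a=>real" and c :: real assume g: "cts g"
  have cg: "cts (%x. c * g x)" by (intro continuous_intros g)
  have "(%k. avg (%x. c * g x) (r k) x) \<longlonglongrightarrow> c * l x g"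
   using tendsto_mult_left[OF l[OF x g],of c] birkhoff_linear(2)[OF g g] by (simp add: avg_def)
  thus "l x (%x. c * g x) = c * l x g" using l[OF x cg] LIMSEQ_unique by blast
  show "0<=l x g" if "ALL x. 0<=g x"
  proof (rule LIMSEQ_le_const[OF l[OF x g]], intro exI allI impI)
   have "0<=birk g x t" for t using birkhoff_mono[of "%_. 0" g x t] g that by (simp add: birkhoff_int_def)
   thus "0<=avg g (r k) x" for k by (simp add: avg_def)
  qed
  assume h: "cts h"
  have gh: "cts (%x. g x+h x)" by (intro continuous_intros g h)
  have "(%k. avg (%x. g x+h x) (r k) x) \<longlonglongrightarrow> l x g+l x h"
   using tendsto_add[OF l[OF x g] l[OF x h]] birkhoff_linear(1)[OF g h] by (simp add: avg_def add_divide_distrib)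
  thus "l x (%x. g x+h x) = l x g+l x h" using l[OF x gh] LIMSEQ_unique by blast
 next
  have "(%k. avg (%_. 1) (r k) x) \<longlonglongrightarrow> 1"
  proof (rule tendsto_eventually)
   show "\<forall>\<^sub>F k in sequentially. avg (%_. 1) (r k) x = 1" using eventually_ge_at_top[of 1]
   proof eventually_elim
    case (elim k)
    hence "r k~=0" using r_ge[of k] by auto
    thus ?case by (simp add: avg_def birkhoff_int_def)
   qed
  qed
  thus "l x (%_. 1) = 1" using l[OF x,of "%_. 1"] LIMSEQ_unique by auto
 qed
 have avg_shift: "(%k. avg g (r k) (f t x)-avg g (r k) x) \<longlonglongrightarrow> 0" if g: "cts g" for g t x
 proof -
  from bounded_fun[OF g] obtain B where B: "B > 0" "!!x. \<bar>g x\<bar><=B" by blast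
  show ?thesis
  proof (rule Lim_null_comparison)
   show "(%k. 2 * B * \<bar>t\<bar>/real (r k)) \<longlonglongrightarrow> 0" by (rule tendsto_divide_0[OF tendsto_const])
     (auto intro!: filterlim_at_top_imp_at_infinity filterlim_compose[OF filterlim_real_sequentially] filterlim_subseq r)
   show "\<forall>\<^sub>F k in sequentially. norm (avg g (r k) (f t x)-avg g (r k) x)<=2 * B * \<bar>t\<bar>/real (r k)"
    using birkhoff_flow_close[OF g B(2),of "real (r _)" t x]
    by (intro always_eventually allI) (simp add: avg_def diff_divide_distrib[symmetric] abs_divide divide_right_mono)
  qed
 qed
 have Xinv: "f t x\<in>X" if "x\<in>X" for t x unfolding X_def
 proof (intro CollectI allI)
  fix j
  have "(%k. (avg (p j) (r k) (f t x)-avg (p j) (r k) x)+avg (p j) (r k) x) \<longlonglongrightarrow> 0+l x (p j)" by (intro tendsto_add avg_shift p l that)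
  thus "convergent (%k. avg (p j) (r k) (f t x))" by (auto simp: convergent_def)
 qed
 have Xinv': "f t x\<in>X \<longleftrightarrow> x\<in>X" for t x using Xinv[of x t] Xinv[of "f t x" "-t"] by auto
 have linv: "l (f t x) g = l x g" if "x\<in>X" "cts g" for t x g
 proof -
  have "(%k. (avg g (r k) (f t x)-avg g (r k) x)+avg g (r k) x) \<longlonglongrightarrow> 0+l x g" by (intro tendsto_add avg_shift l that)
  hence "(%k. avg g (r k) (f t x)) \<longlonglongrightarrow> l x g" by simp
  thus ?thesis unfolding l_def by (rule limI)
 qed
 have "EX m. sets m = sets borel&prob_space m&(ALL g. cts g --> integral\<^sup>L m g = l x g)" if "x\<in>X" for x
  using riesz_representation[OF comp lstate[OF that]] by metis
 then obtain \<nu>0 where \<nu>0: "!!x. x\<in>X ==> sets (\<nu>0 x) = sets borel&prob_space (\<nu>0 x)&(ALL g. cts g --> integral\<^sup>L (\<nu>0 x) g = l x g)"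
  by metis
 \<comment> \<open>Off the invariant set \<open>X\<close> of full measure the value
   \<open>\<mu>\<close> keeps the kernel invariant and constant along orbits at every point.\<close>
 define \<nu> where "\<nu> x = (if x\<in>X then \<nu>0 x else \<mu>)" for x
 have \<nu>l: "integral\<^sup>L (\<nu> x) g = l x g" if "x\<in>X" "cts g" for x and g :: "'a=>real" using \<nu>0[OF that(1)] that by (simp add: \<nu>_def)
 have \<nu>inv: "invariant_measure f (\<nu> x)" for x
 proof (cases "x\<in>X")
  case True
  show ?thesis
  proof (rule invariant_measureI)
   show "sets (\<nu> x) = sets borel" "prob_space (\<nu> x)" using \<nu>0[OF True] True by (auto simp: \<nu>_def)
   fix g :: "'a=>real" and t assume g: "cts g"
   have "avg (%x. g (f t x)) n x = avg g n (f t x)" for n by (simp add: avg_def birkhoff_int_def f_commute[of _ t])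
   hence "l x (%x. g (f t x)) = l (f t x) g" by (simp add: l_def)
   thus "(LINT x|\<nu> x. g (f t x)) = integral\<^sup>L (\<nu> x) g" using \<nu>l[OF True continuous_flow_fun[OF g]] \<nu>l[OF True g] linv[OF True g] by simp
  qed
 next
  case False
  thus ?thesis using inv by (simp add: \<nu>_def)
 qed
 have \<nu>f: "\<nu> (f t x) = \<nu> x" for t x
 proof (cases "x\<in>X")
  case True
  interpret a: compact_inv_flow f "\<nu> x" by (rule compact_inv_flowI[OF \<nu>inv])
  interpret b: compact_inv_flow f "\<nu> (f t x)" by (rule compact_inv_flowI[OF \<nu>inv])
  show ?thesis by (rule finite_measure_eqI_continuous)
    (use a.finite_measure_axioms b.finite_measure_axioms True \<nu>l linv Xinv' in auto)
 next
  case False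
  thus ?thesis using Xinv' by (simp add: \<nu>_def)
 qed
 have \<nu>meas: "(%x. integral\<^sup>L (\<nu> x) g)\<in>borel_measurable (borel :: 'a measure)" if g: "cts g" for g :: "'a=>real"
 proof -
  have [measurable]: "avg g n\<in>borel_measurable borel" for n by (rule borel_measurable_continuous_onI[OF ca[OF g]])
  note X_meas[measurable]
  have "(%x. if x\<in>X then lim (%k. avg g (r k) x) else integral\<^sup>L \<mu> g)\<in>borel_measurable borel" by measurable
  also have "(%x. if x\<in>X then lim (%k. avg g (r k) x) else integral\<^sup>L \<mu> g) = (%x. integral\<^sup>L (\<nu> x) g)"
   using \<nu>l[OF _ g] by (auto simp: \<nu>_def l_def)
  finally show ?thesis .
 qed
 have ae_X: "AE x in \<mu>. x\<in>X" using conv_ae by (simp add: X_def)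
 have ae_lim: "AE x in \<mu>. (%k. avg g (r k) x) \<longlonglongrightarrow> integral\<^sup>L (\<nu> x) g" if g: "cts g" for g :: "'a=>real"
  using ae_X by eventually_elim (use l[OF _ g] \<nu>l[OF _ g] in simp)
 have dis: "(LINT x|\<mu>. ind A x * g x) = (LINT x|\<mu>. ind A x * integral\<^sup>L (\<nu> x) g)"
  if g: "cts g" and A: "A\<in>sets borel" "!!t. f t -` A = A" for g :: "'a=>real" and A
 proof -
  from bounded_fun[OF g] obtain B where B: "B > 0" "!!x. \<bar>g x\<bar><=B" by blast
  have [measurable]: "A\<in>sets \<mu>" using A by simp
  have [measurable]: "(%x. integral\<^sup>L (\<nu> x) g)\<in>borel_measurable \<mu>" "avg g n\<in>borel_measurable \<mu>" for n
   by (rule meas_borel[OF \<nu>meas[OF g]]) (rule continuous_measurable[OF ca[OF g]])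
  have "(%k. (LINT x|\<mu>. ind A x * avg g (r k) x)) \<longlonglongrightarrow> (LINT x|\<mu>. ind A x * integral\<^sup>L (\<nu> x) g)"
  proof (rule integral_dominated_convergence[where w = "%_. B"])
   show "AE x in \<mu>. (%k. ind A x * avg g (r k) x) \<longlonglongrightarrow> ind A x * integral\<^sup>L (\<nu> x) g"
    using ae_lim[OF g] by eventually_elim (intro tendsto_intros)
   show "AE x in \<mu>. norm (ind A x * avg g (r k) x)<=B" for k using avg_abs_le[OF g B(2)] B(1) by (auto simp: indicator_def)
  qed auto
  moreover have "(%k. (LINT x|\<mu>. ind A x * avg g (r k) x)) \<longlonglongrightarrow> (LINT x|\<mu>. ind A x * g x)"
  proof (rule tendsto_eventually)
   have "(LINT x|\<mu>. ind A x * avg g (r k) x) = (LINT x|\<mu>. ind A x * g x)" if "k>=1" for k using integral_avg[OF g A,of "r k"] r_ge[of k] that by simp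
   thus "\<forall>\<^sub>F k in sequentially. (LINT x|\<mu>. ind A x * avg g (r k) x) = (LINT x|\<mu>. ind A x * g x)" unfolding eventually_sequentially by blast
  qed
  ultimately show ?thesis using LIMSEQ_unique by blast
 qed
 have erg: "AE x in \<mu>. ergodic_measure f (\<nu> x)"
 proof -
  \<comment> \<open>The variance of the average under the component of \<open>x\<close>; its
    integral is the mean square of the average minus that of its limit.\<close>
  define v where "v j n x = (LINT y|\<nu> x. (avg (p j) n y)\<^sup>2)-(LINT y|\<nu> x. p j y)\<^sup>2" for j n x
  have sq: "cts (%y. (avg (p j) n y)\<^sup>2)" for j n by (intro continuous_intros ca p)
  \<comment> \<open>The index is raised by 1 so that the value of \<open>r\<close> is at least 1
    there, as nonnegativity of \<open>v\<close> demands.\<close>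
  have "EX s. strict_mono s&(AE x in \<mu>. (%k. v j (r (s k+1)) x) \<longlonglongrightarrow> 0)" for j
  proof -
   from bounded_fun[OF p[of j]] obtain B where B: "B > 0" "!!x. \<bar>p j x\<bar><=B" by blast
   have avgb: "\<bar>avg (p j) n x\<bar><=B" for n x by (rule avg_abs_le[OF p B(2)])
   have sqb: "\<bar>(avg (p j) n x)\<^sup>2\<bar><=B\<^sup>2" for n x using avgb[of n x] by (simp add: abs_le_square_iff[symmetric])
   have pb: "\<bar>(LINT y|\<nu> x. p j y)\<bar><=B" for x
   proof -
    interpret a: compact_inv_flow f "\<nu> x" by (rule compact_inv_flowI[OF \<nu>inv])
    have "\<bar>(LINT y|\<nu> x. p j y)\<bar><=(LINT y|\<nu> x. B)" using B by (intro integral_abs_bound[THEN order_trans] integral_mono') auto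
    thus ?thesis by simp
   qed
   have qb: "\<bar>(LINT y|\<nu> x. (avg (p j) n y)\<^sup>2)\<bar><=B\<^sup>2" for x n
   proof -
    interpret a: compact_inv_flow f "\<nu> x" by (rule compact_inv_flowI[OF \<nu>inv])
    have "\<bar>(LINT y|\<nu> x. (avg (p j) n y)\<^sup>2)\<bar><=(LINT y|\<nu> x. B\<^sup>2)"
     using sqb by (intro integral_abs_bound[THEN order_trans] integral_mono') auto
    thus ?thesis by simp
   qed
   have [measurable]: "(%x. (LINT y|\<nu> x. p j y))\<in>borel_measurable borel" "(%x. (LINT y|\<nu> x. (avg (p j) n y)\<^sup>2))\<in>borel_measurable borel" for n
    by (rule \<nu>meas[OF p], rule \<nu>meas[OF sq])
   have i1: "integrable \<mu> (%x. (LINT y|\<nu> x. p j y)\<^sup>2)"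
   proof (rule integrable_bounded[of _ "B\<^sup>2"])
    show "\<bar>(LINT y|\<nu> x. p j y)\<^sup>2\<bar><=B\<^sup>2" for x using abs_le_square_iff[of "(LINT y|\<nu> x. p j y)" B] pb[of x] B(1) by simp
   qed auto
   have i2: "integrable \<mu> (%x. (LINT y|\<nu> x. (avg (p j) n y)\<^sup>2))" for n by (rule integrable_bounded[of _ "B\<^sup>2"]) (use qb in auto)
   have iv: "integrable \<mu> (v j n)" for n unfolding v_def[abs_def] using i1 i2 by simp
   have v0: "0<=v j n x" if "n>=1" for n x
   proof -
    interpret a: compact_inv_flow f "\<nu> x" by (rule compact_inv_flowI[OF \<nu>inv])
    have "(LINT y|\<nu> x. avg (p j) n y) = (LINT y|\<nu> x. p j y)" using a.integral_avg[OF p,of UNIV n] that by simp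
    thus ?thesis using a.integral_sq_bound[of "avg (p j) n"] a.integrable_continuous[OF ca[OF p]] a.integrable_continuous[OF sq] by (simp add: v_def)
   qed
   have "(%k. (LINT x|\<mu>. (avg (p j) (r k) x)\<^sup>2)) \<longlonglongrightarrow> (LINT x|\<mu>. (LINT y|\<nu> x. p j y)\<^sup>2)"
   proof (rule integral_dominated_convergence[where w = "%_. B\<^sup>2"])
    show "(%x. (LINT y|\<nu> x. p j y)\<^sup>2)\<in>borel_measurable \<mu>" using i1 by auto
    show "(%x. (avg (p j) (r k) x)\<^sup>2)\<in>borel_measurable \<mu>" for k by (rule continuous_measurable[OF sq])
    show "AE x in \<mu>. (%k. (avg (p j) (r k) x)\<^sup>2) \<longlonglongrightarrow> (LINT y|\<nu> x. p j y)\<^sup>2"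
     using ae_lim[OF p[of j]] by eventually_elim (intro tendsto_intros)
    show "AE x in \<mu>. norm ((avg (p j) (r k) x)\<^sup>2)<=B\<^sup>2" for k using sqb by simp
   qed auto
   hence "(%k. (LINT x|\<mu>. (avg (p j) (r k) x)\<^sup>2)-(LINT x|\<mu>. (LINT y|\<nu> x. p j y)\<^sup>2)) \<longlonglongrightarrow> 0" by (simp add: LIM_zero)
   moreover have "(LINT x|\<mu>. v j n x) = (LINT x|\<mu>. (avg (p j) n x)\<^sup>2)-(LINT x|\<mu>. (LINT y|\<nu> x. p j y)\<^sup>2)" for n
    unfolding v_def using i1 i2 dis[OF sq,of UNIV j n] by simp
   ultimately have "(%k. (LINT x|\<mu>. v j (r k) x)) \<longlonglongrightarrow> 0" by simp
   hence "(%k. (LINT x|\<mu>. v j (r (k+1)) x)) \<longlonglongrightarrow> 0" by (rule LIMSEQ_ignore_initial_segment)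
   moreover have "norm (v j (r (k+1)) x) = v j (r (k+1)) x" for k x using v0[of "r (k+1)" x] r_ge[of "k+1"] by simp
   ultimately have "(%k. (LINT x|\<mu>. norm (v j (r (k+1)) x))) \<longlonglongrightarrow> 0" by simp
   from tendsto_L1_AE_subseq[OF iv this] show ?thesis .
  qed
  then obtain s where s: "!!j. AE x in \<mu>. (%k. v j (r (s j k+1)) x) \<longlonglongrightarrow> 0" by metis
  hence "AE x in \<mu>. ALL j. (%k. v j (r (s j k+1)) x) \<longlonglongrightarrow> 0" by (simp add: AE_all_countable)
  thus ?thesis
  proof eventually_elim
   case (elim x)
   show ?case
   proof (rule ergodicI[OF \<nu>inv p dense])
    show "EX s'::nat=>nat. (ALL k. s' k>=1)&(%k. (LINT y|\<nu> x. (avg (p j) (s' k) y)\<^sup>2)-(LINT y|\<nu> x. p j y)\<^sup>2) \<longlonglongrightarrow> 0" for j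
     using elim[rule_format,of j] r_ge[of "s j _+1"] unfolding v_def by (intro exI[of _ "%k. r (s j k+1)"]) (auto intro: le_trans[OF _ r_ge])
   qed
  qed
 qed
 from \<nu>inv \<nu>f \<nu>meas dis erg show thesis by (rule that)
qed

end


section \<open>Entropy and the ergodic decomposition\<close>

lemma plogp_continuous: "continuous_on {0..1} plogp" unfolding continuous_on_def
proof
 fix x :: real assume x: "x\<in>{0..1}"
 show "(plogp \<longlongrightarrow> plogp x) (at x within {0..1})"
 proof (cases "x = 0")
  case True
  \<comment> \<open>Near 0 the logarithm is compared with the square root: \<open>ln z<=z-1\<close>
    at \<open>z = 1/sqrt y\<close>.\<close>
  have bound: "norm (plogp y)<=2 * sqrt y" if "y\<in>{0..1}" for y
  proof (cases "y = 0")
   case False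
   hence y: "y > 0" using that by auto
   have "ln (1/sqrt y)<=1/sqrt y-1" by (rule ln_le_minus_one) (use y in simp)
   moreover have "ln (1/sqrt y) = - (ln y/2)" using y by (simp add: ln_div ln_sqrt)
   ultimately have "- ln y<=2/sqrt y" by simp
   hence "y * (- ln y)<=y * (2/sqrt y)" using y by (intro mult_left_mono) auto
   also have "\<dots> = 2*(y/sqrt y)" by simp
   also have "\<dots> = 2 * sqrt y" using y by (simp only: real_div_sqrt less_imp_le)
   finally have "- (y * ln y)<=2 * sqrt y" by simp
   moreover have "y * ln y<=0" using y that by (simp add: mult_le_0_iff)
   ultimately show ?thesis using False by (simp add: plogp_def)
  qed simp
  have "((%y. 2 * sqrt y) \<longlongrightarrow> 2 * sqrt 0) (at 0 within {0..1})" by (intro tendsto_intros)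
  hence lim: "((%y. 2 * sqrt y) \<longlongrightarrow> 0) (at 0 within {0..1})" by simp
  show ?thesis unfolding True plogp_0 by (rule Lim_null_comparison[OF _ lim]) (use bound in \<open>auto simp: eventually_at_filter\<close>)
 next
  case False
  hence x0: "x > 0" using x by auto
  have "isCont (%y. y * ln y) x" using x0 by (intro continuous_intros) auto
  hence "((%y. y * ln y) \<longlongrightarrow> x * ln x) (at x within {0..1})" by (intro tendsto_within_subset[OF isContD]) auto
  moreover have "\<forall>\<^sub>F y in at x within {0..1}. y * ln y = plogp y" using eventually_at_topological[of "%y. y * ln y = plogp y" x "{0..1}"] x0
   by (auto intro!: exI[of _ "{0<..}"] simp: plogp_def)
  moreover have "plogp x = x * ln x" using x0 by (simp add: plogp_def)
  ultimately show ?thesis using tendsto_cong by force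
 qed
qed

lemma plogp_measurable [measurable]: "plogp\<in>borel_measurable borel" unfolding plogp_def[abs_def] by measurable

lemma plogp_uniform:
 assumes "\<kappa> > 0"
 obtains d where "d > 0" "!!u v. u\<in>{0..1} ==> v\<in>{0..1} ==> \<bar>u-v\<bar> < d ==> \<bar>plogp u-plogp v\<bar> < \<kappa>"
proof -
 have "uniformly_continuous_on {0..1} plogp" by (rule compact_uniformly_continuous[OF plogp_continuous]) simp
 then obtain d where "d > 0" "!!u v. u\<in>{0..1} ==> v\<in>{0..1} ==> dist v u < d ==> dist (plogp v) (plogp u) < \<kappa>"
  unfolding uniformly_continuous_on_def using assms by blast
 thus thesis using that[of d] by (auto simp: dist_real_def abs_minus_commute)
qed

context compact_inv_flow
begin

text \<open>Closed indicators are limits of continuous functions; complements and disjoint unions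
  then reach all Borel sets. Measurability and the integral identity go through the induction
  together, since the second makes sense only with the first.\<close>

lemma kernel_borel_sets:
 assumes \<nu>: "!!x. invariant_measure f (\<nu> x)"
  and meas: "!!g :: 'a=>real. cts g ==> (%x. integral\<^sup>L (\<nu> x) g)\<in>borel_measurable (borel :: 'a measure)"
  and dis: "!!(g :: 'a=>real) A. cts g ==> A\<in>sets borel ==> (!!t. f t -` A = A) ==>
   (LINT x|\<mu>. ind A x * g x) = (LINT x|\<mu>. ind A x * integral\<^sup>L (\<nu> x) g)"
  and C: "C\<in>sets borel"
 shows "(%x. measure (\<nu> x) C)\<in>borel_measurable (borel :: 'a measure) &
  (ALL A:sets borel. (ALL t. f t -` A = A) --> measure \<mu> (A\<inter>C) = (LINT x|\<mu>. ind A x * measure (\<nu> x) C))"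
proof -
 have pn: "prob_space (\<nu> x)" "sets (\<nu> x) = sets borel" for x using \<nu>[of x] by (auto simp: invariant_measure_def)
 have sn: "space (\<nu> x) = UNIV" for x using sets_eq_borel_space[OF pn(2)] .
 have fm: "finite_measure (\<nu> x)" for x using pn(1) by (simp add: prob_space.finite_measure)
 have m01: "0<=measure (\<nu> x) D" "measure (\<nu> x) D<=1" for x D using prob_space.prob_le_1[OF pn(1)] by auto
 have C': "C\<in>sigma_sets UNIV (Collect closed)" using C by (simp add: borel_eq_closed)
 have Is: "Int_stable (Collect closed :: 'a set set)" by (auto simp: Int_stable_def)
 have sub: "(Collect closed :: 'a set set)\<subseteq>Pow UNIV" by simp
 show ?thesis using Is sub C'
 proof (induction C rule: sigma_sets_induct_disjoint)
  case (basic K)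
  hence K: "closed K" by simp
  hence Kb: "K\<in>sets borel" by simp
  from closed_indicator_limit[OF K] obtain h :: "nat=>'a=>real" where
   h: "!!n. cts (h n)" "!!n x. 0<=h n x" "!!n x. h n x<=1"
    "!!n x. ind K x<=h n x" "!!x. (%n. h n x) \<longlonglongrightarrow> ind K x" by blast
  have lim: "(%n. integral\<^sup>L (\<nu> x) (h n)) \<longlonglongrightarrow> measure (\<nu> x) K" for x by (rule measure_closed_limit[OF pn(2) fm h(1,2,3,5) Kb])
  have m: "(%x. measure (\<nu> x) K)\<in>borel_measurable borel" by (rule borel_measurable_LIMSEQ_real[OF lim meas[OF h(1)]])
  moreover have "measure \<mu> (A\<inter>K) = (LINT x|\<mu>. ind A x * measure (\<nu> x) K)"
   if A: "A\<in>sets borel" "ALL t. f t -` A = A" for A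
  proof -
   have A': "A\<in>sets \<mu>" "K\<in>sets \<mu>" using A Kb by auto
   note [measurable] = A' meas_borel[OF m] meas_borel[OF meas[OF h(1)]] continuous_measurable[OF h(1)]
   have "(%n. (LINT x|\<mu>. ind A x * h n x)) \<longlonglongrightarrow> (LINT x|\<mu>. (ind A x * ind K x :: real))"
   proof (rule integral_dominated_convergence[where w = "%_. 1"])
    show "AE x in \<mu>. (%n. ind A x * h n x) \<longlonglongrightarrow> ind A x * ind K x" by (intro AE_I2 tendsto_mult tendsto_const h(5))
    show "AE x in \<mu>. norm (ind A x * h n x)<=1" for n using h(2,3) by (auto simp: indicator_def)
   qed auto
   moreover have "(%n. (LINT x|\<mu>. ind A x * integral\<^sup>L (\<nu> x) (h n))) \<longlonglongrightarrow> (LINT x|\<mu>. ind A x * measure (\<nu> x) K)"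
   proof (rule integral_dominated_convergence[where w = "%_. 1"])
    show "AE x in \<mu>. norm (ind A x * integral\<^sup>L (\<nu> x) (h n))<=1" for n
    proof (intro AE_I2)
     fix x
     have "0<=integral\<^sup>L (\<nu> x) (h n)" using h by simp
     moreover have "integral\<^sup>L (\<nu> x) (h n)<=(LINT x|\<nu> x. 1)" using h by (intro integral_mono' finite_measure.integrable_const fm) auto
     ultimately show "norm (ind A x * integral\<^sup>L (\<nu> x) (h n))<=1" using prob_space.prob_space[OF pn(1)] by (auto simp: indicator_def)
    qed
   qed (use lim in \<open>auto intro!: tendsto_intros\<close>)
   moreover have "(LINT x|\<mu>. ind A x * h n x) = (LINT x|\<mu>. ind A x * integral\<^sup>L (\<nu> x) (h n))" for n by (rule dis[OF h(1)]) (use A in auto)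
   ultimately have "(LINT x|\<mu>. (ind A x * ind K x :: real)) = (LINT x|\<mu>. ind A x * measure (\<nu> x) K)" using LIMSEQ_unique by fastforce
   moreover have "(LINT x|\<mu>. (ind A x * ind K x :: real)) = (LINT x|\<mu>. (ind (A\<inter>K) x :: real))" by (simp add: indicator_inter_arith)
   moreover have "\<dots> = measure \<mu> (A\<inter>K)" using A' by simp
   ultimately show ?thesis by simp
  qed
  ultimately show ?case by blast
 next
  case empty
  thus ?case by simp
 next
  case (compl C)
  have Cb: "C\<in>sets borel" using compl.hyps by (simp add: borel_eq_closed)
  have mc: "measure (\<nu> x) (UNIV-C) = 1-measure (\<nu> x) C" for x using prob_space.prob_compl[OF pn(1),of C x] Cb by (simp add: sn pn)
  have mC: "(%x. measure (\<nu> x) C)\<in>borel_measurable borel" using compl.IH by blast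
  hence m: "(%x. measure (\<nu> x) (UNIV-C))\<in>borel_measurable borel" unfolding mc by measurable
  moreover have "measure \<mu> (A\<inter>(UNIV-C)) = (LINT x|\<mu>. ind A x * measure (\<nu> x) (UNIV-C))"
   if A: "A\<in>sets borel" "ALL t. f t -` A = A" for A
  proof -
   have "A\<inter>(UNIV-C) = A-A\<inter>C" by auto
   hence "measure \<mu> (A\<inter>(UNIV-C)) = measure \<mu> A-measure \<mu> (A\<inter>C)" using A Cb by (simp add: finite_measure_Diff)
   also have "measure \<mu> (A\<inter>C) = (LINT x|\<mu>. ind A x * measure (\<nu> x) C)" using compl.IH A by blast
   also have "measure \<mu> A = (LINT x|\<mu>. ind A x)" using A by simp
   also have "(LINT x|\<mu>. ind A x)-(LINT x|\<mu>. ind A x * measure (\<nu> x) C) = (LINT x|\<mu>. ind A x-ind A x * measure (\<nu> x) C)"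
   proof (rule Bochner_Integration.integral_diff[symmetric])
    show "integrable \<mu> (ind A :: 'a=>real)" using A by (simp add: emeasure_eq_measure)
    show "integrable \<mu> (%x. ind A x * measure (\<nu> x) C)" by (rule integrable_bounded[of _ 1]) (use m01 mC A in \<open>auto simp: indicator_def\<close>)
   qed
   finally show ?thesis unfolding mc by (simp add: right_diff_distrib)
  qed
  ultimately show ?case by blast
 next
  case (union C)
  have Cb: "C i\<in>sets borel" for i using union.hyps(2) by (auto simp: borel_eq_closed)
  have s: "(%i. measure (\<nu> x) (C i)) sums measure (\<nu> x) (\<Union>i. C i)" for x
   by (rule finite_measure.finite_measure_UNION[OF fm]) (use Cb union.hyps in \<open>auto simp: pn\<close>)
  have mC: "(%x. measure (\<nu> x) (C i))\<in>borel_measurable borel" for i using union.IH by blast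
  have lim: "(%n. \<Sum>i<n. measure (\<nu> x) (C i)) \<longlonglongrightarrow> measure (\<nu> x) (\<Union>i. C i)" for x using s[of x] by (simp add: sums_def)
  have mS: "(%x. \<Sum>i<n. measure (\<nu> x) (C i))\<in>borel_measurable borel" for n using mC by measurable
  have m: "(%x. measure (\<nu> x) (\<Union>i. C i))\<in>borel_measurable borel" by (rule borel_measurable_LIMSEQ_real[OF lim mS])
  moreover have "measure \<mu> (A\<inter>(\<Union>i. C i)) = (LINT x|\<mu>. ind A x * measure (\<nu> x) (\<Union>i. C i))"
   if A: "A\<in>sets borel" "ALL t. f t -` A = A" for A
  proof -
   have A': "A\<in>sets \<mu>" using A by auto
   note [measurable] = A' meas_borel[OF m] meas_borel[OF mS] meas_borel[OF mC]
   have le1: "(\<Sum>i<n. measure (\<nu> x) (C i))<=1" for n x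
    using sum_le_suminf[OF sums_summable[OF s[of x]],of "{..<n}"] sums_unique[OF s[of x]] m01(2)[of x "\<Union>i. C i"] by simp
   have "(%n. (LINT x|\<mu>. ind A x * (\<Sum>i<n. measure (\<nu> x) (C i)))) \<longlonglongrightarrow> (LINT x|\<mu>. ind A x * measure (\<nu> x) (\<Union>i. C i))"
   proof (rule integral_dominated_convergence[where w = "%_. 1"])
    show "AE x in \<mu>. norm (ind A x * (\<Sum>i<n. measure (\<nu> x) (C i)))<=1" for n using le1 by (auto simp: indicator_def sum_nonneg)
   qed (use lim in \<open>auto intro!: tendsto_intros\<close>)
   moreover have "(LINT x|\<mu>. ind A x * (\<Sum>i<n. measure (\<nu> x) (C i))) = (\<Sum>i<n. measure \<mu> (A\<inter>C i))" for n
   proof -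
    have "(LINT x|\<mu>. ind A x * (\<Sum>i<n. measure (\<nu> x) (C i))) = (LINT x|\<mu>. (\<Sum>i<n. ind A x * measure (\<nu> x) (C i)))" by (simp add: sum_distrib_left)
    also have "\<dots> = (\<Sum>i<n. (LINT x|\<mu>. ind A x * measure (\<nu> x) (C i)))"
    proof (rule Bochner_Integration.integral_sum)
     show "integrable \<mu> (%x. ind A x * measure (\<nu> x) (C i))" for i
      by (rule integrable_bounded[of _ 1]) (use m01 mC A in \<open>auto simp: indicator_def\<close>)
    qed
    also have "\<dots> = (\<Sum>i<n. measure \<mu> (A\<inter>C i))" using union.IH A by (intro sum.cong refl) auto
    finally show ?thesis .
   qed
   ultimately have "(%i. measure \<mu> (A\<inter>C i)) sums (LINT x|\<mu>. ind A x * measure (\<nu> x) (\<Union>i. C i))" by (simp add: sums_def)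
   moreover have "(%i. measure \<mu> (A\<inter>C i)) sums measure \<mu> (\<Union>i. A\<inter>C i)"
    proof (rule finite_measure_UNION)
    show "disjoint_family (%i. A\<inter>C i)" using union.hyps(1) unfolding disjoint_family_on_def by blast
   qed (use Cb A in auto)
   ultimately have "(LINT x|\<mu>. ind A x * measure (\<nu> x) (\<Union>i. C i)) = measure \<mu> (\<Union>i. A\<inter>C i)" by (rule sums_unique2)
   thus ?thesis by (simp only: Int_UN_distrib)
  qed
  ultimately show ?case by blast
 qed
qed


text \<open>Condition on the finite sigma-algebra generated by the rounded values of the probabilities of the atoms.\<close>
lemma hrate_le_integral_ent:
 fixes c :: "'a=>'b"
 assumes \<nu>: "!!x. invariant_measure f (\<nu> x)" and \<nu>f: "!!x t. \<nu> (f t x) = \<nu> x"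
  and meas: "!!C. C\<in>sets borel ==> (%x. measure (\<nu> x) C)\<in>borel_measurable (borel :: 'a measure)"
  and dis: "!!A C. C\<in>sets borel ==> A\<in>sets borel ==> (!!t. f t -` A = A) ==>
    measure \<mu> (A\<inter>C) = (LINT x|\<mu>. ind A x * measure (\<nu> x) C)"
  and c: "simple c" and n: "n>=1"
 shows "n * hrate f \<mu> c<=(LINT x|\<mu>. ent (\<nu> x) (nm f c (times n)))"
proof -
 define N where "N = nm f c (times n)"
 have N: "simple N" unfolding N_def by (rule simple_nm[OF c])
 define V where "V = range N"
 have V: "finite V" using simple_functionD(1)[OF N] by (simp add: V_def)
 define q where "q v x = measure (\<nu> x) (N -` {v})" for v x
 have Nb: "N -` {v}\<in>sets borel" for v using simple_functionD(2)[OF N,of "{v}"] by simp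
 have pn: "prob_space (\<nu> x)" "sets (\<nu> x) = sets borel" for x using \<nu>[of x] by (auto simp: invariant_measure_def)
 have sn: "space (\<nu> x) = UNIV" for x using sets_eq_borel_space[OF pn(2)] .
 have q01: "0<=q v x" "q v x<=1" for v x unfolding q_def using prob_space.prob_le_1[OF pn(1)] by auto
 have q_meas[measurable]: "q v\<in>borel_measurable borel" for v unfolding q_def[abs_def] by (rule meas[OF Nb])
 have qf: "q v (f t x) = q v x" for v t x by (simp add: q_def \<nu>f)
 have ent_q: "ent (\<nu> x) N = - (SUM v:V. plogp (q v x))" for x by (simp add: ent_def sn V_def q_def)
 have plq: "integrable \<mu> (%x. plogp (q v x))" for v
 proof -
  obtain B where "ALL y:plogp ` {0..1}. norm y<=B"
   using compact_imp_bounded[OF compact_continuous_image[OF plogp_continuous compact_Icc]] unfolding bounded_iff by blast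
  hence "!!u. u\<in>{0..1} ==> \<bar>plogp u\<bar><=B" by auto
  thus ?thesis by (intro integrable_bounded[of _ B]) (use q01 in auto)
 qed
 have main: "n * hrate f \<mu> c<=(LINT x|\<mu>. ent (\<nu> x) N)+card V * \<kappa>" if \<kappa>: "\<kappa> > 0" for \<kappa> :: real
 proof -
  from plogp_uniform[OF \<kappa>] obtain d where d: "d > 0"
   "!!u v. u\<in>{0..1} ==> v\<in>{0..1} ==> \<bar>u-v\<bar> < d ==> \<bar>plogp u-plogp v\<bar> < \<kappa>" by blast
  obtain K0 where K0: "1/real (Suc K0) < d" using nat_approx_posE[OF d(1)] .
  define K where "K = real (Suc K0)"
  have K: "K > 0" "1/K < d" using K0 by (auto simp: K_def)
  obtain vs where vs: "set vs = V" using finite_list[OF V] by blast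
  \<comment> \<open>\<open>\<alpha>\<close> records the component probabilities of all words up to
    precision \<open>1/K\<close>. It is invariant with finitely many values, so conditioning on it
    approximates conditioning on the component.\<close>
  define \<alpha> where "\<alpha> x = map (%v. \<lfloor>K * q v x\<rfloor>) vs" for x
  have sfl: "simple (%x. \<lfloor>K * q v x\<rfloor>)" for v unfolding simple_function_def
  proof (intro conjI ballI)
   have "(%x. \<lfloor>K * q v x\<rfloor>) ` space \<mu>\<subseteq>{0..\<lfloor>K\<rfloor>}" using q01 K by (auto intro!: floor_mono mult_left_le)
   thus "finite ((%x. \<lfloor>K * q v x\<rfloor>) ` space \<mu>)" using finite_subset by blast
   fix z assume "z\<in>(%x. \<lfloor>K * q v x\<rfloor>) ` space \<mu>"
   have "{x\<in>space borel. real_of_int z<=K * q v x&K * q v x < real_of_int z+1}\<in>sets borel" by measurable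
   also have "{x\<in>space borel. real_of_int z<=K * q v x&K * q v x < real_of_int z+1} = (%x. \<lfloor>K * q v x\<rfloor>) -` {z}\<inter>space \<mu>"
    by (auto simp: floor_eq_iff)
   finally show "(%x. \<lfloor>K * q v x\<rfloor>) -` {z}\<inter>space \<mu>\<in>sets \<mu>" by simp
  qed
  have \<alpha>: "simple \<alpha>" unfolding \<alpha>_def[abs_def] by (rule simple_function_map) (rule sfl)
  have \<alpha>f: "\<alpha> (f t x) = \<alpha> x" for t x by (simp add: \<alpha>_def qf)
  have \<alpha>close: "\<bar>q v x-q v y\<bar><=1/K" if "\<alpha> x = \<alpha> y" "v\<in>V" for v x y
  proof -
   have "\<lfloor>K * q v x\<rfloor> = \<lfloor>K * q v y\<rfloor>" using that vs by (auto simp: \<alpha>_def)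
   hence "\<bar>K * q v x-K * q v y\<bar><=1" by linarith
   hence "K * \<bar>q v x-q v y\<bar><=1" using K by (simp add: right_diff_distrib[symmetric] abs_mult)
   thus ?thesis using K by (simp add: field_simps)
  qed
  have cent_k: "cent (nm f c (times (k * n))) \<alpha><=k * cent N \<alpha>" for k
  proof (induction k)
   case 0
   have "nm f c (times 0) = (%_. [])" by (auto simp: nm_def times_def)
   moreover have "ent \<mu> (%x. ([] :: 'b list,\<alpha> x)) = ent \<mu> \<alpha>" by (rule ent_cong_determined) (auto intro!: simple_function_Pair \<alpha>)
   ultimately show ?case by (simp add: cent_def)
  next
   case (Suc k)
   have sh: "nm f c (map (%t. t+real (k * n)) (times n)) = (%x. N (f (real (k * n)) x))" by (rule ext) (simp only: nm_shift N_def)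
   have "cent (nm f c (times (Suc k * n))) \<alpha><=cent (%x. (nm f c (times (k * n)) x,N (f (real (k * n)) x))) \<alpha>"
   proof -
    have e: "nm f c (times (Suc k * n)) x = nm f c (times (k * n)) x @ N (f (real (k * n)) x)" for x
     using times_add[of "k * n" n] fun_cong[OF sh,of x] by (simp add: nm_def add.commute)
    have "ent \<mu> (%x. (nm f c (times (Suc k * n)) x,\<alpha> x))<=ent \<mu> (%x. ((nm f c (times (k * n)) x,N (f (real (k * n)) x)),\<alpha> x))"
    proof (rule ent_determined)
     show "simple (%x. (nm f c (times (Suc k * n)) x,\<alpha> x))"
      "simple (%x. ((nm f c (times (k * n)) x,N (f (real (k * n)) x)),\<alpha> x))" by (intro simple_function_Pair \<alpha> simple_nm c simple_flow N)+
    qed (simp only: e prod.inject)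
    thus ?thesis by (simp add: cent_def)
   qed
   also have "\<dots><=cent (nm f c (times (k * n))) \<alpha>+cent (%x. N (f (real (k * n)) x)) \<alpha>"
    by (intro cent_pair_le simple_nm c \<alpha> simple_flow N)
   also have "cent (%x. N (f (real (k * n)) x)) \<alpha> = cent N \<alpha>"
    using ent_flow[OF simple_function_Pair[OF N \<alpha>],of "real (k * n)"] by (simp add: cent_def \<alpha>f)
   finally show ?case using Suc by (simp add: algebra_simps)
  qed
  \<comment> \<open>Adjoining \<open>\<alpha>\<close> costs the fixed amount
    \<open>ent \<mu> \<alpha>\<close> for any number \<open>k\<close> of blocks. Since
    \<open>\<alpha>\<close> is invariant, every block has the same conditional entropy, and the
    fixed cost disappears as \<open>k\<close> grows.\<close>
  have step1: "n * hrate f \<mu> c<=cent N \<alpha>"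
  proof (rule field_le_epsilon)
   fix e :: real assume e: "e > 0"
   obtain k0 :: nat where k0: "ent \<mu> \<alpha>/e < k0" using reals_Archimedean2 by blast
   define k where "k = Suc k0"
   have "k * n>=1" using n by (simp add: k_def)
   from hrate_le[OF this] have "(k * n) * hrate f \<mu> c<=ent \<mu> (nm f c (times (k * n)))" using \<open>k * n >= 1\<close> by (simp add: field_simps)
   also have "\<dots><=ent \<mu> (%x. (nm f c (times (k * n)) x,\<alpha> x))"
    by (rule ent_determined) (auto intro!: simple_function_Pair \<alpha> simple_nm c)
   also have "\<dots> = ent \<mu> \<alpha>+cent (nm f c (times (k * n))) \<alpha>" by (simp add: cent_def)
   also have "\<dots><=k * e+k * cent N \<alpha>"
   proof (rule add_mono[OF _ cent_k])
    have "ent \<mu> \<alpha> < k0 * e" using k0 e by (simp add: pos_divide_less_eq)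
    thus "ent \<mu> \<alpha><=k * e" using e by (simp add: k_def algebra_simps)
   qed
   finally have "k * (n * hrate f \<mu> c)<=k * (cent N \<alpha>+e)" by (simp add: algebra_simps)
   thus "n * hrate f \<mu> c<=cent N \<alpha>+e" by (simp add: k_def)
  qed
  let ?A = "%a. \<alpha> -` {a}"
  let ?W = "range \<alpha>"
  have W: "finite ?W" using simple_functionD(1)[OF \<alpha>] by simp
  have Ab: "?A a\<in>sets borel" for a using simple_functionD(2)[OF \<alpha>, of "{a}"] by simp
  have Ainv: "f t -` ?A a = ?A a" for a t by (auto simp: \<alpha>f)
  have mN: "pr (%x. (N x,\<alpha> x)) (v,a) = (LINT x|\<mu>. ind (?A a) x * q v x)" for v a
  proof -
   have "(%x. (N x,\<alpha> x)) -` {(v,a)}\<inter>space \<mu> = ?A a\<inter>N -` {v}" by auto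
   thus ?thesis using dis[OF Nb Ab Ainv] by (simp add: q_def)
  qed
  have ae: "- (SUM v:V. plogp (pr (%x. (N x,\<alpha> x)) (v,a)))+plogp (pr \<alpha> a)
   <= (SUM v:V. (LINT x|\<mu>. ind (?A a) x * (\<kappa> - plogp (q v x))))" if a: "a\<in>?W" for a
  proof (cases "pr \<alpha> a = 0")
   case True
   have "pr (%x. (N x,\<alpha> x)) (v,a) = 0" for v
   proof -
    have "pr (%x. (N x,\<alpha> x)) (v,a)<=pr \<alpha> a" by (intro finite_measure_mono) (use Ab in auto)
    thus ?thesis using True by (simp add: measure_le_0_iff)
   qed
   moreover have "0<=(LINT x|\<mu>. ind (?A a) x * (\<kappa> - plogp (q v x)))" for v
    using \<kappa> plogp_nonpos[OF q01,of v] by (intro Bochner_Integration.integral_nonneg mult_nonneg_nonneg) (auto intro: order_trans[of _ 0])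
   ultimately show ?thesis using True by (simp add: sum_nonneg)
  next
   case False
   define P where "P = pr \<alpha> a"
   have P: "P > 0" using False by (simp add: P_def zero_less_measure_iff)
   obtain x0 where x0: "\<alpha> x0 = a" using a by auto
   have intA: "integrable \<mu> (%x. ind (?A a) x * h x)" if "integrable \<mu> h" for h :: "'a=>real"
    using integrable_mult_indicator[OF _ that,of "?A a"] Ab by simp
   have iq: "integrable \<mu> (q v)" for v by (rule integrable_bounded[of _ 1]) (use q01 in auto)
   have PI: "(LINT x|\<mu>. ind (?A a) x * z) = P * z" for z :: real using Ab by (simp add: P_def)
   have pv: "- plogp (pr (%x. (N x,\<alpha> x)) (v,a))+pr (%x. (N x,\<alpha> x)) (v,a) * ln P<=(LINT x|\<mu>. ind (?A a) x * (\<kappa> - plogp (q v x)))"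
    if v: "v\<in>V" for v
   proof -
    define r where "r = pr (%x. (N x,\<alpha> x)) (v,a)/P"
    have r: "pr (%x. (N x,\<alpha> x)) (v,a) = P * r" using P by (simp add: r_def)
    have rP: "P * r = (LINT x|\<mu>. ind (?A a) x * q v x)" using r mN by simp
    \<comment> \<open>\<open>r\<close> is the mean of \<open>q v\<close> over the atom
      \<open>a\<close>, on which \<open>q v\<close> varies by at most \<open>1/K\<close>.\<close>
    have rclose: "\<bar>r-q v x\<bar> < d" if x: "\<alpha> x = a" for x
    proof -
     have "P * r<=(LINT y|\<mu>. ind (?A a) y * (q v x+1/K))" unfolding rP
     proof (rule integral_mono)
      fix y show "ind (?A a) y * q v y<=ind (?A a) y * (q v x+1/K)" using \<alpha>close[of y x v] x v by (auto simp: indicator_def)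
     qed (intro intA iq integrable_const)+
     moreover have "(LINT y|\<mu>. ind (?A a) y * (q v x-1/K))<=P * r" unfolding rP
     proof (rule integral_mono)
      fix y show "ind (?A a) y * (q v x-1/K)<=ind (?A a) y * q v y" using \<alpha>close[of y x v] x v by (auto simp: indicator_def)
     qed (intro intA iq integrable_const)+
     ultimately have "r<=q v x+1/K" "q v x-1/K<=r" unfolding PI using P by auto
     thus ?thesis using K by linarith
    qed
    have r01: "r\<in>{0..1}"
    proof -
     have "pr (%x. (N x,\<alpha> x)) (v,a)<=P" unfolding P_def by (intro finite_measure_mono) (use Ab in auto)
     thus ?thesis using P by (simp add: r_def)
    qed
    have pt: "- plogp r<=\<kappa> - plogp (q v x)" if "\<alpha> x = a" for x using d(2)[OF r01 _ rclose[OF that]] q01 by fastforce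
    have "- plogp (P * r)+P * r * ln P = P * (- plogp r)" using P r01 by (cases "r = 0") (auto simp: plogp_def ln_mult algebra_simps)
    also have "\<dots> = (LINT x|\<mu>. ind (?A a) x * (- plogp r))" by (rule PI[symmetric])
    also have "\<dots><=(LINT x|\<mu>. ind (?A a) x * (\<kappa> - plogp (q v x)))"
    proof (rule integral_mono)
     fix x show "ind (?A a) x * (- plogp r)<=ind (?A a) x * (\<kappa> - plogp (q v x))" using pt[of x] by (auto simp: indicator_def)
    qed (intro intA plq integrable_const Bochner_Integration.integrable_diff)+
    finally show ?thesis unfolding r .
   qed
   have "P = (SUM v:V. pr (%x. (\<alpha> x,N x)) (a,v))" unfolding P_def by (rule pr_marginal[OF \<alpha> N V]) (simp add: V_def)
   also have "\<dots> = (SUM v:V. pr (%x. (N x,\<alpha> x)) (v,a))" by (intro sum.cong refl) (rule pr_pair_swap)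
   finally have Psum: "(SUM v:V. pr (%x. (N x,\<alpha> x)) (v,a)) = P" by (rule sym)
   have "plogp P = (SUM v:V. pr (%x. (N x,\<alpha> x)) (v,a)) * ln P" unfolding Psum using P by (simp add: plogp_def)
   hence "- (SUM v:V. plogp (pr (%x. (N x,\<alpha> x)) (v,a)))+plogp P
    = (SUM v:V. - plogp (pr (%x. (N x,\<alpha> x)) (v,a))+pr (%x. (N x,\<alpha> x)) (v,a) * ln P)"
    by (simp add: sum.distrib sum_negf sum_subtractf sum_distrib_right)
   also have "\<dots><=(SUM v:V. (LINT x|\<mu>. ind (?A a) x * (\<kappa> - plogp (q v x))))" by (rule sum_mono) (rule pv)
   finally show ?thesis by (simp add: P_def)
  qed
  have "cent N \<alpha> = (SUM a:?W. - (SUM v:V. plogp (pr (%x. (N x,\<alpha> x)) (v,a)))+plogp (pr \<alpha> a))"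
   unfolding cent_def ent_pair[OF N \<alpha>] using ent_def[of \<mu> \<alpha>] by (subst sum.swap) (simp add: V_def sum.distrib sum_negf sum_subtractf)
  also have "\<dots><=(SUM a:?W. SUM v:V. (LINT x|\<mu>. ind (?A a) x * (\<kappa> - plogp (q v x))))" by (rule sum_mono) (rule ae)
  also have "\<dots> = (SUM v:V. SUM a:?W. (LINT x|\<mu>. ind (?A a) x * (\<kappa> - plogp (q v x))))" by (rule sum.swap)
  also have "\<dots> = (SUM v:V. (LINT x|\<mu>. \<kappa> - plogp (q v x)))"
  proof (intro sum.cong refl)
   fix v
   have ind: "(SUM a:?W. ind (?A a) x * z) = z" for x and z :: real
   proof -
    have "(SUM a:?W. ind (?A a) x * z) = (SUM a:{\<alpha> x}. ind (?A a) x * z)"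
     by (rule sum.mono_neutral_right) (use W in \<open>auto simp: indicator_def\<close>)
    thus ?thesis by simp
   qed
   have "(SUM a:?W. (LINT x|\<mu>. ind (?A a) x * (\<kappa> - plogp (q v x)))) = (LINT x|\<mu>. (SUM a:?W. ind (?A a) x * (\<kappa> - plogp (q v x))))"
   proof (rule Bochner_Integration.integral_sum[symmetric])
    fix a
    have "integrable \<mu> (%x. \<kappa> - plogp (q v x))" using plq by simp
    thus "integrable \<mu> (%x. ind (?A a) x * (\<kappa> - plogp (q v x)))"
     using integrable_mult_indicator[of "?A a" \<mu> "%x. \<kappa> - plogp (q v x)"] Ab by simp
   qed
   thus "(SUM a:?W. (LINT x|\<mu>. ind (?A a) x * (\<kappa> - plogp (q v x)))) = (LINT x|\<mu>. \<kappa> - plogp (q v x))" by (simp only: ind)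
  qed
  also have "\<dots> = (LINT x|\<mu>. ent (\<nu> x) N)+card V * \<kappa>" unfolding ent_q using plq by (simp add: Bochner_Integration.integral_sum sum_subtractf)
  finally show ?thesis using step1 by linarith
 qed
 have "n * hrate f \<mu> c<=(LINT x|\<mu>. ent (\<nu> x) N)"
 proof (rule field_le_epsilon)
  fix e :: real assume e: "e > 0"
  have "card V * (e/Suc (card V))<=e" using e by (simp add: field_simps)
  thus "n * hrate f \<mu> c<=(LINT x|\<mu>. ent (\<nu> x) N)+e" using main[of "e/Suc (card V)"] e by simp
 qed
 thus ?thesis by (simp add: N_def)
qed


lemma ent_nm_le:
 assumes c: "simple c"
 shows "ent \<mu> (nm f c (times n))<=n * ln (card (range c))"
proof -
 have fin: "finite (range c)" using simple_functionD(1)[OF c] by simp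
 have "ent \<mu> (nm f c (times n))<=ln (card {ws. set ws\<subseteq>range c&length ws = n})"
  by (rule ent_le_card[OF simple_nm[OF c] finite_lists_length_eq[OF fin]]) (auto simp: nm_def times_def)
 also have "\<dots> = n * ln (card (range c))" using fin by (simp add: card_lists_length_eq ln_realpow card_gt_0_iff)
 finally show ?thesis .
qed

text \<open>Stated for one finite-valued \<open>c\<close> at a time and as an upper bound for the
  rate of \<open>\<mu>\<close>: this is the direction that yields an ergodic component whose rate
  exceeds a given value.\<close>

theorem entropy_decomposition:
 obtains \<nu> :: "'a=>'a measure" where "!!x. invariant_measure f (\<nu> x)" "AE x in \<mu>. ergodic_measure f (\<nu> x)"
  "!!g :: 'a=>real. cts g ==> integrable \<mu> (%x. integral\<^sup>L (\<nu> x) g)"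
  "!!g :: 'a=>real. cts g ==> (LINT x|\<mu>. g x) = (LINT x|\<mu>. integral\<^sup>L (\<nu> x) g)"
  "!!c :: 'a=>'a set. simple c ==> integrable \<mu> (%x. hrate f (\<nu> x) c)"
  "!!c :: 'a=>'a set. simple c ==> hrate f \<mu> c<=(LINT x|\<mu>. hrate f (\<nu> x) c)"
proof (rule ergodic_kernel)
 fix \<nu> :: "'a=>'a measure"
 assume \<nu>: "!!x. invariant_measure f (\<nu> x)" "!!x t. \<nu> (f t x) = \<nu> x"
  and meas: "!!g :: 'a=>real. cts g ==> (%x. integral\<^sup>L (\<nu> x) g)\<in>borel_measurable (borel :: 'a measure)"
  and dis: "!!(g :: 'a=>real) A. cts g ==> A\<in>sets borel ==> (!!t. f t -` A = A) ==>
   (LINT x|\<mu>. ind A x * g x) = (LINT x|\<mu>. ind A x * integral\<^sup>L (\<nu> x) g)"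
  and erg: "AE x in \<mu>. ergodic_measure f (\<nu> x)"
 have kb: "(%x. measure (\<nu> x) C)\<in>borel_measurable (borel :: 'a measure)"
   "A\<in>sets borel ==> (!!t. f t -` A = A) ==> measure \<mu> (A\<inter>C) = (LINT x|\<mu>. ind A x * measure (\<nu> x) C)"
  if "C\<in>sets borel" for A C using kernel_borel_sets[OF \<nu>(1) meas dis that] by blast+
 have cif: "compact_inv_flow f (\<nu> x)" for x by (rule compact_inv_flowI[OF \<nu>(1)])
 have int: "integrable \<mu> (%x. integral\<^sup>L (\<nu> x) g)" if g: "cts g" for g :: "'a=>real"
 proof -
  from bounded_fun[OF g] obtain B where B: "B > 0" "!!x. \<bar>g x\<bar><=B" by blast
  have "\<bar>integral\<^sup>L (\<nu> x) g\<bar><=B" for x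
  proof -
   interpret a: compact_inv_flow f "\<nu> x" by (rule cif)
   have "\<bar>integral\<^sup>L (\<nu> x) g\<bar><=(LINT y|\<nu> x. B)" using B by (intro integral_abs_bound[THEN order_trans] integral_mono') auto
   thus ?thesis by simp
  qed
  thus ?thesis using meas[OF g] by (intro integrable_bounded)
 qed
 have dg: "(LINT x|\<mu>. g x) = (LINT x|\<mu>. integral\<^sup>L (\<nu> x) g)" if g: "cts g" for g :: "'a=>real" using dis[OF g,of UNIV] by simp
 have hr: "integrable \<mu> (%x. hrate f (\<nu> x) c)&hrate f \<mu> c<=(LINT x|\<mu>. hrate f (\<nu> x) c)"
  if c: "simple c" for c :: "'a=>'a set"
 proof -
  define e where "e n x = ent (\<nu> x) (nm f c (times n))/n" for n x
  define B where "B = ln (card (range c))"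
  have cx: "simple_function (\<nu> x) c" for x
  proof -
   interpret a: compact_inv_flow f "\<nu> x" by (rule cif)
   show ?thesis using c by (simp add: simple_function_def)
  qed
  have B0: "0<=B" using simple_functionD(1)[OF c] by (simp add: B_def card_gt_0_iff Suc_leI)
  have e_bd: "\<bar>e n x\<bar><=B" for n x
  proof -
   interpret a: compact_inv_flow f "\<nu> x" by (rule cif)
   show ?thesis using a.ent_nm_le[OF cx,of n] a.ent_nonneg[of "nm f c (times n)"] B0 by (cases "n = 0") (auto simp: e_def B_def field_simps)
  qed
  have e_lim: "(%n. e n x) \<longlonglongrightarrow> hrate f (\<nu> x) c" for x
  proof -
   interpret a: compact_inv_flow f "\<nu> x" by (rule cif)
   show ?thesis unfolding e_def by (rule a.hrate_lim[OF cx])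
  qed
  have e_meas: "e n\<in>borel_measurable borel" for n
  proof -
   let ?N = "nm f c (times n)"
   have Nb: "?N -` {v}\<in>sets borel" for v using simple_functionD(2)[OF simple_nm[OF c],of "times n" "{v}"] by simp
   have sn: "space (\<nu> x) = UNIV" for x
   proof -
    interpret a: compact_inv_flow f "\<nu> x" by (rule cif)
    show ?thesis by simp
   qed
   note [measurable] = kb(1)[OF Nb]
   have "e n = (%x. - (SUM v:range ?N. plogp (measure (\<nu> x) (?N -` {v})))/n)" by (simp add: e_def[abs_def] ent_def sn)
   also have "\<dots>\<in>borel_measurable borel" by measurable
   finally show ?thesis .
  qed
  have h_meas: "(%x. hrate f (\<nu> x) c)\<in>borel_measurable borel" by (rule borel_measurable_LIMSEQ_real[OF e_lim e_meas])
  have h_bd: "\<bar>hrate f (\<nu> x) c\<bar><=B" for x by (rule LIMSEQ_le_const2[OF tendsto_rabs[OF e_lim]]) (use e_bd in auto)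
  have lim: "(%n. (LINT x|\<mu>. e n x)) \<longlonglongrightarrow> (LINT x|\<mu>. hrate f (\<nu> x) c)"
   by (rule integral_dominated_convergence[where w = "%_. B"])
    (use e_meas h_meas e_lim e_bd in \<open>auto intro: meas_borel\<close>)
  have "hrate f \<mu> c<=(LINT x|\<mu>. hrate f (\<nu> x) c)"
  proof (rule LIMSEQ_le_const[OF lim], intro exI allI impI)
   fix n :: nat assume n: "1<=n"
   have "n * hrate f \<mu> c<=(LINT x|\<mu>. ent (\<nu> x) (nm f c (times n)))" by (rule hrate_le_integral_ent[OF \<nu> kb(1) kb(2) c n]) auto
   thus "hrate f \<mu> c<=(LINT x|\<mu>. e n x)" using n by (simp add: e_def field_simps)
  qed
  moreover have "integrable \<mu> (%x. hrate f (\<nu> x) c)" by (rule integrable_bounded[OF h_meas h_bd])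
  ultimately show ?thesis by simp
 qed
 from \<nu>(1) erg int dg hr[THEN conjunct1] hr[THEN conjunct2] show thesis by (rule that)
qed

end


section \<open>Limit measures of separated sets\<close>

text \<open>Sets with null boundary. The sandwich by an open and a closed set replaces interior and
  closure, so that set operations and preimages under the flow only have to transform
  witnesses.\<close>

definition cont_set :: "'a::topological_space measure=>'a set=>bool" where
 "cont_set \<mu> C \<longleftrightarrow> (EX U K. open U&closed K&U\<subseteq>C&C\<subseteq>K&measure \<mu> (K-U) = 0)"

lemma cont_set_Int:
 fixes M :: "'a::topological_space measure"
 assumes "prob_space M" "sets M = sets borel" "cont_set M A" "cont_set M B" shows "cont_set M (A\<inter>B)"
proof -
 interpret prob_space M by fact
 obtain U K where UK: "open U" "closed K" "U\<subseteq>A" "A\<subseteq>K" "measure M (K-U) = 0" using assms(3) by (auto simp: cont_set_def)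
 obtain V L where VL: "open V" "closed L" "V\<subseteq>B" "B\<subseteq>L" "measure M (L-V) = 0" using assms(4) by (auto simp: cont_set_def)
 have "measure M (K\<inter>L-U\<inter>V)<=measure M ((K-U)\<union>(L-V))" by (rule finite_measure_mono) (use UK VL assms(2) in auto)
 also have "\<dots><=measure M (K-U)+measure M (L-V)" by (rule measure_Un_le) (use UK VL assms(2) in auto)
 finally have "measure M (K\<inter>L-U\<inter>V) = 0" using UK VL by (simp add: measure_le_0_iff)
 thus ?thesis unfolding cont_set_def by (intro exI[of _ "U\<inter>V"] exI[of _ "K\<inter>L"]) (use UK VL in auto)
qed

lemma cont_set_Compl: "cont_set \<mu> A ==> cont_set \<mu> (- A)" unfolding cont_set_def
proof (elim exE conjE)
 fix U K assume "open U" "closed K" "U\<subseteq>A" "A\<subseteq>K" "measure \<mu> (K-U) = 0"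
 moreover have "- U - - K = K-U" by auto
 ultimately show "EX V L. open V&closed L&V\<subseteq>- A & - A\<subseteq>L&measure \<mu> (L-V) = 0"
  by (intro exI[of _ "- K"] exI[of _ "- U"]) auto
qed

lemma cont_set_INT:
 fixes M :: "'a::topological_space measure"
 assumes "prob_space M" "sets M = sets borel" "finite I" "!!i. i\<in>I ==> cont_set M (A i)"
 shows "cont_set M (\<Inter>i\<in>I. A i)" using assms(3,4)
proof (induction I rule: finite_induct)
 case empty
 show ?case unfolding cont_set_def by (intro exI[of _ UNIV]) auto
next
 case (insert i I)
 thus ?case using cont_set_Int[OF assms(1,2),of "A i" "\<Inter>i\<in>I. A i"] by simp
qed

lemma bounded_borel_integrable:
 fixes F :: "real=>real"
 assumes "F\<in>borel_measurable borel" "!!s. \<bar>F s\<bar><=B"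
 shows "F integrable_on {a..b}"
proof -
 have "set_integrable lborel {a..b} F" unfolding set_integrable_def
  by (rule integrableI_bounded_set_indicator[where B = B]) (use assms in \<open>auto simp: emeasure_lborel_Icc_eq\<close>)
 thus ?thesis by (rule set_borel_integral_eq_integral(1))
qed

lemma nm_vimage:
 "nm f c (times q) -` {v} = (if length v = q then (\<Inter>i\<in>{..<q}. f (real i) -` (c -` {v ! i})) else {})"
proof (rule set_eqI)
 fix x
 have len: "length (nm f c (times q) x) = q" by (simp add: nm_def times_def)
 have nth: "nm f c (times q) x ! i = c (f (real i) x)" if "i < q" for i using that by (simp add: nm_def times_def)
 have "nm f c (times q) x = v \<longleftrightarrow> length v = q&(ALL i<q. c (f (real i) x) = v ! i)"
  using list_eq_iff_nth_eq[of "nm f c (times q) x" v] len nth by auto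
 thus "x\<in>nm f c (times q) -` {v} \<longleftrightarrow> x\<in>(if length v = q then (\<Inter>i\<in>{..<q}. f (real i) -` (c -` {v ! i})) else {})" by auto
qed

lemma plogp_tangent:
 assumes "0<=y" "0 < c"
 shows "plogp c+(1+ln c)*(y-c)<=plogp y"
proof (cases "y = 0")
 case True
 thus ?thesis using assms by (simp add: plogp_def algebra_simps)
next
 case False
 hence y: "y > 0" using assms by simp
 have "ln (c/y)<=c/y-1" by (rule ln_le_minus_one) (use y assms in simp)
 hence "y * ln (c/y)<=y * (c/y-1)" using y by (intro mult_left_mono) auto
 moreover have "y * (c/y-1) = c-y" using y by (simp add: field_simps)
 ultimately have "y * (ln c-ln y)<=c-y" using y assms by (simp add: ln_div)
 thus ?thesis using y assms by (simp add: plogp_def algebra_simps)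
qed

text \<open>The tangent bound is integrated at the mean \<open>c\<close>. If \<open>c = 0\<close>
  the slope there is infinite; tangents at small \<open>d > 0\<close> are used instead, and
  \<open>d\<close> tends to 0.\<close>

lemma plogp_jensen:
 fixes P :: "real=>real"
 assumes P: "P\<in>borel_measurable borel" "!!s. 0<=P s" "!!s. P s<=1" and N: "N > 0"
 shows "integral {0..N} (%s. - plogp (P s))<=N * (- plogp (integral {0..N} P/N))"
proof -
 have i1: "P integrable_on {0..N}" by (rule bounded_borel_integrable[of _ 1]) (use P in auto)
 obtain B where "ALL y:plogp ` {0..1}. norm y<=B"
  using compact_imp_bounded[OF compact_continuous_image[OF plogp_continuous compact_Icc]] unfolding bounded_iff by blast
 hence i2: "(%s. - plogp (P s)) integrable_on {0..N}" by (intro bounded_borel_integrable[of _ B]) (use P in auto)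
 define c where "c = integral {0..N} P/N"
 have c0: "c>=0" unfolding c_def using N P(2) by (intro divide_nonneg_nonneg integral_nonneg i1) auto
 have Nc: "integral {0..N} P = N * c" using N by (simp add: c_def)
 have ub: "integral {0..N} (%s. - plogp (P s))<=N * (- plogp d)-(1+ln d)*(N * c-N * d)" if d: "d > 0" for d
 proof -
  have j1: "(%s. P s-d) integrable_on {0..N}" by (intro integrable_diff i1) auto
  have j2: "(%s. (1+ln d)*(P s-d)) integrable_on {0..N}" by (intro integrable_on_mult_right j1)
  have i3: "(%s. - plogp d-(1+ln d)*(P s-d)) integrable_on {0..N}" by (intro integrable_diff j2) auto
  have "integral {0..N} (%s. - plogp (P s))<=integral {0..N} (%s. - plogp d-(1+ln d)*(P s-d))"
   by (rule integral_le[OF i2 i3]) (use plogp_tangent[OF P(2) d] in \<open>auto simp: algebra_simps\<close>)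
  also have "\<dots> = N * (- plogp d)-(1+ln d)*(N * c-N * d)"
  proof -
   have "integral {0..N} (%s. P s-d) = integral {0..N} P-integral {0..N} (%s. d)" by (rule Henstock_Kurzweil_Integration.integral_diff[OF i1]) auto
   hence k: "integral {0..N} (%s. P s-d) = N * c-N * d" using N by (simp add: Nc)
   have "integral {0..N} (%s. - plogp d-(1+ln d)*(P s-d))
     = integral {0..N} (%s. - plogp d)-integral {0..N} (%s. (1+ln d)*(P s-d))" by (rule Henstock_Kurzweil_Integration.integral_diff[OF _ j2]) auto
   thus ?thesis using N k by simp
  qed
  finally show ?thesis .
 qed
 show ?thesis
 proof (cases "c = 0")
  case False
  hence "c > 0" using c0 by simp
  from ub[OF this] show ?thesis by (simp only: c_def) simp
 next
  case True
  have small: "integral {0..N} (%s. - plogp (P s))<=N * d" if d: "d > 0" for d using ub[OF d] True d by (simp add: plogp_def algebra_simps)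
  have "integral {0..N} (%s. - plogp (P s))<=0"
  proof (rule field_le_epsilon)
   fix e :: real assume "e > 0"
   thus "integral {0..N} (%s. - plogp (P s))<=0+e" using small[of "e/N"] N by simp
  qed
  moreover have "integral {0..N} P/N = 0" using True unfolding c_def .
  ultimately show ?thesis by (simp only: plogp_0)
 qed
qed

context compact_flow
begin

text \<open>Only countably many spheres about a point can have positive measure, so every centre has
  a radius between \<open>d/4\<close> and \<open>d/2\<close> with null sphere. The lower limit keeps
  the balls a cover, the upper one keeps points of the same ball closer than \<open>d\<close>; cells
  are formed by first hit.\<close>

lemma null_boundary_partition:
 assumes inv: "invariant_measure f \<mu>" and "\<gamma> > 0"
 obtains c :: "'a=>nat" where "simple_function \<mu> c" "!!i. cont_set \<mu> (c -` {i})"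
  "!!x y s. c x = c y ==> \<bar>s\<bar><=1 ==> dist (f s x) (f s y)<=\<gamma>"
proof -
 interpret compact_inv_flow f \<mu> by (rule compact_inv_flowI[OF inv])
 from f_uniform[OF \<open>\<gamma> > 0\<close>, of 1] obtain d where d: "d > 0"
  "!!(x::'a) y s. dist x y < d ==> \<bar>s\<bar><=1 ==> dist (f s x) (f s y) < \<gamma>" by blast
 have "EX r:{d/4<..<d/2}. measure \<mu> {y. dist x y = r} = 0" for x
 proof -
  have m: "dist x\<in>borel_measurable \<mu>" by (rule continuous_measurable) (intro continuous_intros)
  interpret D: finite_measure "distr \<mu> borel (dist x)" by (rule finite_measure_distr[OF m])
  have "uncountable {d/4<..<d/2}" using d(1) by (simp add: uncountable_open_interval)
  moreover have "countable {r. measure (distr \<mu> borel (dist x)) {r}~=0}" by (rule D.countable_support)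
  ultimately have nsub: "\<not> {d/4<..<d/2}\<subseteq>{r. measure (distr \<mu> borel (dist x)) {r}~=0}" using countable_subset by blast
  obtain r where r: "r\<in>{d/4<..<d/2}" "measure (distr \<mu> borel (dist x)) {r} = 0"
  proof -
   from nsub obtain r where "r\<in>{d/4<..<d/2}" "\<not> measure (distr \<mu> borel (dist x)) {r}~=0" by blast
   thus thesis by (intro that) auto
  qed
  have "measure (distr \<mu> borel (dist x)) {r} = measure \<mu> {y. dist x y = r}" by (subst measure_distr[OF m]) (auto intro!: arg_cong[where f = "measure \<mu>"])
  thus ?thesis using r by auto
 qed
 then obtain \<rho> where \<rho>: "!!x. d/4 < \<rho> x" "!!x. \<rho> x < d/2" "!!x. measure \<mu> {y. dist x y = \<rho> x} = 0"
  unfolding Bex_def greaterThanLessThan_iff by metis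
 obtain F where F: "finite F" "!!x::'a. EX q:F. dist q x < d/4" using finite_net[of "d/4"] d(1) by auto
 obtain xs where xs: "set xs = F" using finite_list[OF F(1)] by blast
 define B where "B i = {y. dist (xs ! i) y < \<rho> (xs ! i)}" for i
 have oB: "open (B i)" for i unfolding B_def by (intro open_Collect_less continuous_intros)
 have cB: "cont_set \<mu> (B i)" for i unfolding cont_set_def
 proof (intro exI conjI)
  show "closed {y. dist (xs ! i) y<=\<rho> (xs ! i)}" by (intro closed_Collect_le continuous_intros)
  have "{y. dist (xs ! i) y<=\<rho> (xs ! i)}-B i = {y. dist (xs ! i) y = \<rho> (xs ! i)}" by (auto simp: B_def)
  thus "measure \<mu> ({y. dist (xs ! i) y<=\<rho> (xs ! i)}-B i) = 0" using \<rho>(3) by simp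
 qed (use oB in \<open>auto simp: B_def\<close>)
 have ex: "EX i. i < length xs&y\<in>B i" for y
 proof -
  obtain q where q: "q\<in>F" "dist q y < d/4" using F(2) by blast
  then obtain i where "i < length xs" "xs ! i = q" using xs by (metis in_set_conv_nth)
  thus ?thesis using q \<rho>(1)[of q] by (intro exI[of _ i]) (auto simp: B_def)
 qed
 define c where "c y = (LEAST i. i < length xs&y\<in>B i)" for y
 have c: "c y < length xs" "y\<in>B (c y)" "j < c y ==> y\<notin>B j" for y j
 proof -
  have "c y < length xs&y\<in>B (c y)" unfolding c_def by (rule LeastI_ex) (rule ex)
  thus "c y < length xs" "y\<in>B (c y)" by auto
  assume j: "j < c y"
  hence "\<not> (j < length xs&y\<in>B j)" unfolding c_def by (rule not_less_Least)
  thus "y\<notin>B j" using j \<open>c y < length xs & y \<in> B (c y)\<close> by auto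
 qed
 have pre: "c -` {i} = (if i < length xs then B i\<inter>(\<Inter>j<i. - B j) else {})" for i
 proof (intro set_eqI iffI)
  fix y assume "y\<in>c -` {i}"
  thus "y\<in>(if i < length xs then B i\<inter>(\<Inter>j<i. - B j) else {})" using c(1)[of y] c(2)[of y] c(3)[of _ y] by auto
 next
  fix y assume "y\<in>(if i < length xs then B i\<inter>(\<Inter>j<i. - B j) else {})"
  hence y: "i < length xs" "y\<in>B i" "!!j. j < i ==> y\<notin>B j" by (auto split: if_splits)
  have "c y = i" unfolding c_def by (rule Least_equality) (use y in \<open>auto simp: not_less[symmetric]\<close>)
  thus "y\<in>c -` {i}" by simp
 qed
 have oB': "B i\<in>sets \<mu>" for i using oB by auto
 show thesis
 proof (rule that[of c])
  show "simple_function \<mu> c" unfolding simple_function_def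
  proof (intro conjI ballI)
   have "c ` space \<mu>\<subseteq>{..<length xs}" using c(1) by auto
   thus "finite (c ` space \<mu>)" using finite_subset by blast
   fix i
   have "closed (\<Inter>j<i. - B j)" using oB by auto
   hence "c -` {i}\<in>sets borel" unfolding pre using oB[of i] by (auto intro!: sets.Int)
   thus "c -` {i}\<inter>space \<mu>\<in>sets \<mu>" by simp
  qed
  show "cont_set \<mu> (c -` {i})" for i
  proof (cases "i < length xs")
   case True
   thus ?thesis unfolding pre using cB by (auto intro!: cont_set_Int cont_set_INT cont_set_Compl prob_space_axioms)
  next
   case False
   thus ?thesis unfolding pre cont_set_def by (intro exI[of _ "{}"]) auto
  qed
  fix x y s assume "c x = c y" "\<bar>s\<bar><=(1::real)"
  moreover have "dist x y < d" using c(2)[of x] c(2)[of y] \<open>c x = c y\<close> \<rho>(2)[of "xs ! c y"] dist_triangle3[of x y "xs ! c y"] by (auto simp: B_def)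
  ultimately show "dist (f s x) (f s y)<=\<gamma>" using d(2) by (auto intro: less_imp_le)
 qed
qed

lemma cont_set_flow:
 assumes inv: "invariant_measure f \<mu>" and C: "cont_set \<mu> C" shows "cont_set \<mu> (f t -` C)"
proof -
 interpret compact_inv_flow f \<mu> by (rule compact_inv_flowI[OF inv])
 obtain U K where UK: "open U" "closed K" "U\<subseteq>C" "C\<subseteq>K" "measure \<mu> (K-U) = 0" using C by (auto simp: cont_set_def)
 have "f t -` K-f t -` U = f t -` (K-U)" by auto
 moreover have "measure \<mu> (f t -` (K-U)) = 0" using UK prob_flow[of "K-U" t] by auto
 moreover have "open (f t -` U)" "closed (f t -` K)" using UK f_continuous[of UNIV t] by (auto intro: open_vimage closed_vimage)
 ultimately show ?thesis unfolding cont_set_def by (intro exI[of _ "f t -` U"] exI[of _ "f t -` K"]) (use UK in auto)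
qed


text \<open>Misiurewicz's counting for the weighted point measure on \<open>E\<close>. Sampling on a
  grid of step 1 separates \<open>E\<close>, so the name entropy equals the entropy of
  \<open>w\<close>. Subadditivity cuts names into blocks of length \<open>q\<close>, and integrating
  over the offset of the grid turns sums into flow averages, to which Jensen's inequality
  applies.\<close>

lemma ent_point_names:
 fixes c :: "'a=>'b"
 assumes E: "finite E" "E~={}" "separated f t \<gamma> E" and t: "0<=t"
  and c: "finite (range c)" "!!v. c -` {v}\<in>sets borel"
   "!!x y s. c x = c y ==> \<bar>s\<bar><=1 ==> dist (f s x) (f s y)<=\<gamma>"
  and w: "!!x. x\<in>E ==> 0<=w x" "(SUM x:E. w x) = 1"
  and N: "N = nat \<lceil>t\<rceil>+1" and V: "V = range (nm f c (times q))"
 shows "q * (SUM x:E. - plogp (w x)) <=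
  N * (SUM v:V. - plogp ((SUM x:E. w x * integral {0..real N} (%s. ind (nm f c (times q) -` {v}) (f s x)))/N))
  + q * q * ln (card (range c))"
proof -
 define M where "M = point_measure E (%x. ennreal (w x))"
 have sM: "space M = E" "sets M = Pow E" by (simp_all add: M_def space_point_measure sets_point_measure)
 have mM: "measure M A = (SUM x:A. w x)" if "A\<subseteq>E" for A
 proof -
  have "emeasure M A = (SUM x:A. ennreal (w x))" unfolding M_def by (rule emeasure_point_measure_finite[OF E(1) that])
  also have "\<dots> = ennreal (SUM x:A. w x)" using that w(1) by (intro sum_ennreal) auto
  finally show ?thesis using that w(1) by (simp add: measure_def sum_nonneg subset_iff)
 qed
 interpret M: prob_space M
 proof
  have "emeasure M E = ennreal (SUM x:E. w x)"
   unfolding M_def using emeasure_point_measure_finite[OF E(1),of E "%x. ennreal (w x)"] w(1) by (simp add: sum_ennreal)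
  thus "emeasure M (space M) = 1" using w(2) sM by simp
 qed
 have sf: "simple_function M X" for X :: "'a=>'z" unfolding simple_function_def using E(1) sM by auto
 have sf2: "simple_function M (X :: 'a=>'y)" for X unfolding simple_function_def using E(1) sM by auto
 define R where "R r n = map (%l. r+real l) [0..<n]" for r :: real and n :: nat
 define H where "H r n = ent M (nm f c (R r n))" for r n
 define b where "b s = ent M (%x. nm f c (times q) (f s x))" for s
 have sfb: "simple_function M (X :: 'a=>'b list)" for X unfolding simple_function_def using E(1) sM by auto
 have H_step: "H r (n+q)<=H r n+b (r+real n)" for r n
 proof -
  have e: "nm f c (R r (n+q)) x = nm f c (R r n) x @ nm f c (times q) (f (r+real n) x)" for x
  proof -
   have "R r (n+q) = R r n @ map (%u. u+(r+real n)) (times q)" by (rule nth_equalityI) (auto simp: R_def times_def nth_append)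
   thus ?thesis by (simp add: nm_def f_add)
  qed
  have "H r (n+q)<=ent M (%x. (nm f c (R r n) x,nm f c (times q) (f (r+real n) x)))" unfolding H_def
  proof (rule M.ent_determined)
   show "simple_function M (%x. (nm f c (R r n) x,nm f c (times q) (f (r+real n) x)))" by (intro simple_function_Pair sfb)
  qed (auto simp: e sfb)
  also have "\<dots><=H r n+b (r+real n)" unfolding H_def b_def by (intro M.ent_subadd sfb)
  finally show ?thesis .
 qed
 have H_mono: "H r n<=H r m" if "n<=m" for r n m unfolding H_def
 proof (rule M.ent_determined[OF sfb sfb])
  fix x y assume "nm f c (R r m) x = nm f c (R r m) y"
  hence "map (%u. c (f u x)) (R r m) = map (%u. c (f u y)) (R r m)" by (simp add: nm_def)
  hence "ALL u:set (R r m). c (f u x) = c (f u y)" by simp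
  moreover have "set (R r n)\<subseteq>set (R r m)" using that by (auto simp: R_def)
  ultimately show "nm f c (R r n) x = nm f c (R r n) y" by (auto simp: nm_def)
 qed
 have card_pos: "card (range c) > 0" using c(1) by (simp add: card_gt_0_iff)
 have ln0: "0<=ln (card (range c))" using card_pos by simp
 have H_bd: "H r n<=n * ln (card (range c))" for r n
 proof -
  have "H r n<=ln (card {ws. set ws\<subseteq>range c&length ws = n})"
   unfolding H_def by (rule M.ent_le_card[OF sfb finite_lists_length_eq[OF c(1)]]) (auto simp: nm_def R_def)
  also have "\<dots> = n * ln (card (range c))" using c(1) card_pos by (simp add: card_lists_length_eq ln_realpow)
  finally show ?thesis .
 qed
 \<comment> \<open>All \<open>q\<close> phases of the cutting into blocks are summed at once: each
   position \<open>l < n\<close> starts a block in exactly one phase.\<close>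
 have sumH: "(\<Sum>j<q. H r (n+j))<=(\<Sum>l<n. b (r+real l))+(\<Sum>j<q. H r j)" for r n
 proof (induction n)
  case (Suc n)
  have "(\<Sum>j<q. H r (Suc n+j))+H r n = (\<Sum>j<Suc q. H r (n+j))" by (subst sum.lessThan_Suc_shift) simp
  also have "\<dots> = (\<Sum>j<q. H r (n+j))+H r (n+q)" by simp
  finally show ?case using Suc H_step[of r n] by simp
 qed simp
 have pre: "q * H r n<=(\<Sum>l<n. b (r+real l))+q * q * ln (card (range c))" for r n
 proof -
  have "q * H r n = (\<Sum>j<q. H r n)" by simp
  also have "\<dots><=(\<Sum>j<q. H r (n+j))" by (intro sum_mono H_mono) auto
  also note sumH
  also have "(\<Sum>j<q. H r j)<=(\<Sum>j<q. real q * ln (card (range c)))"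
  proof (rule sum_mono)
   fix j assume "j\<in>{..<q}"
   hence "real j * ln (card (range c))<=real q * ln (card (range c))" using ln0 by (intro mult_right_mono) auto
   thus "H r j<=real q * ln (card (range c))" using H_bd[of r j] by linarith
  qed
  finally show ?thesis by simp
 qed
 \<comment> \<open>For any offset \<open>r\<close> in the unit interval, the \<open>N\<close>
   sampling times come within distance 1 of every time in \<open>{0..t}\<close>, and equal values of
   \<open>c\<close> control distances for one time unit in both directions. This is why
   \<open>N\<close> exceeds the rounded length by 1.\<close>
 have sep: "H r N = (SUM x:E. - plogp (w x))" if r: "0<=r" "r<=1" for r
 proof -
  have inj: "inj_on (nm f c (R r N)) E"
  proof (rule inj_onI)
   fix x y assume xy: "x\<in>E" "y\<in>E" "nm f c (R r N) x = nm f c (R r N) y"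
   hence "map (%u. c (f u x)) (R r N) = map (%u. c (f u y)) (R r N)" by (simp add: nm_def)
   hence eq: "c (f u x) = c (f u y)" if "u\<in>set (R r N)" for u using that by simp
   have "dist (f u x) (f u y)<=\<gamma>" if u: "u\<in>{0..t}" for u
   proof -
    define l where "l = nat \<lceil>u-r\<rceil>"
    have "\<lceil>u-r\<rceil><=\<lceil>t\<rceil>" using u r by (intro ceiling_mono) auto
    hence "l < N" unfolding l_def N by simp
    hence "r+real l\<in>set (R r N)" by (auto simp: R_def)
    from eq[OF this] have "dist (f (u-(r+real l)) (f (r+real l) x)) (f (u-(r+real l)) (f (r+real l) y))<=\<gamma>"
    proof (rule c(3))
     show "\<bar>u-(r+real l)\<bar><=1"
     proof (cases "\<lceil>u-r\<rceil>>=0")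
      case True
      hence "real l = of_int \<lceil>u-r\<rceil>" by (simp add: l_def)
      thus ?thesis by linarith
     next
      case False
      hence "l = 0" by (simp add: l_def)
      moreover have "u-r < 0" using False by linarith
      ultimately show ?thesis using u r by auto
     qed
    qed
    thus ?thesis by (simp add: f_add[symmetric])
   qed
   thus "x = y" using E(3) xy t by (simp add: separated_iff)
  qed
  have "ent M (nm f c (R r N)) = - (SUM v:nm f c (R r N) ` E. plogp (measure M (nm f c (R r N) -` {v}\<inter>E)))" by (simp add: ent_def sM)
  also have "\<dots> = - (SUM x:E. plogp (measure M (nm f c (R r N) -` {nm f c (R r N) x}\<inter>E)))" by (simp add: sum.reindex[OF inj])
  also have "\<dots> = - (SUM x:E. plogp (w x))"
  proof -
   have "nm f c (R r N) -` {nm f c (R r N) x}\<inter>E = {x}" if "x\<in>E" for x using that inj by (auto dest: inj_onD)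
   thus ?thesis using mM by simp
  qed
  finally show ?thesis by (simp add: H_def sum_negf)
 qed
 let ?Q = "nm f c (times q)"
 have Vfin: "finite V"
 proof -
  have "V\<subseteq>{ws. set ws\<subseteq>range c&length ws = q}" unfolding V by (auto simp: nm_def times_def)
  thus ?thesis using finite_lists_length_eq[OF c(1)] finite_subset by blast
 qed
 have Qb: "?Q -` {v}\<in>sets borel" for v
 proof -
  have "?Q -` {v} = (if length v = q then (\<Inter>i<q. f (real i) -` (c -` {v ! i})) else {})" by (rule nm_vimage)
  moreover have "f (real i) -` (c -` {v ! i})\<in>sets borel" for i
   using measurable_sets[OF borel_measurable_continuous_onI[OF f_continuous[of UNIV "real i"]] c(2)[of "v ! i"]] by simp
  ultimately show ?thesis by (cases "q = 0") auto
 qed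
 define P where "P v s = (SUM x:E. w x * ind (?Q -` {v}) (f s x))" for v s
 have Pm: "P v\<in>borel_measurable borel" for v
 proof -
  have [measurable]: "(%s. f s x)\<in>borel_measurable borel" for x by (rule borel_measurable_continuous_onI[OF f_orbit_continuous])
  note Qb[measurable]
  show ?thesis unfolding P_def[abs_def] by measurable
 qed
 have P01: "0<=P v s" "P v s<=1" for v s
 proof -
  show "0<=P v s" unfolding P_def using w(1) by (intro sum_nonneg) auto
  have "P v s<=(SUM x:E. w x)" unfolding P_def using w(1) by (intro sum_mono) (auto simp: indicator_def)
  thus "P v s<=1" using w(2) by simp
 qed
 have b_P: "b s = (SUM v:V. - plogp (P v s))" for s
 proof -
  have "measure M ((%x. ?Q (f s x)) -` {v}\<inter>space M) = P v s" for v
  proof -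
   have "measure M ((%x. ?Q (f s x)) -` {v}\<inter>space M) = (SUM x:(%x. ?Q (f s x)) -` {v}\<inter>E. w x)" by (subst mM) (auto simp: sM)
   also have "\<dots> = P v s" unfolding P_def using E(1) by (intro sum.mono_neutral_cong_left) (auto simp: indicator_def)
   finally show ?thesis .
  qed
  thus ?thesis unfolding b_def by (subst M.ent_superset[OF Vfin]) (auto simp: V sum_negf)
 qed
 obtain B where "ALL y:plogp ` {0..1}. norm y<=B"
  using compact_imp_bounded[OF compact_continuous_image[OF plogp_continuous compact_Icc]] unfolding bounded_iff by blast
 hence plB: "\<bar>plogp (P v s)\<bar><=B" for v s using P01[of v s] by auto
 have plm: "(%s. - plogp (P v s))\<in>borel_measurable borel" for v using Pm[of v] by measurable
 have pli: "(%s. - plogp (P v s)) integrable_on {u..u'}" for v u u' by (rule bounded_borel_integrable[where B = B,OF plm]) (use plB in auto)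
 have bi: "b integrable_on {u..u'}" for u u' unfolding b_P[abs_def] by (intro integrable_sum Vfin pli)
 have shift: "integral {0..real n} b = (\<Sum>l<n. integral {0..1} (%s. b (s+real l)))" for n
 proof (induction n)
  case (Suc n)
  have "integral {0..real n} b+integral {real n..real (Suc n)} b = integral {0..real (Suc n)} b"
   by (rule Henstock_Kurzweil_Integration.integral_combine) (auto intro: bi)
  moreover have "integral {real n..real (Suc n)} b = integral {0..1} (%s. b (s+real n))"
   using integral_shift_Icc_real[of 0 1 b "real n"] by (simp add: comp_def add.commute)
  ultimately show ?case using Suc by simp
 qed simp
 have bsi: "(%s. b (s+real l)) integrable_on {0..1}" for l
 proof -
  have "(%s. - plogp (P v (s+real l))) integrable_on {0..1}" for v
  proof (rule bounded_borel_integrable[of _ B])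
   note plm[measurable]
   show "(%s. - plogp (P v (s+real l)))\<in>borel_measurable borel"
    by (rule measurable_compose[of "%s. s+real l" borel borel "%s. - plogp (P v s)"]) measurable
  qed (use plB in auto)
  thus ?thesis unfolding b_P by (intro integrable_sum Vfin)
 qed
 \<comment> \<open>The bound for a single offset is integrated over the unit interval, so the grid
   sums merge into one integral over \<open>{0..real N}\<close>.\<close>
 let ?C = "real q * (SUM x:E. - plogp (w x))-q * q * ln (card (range c))"
 have "?C = integral {0..1} (%s::real. ?C)" by simp
 also have "\<dots><=integral {0..1} (%s. \<Sum>l<N. b (s+real l))"
 proof (rule integral_le)
  fix s :: real assume "s\<in>{0..1}"
  thus "?C<=(\<Sum>l<N. b (s+real l))" using pre[of s N] sep[of s] by simp
 qed (auto intro: integrable_sum bsi)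
 also have "\<dots> = integral {0..real N} b" unfolding shift by (rule Henstock_Kurzweil_Integration.integral_sum) (auto intro: bsi)
 also have "\<dots> = (SUM v:V. integral {0..real N} (%s. - plogp (P v s)))"
  unfolding b_P[abs_def] by (rule Henstock_Kurzweil_Integration.integral_sum[OF Vfin]) (rule pli)
 also have "\<dots><=(SUM v:V. N * (- plogp (integral {0..real N} (P v)/N)))" by (intro sum_mono plogp_jensen Pm P01) (simp add: N)
 also have "\<dots> = N * (SUM v:V. - plogp ((SUM x:E. w x * integral {0..real N} (%s. ind (?Q -` {v}) (f s x)))/N))"
 proof -
  have "integral {0..real N} (P v) = (SUM x:E. w x * integral {0..real N} (%s. ind (?Q -` {v}) (f s x)))" for v
  proof -
   have i: "(%s. ind (?Q -` {v}) (f s x) :: real) integrable_on {0..real N}" for x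
   proof (rule bounded_borel_integrable[of _ 1])
    have [measurable]: "(%s. f s x)\<in>borel_measurable borel" by (rule borel_measurable_continuous_onI[OF f_orbit_continuous])
    note Qb[measurable]
    show "(%s. ind (?Q -` {v}) (f s x) :: real)\<in>borel_measurable borel" by measurable
   qed (auto simp: indicator_def)
   show ?thesis unfolding P_def[abs_def] using i by (subst Henstock_Kurzweil_Integration.integral_sum) (auto intro: E(1) integrable_on_mult_right)
  qed
  thus ?thesis by (simp add: sum_distrib_left)
 qed
 finally show ?thesis by simp
qed


text \<open>The numbers \<open>m k\<close> enter only through comparison with \<open>L k\<close> on
  continuous functions above and below \<open>C\<close>. This fits time averages of indicators, on
  which the functionals \<open>L k\<close> themselves are not evaluated.\<close>

lemma portmanteau:
 fixes \<mu> :: "'a measure"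
 assumes \<mu>: "sets \<mu> = sets borel" "prob_space \<mu>"
  and lim: "!!g :: 'a=>real. cts g ==> ((%k. L k g) \<longlongrightarrow> integral\<^sup>L \<mu> g) G"
  and C: "cont_set \<mu> C" "C\<in>sets borel"
  and upper: "!!g k. cts g ==> (!!x. 0<=g x&g x<=1) ==> (!!x. ind C x<=g x) ==> m k<=L k g"
  and lower: "!!g k. cts g ==> (!!x. 0<=g x&g x<=1) ==> (!!x. g x<=ind C x) ==> L k g<=m k"
 shows "(m \<longlongrightarrow> measure \<mu> C) G"
proof (rule order_tendstoI)
 interpret prob_space \<mu> by fact
 have fm: "finite_measure \<mu>" by (rule finite_measure_axioms)
 have sp: "space \<mu> = UNIV" by (rule sets_eq_borel_space[OF \<mu>(1)])
 obtain U K where UK: "open U" "closed K" "U\<subseteq>C" "C\<subseteq>K" "measure \<mu> (K-U) = 0" using C(1) by (auto simp: cont_set_def)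
 have sb: "U\<in>sets \<mu>" "K\<in>sets \<mu>" "C\<in>sets \<mu>" using UK C(2) \<mu>(1) by auto
 have "measure \<mu> K = measure \<mu> U+measure \<mu> (K-U)" using finite_measure_Diff[OF sb(2,1)] UK by auto
 moreover have "measure \<mu> U<=measure \<mu> C" "measure \<mu> C<=measure \<mu> K" using UK sb by (auto intro: finite_measure_mono)
 ultimately have eq: "measure \<mu> K = measure \<mu> C" "measure \<mu> U = measure \<mu> C" using UK by auto
 {
  fix a assume a: "measure \<mu> C < a"
  from closed_indicator_limit[OF UK(2)] obtain h :: "nat=>'a=>real" where
   h: "!!n. cts (h n)" "!!n x. 0<=h n x" "!!n x. h n x<=1"
    "!!n x. ind K x<=h n x" "!!x. (%n. h n x) \<longlonglongrightarrow> ind K x" by blast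
  have "(%n. integral\<^sup>L \<mu> (h n)) \<longlonglongrightarrow> measure \<mu> C"
   unfolding eq(1)[symmetric] by (rule measure_closed_limit[OF \<mu>(1) fm h(1,2,3,5)]) (use UK in auto)
  from order_tendstoD(2)[OF this a] obtain n where n: "integral\<^sup>L \<mu> (h n) < a" unfolding eventually_sequentially by blast
  have ml: "m k<=L k (h n)" for k
  proof (rule upper[OF h(1)])
   have "ind C x<=(ind K x :: real)" for x using UK by (auto simp: indicator_def)
   thus "ind C x<=h n x" for x using h(4)[of x n] order_trans by blast
  qed (use h in auto)
  show "\<forall>\<^sub>F k in G. m k < a" by (rule eventually_mono[OF order_tendstoD(2)[OF lim[OF h(1)] n]]) (rule le_less_trans[OF ml])
 next
  fix a assume a: "a < measure \<mu> C"
  have "closed (- U)" using UK by auto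
  from closed_indicator_limit[OF this] obtain h :: "nat=>'a=>real" where
   h: "!!n. cts (h n)" "!!n x. 0<=h n x" "!!n x. h n x<=1"
    "!!n x. ind (- U) x<=h n x" "!!x. (%n. h n x) \<longlonglongrightarrow> ind (- U) x" by blast
  have hl: "(%n. integral\<^sup>L \<mu> (h n)) \<longlonglongrightarrow> measure \<mu> (- U)"
   by (rule measure_closed_limit[OF \<mu>(1) fm h(1,2,3,5)]) (use UK in auto)
  have ha: "measure \<mu> (- U) < 1-a" using prob_compl[OF sb(1)] a eq by (simp add: sp Compl_eq_Diff_UNIV)
  from order_tendstoD(2)[OF hl ha] obtain n where n: "integral\<^sup>L \<mu> (h n) < 1-a" unfolding eventually_sequentially by blast
  have c: "cts (%x. 1-h n x)" by (intro continuous_intros h)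
  have "integrable \<mu> (h n)" by (rule integrable_continuous_compact[OF comp \<mu>(1) fm h(1)])
  hence "(LINT x|\<mu>. 1-h n x) > a" using n prob_space by simp
  note gt = this
  have Lm: "L k (%x. 1-h n x)<=m k" for k
  proof (rule lower[OF c])
   show "1-h n x<=ind C x" for x using h(4)[of x n] h(2)[of n x] UK(3) by (cases "x\<in>C"; cases "x\<in>U") auto
  qed (use h in auto)
  show "\<forall>\<^sub>F k in G. a < m k" by (rule eventually_mono[OF order_tendstoD(1)[OF lim[OF c] gt]]) (rule less_le_trans[OF _ Lm])
 }
qed

lemma avg_linear:
 fixes g h :: "'a=>real"
 assumes "cts g" "cts h"
 shows "avg (%x. g x+h x) n x = avg g n x+avg h n x" "avg (%x. c * g x) n x = c * avg g n x"
 using birkhoff_linear[OF assms] by (simp_all add: avg_def add_divide_distrib)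

lemma avg_nonneg: "cts g ==> (!!x. 0<=g x) ==> 0<=avg g n x"
 using birkhoff_mono[of "%_. 0" g x "real n"] by (simp add: avg_def birkhoff_int_def)

text \<open>The constant \<open>d0\<close> allows the exponent \<open>a\<close> to be attained and
  not merely approached, which later gives a measure with free energy exactly the pressure. Averages
  run over the length \<open>N k\<close> of the sampling grid, which differs from \<open>t k\<close>
  by at most 2.\<close>

theorem misiurewicz:
 fixes \<phi> :: "'a=>real" and E :: "nat=>'a set" and t :: "nat=>real" and a d0 :: real
 assumes \<phi>: "cts \<phi>" and \<gamma>: "\<gamma> > 0"
  and E: "!!k. finite (E k)" "!!k. E k~={}" "!!k. separated f (t k) \<gamma> (E k)"
  and t: "!!k. 0<=t k" "filterlim t at_top sequentially"
  and a: "!!k. a * t k-d0<=ln (SUM x:E k. exp (birk \<phi> x (t k)))"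
  and w: "!!k x. w k x = exp (birk \<phi> x (t k))/(SUM x:E k. exp (birk \<phi> x (t k)))"
  and N: "!!k. N k = nat \<lceil>t k\<rceil>+1"
 obtains \<mu> G where "G<=sequentially" "G~=bot" "invariant_measure f \<mu>"
  "!!g :: 'a=>real. cts g ==> ((%k. SUM x:E k. w k x * avg g (N k) x) \<longlongrightarrow> integral\<^sup>L \<mu> g) G"
  "ereal a<=free_energy f \<phi> \<mu>"
proof -
 define W where "W k = (SUM x:E k. exp (birk \<phi> x (t k)))" for k
 have W0: "W k > 0" for k unfolding W_def using E by (intro sum_pos) auto
 have wW: "w k x = exp (birk \<phi> x (t k))/W k" for k x by (simp add: w W_def)
 have w0: "0 < w k x" for k x using W0[of k] by (simp add: wW)
 have w1: "(SUM x:E k. w k x) = 1" for k unfolding wW sum_divide_distrib[symmetric] W_def[symmetric] using W0[of k] by simp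
 have N1: "N k>=1" for k by (simp add: N)
 have Nt: "t k<=N k" "N k<=t k+2" for k using t(1)[of k] by (auto simp: N) linarith+
 define L where "L k g = (SUM x:E k. w k x * avg g (N k) x)" for k and g :: "'a=>real"
 have st: "state_on (L k)" for k unfolding state_on_def
 proof (intro conjI allI impI)
  fix g h :: "'a=>real" and c :: real assume g: "cts g"
  show "L k (%x. c * g x) = c * L k g" by (simp add: L_def avg_linear(2)[OF g g] sum_distrib_left mult.left_commute)
  show "0<=L k g" if "ALL x. 0<=g x" unfolding L_def using w0 avg_nonneg[OF g] that by (intro sum_nonneg mult_nonneg_nonneg) (auto intro: less_imp_le)
  assume h: "cts h"
  show "L k (%x. g x+h x) = L k g+L k h" by (simp add: L_def avg_linear(1)[OF g h] sum.distrib distrib_left)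
 next
  show "L k (%_. 1) = 1" using w1[of k] N1[of k] by (simp add: L_def avg_def birkhoff_int_def)
 qed
 obtain G \<Lambda> where G: "G<=sequentially" "G~=bot" and \<Lambda>: "state_on \<Lambda>"
  and lim: "!!g. cts g ==> ((%k. L k g) \<longlongrightarrow> \<Lambda> g) G" by (rule state_cluster[where L = L,OF comp st]) blast
 obtain \<mu> where \<mu>: "sets \<mu> = sets borel" "prob_space \<mu>"
  and \<mu>\<Lambda>: "!!g. cts g ==> integral\<^sup>L \<mu> g = \<Lambda> g" by (rule riesz_representation[OF comp \<Lambda>]) blast
 have lim\<mu>: "((%k. L k g) \<longlongrightarrow> integral\<^sup>L \<mu> g) G" if "cts g" for g :: "'a=>real"
  using lim[OF that] \<mu>\<Lambda>[OF that] by simp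
 have Nlim: "filterlim (%k. real (N k)) at_top sequentially" by (rule filterlim_at_top_mono[OF t(2)]) (use Nt in auto)
 have cN: "(%k. z/real (N k)) \<longlonglongrightarrow> 0" for z :: real by (rule tendsto_divide_0[OF tendsto_const filterlim_at_top_imp_at_infinity[OF Nlim]])
 have inv: "invariant_measure f \<mu>"
 proof (rule invariant_measureI[OF \<mu>])
  fix g :: "'a=>real" and r assume g: "cts g"
  have cg: "cts (%x. g (f r x))" by (rule continuous_flow_fun[OF g])
  from bounded_fun[OF g] obtain B where B: "B > 0" "!!x. \<bar>g x\<bar><=B" by blast
  have "\<bar>L k (%x. g (f r x))-L k g\<bar><=2 * B * \<bar>r\<bar>/N k" for k
  proof -
   have "avg (%x. g (f r x)) n x = avg g n (f r x)" for n x by (simp add: avg_def birkhoff_int_def f_commute[of _ r])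
   hence "L k (%x. g (f r x))-L k g = (SUM x:E k. w k x * (avg g (N k) (f r x)-avg g (N k) x))" by (simp add: L_def right_diff_distrib sum_subtractf)
   also have "\<bar>\<dots>\<bar><=(SUM x:E k. \<bar>w k x * (avg g (N k) (f r x)-avg g (N k) x)\<bar>)" by (rule sum_abs)
   also have "\<dots><=(SUM x:E k. w k x * (2 * B * \<bar>r\<bar>/N k))"
   proof (rule sum_mono)
    fix x
    have "\<bar>avg g (N k) (f r x)-avg g (N k) x\<bar><=2 * B * \<bar>r\<bar>/N k" using birkhoff_flow_close[OF g B(2),of "real (N k)" r x]
     by (simp add: avg_def diff_divide_distrib[symmetric] abs_divide divide_right_mono)
    thus "\<bar>w k x * (avg g (N k) (f r x)-avg g (N k) x)\<bar><=w k x * (2 * B * \<bar>r\<bar>/N k)"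
     unfolding abs_mult using w0[of k x] by (simp only: abs_of_pos) (intro mult_left_mono, auto)
   qed
   also have "\<dots> = 2 * B * \<bar>r\<bar>/N k" unfolding sum_distrib_right[symmetric] w1 by simp
   finally show ?thesis .
  qed
  hence "(%k. L k (%x. g (f r x))-L k g) \<longlonglongrightarrow> 0"
   by (intro Lim_null_comparison[OF _ cN[of "2 * B * \<bar>r\<bar>"]]) (auto intro: always_eventually)
  hence "((%k. L k (%x. g (f r x))-L k g) \<longlongrightarrow> 0) G" by (rule tendsto_mono[OF G(1)])
  moreover have "((%k. L k (%x. g (f r x))-L k g) \<longlongrightarrow> integral\<^sup>L \<mu> (%x. g (f r x))-integral\<^sup>L \<mu> g) G"
   by (intro tendsto_diff lim\<mu> g cg)
  ultimately show "integral\<^sup>L \<mu> (%x. g (f r x)) = integral\<^sup>L \<mu> g" using tendsto_unique[OF G(2)] by fastforce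
 qed
 interpret compact_inv_flow f \<mu> by (rule compact_inv_flowI[OF inv])
 obtain c :: "'a=>nat" where c: "simple_function \<mu> c" "!!i. cont_set \<mu> (c -` {i})"
  "!!x y s. c x = c y ==> \<bar>s\<bar><=1 ==> dist (f s x) (f s y)<=\<gamma>"
  by (rule null_boundary_partition[OF inv \<gamma>]) blast
 have cfin: "finite (range c)" and cb: "!!v. c -` {v}\<in>sets borel" using simple_functionD[OF c(1)] by auto
 from bounded_fun[OF \<phi>] obtain B where B: "B > 0" "!!x. \<bar>\<phi> x\<bar><=B" by blast
 have key: "a-integral\<^sup>L \<mu> \<phi><=ent \<mu> (nm f c (times q))/q" if q: "q>=1" for q
 proof -
  let ?Q = "nm f c (times q)"
  define V where "V = range ?Q"
  have sQ: "simple_function \<mu> ?Q" by (rule simple_nm[OF c(1)])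
  have Vfin: "finite V" using simple_functionD(1)[OF sQ] by (simp add: V_def)
  have Qb: "?Q -` {v}\<in>sets borel" for v using simple_functionD(2)[OF sQ,of "{v}"] by simp
  have Qc: "cont_set \<mu> (?Q -` {v})" for v
  proof -
   have "?Q -` {v} = (if length v = q then (\<Inter>i\<in>{..<q}. f (real i) -` (c -` {v ! i})) else {})" by (rule nm_vimage)
   moreover have "cont_set \<mu> {}" unfolding cont_set_def by (intro exI[of _ "{}"]) auto
   ultimately show ?thesis using cont_set_INT[OF \<mu>(2,1),of "{..<q}" "%i. f (real i) -` (c -` {v ! i})"] cont_set_flow[OF inv c(2)] by simp
  qed
  define m where "m v k = (SUM x:E k. w k x * integral {0..real (N k)} (%s. ind (?Q -` {v}) (f s x)))/N k" for v k
  have mi: "(%s. ind (?Q -` {v}) (f s x) :: real) integrable_on {0..real n}" for v x n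
  proof (rule bounded_borel_integrable[of _ 1])
   have [measurable]: "(%s. f s x)\<in>borel_measurable borel" by (rule borel_measurable_continuous_onI[OF f_orbit_continuous])
   note Qb[measurable]
   show "(%s. ind (?Q -` {v}) (f s x) :: real)\<in>borel_measurable borel" by measurable
  qed (auto simp: indicator_def)
  have mL: "m v k = (SUM x:E k. w k x * (integral {0..real (N k)} (%s. ind (?Q -` {v}) (f s x))/N k))" for v k by (simp add: m_def sum_divide_distrib)
  have m_lim: "(m v \<longlongrightarrow> measure \<mu> (?Q -` {v})) G" for v
  proof (rule portmanteau[OF \<mu> lim\<mu> Qc Qb])
   fix g :: "'a=>real" and k assume g: "cts g"
   {
    assume "!!x. ind (?Q -` {v}) x<=g x"
    hence "integral {0..real (N k)} (%s. ind (?Q -` {v}) (f s x))<=birk g x (N k)" for x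
     unfolding birkhoff_int_def by (intro integral_le mi birkhoff_integrable[OF g]) auto
    thus "m v k<=L k g" unfolding mL L_def avg_def using w0[of k] N1[of k] by (intro sum_mono mult_left_mono divide_right_mono) (auto intro: less_imp_le)
   next
    assume "!!x. g x<=ind (?Q -` {v}) x"
    hence "birk g x (N k)<=integral {0..real (N k)} (%s. ind (?Q -` {v}) (f s x))" for x
     unfolding birkhoff_int_def by (intro integral_le mi birkhoff_integrable[OF g]) auto
    thus "L k g<=m v k" unfolding mL L_def avg_def using w0[of k] N1[of k] by (intro sum_mono mult_left_mono divide_right_mono) (auto intro: less_imp_le)
   }
  qed
  have m01: "m v k\<in>{0..1}" for v k
  proof -
   have "0<=integral {0..real (N k)} (%s. ind (?Q -` {v}) (f s x) :: real)" for x by (rule Henstock_Kurzweil_Integration.integral_nonneg[OF mi]) auto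
   moreover have "integral {0..real (N k)} (%s. ind (?Q -` {v}) (f s x) :: real)<=integral {0..real (N k)} (%s. 1)" for x
    by (rule integral_le[OF mi]) (auto simp: indicator_def)
   ultimately have I: "0<=integral {0..real (N k)} (%s. ind (?Q -` {v}) (f s x))/N k"
    "integral {0..real (N k)} (%s. ind (?Q -` {v}) (f s x))/N k<=(1::real)" for x using N1[of k] by (auto simp: divide_le_eq)
   have "0<=m v k" unfolding mL by (intro sum_nonneg mult_nonneg_nonneg less_imp_le[OF w0] I)
   moreover have "m v k<=(SUM x:E k. w k x * 1)" unfolding mL by (intro sum_mono mult_left_mono less_imp_le[OF w0] I)
   ultimately show ?thesis using w1[of k] by simp
  qed
  have pl_lim: "((%k. plogp (m v k)) \<longlongrightarrow> plogp (measure \<mu> (?Q -` {v}))) G" for v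
  proof (rule continuous_on_tendsto_compose[OF plogp_continuous m_lim])
   show "measure \<mu> (?Q -` {v})\<in>{0..1}" by simp
   show "\<forall>\<^sub>F k in G. m v k\<in>{0..1}" using m01 by (intro always_eventually allI)
  qed
  have S_lim: "((%k. SUM v:V. - plogp (m v k)) \<longlongrightarrow> ent \<mu> ?Q) G"
  proof -
   have "((%k. SUM v:V. - plogp (m v k)) \<longlongrightarrow> (SUM v:V. - plogp (measure \<mu> (?Q -` {v})))) G"
    by (intro tendsto_sum tendsto_minus pl_lim)
   also have "(SUM v:V. - plogp (measure \<mu> (?Q -` {v}))) = ent \<mu> ?Q" by (simp add: ent_def V_def sum_negf)
   finally show ?thesis .
  qed
  have fin: "q * (a * (t k/N k)-L k \<phi> - (2 * B+d0)/N k)<=(SUM v:V. - plogp (m v k))+real q * real q * ln (card (range c))/N k" for k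
  proof -
   \<comment> \<open>For exponential weights the entropy of \<open>w k\<close> is
     \<open>ln (W k)\<close> minus the mean Birkhoff integral, so the free energy appears without
     loss.\<close>
   have pw: "- plogp (w k x) = w k x * ln (W k)-w k x * birk \<phi> x (t k)" for x
   proof -
    have "ln (w k x) = birk \<phi> x (t k)-ln (W k)" unfolding wW using W0[of k] by (simp add: ln_div)
    hence "w k x * ln (w k x) = w k x * (birk \<phi> x (t k)-ln (W k))" by simp
    thus ?thesis using w0[of k x] by (simp add: plogp_def right_diff_distrib)
   qed
   have bt: "birk \<phi> x (t k)<=N k * avg \<phi> (N k) x+2 * B" for x
   proof -
    have "birk \<phi> x (t k+(N k-t k)) = birk \<phi> x (t k)+birk \<phi> (f (t k) x) (N k-t k)" by (rule birkhoff_add[OF \<phi>]) (use t(1) Nt in auto)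
    moreover have "\<bar>birk \<phi> (f (t k) x) (N k-t k)\<bar><=B * (N k-t k)" by (rule birkhoff_abs_le[OF \<phi> B(2)]) (use Nt in auto)
    moreover have "B * (N k-t k)<=B * 2" using B Nt[of k] by (intro mult_left_mono) auto
    moreover have "N k * avg \<phi> (N k) x = birk \<phi> x (N k)" using N1[of k] by (simp add: avg_def)
    ultimately show ?thesis by simp
   qed
   have "a * t k-N k * L k \<phi> - (2 * B+d0)<=(SUM x:E k. - plogp (w k x))"
   proof -
    have "(SUM x:E k. w k x * birk \<phi> x (t k))<=(SUM x:E k. w k x * (N k * avg \<phi> (N k) x+2 * B))"
     using bt w0[of k] by (intro sum_mono mult_left_mono) (auto intro: less_imp_le)
    also have "\<dots> = (SUM x:E k. w k x * (N k * avg \<phi> (N k) x))+(SUM x:E k. w k x)*(2 * B)"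
     by (simp only: distrib_left sum.distrib sum_distrib_right)
    also have "\<dots> = N k * L k \<phi>+2 * B" unfolding w1 by (simp add: L_def sum_distrib_left mult.left_commute)
    finally have "(SUM x:E k. w k x * birk \<phi> x (t k))<=N k * L k \<phi>+2 * B" .
    moreover have "(SUM x:E k. - plogp (w k x)) = ln (W k)-(SUM x:E k. w k x * birk \<phi> x (t k))"
     unfolding pw sum_subtractf sum_distrib_right[symmetric] w1 by simp
    ultimately show ?thesis using a[of k] by (simp add: W_def)
   qed
   hence "q * (a * t k-N k * L k \<phi> - (2 * B+d0))<=q * (SUM x:E k. - plogp (w k x))" by (intro mult_left_mono) auto
   also have "\<dots><=N k * (SUM v:V. - plogp (m v k))+real q * real q * ln (card (range c))" unfolding m_def
    by (rule ent_point_names[OF E(1,2,3) t(1) cfin cb c(3) _ w1 N V_def]) (use w0 in \<open>auto intro: less_imp_le\<close>)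
   finally have "q * (a * t k-N k * L k \<phi> - (2 * B+d0))/N k<=(N k * (SUM v:V. - plogp (m v k))+real q * real q * ln (card (range c)))/N k"
    by (rule divide_right_mono) simp
   thus ?thesis using N1[of k] by (simp add: add_divide_distrib diff_divide_distrib right_diff_distrib distrib_left)
  qed
  have "(%k. (t k-N k)/N k) \<longlonglongrightarrow> 0"
  proof (rule Lim_null_comparison[OF _ cN[of 2]])
   show "\<forall>\<^sub>F k in sequentially. norm ((t k-N k)/N k)<=2/N k"
   proof (intro always_eventually allI)
    fix k
    have "\<bar>t k-N k\<bar><=2" using Nt[of k] by linarith
    thus "norm ((t k-N k)/N k)<=2/N k" by (simp add: abs_divide divide_right_mono)
   qed
  qed
  hence "(%k. (t k-N k)/N k+1) \<longlonglongrightarrow> 0+1" by (intro tendsto_intros)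
  moreover have "(t k-N k)/N k+1 = t k/N k" for k using N1[of k] by (simp add: diff_divide_distrib)
  ultimately have "(%k. t k/N k) \<longlonglongrightarrow> 1" by simp
  note tG = tendsto_mono[OF G(1) this] and cG = tendsto_mono[OF G(1) cN]
  have l1: "((%k. q * (a * (t k/N k)-L k \<phi> - (2 * B+d0)/N k)) \<longlongrightarrow> q * (a * 1-integral\<^sup>L \<mu> \<phi> - 0)) G"
   by (intro tendsto_intros tG lim\<mu>[OF \<phi>] cG)
  have l2: "((%k. (SUM v:V. - plogp (m v k))+real q * real q * ln (card (range c))/N k) \<longlongrightarrow> ent \<mu> ?Q+0) G"
   by (intro tendsto_add S_lim cG)
  have "q * (a * 1-integral\<^sup>L \<mu> \<phi> - 0)<=ent \<mu> ?Q+0" by (rule tendsto_le[OF G(2) l2 l1]) (intro always_eventually allI fin)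
  thus ?thesis using q by (simp add: field_simps)
 qed
 have "a-integral\<^sup>L \<mu> \<phi><=hrate f \<mu> c" unfolding hrate_def by (rule cINF_greatest) (use key in auto)
 hence "ereal (a-integral\<^sup>L \<mu> \<phi>)<=ks_entropy f \<mu>" using hrate_le_ks[OF c(1)] order_trans by (metis ereal_less_eq(3))
 hence "ereal a<=free_energy f \<phi> \<mu>" unfolding free_energy_def by (cases "ks_entropy f \<mu>") auto
 with G inv lim\<mu> show thesis by (intro that) (auto simp: L_def)
qed

end


section \<open>Almost expansive measures\<close>

context compact_inv_flow
begin

text \<open>The relatively independent self-joining over a finite partition, as a functional.\<close>
definition self_join :: "('a=>'b)=>('a\<times>'a=>real)=>real" where
 "self_join a g = (SUM v:range a. (LINT x|\<mu>. ind (a -` {v}) x * (LINT y|\<mu>. ind (a -` {v}) y * g (x,y)))/prob (a -` {v}))"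

lemma section_integrable:
 fixes g :: "'a\<times>'a=>real"
 assumes g: "cts g" and A: "A\<in>sets borel"
 shows "integrable \<mu> (%y. ind A y * g (x,y))"
proof -
 have "cts (%y. g (x,y))" by (rule continuous_on_compose2[OF g]) (auto intro!: continuous_intros)
 thus ?thesis using integrable_mult_indicator[OF _ integrable_continuous,of A "%y. g (x,y)"] A by simp
qed

lemma section_integral_continuous:
 fixes g :: "'a\<times>'a=>real"
 assumes g: "cts g" and A: "A\<in>sets borel"
 shows "cts (%x. (LINT y|\<mu>. ind A y * g (x,y)))" unfolding continuous_on_iff
proof (intro ballI allI impI)
 fix x :: 'a and e :: real assume e: "e > 0"
 have "compact (UNIV :: ('a\<times>'a) set)" using compact_Times[OF comp comp] by simp
 from compact_uniformly_continuous[OF g this] obtain d where d: "d > 0" "!!p q. dist q p < d ==> dist (g q) (g p) < e/2"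
  using e unfolding uniformly_continuous_on_def by (metis UNIV_I half_gt_zero)
 show "EX d>0. ALL x':UNIV. dist x' x < d --> dist (LINT y|\<mu>. ind A y * g (x',y)) (LINT y|\<mu>. ind A y * g (x,y)) < e"
 proof (intro exI[of _ d] conjI ballI impI d(1))
  fix x' assume x': "dist x' x < d"
  have pt: "\<bar>ind A y * g (x',y)-ind A y * g (x,y)\<bar><=e/2" for y
  proof -
   have "dist (x',y) (x,y) < d" using x' by (simp add: dist_Pair_Pair)
   hence "\<bar>g (x',y)-g (x,y)\<bar><=e/2" using d(2) by (fastforce simp: dist_real_def)
   thus ?thesis using e by (auto simp: indicator_def)
  qed
  have "\<bar>(LINT y|\<mu>. ind A y * g (x',y))-(LINT y|\<mu>. ind A y * g (x,y))\<bar>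
   = \<bar>(LINT y|\<mu>. ind A y * g (x',y)-ind A y * g (x,y))\<bar>" using section_integrable[OF g A] by simp
  also have "\<dots><=(LINT y|\<mu>. e/2)" using pt e by (intro integral_abs_bound[THEN order_trans] integral_mono') auto
  finally show "dist (LINT y|\<mu>. ind A y * g (x',y)) (LINT y|\<mu>. ind A y * g (x,y)) < e" using e by (simp add: dist_real_def)
 qed
qed

lemma double_integrable:
 fixes g :: "'a\<times>'a=>real"
 assumes g: "cts g" and A: "A\<in>sets borel"
 shows "integrable \<mu> (%x. ind A x * (LINT y|\<mu>. ind A y * g (x,y)))"
 using integrable_mult_indicator[OF _ integrable_continuous[OF section_integral_continuous[OF assms]],of A] A by simp

lemma self_join_const_sum:
 assumes a: "simple a"
 shows "(SUM v:range a. prob (a -` {v}) * prob (a -` {v})/prob (a -` {v})) = 1"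
proof -
 have "(SUM v:range a. prob (a -` {v}) * prob (a -` {v})/prob (a -` {v})) = (SUM v:range a. pr a v)" by (intro sum.cong refl) auto
 thus ?thesis using pr_sum[OF a,of "range a"] simple_functionD(1)[OF a] by simp
qed

lemma self_join_state:
 assumes a: "simple a"
 shows "state_on (self_join a)" unfolding state_on_def
proof (intro conjI allI impI)
 have ab: "a -` {v}\<in>sets borel" for v using simple_functionD(2)[OF a,of "{v}"] by simp
 fix g h :: "'a\<times>'a=>real" and c :: real assume g: "cts g"
 show "self_join a (%x. c * g x) = c * self_join a g" by (simp add: self_join_def sum_distrib_left mult.left_commute[of _ c])
 show "0<=self_join a g" if "ALL x. 0<=g x" unfolding self_join_def using that
  by (intro sum_nonneg divide_nonneg_nonneg Bochner_Integration.integral_nonneg mult_nonneg_nonneg) auto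
 assume h: "cts h"
 have "(LINT x|\<mu>. ind (a -` {v}) x * (LINT y|\<mu>. ind (a -` {v}) y * (g (x,y)+h (x,y))))
  = (LINT x|\<mu>. ind (a -` {v}) x * (LINT y|\<mu>. ind (a -` {v}) y * g (x,y)))
  + (LINT x|\<mu>. ind (a -` {v}) x * (LINT y|\<mu>. ind (a -` {v}) y * h (x,y)))" for v
  using section_integrable[OF g ab] section_integrable[OF h ab] double_integrable[OF g ab] double_integrable[OF h ab] by (simp add: distrib_left)
 thus "self_join a (%x. g x+h x) = self_join a g+self_join a h" by (simp add: self_join_def add_divide_distrib sum.distrib)
next
 have ab: "a -` {v}\<in>sets borel" for v using simple_functionD(2)[OF a,of "{v}"] by simp
 show "self_join a (%_. 1) = 1" using self_join_const_sum[OF a] ab by (simp add: self_join_def)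
qed

text \<open>Carries null sets of \<open>\<mu>\<close>, in particular the non-expansive points, over
  to limits of self-joinings.\<close>

lemma self_join_fst:
 assumes a: "simple a" and g: "cts g"
 shows "self_join a (%p. g (fst p)) = (LINT x|\<mu>. g x)"
proof -
 have fin: "finite (range a)" using simple_functionD(1)[OF a] by simp
 have ab: "a -` {v}\<in>sets borel" for v using simple_functionD(2)[OF a,of "{v}"] by simp
 have intA: "integrable \<mu> (%x. ind (a -` {v}) x * g x)" for v using integrable_mult_indicator[OF _ integrable_continuous[OF g],of "a -` {v}"] ab by simp
 have "self_join a (%p. g (fst p)) = (SUM v:range a. (LINT x|\<mu>. ind (a -` {v}) x * g x))" unfolding self_join_def
 proof (rule sum.cong[OF refl])
  fix v
  have "(LINT x|\<mu>. ind (a -` {v}) x * (LINT y|\<mu>. ind (a -` {v}) y * g (fst (x,y))))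
   = (LINT x|\<mu>. ind (a -` {v}) x * g x * prob (a -` {v}))" using ab by (simp add: mult.assoc mult.commute[of "g _"])
  also have "\<dots> = (LINT x|\<mu>. ind (a -` {v}) x * g x) * prob (a -` {v})" by simp
  finally have e: "(LINT x|\<mu>. ind (a -` {v}) x * (LINT y|\<mu>. ind (a -` {v}) y * g (fst (x,y))))
   = (LINT x|\<mu>. ind (a -` {v}) x * g x) * prob (a -` {v})" .
  show "(LINT x|\<mu>. ind (a -` {v}) x * (LINT y|\<mu>. ind (a -` {v}) y * g (fst (x,y))))/prob (a -` {v})
   = (LINT x|\<mu>. ind (a -` {v}) x * g x)"
  \<comment> \<open>On a null cell the quotient is 0 by the convention for division, and the
    integral over the cell vanishes too.\<close>
  proof (cases "prob (a -` {v}) = 0")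
   case True
   hence "AE x in \<mu>. x\<notin>a -` {v}" using ab by (intro AE_not_in) (auto simp: null_sets_def emeasure_eq_measure)
   hence "(LINT x|\<mu>. ind (a -` {v}) x * g x) = 0" by (intro integral_eq_zero_AE) (auto elim!: eventually_mono)
   thus ?thesis using True by simp
  next
   case False
   thus ?thesis unfolding e by simp
  qed
 qed
 also have "\<dots> = (LINT x|\<mu>. (SUM v:range a. ind (a -` {v}) x * g x))" by (rule Bochner_Integration.integral_sum[symmetric]) (rule intA)
 also have "\<dots> = (LINT x|\<mu>. g x)"
 proof (rule Bochner_Integration.integral_cong[OF refl])
  fix x
  have "(SUM v:range a. ind (a -` {v}) x * g x) = (SUM v:{a x}. ind (a -` {v}) x * g x)"
   by (rule sum.mono_neutral_right) (use fin in \<open>auto simp: indicator_def\<close>)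
  thus "(SUM v:range a. ind (a -` {v}) x * g x) = g x" by simp
 qed
 finally show ?thesis .
qed

text \<open>Nearly all mass sits at the value \<open>None\<close>. As \<open>plogp\<close> vanishes
  at 0 and 1 and is uniformly continuous, each of the \<open>n\<close> terms is at most
  \<open>\<kappa>/n\<close>.\<close>

lemma small_entropy:
 assumes "\<kappa> > 0"
 obtains \<rho> where "\<rho> > 0" "!!b :: 'a=>'c option. simple b ==> finite V ==> range b\<subseteq>insert None (Some ` V) ==>
  (!!v. v\<in>V ==> prob (b -` {Some v})<=\<rho>) ==> ent \<mu> b<=\<kappa>"
proof -
 define n where "n = real (card V)+1"
 have n: "n>=1" by (simp add: n_def)
 have "\<kappa>/n > 0" using assms n by simp
 from plogp_uniform[OF this] obtain d where d: "d > 0"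
  "!!u v. u\<in>{0..1} ==> v\<in>{0..1} ==> \<bar>u-v\<bar> < d ==> \<bar>plogp u-plogp v\<bar> < \<kappa>/n" by blast
 show thesis
 proof (rule that[of "d/(2 * n)"])
  show "d/(2 * n) > 0" using d n by simp
  fix b :: "'a=>'c option" assume b: "simple b" and V: "finite V" "range b\<subseteq>insert None (Some ` V)"
   and small: "!!v. v\<in>V ==> prob (b -` {Some v})<=d/(2 * n)"
  have dn: "d/(2 * n) < d" using d n by (simp add: divide_less_eq)
  have f2: "finite (insert None (Some ` V))" using V by simp
  have pS: "- plogp (prob (b -` {Some v}))<=\<kappa>/n" if "v\<in>V" for v using d(2)[of "prob (b -` {Some v})" 0] small[OF that] dn by simp
  have "(SUM u:insert None (Some ` V). pr b u) = 1" by (rule pr_sum[OF b f2]) (use V in simp)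
  hence "prob (b -` {None})+(SUM v:V. prob (b -` {Some v})) = 1" using V by (simp add: sum.reindex)
  moreover have "(SUM v:V. prob (b -` {Some v}))<=(SUM v:V. d/(2 * n))" by (rule sum_mono) (rule small)
  moreover have "(SUM v:V. d/(2 * n)) < d"
  proof -
   have "(SUM v:V. d/(2 * n)) = real (card V) * d/(2 * n)" by simp
   also have "\<dots><=n * d/(2 * n)" using d n by (intro divide_right_mono mult_right_mono) (auto simp: n_def)
   also have "\<dots> < d" using d n by simp
   finally show ?thesis .
  qed
  ultimately have "\<bar>prob (b -` {None})-1\<bar> < d" using prob_le_1[of "b -` {None}"] by linarith
  hence pN: "- plogp (prob (b -` {None}))<=\<kappa>/n" using d(2)[of "prob (b -` {None})" 1] by simp
  have "ent \<mu> b = - (SUM u:insert None (Some ` V). plogp (pr b u))" by (rule ent_superset[OF f2]) (use V in simp)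
  also have "\<dots> = - plogp (prob (b -` {None}))+(SUM v:V. - plogp (prob (b -` {Some v})))" using V by (simp add: sum.reindex sum_negf)
  also have "\<dots><=\<kappa>/n+(SUM v:V. \<kappa>/n)" by (intro add_mono sum_mono pN pS)
  also have "\<dots> = \<kappa>/n * n" using n_def by (simp add: distrib_left)
  also have "\<dots> = \<kappa>" using n by simp
  finally show "ent \<mu> b<=\<kappa>" .
 qed
qed

lemma ent_nm_le_mult:
 fixes c :: "'a=>'b"
 assumes "simple c" shows "ent \<mu> (nm f c ts)<=length ts * ent \<mu> c"
proof (induction ts)
 case Nil
 have "nm f c [] = (%_. [])" by (auto simp: nm_def)
 thus ?case using ent_const[of "[] :: 'b list"] by simp
next
 case (Cons t ts)
 have "ent \<mu> (nm f c ([t] @ ts))<=ent \<mu> (nm f c [t])+ent \<mu> (nm f c ts)" by (rule ent_nm_append[OF assms])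
 moreover have "ent \<mu> (nm f c [t]) = ent \<mu> (%x. c (f t x))"
  by (rule ent_cong_determined) (auto simp: nm_def intro!: simple_nm simple_flow assms simple_function_map)
 moreover have "\<dots> = ent \<mu> c" by (rule ent_flow[OF assms])
 ultimately show ?case using Cons by (simp add: algebra_simps)
qed

end


context compact_inv_flow
begin

text \<open>An average over the first coordinate is at most its maximum, attained at some
  \<open>p v\<close> by compactness. This turns a joining into one representative point per
  cell.\<close>

lemma self_join_le_section_max:
 fixes g :: "'a\<times>'a=>real"
 assumes a: "simple a" and g: "cts g" "!!z. 0<=g z"
 obtains p where "self_join a g<=(SUM v:range a. (LINT y|\<mu>. ind (a -` {v}) y * g (p v,y)))"
proof -
 have ab: "a -` {v}\<in>sets borel" for v using simple_functionD(2)[OF a,of "{v}"] by simp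
 define H where "H v x = (LINT y|\<mu>. ind (a -` {v}) y * g (x,y))" for v x
 have "EX x. ALL y. H v y<=H v x" for v using continuous_attains_sup[OF comp _ section_integral_continuous[OF g(1) ab[of v]]] by (auto simp: H_def)
 then obtain p where p: "!!v y. H v y<=H v (p v)" by metis
 show thesis
 proof (rule that[of p])
  have "(LINT x|\<mu>. ind (a -` {v}) x * H v x)/prob (a -` {v})<=H v (p v)" for v
  proof -
   have "(LINT x|\<mu>. ind (a -` {v}) x * H v x)<=(LINT x|\<mu>. ind (a -` {v}) x * H v (p v))"
    using p by (intro integral_mono double_integrable[OF g(1) ab,folded H_def])
     (auto intro!: mult_left_mono integrable_mult_left integrable_real_indicator simp: ab emeasure_eq_measure)
   also have "\<dots> = prob (a -` {v}) * H v (p v)" using ab by simp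
   finally have "(LINT x|\<mu>. ind (a -` {v}) x * H v x)<=prob (a -` {v}) * H v (p v)" .
   moreover have "0<=H v (p v)" unfolding H_def by (intro Bochner_Integration.integral_nonneg mult_nonneg_nonneg g) auto
   ultimately show ?thesis by (cases "prob (a -` {v}) = 0") (auto simp: divide_le_eq mult.commute less_le)
  qed
  thus "self_join a g<=(SUM v:range a. (LINT y|\<mu>. ind (a -` {v}) y * g (p v,y)))" unfolding self_join_def H_def[symmetric] by (intro sum_mono)
 qed
qed

lemma section_max_le_prob:
 fixes g :: "'a\<times>'a=>real"
 assumes a: "simple a" and V: "open V"
  and g: "cts g" "!!z. 0<=g z" "!!z. g z<=1" "!!z. z\<notin>V ==> g z = 0"
 shows "(SUM v:range a. (LINT y|\<mu>. ind (a -` {v}) y * g (p v,y)))<=prob {y. (p (a y),y)\<in>V}"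
  and "{y. (p (a y),y)\<in>V}\<in>sets borel"
proof -
 have fin: "finite (range a)" using simple_functionD(1)[OF a] by simp
 have ab: "a -` {v}\<in>sets borel" for v using simple_functionD(2)[OF a,of "{v}"] by simp
 have sec: "{y. (p v,y)\<in>V}\<in>sets borel" for v
 proof -
  have "open (Pair (p v) -` V)" by (rule open_vimage[OF V]) (auto intro!: continuous_intros)
  thus ?thesis by (simp add: vimage_def)
 qed
 have eq: "{y. (p (a y),y)\<in>V} = (\<Union>v\<in>range a. a -` {v}\<inter>{y. (p v,y)\<in>V})" by auto
 thus "{y. (p (a y),y)\<in>V}\<in>sets borel" using fin ab sec by (auto intro!: sets.finite_UN simp del: UN_simps)
 have "(SUM v:range a. (LINT y|\<mu>. ind (a -` {v}) y * g (p v,y)))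
  <= (SUM v:range a. prob (a -` {v}\<inter>{y. (p v,y)\<in>V}))"
 proof (rule sum_mono)
  fix v
  have "(LINT y|\<mu>. ind (a -` {v}) y * g (p v,y))<=(LINT y|\<mu>. ind (a -` {v}\<inter>{y. (p v,y)\<in>V}) y)"
   by (rule integral_mono[OF section_integrable[OF g(1) ab]], rule integrable_real_indicator)
    (use ab sec g in \<open>auto simp: emeasure_eq_measure indicator_def\<close>)
  thus "(LINT y|\<mu>. ind (a -` {v}) y * g (p v,y))<=prob (a -` {v}\<inter>{y. (p v,y)\<in>V})" using ab sec by simp
 qed
 also have "\<dots> = prob {y. (p (a y),y)\<in>V}"
  unfolding eq by (rule finite_measure_finite_Union[symmetric]) (use fin ab sec in \<open>auto simp: disjoint_family_on_def\<close>)
 finally show "(SUM v:range a. (LINT y|\<mu>. ind (a -` {v}) y * g (p v,y)))<=prob {y. (p (a y),y)\<in>V}" .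
qed

definition window :: "nat=>nat=>real list" where
 "window T N = map (%k. T * (real k-real N)) [0..<2 * N+1]"

lemma window_names_close:
 assumes T: "T>=1" and \<alpha>: "!!x y s. \<alpha> x = \<alpha> y ==> 0<=s ==> s<=real T ==> dist (f s x) (f s y)<=\<epsilon>"
  and eq: "nm f \<alpha> (window T N) x = nm f \<alpha> (window T N) y" and s: "\<bar>s\<bar><=N"
 shows "dist (f s x) (f s y)<=\<epsilon>"
proof -
 \<comment> \<open>The sampling interval containing \<open>s\<close>, counted from the left end of
   the window.\<close>
 define k where "k = nat (\<lfloor>s/T\<rfloor>+int N)"
 have "\<bar>s\<bar>/T<=\<bar>s\<bar>/1" using T by (intro divide_left_mono) auto
 hence "\<bar>s/T\<bar><=N" using s by (simp add: abs_divide)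
 hence fl: "- int N<=\<lfloor>s/T\<rfloor>" "\<lfloor>s/T\<rfloor><=int N" by linarith+
 hence k: "k < 2 * N+1" "real k-real N = real_of_int \<lfloor>s/T\<rfloor>" by (auto simp: k_def)
 define r where "r = s-T * (real k-real N)"
 have "real k-real N<=s/T" "s/T < real k-real N+1" unfolding k(2) by linarith+
 hence r: "0<=r" "r<=T" using T unfolding r_def by (auto simp: field_simps)
 have "\<alpha> (f (T * (real k-real N)) x) = \<alpha> (f (T * (real k-real N)) y)"
  using bspec[OF eq[unfolded nm_def window_def map_map map_eq_conv set_upt],of k] k(1) by simp
 from \<alpha>[OF this r] show ?thesis by (simp add: f_add[symmetric] r_def)
qed

text \<open>A limit of the self-joinings lives on pairs of points with close orbits, so almost expansiveness
 puts it on the flow relation.\<close>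
lemma names_near_orbit:
 assumes Z: "Z\<in>sets borel" "NE f \<epsilon>\<subseteq>Z" "measure \<mu> Z = 0"
  and T: "T>=1" and \<alpha>: "simple \<alpha>" "!!x y s. \<alpha> x = \<alpha> y ==> 0<=s ==> s<=real T ==> dist (f s x) (f s y)<=\<epsilon>"
  and "\<kappa> > 0"
 obtains n :: nat where "!!V :: ('a\<times>'a) set. open V ==> (!!x r. \<bar>r\<bar><=real n ==> (x,f r x)\<in>V) ==>
  EX N p. {y. (p (nm f \<alpha> (window T N) y),y)\<in>V}\<in>sets borel&1-\<kappa> < prob {y. (p (nm f \<alpha> (window T N) y),y)\<in>V}"
proof -
 let ?a = "%N. nm f \<alpha> (window T N)"
 note a = simple_nm[OF \<alpha>(1)]
 have comp2: "compact (UNIV :: ('a\<times>'a) set)" using compact_Times[OF comp comp] by simp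
 from state_cluster[OF comp2 self_join_state[OF a]] obtain G \<Lambda> where G: "G<=sequentially" "G~=bot" "state_on \<Lambda>"
  "!!g. cts g ==> ((%k. self_join (?a k) g) \<longlongrightarrow> \<Lambda> g) G" by blast
 from riesz_representation[OF comp2 G(3)] obtain \<Theta> where \<Theta>: "sets \<Theta> = sets borel" "prob_space \<Theta>"
  "!!g. cts g ==> integral\<^sup>L \<Theta> g = \<Lambda> g" by blast
 interpret \<Theta>: prob_space \<Theta> by fact
 have sp\<Theta>: "space \<Theta> = UNIV" using sets_eq_borel_space[OF \<Theta>(1)] .
 define R where "R N = {z :: 'a\<times>'a. ALL s:{- real N..real N}. dist (f s (fst z)) (f s (snd z))<=\<epsilon>}" for N :: nat
 have Rc: "closed (R N)" for N
 proof -
  have "R N = (\<Inter>s\<in>{- real N..real N}. {z. dist (f s (fst z)) (f s (snd z))<=\<epsilon>})" by (auto simp: R_def)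
  moreover have "closed {z. dist (f s (fst z)) (f s (snd z))<=\<epsilon>}" for s by (intro closed_Collect_le continuous_intros f_continuous_compose)
  ultimately show ?thesis by auto
 qed
 \<comment> \<open>A self-joining gives full weight to pairs with equal names, and for windows of
   radius at least \<open>N\<close> such pairs lie in the closed set \<open>R N\<close>; the limit
   inherits this.\<close>
 have R1: "measure \<Theta> (R N) = 1" for N
 proof -
  from closed_indicator_limit[OF Rc[of N]] obtain h where h: "!!n. cts (h n)" "!!n x. 0<=h n x" "!!n x. h n x<=(1::real)"
   "!!n x. ind (R N) x<=h n x" "!!x. (%n. h n x) \<longlonglongrightarrow> ind (R N) x" by blast
  have "integral\<^sup>L \<Theta> (h n) = 1" for n
  proof -
   have h1: "h n z = 1" if "z\<in>R N" for z using h(4)[of z n] h(3)[of n z] that by simp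
   have "self_join (?a k) (h n) = 1" if k: "k>=N" for k
   proof -
    have "self_join (?a k) (h n) = self_join (?a k) (%_. 1)"
    proof -
     have *: "ind (?a k -` {v}) x * (LINT y|\<mu>. ind (?a k -` {v}) y * h n (x,y))
      = ind (?a k -` {v}) x * (LINT y|\<mu>. ind (?a k -` {v}) y * 1)" for v x
     proof (cases "?a k x = v")
      case True
      have "ind (?a k -` {v}) y * h n (x,y) = ind (?a k -` {v}) y * 1" for y
      proof (cases "?a k y = v")
       case yv: True
       have eqv: "?a k x = ?a k y" using True yv by simp
       have "dist (f s x) (f s y)<=\<epsilon>" if "\<bar>s\<bar><=real k" for s by (rule window_names_close[OF T _ eqv that]) (rule \<alpha>(2))
       hence "(x,y)\<in>R N" unfolding R_def using k by auto
       thus ?thesis using h1 by simp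
      qed auto
      thus ?thesis by (simp only:)
     qed auto
     show ?thesis unfolding self_join_def * ..
    qed
    thus ?thesis using state_one[OF self_join_state[OF a]] by simp
   qed
   hence "\<forall>\<^sub>F k in G. self_join (?a k) (h n) = 1" by (intro filter_leD[OF G(1)] eventually_sequentiallyI[of N])
   hence "((%k. self_join (?a k) (h n)) \<longlongrightarrow> 1) G" by (rule tendsto_eventually)
   thus ?thesis using tendsto_unique[OF G(2) G(4)[OF h(1)]] \<Theta>(3)[OF h(1)] by simp
  qed
  hence "(%n. 1) \<longlonglongrightarrow> measure \<Theta> (R N)"
   using measure_closed_limit[OF \<Theta>(1) \<Theta>.finite_measure_axioms h(1,2,3,5)] Rc by (auto simp: borel_closed)
  thus ?thesis by (simp add: LIMSEQ_const_iff)
 qed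
 have fstm: "fst\<in>measurable \<Theta> \<mu>" by (subst measurable_cong_sets[OF \<Theta>(1) sets_eq]) (intro borel_measurable_continuous_onI continuous_intros)
 have "distr \<Theta> \<mu> fst = \<mu>"
 proof (rule finite_measure_eqI_continuous)
  show "finite_measure (distr \<Theta> \<mu> fst)" using \<Theta>.prob_space_distr[OF fstm] by (simp add: prob_space_def)
  fix g :: "'a=>real" assume g: "cts g"
  have g2: "cts (%z. g (fst z))" by (rule continuous_on_compose2[OF g]) (auto intro!: continuous_intros)
  have "((%k. self_join (?a k) (%z. g (fst z))) \<longlongrightarrow> integral\<^sup>L \<mu> g) G" using self_join_fst[OF a g] by simp
  hence "integral\<^sup>L \<Theta> (%z. g (fst z)) = integral\<^sup>L \<mu> g" using tendsto_unique[OF G(2) G(4)[OF g2]] \<Theta>(3)[OF g2] by simp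
  thus "integral\<^sup>L (distr \<Theta> \<mu> fst) g = integral\<^sup>L \<mu> g" by (simp add: integral_distr[OF fstm continuous_measurable[OF g]])
 qed (use \<Theta> in \<open>auto simp: finite_measure_axioms\<close>)
 hence "measure \<Theta> (fst -` Z) = 0" using measure_distr[OF fstm,of Z] Z sp\<Theta> by simp
 moreover have Zs: "fst -` Z\<in>sets \<Theta>" using measurable_sets[OF fstm,of Z] Z sp\<Theta> by simp
 ultimately have aeZ: "AE z in \<Theta>. z\<notin>fst -` Z" by (intro AE_not_in) (simp add: null_sets_def \<Theta>.emeasure_eq_measure)
 have "AE z in \<Theta>. z\<in>R N" for N using R1[of N] \<Theta>.prob_eq_1[of "R N"] Rc \<Theta>(1) by (simp add: borel_closed)
 hence aeR: "AE z in \<Theta>. ALL N. z\<in>R N" by (simp add: AE_all_countable)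
 \<comment> \<open>The part of the orbit relation realised by time shifts of size at most
   \<open>n\<close>. Its compactness allows a continuous function to separate it from the complement
   of an open neighbourhood.\<close>
 define Q where "Q n = (%(r,x). (x,f r x)) ` ({- real n..real n}\<times>UNIV)" for n :: nat
 have Qc: "compact (Q n)" for n unfolding Q_def
 proof (rule compact_continuous_image)
  have "continuous_on ({- real n..real n}\<times>UNIV) (%z. (snd z,f (fst z) (snd z)))" using f_joint by (auto intro!: continuous_intros simp: case_prod_beta')
  thus "continuous_on ({- real n..real n}\<times>UNIV) (%(r,x). (x,f r x))" by (simp add: case_prod_beta')
 qed (intro compact_Times comp compact_Icc)
 have Qs: "Q n\<in>sets \<Theta>" for n using compact_imp_closed[OF Qc] \<Theta>(1) by (simp add: borel_closed)
 have "AE z in \<Theta>. z\<in>(\<Union>n. Q n)" using aeZ aeR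
 proof eventually_elim
  case (elim z)
  obtain x y where z: "z = (x,y)" by (cases z)
  have "dist (f s x) (f s y)<=\<epsilon>" for s
  proof -
   obtain N :: nat where "\<bar>s\<bar><=N" using real_arch_simple by blast
   thus ?thesis using elim(2)[rule_format,of N] by (auto simp: R_def z abs_le_iff)
  qed
  hence "y\<in>Gamma_eps f \<epsilon> x" by (simp add: Gamma_eps_def)
  moreover have "x\<notin>NE f \<epsilon>" using elim(1) Z(2) by (auto simp: z)
  ultimately obtain r where r: "y = f r x" by (auto simp: NE_def)
  obtain n :: nat where "\<bar>r\<bar><=n" using real_arch_simple by blast
  hence "z\<in>Q n" unfolding Q_def using r z by (intro image_eqI[of _ _ "(r,x)"]) (auto simp: abs_le_iff)
  thus ?case by blast
 qed
 hence "measure \<Theta> (\<Union>n. Q n) = 1" using \<Theta>.prob_eq_1[of "\<Union>n. Q n"] Qs by auto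
 moreover have "(%n. measure \<Theta> (Q n)) \<longlonglongrightarrow> measure \<Theta> (\<Union>n. Q n)"
  by (rule \<Theta>.finite_Lim_measure_incseq) (use Qs in \<open>auto simp: incseq_def Q_def\<close>)
 ultimately have "\<forall>\<^sub>F n in sequentially. measure \<Theta> (Q n) > 1-\<kappa>" using \<open>\<kappa> > 0\<close> by (intro order_tendstoD(1)) auto
 then obtain n where n: "measure \<Theta> (Q n) > 1-\<kappa>" by (meson eventually_sequentially order_refl)
 show thesis
 proof (rule that[of n])
  fix V :: "('a\<times>'a) set" assume V: "open V" "!!x r. \<bar>r\<bar><=real n ==> (x,f r x)\<in>V"
  have "Q n\<subseteq>V" using V(2) by (auto simp: Q_def abs_le_iff)
  from urysohn_compact[OF Qc V(1) this] obtain g where g: "cts g" "!!z. 0<=g z" "!!z. g z<=(1::real)"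
   "!!z. z\<in>Q n ==> g z = 1" "!!z. z\<notin>V ==> g z = 0" by blast
  have gi: "integrable \<Theta> g" by (rule integrable_continuous_compact[OF comp2 \<Theta>(1) \<Theta>.finite_measure_axioms g(1)])
  have "measure \<Theta> (Q n) = (LINT z|\<Theta>. ind (Q n) z)" using Qs by simp
  also have "\<dots><=\<Lambda> g" unfolding \<Theta>(3)[OF g(1),symmetric] by (rule integral_mono[OF _ gi], rule integrable_real_indicator)
    (use Qs g in \<open>auto simp: \<Theta>.emeasure_eq_measure indicator_def\<close>)
  finally have "\<forall>\<^sub>F k in G. self_join (?a k) g > 1-\<kappa>" using n by (intro order_tendstoD(1)[OF G(4)[OF g(1)]]) auto
  then obtain N where N: "self_join (?a N) g > 1-\<kappa>" using eventually_happens'[OF G(2)] by blast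
  from self_join_le_section_max[OF a g(1,2)] obtain p where
   p: "self_join (?a N) g<=(SUM v:range (?a N). (LINT y|\<mu>. ind (?a N -` {v}) y * g (p v,y)))" by blast
  note this
  also note section_max_le_prob(1)[OF a V(1) g(1,2,3,5)]
  finally show "EX N p. {y. (p (nm f \<alpha> (window T N) y),y)\<in>V}\<in>sets borel&1-\<kappa> < prob {y. (p (nm f \<alpha> (window T N) y),y)\<in>V}"
   using N section_max_le_prob(2)[OF a V(1) g(1,2,3,5)] by (intro exI[of _ N] exI[of _ p]) auto
 qed
qed

end


text \<open>Removes an additive constant by letting the number of blocks grow.\<close>

lemma linear_growth_le:
 fixes x y z :: real
 assumes "!!Q :: nat. Q>=(1 :: nat) ==> real Q * x<=real Q * y+z"
 shows "x<=y"
proof (rule ccontr)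
 assume "\<not> x<=y"
 hence d: "x-y > 0" by simp
 obtain Q :: nat where Q: "\<bar>z\<bar>/(x-y) < Q" using reals_Archimedean2 by blast
 hence "\<bar>z\<bar> < Q * (x-y)" using d by (simp add: divide_less_eq)
 moreover have "Q>=1" using Q d by (cases Q) (auto simp: divide_less_0_iff)
 ultimately show False using assms[of Q] by (simp add: right_diff_distrib)
qed

context compact_inv_flow
begin

text \<open>Inner regularity puts compact cores into the level sets; finitely many disjoint compact
  sets have positive mutual distance, so closeness of two core points determines the label.\<close>

lemma separated_cores:
 assumes \<eta>: "simple \<eta>" and "\<rho> > 0"
 obtains K \<gamma> where "\<gamma> > 0" "!!v. compact (K v)" "!!v. K v\<subseteq>\<eta> -` {v}" "!!v. prob (\<eta> -` {v}-K v) < \<rho>"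
  "!!v w x y. v\<in>range \<eta> ==> w\<in>range \<eta> ==> x\<in>K v ==> y\<in>K w ==> dist x y < \<gamma> ==> v = w"
proof -
 have \<eta>b: "\<eta> -` {v}\<in>sets borel" for v using simple_functionD(2)[OF \<eta>, of "{v}"] by simp
 have fin: "finite (range \<eta>)" using simple_functionD(1)[OF \<eta>] by simp
 have "EX K. compact K&K\<subseteq>\<eta> -` {v}&prob (\<eta> -` {v}-K) < \<rho>" for v
  using borel_inner_regular[OF comp sets_eq prob_space_axioms \<eta>b \<open>\<rho> > 0\<close>] by metis
 then obtain K where K: "!!v. compact (K v)" "!!v. K v\<subseteq>\<eta> -` {v}" "!!v. prob (\<eta> -` {v}-K v) < \<rho>" by metis
 have "EX d>0. fst vw~=snd vw --> (ALL x:K (fst vw). ALL y:K (snd vw). d<=dist x y)" for vw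
 proof (cases "fst vw~=snd vw&K (fst vw)\<times>K (snd vw)~={}")
  case True
  have "continuous_on (K (fst vw)\<times>K (snd vw)) (%z. dist (fst z) (snd z))" by (intro continuous_intros)
  from continuous_attains_inf[OF compact_Times[OF K(1) K(1)] _ this] True obtain z where
   z: "z\<in>K (fst vw)\<times>K (snd vw)" "!!u. u\<in>K (fst vw)\<times>K (snd vw) ==> dist (fst z) (snd z)<=dist (fst u) (snd u)" by blast
  have "fst z~=snd z" using z(1) True K(2)[of "fst vw"] K(2)[of "snd vw"] by (auto simp: subset_iff)
  thus ?thesis using z(2) by (intro exI[of _ "dist (fst z) (snd z)"]) force
 qed (use zero_less_one in blast)
 then obtain d where d: "!!vw. d vw > 0" "!!vw x y. fst vw~=snd vw ==> x\<in>K (fst vw) ==> y\<in>K (snd vw) ==> d vw<=dist x y"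
  by metis
 let ?I = "range \<eta>\<times>range \<eta>"
 show thesis
 proof (rule that[of "Min (d ` ?I)" K])
  show "Min (d ` ?I) > 0" using fin d(1) by (subst Min_gr_iff) auto
  fix v w x y assume v: "v\<in>range \<eta>" "w\<in>range \<eta>" and xy: "x\<in>K v" "y\<in>K w" "dist x y < Min (d ` ?I)"
  have "Min (d ` ?I)<=d (v,w)" using fin v by (intro Min_le) auto
  thus "v = w" using d(2)[of "(v,w)" x y] xy by force
 qed (use K in auto)
qed

text \<open>Off an event of small probability, the \<open>\<alpha>\<close>-names pin down the orbit of the point up to one of boundedly many
 time shifts, and hence its \<open>\<eta>\<close>-name up to the rare visits outside the compact cores.\<close>
lemma names_almost_determine:
 fixes \<eta> :: "'a=>'b" and \<kappa> :: real
 assumes Z: "Z\<in>sets borel" "NE f \<epsilon>\<subseteq>Z" "measure \<mu> Z = 0"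
  and T: "T>=1" and \<alpha>: "simple \<alpha>" "!!x y s. \<alpha> x = \<alpha> y ==> 0<=s ==> s<=real T ==> dist (f s x) (f s y)<=\<epsilon>"
  and \<eta>: "simple \<eta>" and \<kappa>: "\<kappa> > 0"
 obtains C where "!!m. EX N. cent (nm f \<eta> (times m)) (nm f \<alpha> (window T N))<=C+m * \<kappa>"
proof -
 have \<eta>b: "\<eta> -` {v}\<in>sets borel" for v using simple_functionD(2)[OF \<eta>, of "{v}"] by simp
 have fin: "finite (range \<eta>)" using simple_functionD(1)[OF \<eta>] by simp
 define c where "c = real (card (range \<eta>))"
 have c1: "c>=1" using fin card_gt_0_iff[of "range \<eta>"] by (auto simp: c_def Suc_le_eq)
 \<comment> \<open>On an event of probability \<open>\<kappa>'\<close> all \<open>m\<close> labels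
   may be listed at a cost of at most \<open>m * \<kappa>/2\<close>; the other half is spent on the
   names of \<open>b\<close>.\<close>
 define \<kappa>' where "\<kappa>' = \<kappa>/(2*(ln c+1))"
 have lnc: "ln c>=0" using c1 by simp
 have \<kappa>': "\<kappa>' > 0" "\<kappa>' * ln c<=\<kappa>/2" using \<kappa> lnc by (auto simp: \<kappa>'_def field_simps intro: mult_pos_pos)
 have "\<kappa>/2 > 0" using \<kappa> by simp
 from small_entropy[OF this,of "range \<eta>"] obtain \<rho> where \<rho>: "\<rho> > 0" "!!b :: 'a=>'b option. simple b ==> finite (range \<eta>) ==>
  range b\<subseteq>insert None (Some ` range \<eta>) ==> (!!v. v\<in>range \<eta> ==> prob (b -` {Some v})<=\<rho>) ==> ent \<mu> b<=\<kappa>/2" by blast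
 obtain K \<gamma> where \<gamma>: "\<gamma> > 0" and K: "!!v. compact (K v)" "!!v. K v\<subseteq>\<eta> -` {v}"
  "!!v. prob (\<eta> -` {v}-K v) < \<rho>"
  "!!v w x y. v\<in>range \<eta> ==> w\<in>range \<eta> ==> x\<in>K v ==> y\<in>K w ==> dist x y < \<gamma> ==> v = w"
  by (rule separated_cores[OF \<eta> \<rho>(1)]) (rule that)
 have Kb: "K v\<in>sets borel" for v using compact_imp_closed[OF K(1)] by (rule borel_closed)
 \<comment> \<open>\<open>b\<close> reveals the label only outside the cores, so its entropy is
   small; inside the cores the label follows from a nearby orbit.\<close>
 define b where "b y = (if y\<in>K (\<eta> y) then None else Some (\<eta> y))" for y
 have bran: "range b\<subseteq>insert None (Some ` range \<eta>)" by (auto simp: b_def)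
 have bS: "b -` {Some v} = \<eta> -` {v}-K v" for v by (auto simp: b_def split: if_splits)
 have b: "simple b" unfolding simple_function_def
 proof (intro conjI ballI)
  show "finite (b ` space \<mu>)" using finite_subset[OF bran] fin by simp
  fix u assume "u\<in>b ` space \<mu>"
  have bN: "b -` {None} = (\<Union>v\<in>range \<eta>. K v)" using K(2) by (fastforce simp: b_def split: if_splits)
  have "(\<Union>v\<in>range \<eta>. K v)\<in>sets borel" by (rule sets.finite_UN[OF fin]) (rule Kb)
  hence "b -` {u}\<in>sets borel" using \<eta>b Kb by (cases u) (auto simp: bN bS)
  thus "b -` {u}\<inter>space \<mu>\<in>sets \<mu>" by simp
 qed
 have entb: "ent \<mu> b<=\<kappa>/2" by (rule \<rho>(2)[OF b fin bran]) (use K(3) in \<open>simp add: bS less_imp_le\<close>)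
 have "\<gamma>/4 > 0" using \<gamma> by simp
 from f_small_time[OF this] obtain h where h: "h > 0" "!!x r. \<bar>r\<bar><=h ==> dist (f r x) x < \<gamma>/4" by blast
 from names_near_orbit[OF Z T \<alpha> \<kappa>'(1)] obtain n :: nat where n: "!!V :: ('a\<times>'a) set. open V ==> (!!x r. \<bar>r\<bar><=real n ==> (x,f r x)\<in>V) ==>
  EX N p. {y. (p (nm f \<alpha> (window T N) y),y)\<in>V}\<in>sets borel&1-\<kappa>' < prob {y. (p (nm f \<alpha> (window T N) y),y)\<in>V}"
  by blast
 \<comment> \<open>\<open>r\<close> runs through a grid of mesh \<open>h\<close> that starts at
   \<open>- real n\<close>. Grid indices below \<open>J\<close> reach all shifts of size at most
   \<open>n\<close>, and \<open>J\<close> itself will mark failure.\<close>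
 define J where "J = nat \<lceil>2 * real n/h\<rceil>+1"
 define r where "r i = - real n+real i * h" for i
 show thesis
 proof (rule that[of "ln (real (J+1))"])
  fix m :: nat
  \<comment> \<open>An open neighbourhood of the bounded orbit relation: up to one time shift of the
    first point, the two orbits agree within \<open>\<gamma>/4\<close> at the \<open>m\<close>
    integer times.\<close>
  define V where "V = (\<Union>\<rho>\<in>{- real n..real n}. \<Inter>j<m. {z :: 'a\<times>'a. dist (f (j+\<rho>) (fst z)) (f j (snd z)) < \<gamma>/4})"
  have V: "open V" unfolding V_def by (intro open_UN ballI open_INT finite_lessThan open_Collect_less continuous_intros f_continuous_compose)
  have "(x,f r x)\<in>V" if "\<bar>r\<bar><=real n" for x r unfolding V_def using that \<gamma> by (intro UN_I[of r]) (auto simp: f_add abs_le_iff)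
  from n[OF V this] obtain N p where Np: "{y. (p (nm f \<alpha> (window T N) y),y)\<in>V}\<in>sets borel"
   "1-\<kappa>' < prob {y. (p (nm f \<alpha> (window T N) y),y)\<in>V}" by blast
  let ?a = "nm f \<alpha> (window T N)" and ?H = "nm f \<eta> (times m)"
  have a: "simple ?a" and H: "simple ?H" by (intro simple_nm \<alpha> \<eta>)+
  define A where "A i y \<longleftrightarrow> (ALL j<m. dist (f (j+r i) (p (?a y))) (f j y) < \<gamma>/2)" for i y
  \<comment> \<open>The least grid shift by which the representative orbit follows \<open>y\<close>.
    Its entropy is at most \<open>ln (real (J+1))\<close>, independently of
    \<open>m\<close>.\<close>
  define \<zeta> where "\<zeta> y = (LEAST i. i>=J \<or> A i y)" for y
  have \<zeta>J: "\<zeta> y<=J" for y unfolding \<zeta>_def by (rule Least_le) simp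
  have \<zeta>A: "A (\<zeta> y) y" if "\<zeta> y < J" for y using LeastI[of "%i. i>=J \<or> A i y" J] that unfolding \<zeta>_def by auto
  have Ab: "{y. A i y}\<in>sets borel" for i
  proof -
   have "{y. A i y} = (\<Union>v\<in>range ?a. ?a -` {v}\<inter>(\<Inter>j<m. {y. dist (f (j+r i) (p v)) (f j y) < \<gamma>/2}))" by (auto simp: A_def)
   also have "\<dots>\<in>sets borel"
   proof (intro sets.finite_UN sets.Int)
    show "finite (range ?a)" using simple_functionD(1)[OF a] by simp
    show "?a -` {v}\<in>sets borel" for v using simple_functionD(2)[OF a,of "{v}"] by simp
    show "(\<Inter>j<m. {y. dist (f (j+r i) (p v)) (f j y) < \<gamma>/2})\<in>sets borel" for v
     by (intro borel_open open_INT finite_lessThan ballI open_Collect_less continuous_intros f_continuous_compose)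
   qed
   finally show ?thesis .
  qed
  have \<zeta>: "simple \<zeta>" unfolding simple_function_def
  proof (intro conjI ballI)
   show "finite (\<zeta> ` space \<mu>)" by (rule finite_subset[of _ "{..J}"]) (use \<zeta>J in auto)
   have "Measurable.pred \<mu> (A i)" for i using Ab[of i] by (subst Measurable.pred_def) simp
   hence "\<zeta>\<in>measurable \<mu> (count_space UNIV)" unfolding \<zeta>_def by (intro measurable_Least pred_intros_logic) auto
   thus "\<zeta> -` {u}\<inter>space \<mu>\<in>sets \<mu>" for u by (rule measurable_sets) simp
  qed
  have "prob (\<zeta> -` {J})<=\<kappa>'"
  proof -
   have "\<zeta> y < J" if y: "(p (?a y),y)\<in>V" for y
   proof -
    from y obtain \<rho> where \<rho>: "\<rho>\<in>{- real n..real n}" "ALL j:{..<m}. dist (f (j+\<rho>) (p (?a y))) (f j y) < \<gamma>/4"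
     unfolding V_def UN_iff INT_iff mem_Collect_eq fst_conv snd_conv by blast
    define i where "i = nat \<lfloor>(\<rho>+n)/h\<rfloor>"
    have q0: "0<=(\<rho>+n)/h" using \<rho>(1) h by auto
    hence i: "real i<=(\<rho>+n)/h" "(\<rho>+n)/h < real i+1" unfolding i_def by linarith+
    have "(\<rho>+n)/h<=2 * real n/h" using \<rho>(1) h by (intro divide_right_mono) auto
    hence "i < J" using i unfolding J_def by linarith
    moreover have "A i y" unfolding A_def
    proof (intro allI impI)
     fix j assume j: "j < m"
     have ri: "\<bar>r i-\<rho>\<bar><=h" using i h by (auto simp: r_def abs_le_iff field_simps)
     have "f (j+r i) (p (?a y)) = f (r i-\<rho>) (f (j+\<rho>) (p (?a y)))" by (simp add: f_add[symmetric] add.commute)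
     hence "dist (f (j+r i) (p (?a y))) (f (j+\<rho>) (p (?a y))) < \<gamma>/4" using h(2)[OF ri] by simp
     thus "dist (f (j+r i) (p (?a y))) (f j y) < \<gamma>/2"
      using \<rho>(2)[rule_format,of j] j dist_triangle[of "f (j+r i) (p (?a y))" "f j y" "f (j+\<rho>) (p (?a y))"] by simp
    qed
    ultimately show ?thesis using Least_le[of "%i. i>=J \<or> A i y" i] unfolding \<zeta>_def by auto
   qed
   hence "\<zeta> -` {J}\<subseteq>UNIV - {y. (p (?a y),y)\<in>V}" by fastforce
   hence "prob (\<zeta> -` {J})<=prob (UNIV - {y. (p (?a y),y)\<in>V})" by (rule finite_measure_mono) (use Np in auto)
   also have "\<dots> = 1-prob {y. (p (?a y),y)\<in>V}" using prob_compl[of "{y. (p (?a y),y)\<in>V}"] Np(1) by simp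
   finally show ?thesis using Np(2) by simp
  qed
  \<comment> \<open>The full name is stored on the failure event alone; elsewhere the constant value
    contributes no entropy.\<close>
  define H' where "H' y = (if \<zeta> y < J then [] else ?H y)" for y
  have H': "simple H'"
  proof -
   have "simple (%y. (%(k,l). if k < J then [] else l) (\<zeta> y,?H y))" using simple_function_compose1[OF simple_function_Pair[OF \<zeta> H]] .
   thus ?thesis by (simp add: H'_def[abs_def])
  qed
  define W where "W k = (if k < J then {[]} else {l. set l\<subseteq>range \<eta>&length l = m})" for k
  have "ent \<mu> (%y. (\<zeta> y,H' y))<=ent \<mu> \<zeta>+(SUM k:\<zeta> ` space \<mu>. pr \<zeta> k * ln (card (W k)))"
   by (rule ent_pair_le[OF \<zeta> H']) (use finite_lists_length_eq[OF fin] in \<open>auto simp: W_def H'_def nm_def times_def\<close>)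
  moreover have "ent \<mu> \<zeta><=ln (card {..J})" by (rule ent_le_card[OF \<zeta>]) (use \<zeta>J in auto)
  moreover have "(SUM k:\<zeta> ` space \<mu>. pr \<zeta> k * ln (card (W k)))<=(SUM k:{J}. pr \<zeta> k * ln (card (W k)))"
  proof -
   have "(SUM k:\<zeta> ` space \<mu>. pr \<zeta> k * ln (card (W k))) = (SUM k:\<zeta> ` space \<mu>\<inter>{J}. pr \<zeta> k * ln (card (W k)))"
   proof (rule sum.mono_neutral_right)
    show "ALL k:\<zeta> ` space \<mu> - \<zeta> ` space \<mu>\<inter>{J}. pr \<zeta> k * ln (card (W k)) = 0"
    proof
     fix k assume "k\<in>\<zeta> ` space \<mu> - \<zeta> ` space \<mu>\<inter>{J}"
     hence "k < J" using le_neq_implies_less[OF \<zeta>J] by auto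
     thus "pr \<zeta> k * ln (card (W k)) = 0" by (simp add: W_def)
    qed
   qed (use simple_functionD(1)[OF \<zeta>] in auto)
   also have "\<dots><=(SUM k:{J}. pr \<zeta> k * ln (card (W k)))"
    by (rule sum_mono2) (use c1 in \<open>auto simp: W_def card_lists_length_eq[OF fin] c_def intro!: mult_nonneg_nonneg ln_ge_zero\<close>)
   finally show ?thesis .
  qed
  moreover have "pr \<zeta> J * ln (card (W J))<=m * (\<kappa>/2)"
  proof -
   have "ln (card (W J)) = m * ln c" using c1 by (simp add: W_def card_lists_length_eq[OF fin] c_def ln_realpow)
   hence "pr \<zeta> J * ln (card (W J)) = prob (\<zeta> -` {J})*(m * ln c)" by simp
   also have "\<dots><=\<kappa>' * (m * ln c)" by (intro mult_right_mono \<open>prob (\<zeta> -` {J}) <= \<kappa>'\<close>) (use lnc in auto)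
   also have "\<dots> = m * (\<kappa>' * ln c)" by simp
   also have "\<dots><=m * (\<kappa>/2)" by (intro mult_left_mono \<kappa>') auto
   finally show ?thesis .
  qed
  ultimately have e1: "ent \<mu> (%y. (\<zeta> y,H' y))<=ln (real (J+1))+m * (\<kappa>/2)" by simp
  have e2: "ent \<mu> (nm f b (times m))<=m * (\<kappa>/2)"
  proof -
   have "ent \<mu> (nm f b (times m))<=length (times m) * ent \<mu> b" by (rule ent_nm_le_mult[OF b])
   also have "\<dots><=m * (\<kappa>/2)" using mult_left_mono[OF entb,of "real m"] by (simp add: times_def)
   finally show ?thesis .
  qed
  note bm = simple_nm[OF b,of "times m"]
  have det: "?H x = ?H y" if e: "\<zeta> x = \<zeta> y" "H' x = H' y" "nm f b (times m) x = nm f b (times m) y" "?a x = ?a y" for x y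
  proof (cases "\<zeta> x < J")
   case True
   have "\<eta> (f j x) = \<eta> (f j y)" if j: "j < m" for j :: nat
   proof -
    have bj: "b (f j x) = b (f j y)" using e(3) j by (auto simp: nm_def times_def)
    show ?thesis
    proof (cases "b (f j x)")
     case None
     hence in_K: "f j x\<in>K (\<eta> (f j x))" "f j y\<in>K (\<eta> (f j y))" using bj by (auto simp: b_def split: if_splits)
     have "dist (f (j+r (\<zeta> x)) (p (?a x))) (f j x) < \<gamma>/2" "dist (f (j+r (\<zeta> x)) (p (?a x))) (f j y) < \<gamma>/2"
      using \<zeta>A[of x] \<zeta>A[of y] True e(1,4) j unfolding A_def by auto
     hence "dist (f j x) (f j y) < \<gamma>" using dist_triangle3[of "f j x" "f j y" "f (j+r (\<zeta> x)) (p (?a x))"] by linarith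
     thus ?thesis by (intro K(4)[OF _ _ in_K]) auto
    next
     case (Some v)
     thus ?thesis using bj by (auto simp: b_def split: if_splits)
    qed
   qed
   thus ?thesis by (auto simp: nm_def times_def)
  next
   case False
   thus ?thesis using e by (simp add: H'_def)
  qed
  have "ent \<mu> (%y. (?H y,?a y))<=ent \<mu> (%y. (((\<zeta> y,H' y),nm f b (times m) y),?a y))"
  proof (rule ent_determined)
   fix x y assume "(((\<zeta> x,H' x),nm f b (times m) x),?a x) = (((\<zeta> y,H' y),nm f b (times m) y),?a y)"
   thus "(?H x,?a x) = (?H y,?a y)" using det[of x y] by simp
  qed (intro simple_function_Pair \<zeta> H H' bm a)+
  also have "\<dots><=ent \<mu> (%y. ((\<zeta> y,H' y),nm f b (times m) y))+ent \<mu> ?a"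
   by (rule ent_subadd) (intro simple_function_Pair \<zeta> H' bm a)+
  also have "ent \<mu> (%y. ((\<zeta> y,H' y),nm f b (times m) y))<=ent \<mu> (%y. (\<zeta> y,H' y))+ent \<mu> (nm f b (times m))"
   by (rule ent_subadd) (intro simple_function_Pair \<zeta> H' bm)+
  finally have "cent ?H ?a<=ln (real (J+1))+m * \<kappa>" unfolding cent_def using e1 e2 by (simp add: algebra_simps)
  thus "EX N. cent (nm f \<eta> (times m)) (nm f \<alpha> (window T N))<=ln (real (J+1))+m * \<kappa>" by blast
 qed
qed

text \<open>Each block is conditioned on its own translated window, which \<open>A\<close>
  determines, and invariance makes all these conditional entropies equal.\<close>

lemma cent_blocks:
 assumes \<eta>: "simple \<eta>" and \<alpha>: "simple \<alpha>" and A: "simple A"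
  and det: "!!q x y. q < Q ==> A x = A y ==> nm f \<alpha> ts (f (real (q * m)) x) = nm f \<alpha> ts (f (real (q * m)) y)"
  and c: "cent (nm f \<eta> (times m)) (nm f \<alpha> ts)<=c"
 shows "cent (nm f \<eta> (times (Q * m))) A<=Q * c" using det
proof (induction Q)
 case 0
 have "ent \<mu> (%x. (nm f \<eta> (times (0 * m)) x,A x)) = ent \<mu> A"
  by (rule ent_cong_determined) (auto intro!: simple_function_Pair simple_nm \<eta> A simp: nm_def times_def)
 thus ?case by (simp add: cent_def)
next
 case (Suc Q)
 let ?X = "nm f \<eta> (times (Q * m))" and ?Y = "%x. nm f \<eta> (times m) (f (real (Q * m)) x)"
 have X: "simple ?X" and Y: "simple ?Y" by (intro simple_nm simple_flow \<eta>)+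
 have tm: "times (Suc Q * m) = times (Q * m) @ map (%t. t+real (Q * m)) (times m)" using times_add[of "Q * m" m] by (simp add: add.commute)
 have "nm f \<eta> (times (Suc Q * m)) x = ?X x @ ?Y x" for x unfolding tm nm_shift[symmetric] by (simp add: nm_def)
 hence "ent \<mu> (%x. (nm f \<eta> (times (Suc Q * m)) x,A x))<=ent \<mu> (%x. ((?X x,?Y x),A x))"
  by (intro ent_determined simple_function_Pair simple_nm \<eta> A X Y) auto
 hence "cent (nm f \<eta> (times (Suc Q * m))) A<=cent (%x. (?X x,?Y x)) A" by (simp add: cent_def)
 also have "\<dots><=cent ?X A+cent ?Y A" by (rule cent_pair_le[OF X Y A])
 also have "cent ?Y A<=cent ?Y (%x. nm f \<alpha> ts (f (real (Q * m)) x))"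
  by (rule cent_antimono[OF Y A simple_flow[OF simple_nm[OF \<alpha>]]]) (rule Suc.prems[OF lessI])
 also have "\<dots> = cent (nm f \<eta> (times m)) (nm f \<alpha> ts)"
  unfolding cent_def using ent_flow[OF simple_function_Pair[OF simple_nm[OF \<eta>] simple_nm[OF \<alpha>]]] ent_flow[OF simple_nm[OF \<alpha>]] by simp
 also have "cent ?X A<=Q * c" by (rule Suc.IH) (rule Suc.prems, simp)
 finally show ?case using c by (simp add: algebra_simps)
qed

text \<open>A partition of mesh \<open>\<epsilon>\<close> over time \<open>T\<close> captures all
  entropy. The window radius \<open>N\<close> depends on the block length \<open>m\<close>, so two
  limits are nested: for fixed \<open>m\<close>, many blocks \<open>Q\<close> absorb the
  \<open>2 * N+1\<close> surplus samples; a growing block length absorbs the constant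
  \<open>C\<close>.\<close>

theorem almost_expansive_hrate_le:
 assumes Z: "Z\<in>sets borel" "NE f \<epsilon>\<subseteq>Z" "measure \<mu> Z = 0"
  and T: "T>=1" and \<alpha>: "simple \<alpha>" "!!x y s. \<alpha> x = \<alpha> y ==> 0<=s ==> s<=real T ==> dist (f s x) (f s y)<=\<epsilon>"
  and \<eta>: "simple \<eta>"
 shows "T * hrate f \<mu> \<eta><=ent \<mu> \<alpha>"
proof (rule field_le_epsilon)
 fix e :: real assume e: "e > 0"
 hence "e/T > 0" using T by simp
 from names_almost_determine[OF Z T \<alpha> \<eta> this] obtain C where
  C: "!!m. EX N. cent (nm f \<eta> (times m)) (nm f \<alpha> (window T N))<=C+m * (e/T)" by blast
 show "T * hrate f \<mu> \<eta><=ent \<mu> \<alpha>+e"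
 proof (rule linear_growth_le[where z = C])
  fix k :: nat assume k: "k>=1"
  define m where "m = T * k"
  from C[of m] obtain N where N: "cent (nm f \<eta> (times m)) (nm f \<alpha> (window T N))<=C+m * (e/T)" by blast
  have "k * (T * hrate f \<mu> \<eta>)<=k * ent \<mu> \<alpha>+(C+m * (e/T))"
  proof (rule linear_growth_le[where z = "real (2 * N+1) * ent \<mu> \<alpha>"])
   fix Q :: nat assume Q: "Q>=1"
   \<comment> \<open>One list of sampling times for all \<open>Q\<close> blocks: their windows
     overlap, so \<open>Q * k\<close> samples and a single additional window suffice.\<close>
   define us where "us = map (%j. T * (real j-real N)) [0..<Q * k+(2 * N+1)]"
   let ?A = "nm f \<alpha> us" and ?H = "nm f \<eta> (times (Q * m))"
   have A: "simple ?A" and H: "simple ?H" by (intro simple_nm \<alpha> \<eta>)+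
   have "Q * m>=1" using T k Q by (simp add: m_def Suc_le_eq)
   from hrate_le[OF this,of \<eta>] have "(Q * m) * hrate f \<mu> \<eta><=ent \<mu> ?H"
    using \<open>Q * m >= 1\<close> by (simp add: pos_le_divide_eq mult.commute)
   also have "\<dots><=ent \<mu> (%x. (?H x,?A x))" by (intro ent_determined simple_function_Pair H A) auto
   also have "\<dots> = cent ?H ?A+ent \<mu> ?A" by (simp add: cent_def)
   also have "cent ?H ?A<=Q * (C+m * (e/T))"
   proof (rule cent_blocks[OF \<eta> \<alpha>(1) A _ N])
    fix q x y assume q: "q < Q" and eq: "?A x = ?A y"
    have "\<alpha> (f (T * (real j-real N)) (f (real (q * m)) x)) = \<alpha> (f (T * (real j-real N)) (f (real (q * m)) y))"
     if "j < 2 * N+1" for j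
    proof -
     have "q * k+k<=Q * k" using mult_le_mono1[of "Suc q" Q k] q by simp
     hence "q * k+j < Q * k+(2 * N+1)" using that by linarith
     hence "\<alpha> (f (T * (real (q * k+j)-real N)) x) = \<alpha> (f (T * (real (q * k+j)-real N)) y)"
      using bspec[OF eq[unfolded nm_def us_def map_map map_eq_conv set_upt],of "q * k+j"] by simp
     moreover have "T * (real (q * k+j)-real N) = T * (real j-real N)+real (q * m)" by (simp add: m_def algebra_simps)
     ultimately show ?thesis by (simp only: f_add)
    qed
    thus "nm f \<alpha> (window T N) (f (real (q * m)) x) = nm f \<alpha> (window T N) (f (real (q * m)) y)"
     unfolding nm_def window_def map_map map_eq_conv set_upt by simp
   qed
   also have "ent \<mu> ?A<=length us * ent \<mu> \<alpha>" by (rule ent_nm_le_mult[OF \<alpha>(1)])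
   finally show "real Q * (real k * (real T * hrate f \<mu> \<eta>))<=real Q * (real k * ent \<mu> \<alpha>+(C+real m * (e/real T)))+real (2 * N+1) * ent \<mu> \<alpha>"
    by (simp add: us_def m_def algebra_simps)
  qed
  also have "m * (e/T) = k * e" using T by (simp add: m_def)
  finally show "real k * (real T * hrate f \<mu> \<eta>)<=real k * (ent \<mu> \<alpha>+e)+C" by (simp add: algebra_simps)
 qed
qed

end


section \<open>Weighted covers and the pressure\<close>

locale flow_potential = compact_flow f for f :: "real=>'a::metric_space=>'a" +
 fixes \<phi> :: "'a=>real"
 assumes \<phi>: "cts \<phi>"
begin

abbreviation (input) "psum E t == SUM x:E. exp (birk \<phi> x t)"

text \<open>Says that \<open>S\<close> has a cover by closed sets of d_t-mesh
  \<open>\<gamma>\<close> and total weight at most \<open>c\<close>. Each member \<open>u\<close>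
  carries its own bound \<open>snd u\<close> for the Birkhoff integrals, which makes covers stable
  under union and concatenation without any distortion estimate.\<close>

definition cov :: "real=>real=>'a set=>real=>bool" where
 "cov t \<gamma> S c \<longleftrightarrow> (EX us :: ('a set\<times>real) list.
  (ALL u:set us. closed (fst u)&(ALL x:fst u. birk \<phi> x t<=snd u&(ALL y:fst u. near t \<gamma> x y))) &
  S\<subseteq>(\<Union>u\<in>set us. fst u)&(\<Sum>u\<leftarrow>us. exp (snd u))<=c)"

lemma covE:
 assumes "cov t \<gamma> S c"
 obtains us where "!!u. u\<in>set us ==> closed (fst u)"
  "!!u x. u\<in>set us ==> x\<in>fst u ==> birk \<phi> x t<=snd u"
  "!!u x y r. u\<in>set us ==> x\<in>fst u ==> y\<in>fst u ==> r\<in>{0..t} ==> dist (f r x) (f r y)<=\<gamma>"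
  "S\<subseteq>(\<Union>u\<in>set us. fst u)" "(\<Sum>u\<leftarrow>us. exp (snd u))<=c"
proof -
 from assms obtain us :: "('a set\<times>real) list" where us: "ALL u:set us. closed (fst u)&(ALL x:fst u. birk \<phi> x t<=snd u&(ALL y:fst u. near t \<gamma> x y))"
  "S\<subseteq>(\<Union>u\<in>set us. fst u)" "(\<Sum>u\<leftarrow>us. exp (snd u))<=c" unfolding cov_def by blast
 show thesis by (rule that[of us]) (use us in auto)
qed

lemma cov_mono: "cov t \<gamma> S c ==> S'\<subseteq>S ==> c<=c' ==> cov t \<gamma> S' c'"
 unfolding cov_def by (meson order_trans)

lemma cov_mesh: "cov t \<gamma> S c ==> \<gamma><=\<gamma>' ==> cov t \<gamma>' S c" unfolding cov_def by (meson order_trans)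

lemma cov_Un: "cov t \<gamma> S c ==> cov t \<gamma> S' c' ==> cov t \<gamma> (S\<union>S') (c+c')" unfolding cov_def
proof (elim exE conjE)
 fix us vs :: "('a set\<times>real) list"
 assume *: "ALL u:set us. closed (fst u)&(ALL x:fst u. birk \<phi> x t<=snd u&(ALL y:fst u. near t \<gamma> x y))"
  "ALL u:set vs. closed (fst u)&(ALL x:fst u. birk \<phi> x t<=snd u&(ALL y:fst u. near t \<gamma> x y))"
  "S\<subseteq>(\<Union>u\<in>set us. fst u)" "S'\<subseteq>(\<Union>u\<in>set vs. fst u)" "(\<Sum>u\<leftarrow>us. exp (snd u))<=c" "(\<Sum>u\<leftarrow>vs. exp (snd u))<=c'"
 show "EX us :: ('a set\<times>real) list.
  (ALL u:set us. closed (fst u)&(ALL x:fst u. birk \<phi> x t<=snd u&(ALL y:fst u. near t \<gamma> x y))) &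
  S\<union>S'\<subseteq>(\<Union>u\<in>set us. fst u)&(\<Sum>u\<leftarrow>us. exp (snd u))<=c+c'"
  by (rule exI[of _ "us @ vs"]) (use * in \<open>auto simp only: set_append Un_iff ball_Un UN_Un map_append sum_list_append intro: add_mono\<close>)
qed

lemma cov_empty: "cov t \<gamma> {} 0" unfolding cov_def by (intro exI[of _ "[]"]) auto

lemma cov_UN:
 assumes "finite I" "!!i. i\<in>I ==> cov t \<gamma> (S i) (c i)"
 shows "cov t \<gamma> (\<Union>i\<in>I. S i) (SUM i:I. c i)" using assms by (induction I) (auto simp: cov_empty intro!: cov_Un)

text \<open>Weights multiply since the Birkhoff bounds add, and the mesh does not grow: each moment
  of the longer interval belongs to one of the two factors.\<close>

lemma cov_concat:
 assumes "cov s \<gamma> S c" "cov t \<gamma> S' c'" "0<=s" "0<=t"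
 shows "cov (s+t) \<gamma> (S\<inter>f s -` S') (c * c')"
proof -
 obtain us where us: "!!u. u\<in>set us ==> closed (fst u)"
  "!!u x. u\<in>set us ==> x\<in>fst u ==> birk \<phi> x s<=snd u"
  "!!u x y r. u\<in>set us ==> x\<in>fst u ==> y\<in>fst u ==> r\<in>{0..s} ==> dist (f r x) (f r y)<=\<gamma>"
  "S\<subseteq>(\<Union>u\<in>set us. fst u)" "(\<Sum>u\<leftarrow>us. exp (snd u))<=c" by (rule covE[OF assms(1)]) (rule that)
 obtain vs where vs: "!!u. u\<in>set vs ==> closed (fst u)"
  "!!u x. u\<in>set vs ==> x\<in>fst u ==> birk \<phi> x t<=snd u"
  "!!u x y r. u\<in>set vs ==> x\<in>fst u ==> y\<in>fst u ==> r\<in>{0..t} ==> dist (f r x) (f r y)<=\<gamma>"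
  "S'\<subseteq>(\<Union>u\<in>set vs. fst u)" "(\<Sum>u\<leftarrow>vs. exp (snd u))<=c'" by (rule covE[OF assms(2)]) (rule that)
 define ws where "ws = map (%(u,v). (fst u\<inter>f s -` fst v,snd u+snd v)) (List.product us vs)"
 have "(\<Sum>w\<leftarrow>ws. exp (snd w)) = (\<Sum>u\<leftarrow>us. exp (snd u))*(\<Sum>u\<leftarrow>vs. exp (snd u))" unfolding ws_def
  by (induction us) (simp_all add: comp_def case_prod_beta' exp_add sum_list_const_mult distrib_right)
 also have "\<dots><=c * c'" by (intro mult_mono us vs order_trans[OF _ us(5)] sum_list_nonneg) auto
 finally have sum: "(\<Sum>w\<leftarrow>ws. exp (snd w))<=c * c'" .
 show ?thesis unfolding cov_def
 proof (intro exI[of _ ws] conjI ballI sum)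
  fix w assume "w\<in>set ws"
  then obtain u v where uv: "u\<in>set us" "v\<in>set vs" "w = (fst u\<inter>f s -` fst v,snd u+snd v)" by (auto simp: ws_def)
  show "closed (fst w)" using us(1)[OF uv(1)] closed_vimage[OF vs(1)[OF uv(2)] f_continuous,of s] by (simp add: uv(3) closed_Int)
  fix x assume x: "x\<in>fst w"
  show "birk \<phi> x (s+t)<=snd w" using us(2)[OF uv(1),of x] vs(2)[OF uv(2),of "f s x"] x by (simp add: uv(3) birkhoff_add[OF \<phi> assms(3,4)])
  fix y r assume y: "y\<in>fst w" and r: "r\<in>{0..s+t}"
  show "dist (f r x) (f r y)<=\<gamma>"
  proof (cases "r<=s")
   case True
   thus ?thesis using us(3)[OF uv(1),of x y r] x y r by (simp add: uv(3))
  next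
   case False
   thus ?thesis using vs(3)[OF uv(2),of "f s x" "f s y" "r-s"] x y r by (simp add: uv(3) f_add[symmetric])
  qed
 next
  show "S\<inter>f s -` S'\<subseteq>(\<Union>w\<in>set ws. fst w)" using us(4) vs(4) by (fastforce simp: ws_def)
 qed
qed

text \<open>Two points of a separated set cannot share a member of the cover, so choosing a member
  for each point is injective.\<close>

lemma cov_separated_le:
 assumes c: "cov t \<gamma> S c" and E: "finite E" "E\<subseteq>S" "separated f t \<gamma> E" and "0<=t"
 shows "(psum E t)<=c"
proof -
 obtain us where us0: "!!u. u\<in>set us ==> closed (fst u)" and us: "!!u x. u\<in>set us ==> x\<in>fst u ==> birk \<phi> x t<=snd u"
  "!!u x y r. u\<in>set us ==> x\<in>fst u ==> y\<in>fst u ==> r\<in>{0..t} ==> dist (f r x) (f r y)<=\<gamma>"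
  "S\<subseteq>(\<Union>u\<in>set us. fst u)" "(\<Sum>u\<leftarrow>us. exp (snd u))<=c" by (rule covE[OF c]) (rule that)
 have "EX i<length us. x\<in>fst (us ! i)" if "x\<in>E" for x
 proof -
  have "x\<in>(\<Union>u\<in>set us. fst u)" using us(3) E(2) that by blast
  then obtain u where "u\<in>set us" "x\<in>fst u" by (rule UN_E)
  thus ?thesis by (auto simp: in_set_conv_nth)
 qed
 then obtain i where i: "!!x. x\<in>E ==> i x < length us" "!!x. x\<in>E ==> x\<in>fst (us ! i x)" by metis
 have inj: "inj_on i E"
 proof (rule inj_onI)
  fix x y assume xy: "x\<in>E" "y\<in>E" "i x = i y"
  have "near t \<gamma> x y" using us(2)[of "us ! i x" x y] i[OF xy(1)] i[OF xy(2)] xy(3) by simp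
  thus "x = y" using E(3) xy \<open>0 <= t\<close> by (simp add: separated_iff)
 qed
 have "(psum E t)<=(SUM x:E. exp (snd (us ! i x)))" using i us(1) by (intro sum_mono) auto
 also have "\<dots> = (SUM j:i ` E. exp (snd (us ! j)))" by (simp add: sum.reindex[OF inj])
 also have "\<dots><=(SUM j:{0..<length us}. exp (snd (us ! j)))" using i by (intro sum_mono2) auto
 also have "\<dots> = (\<Sum>u\<leftarrow>us. exp (snd u))" by (simp add: sum_list_sum_nth)
 finally show ?thesis using us(4) by simp
qed

text \<open>The members are closed Bowen balls about the spanning points; the triangle inequality
  doubles the radius to the mesh.\<close>

lemma cov_of_spanning:
 assumes E: "finite E" "!!x. x\<in>S ==> EX y:E. near t r y x"
  and a: "!!x y. x\<in>E ==> (!!s. s\<in>{0..t} ==> dist (f s x) (f s y)<=r) ==> birk \<phi> y t<=a x"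
 shows "cov t (2 * r) S (SUM x:E. exp (a x))"
proof -
 obtain xs where xs: "set xs = E" "distinct xs" using finite_distinct_list[OF E(1)] by blast
 define us where "us = map (%x. ({y. near t r x y},a x)) xs"
 show ?thesis unfolding cov_def
 proof (intro exI[of _ us] conjI ballI)
  fix u assume "u\<in>set us"
  then obtain x where x: "x\<in>E" "u = ({y. near t r x y},a x)" using xs by (auto simp: us_def)
  show "closed (fst u)" by (simp add: x closed_bowen)
  fix y assume y: "y\<in>fst u"
  thus "birk \<phi> y t<=snd u" using a[OF x(1),of y] by (auto simp: x)
  fix z s assume "z\<in>fst u" "s\<in>{0..t}"
  hence "dist (f s x) (f s y)<=r" "dist (f s x) (f s z)<=r" using y by (auto simp: x)
  thus "dist (f s y) (f s z)<=2 * r" using dist_triangle3[of "f s y" "f s z" "f s x"] by linarith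
 next
  show "S\<subseteq>(\<Union>u\<in>set us. fst u)" using E(2) xs by (fastforce simp: us_def)
  show "(\<Sum>u\<leftarrow>us. exp (snd u))<=(SUM x:E. exp (a x))" using xs by (simp add: us_def comp_def sum_list_distinct_conv_sum_set)
 qed
qed

lemma cov_UNIV_pos: "cov t \<gamma> UNIV c ==> c > 0"
proof -
 assume "cov t \<gamma> UNIV c"
 then obtain us :: "('a set\<times>real) list" where us: "UNIV\<subseteq>(\<Union>u\<in>set us. fst u)" "(\<Sum>u\<leftarrow>us. exp (snd u))<=c" unfolding cov_def by blast
 hence "us~=[]" by auto
 hence "0 < (\<Sum>u\<leftarrow>us. exp (snd u))" by (cases us) (auto intro!: add_pos_nonneg sum_list_nonneg)
 thus ?thesis using us by linarith
qed

text \<open>Handles the initial range of times, on which asymptotic estimates say nothing.\<close>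

lemma cov_bounded_time:
 assumes "\<gamma> > 0"
 obtains N where "N > 0" "!!t. 0<=t ==> t<=T ==> cov t \<gamma> UNIV N"
proof -
 from bounded_fun[OF \<phi>] obtain B where B: "B > 0" "!!x. \<bar>\<phi> x\<bar><=B" by blast
 have "\<gamma>/2 > 0" using assms by simp
 from finite_separated_bound[OF this,of T] obtain n :: nat where n: "!!t E. 0<=t ==> t<=T ==> separated f t (\<gamma>/2) E ==> finite E&card E<=n" by blast
 show thesis
 proof (rule that[of "real n * exp (B * \<bar>T\<bar>)+1"])
  fix t assume t: "0<=t" "t<=T"
  have "separated f t (\<gamma>/2) {}" by (simp add: separated_def)
  then obtain E where E: "finite E" "separated f t (\<gamma>/2) E"
   "!!x. x\<in>UNIV ==> EX y:E. near t (\<gamma>/2) y x"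
   by (rule maximal_separated[OF \<open>\<gamma> / 2 > 0\<close> t(1) empty_subsetI[of UNIV]]) (rule that)
  have bB: "birk \<phi> y t<=B * \<bar>T\<bar>" for y
  proof -
   have "B * t<=B * \<bar>T\<bar>" using t B(1) by (intro mult_left_mono) auto
   thus ?thesis using birkhoff_abs_le[OF \<phi> B(2) t(1),of y] by linarith
  qed
  have "cov t (2*(\<gamma>/2)) UNIV (SUM x:E. exp (B * \<bar>T\<bar>))" by (rule cov_of_spanning[OF E(1)]) (rule E(3), assumption, rule bB)
  hence "cov t \<gamma> UNIV (real (card E) * exp (B * \<bar>T\<bar>))" by simp
  moreover have "real (card E) * exp (B * \<bar>T\<bar>)<=real n * exp (B * \<bar>T\<bar>)+1" using n[OF t E(2)] by (intro add_increasing2 mult_right_mono) auto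
  ultimately show "cov t \<gamma> UNIV (real n * exp (B * \<bar>T\<bar>)+1)" by (rule cov_mono[OF _ subset_refl])
 qed (simp add: add_nonneg_pos)
qed

text \<open>Gibbs' inequality for the first-hit partition of two covers; the point of separating \<open>S\<close> is that the bound
 forces the partition sum of \<open>S\<close> to be large when \<open>S\<close> has large measure.\<close>
lemma gibbs_cover:
 assumes m: "invariant_measure f m" and Z: "Z\<in>sets borel" "NE f \<epsilon>\<subseteq>Z" "measure m Z = 0"
  and T: "T>=(1 :: nat)" and c: "cov T \<epsilon> S c" "cov T \<epsilon> UNIV c'" and \<eta>: "simple_function m \<eta>"
 obtains \<sigma> where "measure m S<=\<sigma>" "\<sigma><=1" "\<sigma> > 0 ==> c > 0"
  "T * (hrate f m \<eta>+integral\<^sup>L m \<phi>)<=ln 2+\<sigma> * ln c+(1-\<sigma>) * ln c'"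
proof -
 interpret compact_inv_flow f m by (rule compact_inv_flowI[OF m])
 obtain us where us: "!!u. u\<in>set us ==> closed (fst u)"
  "!!u x. u\<in>set us ==> x\<in>fst u ==> birk \<phi> x T<=snd u"
  "!!u x y r. u\<in>set us ==> x\<in>fst u ==> y\<in>fst u ==> r\<in>{0..real T} ==> dist (f r x) (f r y)<=\<epsilon>"
  "S\<subseteq>(\<Union>u\<in>set us. fst u)" "(\<Sum>u\<leftarrow>us. exp (snd u))<=c" by (rule covE[OF c(1)]) (rule that)
 obtain vs where vs: "!!u. u\<in>set vs ==> closed (fst u)"
  "!!u x. u\<in>set vs ==> x\<in>fst u ==> birk \<phi> x T<=snd u"
  "!!u x y r. u\<in>set vs ==> x\<in>fst u ==> y\<in>fst u ==> r\<in>{0..real T} ==> dist (f r x) (f r y)<=\<epsilon>"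
  "UNIV\<subseteq>(\<Union>u\<in>set vs. fst u)" "(\<Sum>u\<leftarrow>vs. exp (snd u))<=c'" by (rule covE[OF c(2)]) (rule that)
 \<comment> \<open>The cover of \<open>S\<close> comes first: the first-hit cells then split into
   those of \<open>us\<close>, whose mass \<open>\<sigma>\<close> is at least that of
   \<open>S\<close>, and those of \<open>vs\<close>.\<close>
 define ws where "ws = us @ vs"
 define k where "k = length us"
 define n where "n = length ws"
 have kn: "k<=n" by (simp add: k_def n_def ws_def)
 define a where "a i = snd (ws ! i)" for i
 define \<alpha> where "\<alpha> x = (LEAST i. i < n&x\<in>fst (ws ! i))" for x
 have \<alpha>1: "\<alpha> x < n&x\<in>fst (ws ! \<alpha> x)" for x
 proof -
  have "x\<in>(\<Union>u\<in>set vs. fst u)" using vs(4) by blast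
  then obtain u where "u\<in>set vs" "x\<in>fst u" by (rule UN_E)
  hence "u\<in>set ws" "x\<in>fst u" by (simp_all add: ws_def)
  then obtain i where "i < n&x\<in>fst (ws ! i)" unfolding in_set_conv_nth n_def by metis
  thus ?thesis unfolding \<alpha>_def by (rule LeastI)
 qed
 have wsc: "closed (fst (ws ! i))" if "i < n" for i using that us(1) vs(1) by (auto simp: n_def ws_def nth_append)
 have \<alpha>: "simple_function m \<alpha>" unfolding simple_function_def
 proof (intro conjI ballI)
  show "finite (\<alpha> ` space m)" by (rule finite_subset[of _ "{..<n}"]) (use \<alpha>1 in auto)
  have "Measurable.pred m (%x. i < n&x\<in>fst (ws ! i))" for i using wsc[of i] by (cases "i < n") (auto simp: Measurable.pred_def borel_closed)
  hence "\<alpha>\<in>measurable m (count_space UNIV)" unfolding \<alpha>_def by (rule measurable_Least)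
  thus "\<alpha> -` {u}\<inter>space m\<in>sets m" for u by (rule measurable_sets) simp
 qed
 have wsn: "ws ! i\<in>set us \<or> ws ! i\<in>set vs" if "i < n" for i using nth_mem[of i ws] that by (auto simp: n_def ws_def)
 have close: "dist (f s x) (f s y)<=\<epsilon>" if "\<alpha> x = \<alpha> y" "0<=s" "s<=real T" for x y s
  using wsn[of "\<alpha> x"] us(3)[of "ws ! \<alpha> x" x y s] vs(3)[of "ws ! \<alpha> x" x y s] \<alpha>1[of x] \<alpha>1[of y] that by auto
 have bk: "birk \<phi> x T<=a (\<alpha> x)" for x
  using wsn[of "\<alpha> x"] us(2)[of "ws ! \<alpha> x" x] vs(2)[of "ws ! \<alpha> x" x] \<alpha>1[of x] by (auto simp: a_def)
 define p where "p i = prob (\<alpha> -` {i})" for i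
 have psum: "(\<Sum>i<n. p i) = 1" using pr_sum[OF \<alpha>, of "{..<n}"] \<alpha>1 by (auto simp: p_def)
 have "T * integral\<^sup>L m \<phi> = (LINT x|m. birk \<phi> x T)" by (simp add: integral_birkhoff[OF \<phi>])
 also have "\<dots><=(LINT x|m. (\<Sum>i<n. a i * ind (\<alpha> -` {i}) x))"
 proof (rule integral_mono)
  show "integrable m (%x. birk \<phi> x T)" by (rule integrable_continuous[OF birkhoff_continuous[OF \<phi>]])
  have "\<alpha> -` {i}\<in>sets m" for i using simple_functionD(2)[OF \<alpha>, of "{i}"] by simp
  thus "integrable m (%x. \<Sum>i<n. a i * ind (\<alpha> -` {i}) x)"
   by (intro Bochner_Integration.integrable_sum integrable_mult_right integrable_real_indicator) (auto simp: emeasure_eq_measure)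
  fix x
  have "(\<Sum>i<n. a i * ind (\<alpha> -` {i}) x) = (SUM i:{\<alpha> x}. a i * ind (\<alpha> -` {i}) x)" by (rule sum.mono_neutral_right) (use \<alpha>1 in auto)
  thus "birk \<phi> x T<=(\<Sum>i<n. a i * ind (\<alpha> -` {i}) x)" using bk[of x] by simp
 qed
 also have "\<dots> = (\<Sum>i<n. p i * a i)"
  using simple_functionD(2)[OF \<alpha>] by (subst Bochner_Integration.integral_sum) (auto simp: p_def emeasure_eq_measure mult.commute)
 finally have i1: "T * integral\<^sup>L m \<phi><=(\<Sum>i<n. p i * a i)" .
 have "T * hrate f m \<eta><=ent m \<alpha>" by (rule almost_expansive_hrate_le[OF Z T \<alpha> _ \<eta>]) (rule close)
 also have "ent m \<alpha> = (\<Sum>i<n. - plogp (p i))" using ent_superset[of "{..<n}" \<alpha>] \<alpha>1 by (auto simp: p_def sum_negf)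
 finally have "T * (hrate f m \<eta>+integral\<^sup>L m \<phi>)<=(\<Sum>i<n. - plogp (p i)+p i * a i)" unfolding sum.distrib distrib_left using i1 by linarith
 also have "\<dots> = (\<Sum>i<k. - plogp (p i)+p i * a i)+(SUM i:{k..<n}. - plogp (p i)+p i * a i)"
  by (subst sum.union_disjoint[symmetric]) (use kn in \<open>auto intro!: sum.cong\<close>)
 finally have main: "T * (hrate f m \<eta>+integral\<^sup>L m \<phi>)<=(\<Sum>i<k. - plogp (p i)+p i * a i)+(SUM i:{k..<n}. - plogp (p i)+p i * a i)" .
 define \<sigma> where "\<sigma> = (\<Sum>i<k. p i)"
 have p0: "0<=p i" for i by (simp add: p_def)
 have "(\<Sum>i<n. p i) = \<sigma>+(SUM i:{k..<n}. p i)" unfolding \<sigma>_def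
  by (subst sum.union_disjoint[symmetric]) (use kn in \<open>auto intro!: sum.cong\<close>)
 hence \<sigma>c: "(SUM i:{k..<n}. p i) = 1-\<sigma>" using psum by simp
 have \<sigma>01: "0<=\<sigma>" "\<sigma><=1" using \<sigma>c sum_nonneg[of "{k..<n}" p] sum_nonneg[of "{..<k}" p] p0 by (auto simp: \<sigma>_def)
 have usum: "(\<Sum>i<k. exp (a i))<=c"
 proof -
  have "(\<Sum>i<k. exp (a i)) = (SUM i:{0..<length us}. exp (snd (us ! i)))" by (rule sum.cong) (auto simp: a_def ws_def nth_append k_def)
  thus ?thesis using us(5) by (simp add: sum_list_sum_nth)
 qed
 have vsum: "(SUM i:{k..<n}. exp (a i))<=c'"
 proof -
  have "(SUM i:{k..<n}. exp (a i)) = (SUM i:{0..<length vs}. exp (snd (vs ! i)))"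
   by (rule sum.reindex_bij_witness[of _ "%i. i+k" "%i. i-k"]) (auto simp: a_def ws_def nth_append k_def n_def)
  thus ?thesis using vs(5) by (simp add: sum_list_sum_nth)
 qed
 have part: "(SUM i:I. - plogp (p i)+p i * a i) <= - plogp (SUM i:I. p i)+(SUM i:I. p i) * ln C&((SUM i:I. p i) > 0 --> C > 0)"
  if I: "finite I" "(SUM i:I. exp (a i))<=C" for I C
 proof (cases "I = {}")
  case False
  have "0 < (SUM i:I. exp (a i))" using I False by (intro sum_pos) auto
  hence "(SUM i:I. p i) * ln (SUM i:I. exp (a i))<=(SUM i:I. p i) * ln C" "C > 0" using I p0 by (auto intro!: mult_left_mono sum_nonneg)
  thus ?thesis using log_sum_exp[OF I(1) False,where p = p and a = a,OF p0] by (intro conjI impI; linarith)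
 qed simp
 \<comment> \<open>The entropy of the two-element partition into these groups of cells, at most
   \<open>ln 2\<close> by the Gibbs inequality with vanishing exponents.\<close>
 have "!!b. 0<=(if b then \<sigma> else 1-\<sigma>)" using \<sigma>01 by simp
 hence "- plogp \<sigma> - plogp (1-\<sigma>)<=ln 2"
  using log_sum_exp[where I = "UNIV :: bool set" and p = "%b. if b then \<sigma> else 1-\<sigma>" and a = "%_. 0"] \<sigma>01
  by (simp add: UNIV_bool split: if_splits)
 hence "T * (hrate f m \<eta>+integral\<^sup>L m \<phi>)<=ln 2+\<sigma> * ln c+(1-\<sigma>) * ln c'"
  using main part[OF finite_lessThan usum] part[OF finite_atLeastLessThan vsum] unfolding \<sigma>_def[symmetric] \<sigma>c by linarith
 moreover have "measure m S<=\<sigma>"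
 proof -
  have "S\<subseteq>(\<Union>i<k. \<alpha> -` {i})"
  proof
   fix x assume "x\<in>S"
   hence "x\<in>(\<Union>u\<in>set us. fst u)" using us(4) by blast
   then obtain u where "u\<in>set us" "x\<in>fst u" by (rule UN_E)
   then obtain i where "i < k" "x\<in>fst (us ! i)" unfolding in_set_conv_nth k_def by metis
   hence i: "i < k" "x\<in>fst (ws ! i)" by (auto simp: k_def ws_def nth_append)
   hence "\<alpha> x<=i" unfolding \<alpha>_def by (intro Least_le) (auto simp: n_def k_def ws_def)
   thus "x\<in>(\<Union>i<k. \<alpha> -` {i})" using i by auto
  qed
  moreover have sb: "\<alpha> -` {i}\<in>sets m" for i using simple_functionD(2)[OF \<alpha>, of "{i}"] by simp
  \<comment> \<open>For nonmeasurable \<open>S\<close> the value of \<open>measure\<close> is 0 by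
    convention and the bound is trivial.\<close>
  ultimately have "measure m S<=measure m (\<Union>i<k. \<alpha> -` {i})" by (cases "S\<in>sets m") (auto simp: measure_notin_sets intro!: finite_measure_mono)
  also have "\<dots> = \<sigma>" unfolding \<sigma>_def p_def by (rule finite_measure_finite_Union) (use sb in \<open>auto simp: disjoint_family_on_def\<close>)
  finally show ?thesis .
 qed
 moreover have "\<sigma> > 0 ==> c > 0" using part[OF finite_lessThan usum] by (simp add: \<sigma>_def)
 ultimately show thesis using \<sigma>01 that by blast
qed

end


section \<open>Growth rates of partition sums\<close>

lemma elog_less_iff: "elog x < ereal a \<longleftrightarrow> x < ereal (exp a)"
proof (cases x)
 case (real r)
 thus ?thesis
 proof (cases "r<=0")
  case True
  hence "r < exp a" using exp_gt_zero[of a] by linarith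
  thus ?thesis using True real by (simp add: elog_def)
 next
  case False
  thus ?thesis using real exp_less_cancel_iff[of "ln r" a] by (simp add: elog_def)
 qed
qed (auto simp: elog_def)

lemma elog_mono: "x<=y ==> elog x<=elog y" by (cases x; cases y) (auto simp: elog_def)

lemma growth_rate_upper:
 assumes "growth_rate L < ereal c"
 shows "\<forall>\<^sub>F t in at_top. L t<=ereal (exp (c * t))"
proof -
 have "\<forall>\<^sub>F t in at_top. elog (L t)/ereal t < ereal c" using Limsup_lessD[OF assms[unfolded growth_rate_def]] .
 thus ?thesis using eventually_gt_at_top[of 0]
 proof eventually_elim
  case (elim t)
  hence "elog (L t) < ereal (c * t)" by (cases "elog (L t)") (auto simp: divide_less_eq)
  thus ?case by (simp add: elog_less_iff)
 qed
qed

lemma growth_rate_lower: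
 assumes "ereal c < growth_rate L"
 obtains t where "t > T" "ereal (exp (c * t))<=L t"
proof (rule ccontr)
 assume no: "\<not> thesis"
 have "growth_rate L<=ereal c" unfolding growth_rate_def
 proof (rule Limsup_bounded)
  show "\<forall>\<^sub>F t in at_top. elog (L t)/ereal t<=ereal c" using eventually_gt_at_top[of T] eventually_gt_at_top[of 0]
  proof eventually_elim
   case (elim t)
   hence "L t < ereal (exp (c * t))" using no that not_le by blast
   hence "elog (L t) < ereal (c * t)" by (simp add: elog_less_iff)
   thus ?case using elim(2) by (cases "elog (L t)") (auto simp: divide_le_eq)
  qed
 qed
 thus False using assms by simp
qed

lemma growth_rate_mono: "(!!t. L t<=L' t) ==> growth_rate L<=growth_rate L'" unfolding growth_rate_def
 by (intro Limsup_mono eventually_mono[OF eventually_gt_at_top[of 0]] ereal_divide_right_mono elog_mono) auto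

section \<open>Pressure, free energy and covers at the fixed mesh\<close>

context flow_potential
begin

abbreviation "sep_rate r == growth_rate (Lambda_gen f (birk \<phi>) (UNIV\<times>{0..}) r)"

lemma sep_rate_antimono: "r<=r' ==> sep_rate r'<=sep_rate r"
proof (intro growth_rate_mono)
 fix t assume "r<=r'"
 hence "separated f t r' E ==> separated f t r E" for E unfolding separated_def by (meson le_less_trans)
 thus "Lambda_gen f (birk \<phi>) (UNIV\<times>{0..}) r' t<=Lambda_gen f (birk \<phi>) (UNIV\<times>{0..}) r t"
  unfolding Lambda_gen_def by (intro Sup_subset_mono) auto
qed

text \<open>Smaller scales admit more separated sets, so the limit defining the pressure is monotone
  and equals the supremum.\<close>

lemma top_pressure_SUP: "top_pressure f \<phi> = (SUP r\<in>{0<..}. sep_rate r)"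
proof -
 have "((%r. sep_rate r) \<longlongrightarrow> (SUP r\<in>{0<..}. sep_rate r)) (at_right 0)"
 proof (rule order_tendstoI)
  fix a assume "a < (SUP r\<in>{0<..}. sep_rate r)"
  then obtain r0 where r0: "r0 > 0" "a < sep_rate r0" by (auto simp: less_SUP_iff)
  show "\<forall>\<^sub>F r in at_right 0. a < sep_rate r" unfolding eventually_at_right_field
   by (rule exI[of _ r0]) (use r0 sep_rate_antimono in \<open>auto intro: less_le_trans\<close>)
 next
  fix a assume a: "(SUP r\<in>{0<..}. sep_rate r) < a"
  have "sep_rate r < a" if "0 < r" for r by (rule le_less_trans[OF SUP_upper a]) (use that in simp)
  thus "\<forall>\<^sub>F r in at_right 0. sep_rate r < a" by (rule eventually_mono[OF eventually_at_right_less])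
 qed
 thus ?thesis unfolding top_pressure_def by (intro tendsto_Lim) auto
qed

lemma separated_sum_upper:
 assumes "top_pressure f \<phi> < ereal c" "r > 0"
 shows "\<forall>\<^sub>F t in at_top. ALL E. finite E --> separated f t r E --> (psum E t)<=exp (c * t)"
proof -
 have "sep_rate r<=top_pressure f \<phi>" unfolding top_pressure_SUP using assms by (intro SUP_upper) auto
 hence "sep_rate r < ereal c" using assms by simp
 from growth_rate_upper[OF this] show ?thesis using eventually_ge_at_top[of 0]
 proof eventually_elim
  case (elim t)
  show ?case
  proof (intro allI impI)
   fix E assume E: "finite E" "separated f t r E"
   have "ereal (psum E t)<=Lambda_gen f (birk \<phi>) (UNIV\<times>{0..}) r t" unfolding Lambda_gen_def using E elim(2) by (intro Sup_upper) (auto simp: slice_def)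
   also note elim(1)
   finally show "(psum E t)<=exp (c * t)" by simp
  qed
 qed
qed

text \<open>One scale \<open>r\<close> at which the growth rate exceeds \<open>c\<close> is enough,
  since the limit measure is built from separated sets of a single scale.\<close>

lemma variational_lower:
 assumes "ereal c < top_pressure f \<phi>"
 obtains \<mu> where "invariant_measure f \<mu>" "ereal c<=free_energy f \<phi> \<mu>"
proof -
 from assms obtain r where r: "r > 0" "ereal c < sep_rate r" unfolding top_pressure_SUP less_SUP_iff by auto
 have "EX t E. t > real k&finite E&E~={}&separated f t r E&c * t-0<=ln (psum E t)" for k :: nat
 proof -
  obtain c' where c': "ereal c < c'" "c' < sep_rate r" using dense[OF r(2)] by blast
  then obtain d where d: "c' = ereal d" by (cases c') auto
  from growth_rate_lower[OF c'(2)[unfolded d]] obtain t where t: "t > real k"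
   "ereal (exp (d * t))<=Lambda_gen f (birk \<phi>) (UNIV\<times>{0..}) r t" by blast
  have "c * t < d * t" using c'(1) d t(1) by (intro mult_strict_right_mono) auto
  hence "ereal (exp (c * t)) < Lambda_gen f (birk \<phi>) (UNIV\<times>{0..}) r t" using t(2) by (intro less_le_trans[OF _ t(2)]) simp
  then obtain E where E: "finite E" "separated f t r E" "exp (c * t) < (psum E t)" unfolding Lambda_gen_def less_Sup_iff by auto
  moreover have "E~={}" using E(3) exp_gt_zero[of "c * t"] by (intro notI) simp
  moreover have "c * t-0<=ln (psum E t)" using E(3) by (subst diff_0_right, subst ln_ge_iff) (auto intro: order.strict_trans[OF exp_gt_zero])
  ultimately show ?thesis using t by blast
 qed
 then obtain t E where tE: "!!k. t k > real k" "!!k. finite (E k)" "!!k. E k~={}" "!!k. separated f (t k) r (E k)"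
  "!!k. c * t k-0<=ln (psum (E k) (t k))" by metis
 have t0: "0<=t k" for k using tE(1)[of k] of_nat_0_le_iff[of k] by linarith
 have tinf: "filterlim t at_top sequentially" by (rule filterlim_at_top_mono[OF filterlim_real_sequentially]) (intro always_eventually allI less_imp_le tE(1))
 show thesis by (rule misiurewicz[OF \<phi> r(1) tE(2-4) t0 tinf tE(5) refl refl]) (rule that)
qed

text \<open>Replaces the supremum in the entropy by a single partition, so that a strict inequality
  can be integrated over ergodic components.\<close>

lemma free_energy_witness:
 assumes inv: "invariant_measure f \<mu>" and c: "ereal c < free_energy f \<phi> \<mu>"
 obtains \<eta> :: "'a=>'a set" where "simple_function \<mu> \<eta>" "c < hrate f \<mu> \<eta>+integral\<^sup>L \<mu> \<phi>"
proof -
 interpret compact_inv_flow f \<mu> by (rule compact_inv_flowI[OF inv])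
 have "\<exists>\<eta> :: 'a=>'a set. simple_function \<mu> \<eta>&c < hrate f \<mu> \<eta>+integral\<^sup>L \<mu> \<phi>"
 proof (rule ccontr)
  assume no: "\<not> ?thesis"
  have "ks_entropy f \<mu><=ereal (c-integral\<^sup>L \<mu> \<phi>)"
  proof (rule ks_entropy_le)
   fix \<eta> :: "'a=>'a set" assume "simple_function \<mu> \<eta>"
   hence "\<not> c < hrate f \<mu> \<eta>+integral\<^sup>L \<mu> \<phi>" using no by blast
   thus "ereal (hrate f \<mu> \<eta>)<=ereal (c-integral\<^sup>L \<mu> \<phi>)" by simp
  qed
  thus False using c unfolding free_energy_def by (cases "ks_entropy f \<mu>") auto
 qed
 thus thesis using that by blast
qed

text \<open>If almost no component exceeded \<open>c\<close>, integration over the decomposition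
  would contradict the bound for \<open>\<mu>\<close>. The component keeps the same
  \<open>\<eta>\<close>.\<close>

lemma ergodic_witness:
 assumes inv: "invariant_measure f \<mu>" and \<eta>: "simple_function \<mu> (\<eta> :: 'a=>'a set)" "c < hrate f \<mu> \<eta>+integral\<^sup>L \<mu> \<phi>"
 obtains m where "ergodic_measure f m" "c < hrate f m \<eta>+integral\<^sup>L m \<phi>" "ereal c < free_energy f \<phi> m" "simple_function m \<eta>"
proof -
 interpret compact_inv_flow f \<mu> by (rule compact_inv_flowI[OF inv])
 from entropy_decomposition obtain \<nu> where \<nu>: "!!x. invariant_measure f (\<nu> x)" "AE x in \<mu>. ergodic_measure f (\<nu> x)"
  "integrable \<mu> (%x. integral\<^sup>L (\<nu> x) \<phi>)" "(LINT x|\<mu>. \<phi> x) = (LINT x|\<mu>. integral\<^sup>L (\<nu> x) \<phi>)"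
  "integrable \<mu> (%x. hrate f (\<nu> x) \<eta>)" "hrate f \<mu> \<eta><=(LINT x|\<mu>. hrate f (\<nu> x) \<eta>)"
 proof (rule entropy_decomposition)
  fix \<nu> :: "'a=>'a measure"
  assume "!!x. invariant_measure f (\<nu> x)" "AE x in \<mu>. ergodic_measure f (\<nu> x)"
  "!!g :: 'a=>real. cts g ==> integrable \<mu> (%x. integral\<^sup>L (\<nu> x) g)"
  "!!g :: 'a=>real. cts g ==> (LINT x|\<mu>. g x) = (LINT x|\<mu>. integral\<^sup>L (\<nu> x) g)"
  "!!c :: 'a=>'a set. simple_function \<mu> c ==> integrable \<mu> (%x. hrate f (\<nu> x) c)"
  "!!c :: 'a=>'a set. simple_function \<mu> c ==> hrate f \<mu> c<=(LINT x|\<mu>. hrate f (\<nu> x) c)"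
  thus thesis using that \<phi> \<eta>(1) by blast
 qed
 have "\<not> (AE x in \<mu>. hrate f (\<nu> x) \<eta>+integral\<^sup>L (\<nu> x) \<phi><=c)"
 proof
  assume "AE x in \<mu>. hrate f (\<nu> x) \<eta>+integral\<^sup>L (\<nu> x) \<phi><=c"
  hence "(LINT x|\<mu>. hrate f (\<nu> x) \<eta>+integral\<^sup>L (\<nu> x) \<phi>)<=(LINT x|\<mu>. c)" using \<nu>(3,5) by (intro integral_mono_AE) auto
  thus False using \<nu>(3-6) \<eta>(2) prob_space by simp
 qed
 then obtain x where x: "ergodic_measure f (\<nu> x)" "c < hrate f (\<nu> x) \<eta>+integral\<^sup>L (\<nu> x) \<phi>"
  using \<nu>(2) by (metis (mono_tags, lifting) AE_mp AE_I2 not_le)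
 interpret x: compact_inv_flow f "\<nu> x" by (rule compact_inv_flowI[OF \<nu>(1)])
 have sx: "simple_function (\<nu> x) \<eta>" using \<eta>(1) by (simp add: simple_function_def)
 have "ereal (hrate f (\<nu> x) \<eta>)<=ks_entropy f (\<nu> x)" by (rule x.hrate_le_ks[OF sx])
 hence "ereal c < free_energy f \<phi> (\<nu> x)" using x(2) unfolding free_energy_def by (cases "ks_entropy f (\<nu> x)") auto
 with x sx show thesis by (intro that)
qed

lemma NE_null:
 assumes "ergodic_measure f m" "P_perp_exp f \<phi> \<epsilon> < free_energy f \<phi> m"
 obtains Z where "Z\<in>sets borel" "NE f \<epsilon>\<subseteq>Z" "measure m Z = 0"
proof -
 have "\<not> positive_outer m (NE f \<epsilon>)"
 proof
  assume "positive_outer m (NE f \<epsilon>)"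
  hence "free_energy f \<phi> m<=P_perp_exp f \<phi> \<epsilon>" unfolding P_perp_exp_def using assms(1) by (intro Sup_upper) auto
  thus False using assms(2) by simp
 qed
 then obtain A where "A\<in>sets m" "NE f \<epsilon>\<subseteq>A" "emeasure m A = 0" unfolding positive_outer_def by blast
 moreover have "sets m = sets borel" using assms(1) by (simp add: ergodic_measure_def invariant_measure_def)
 ultimately show thesis by (intro that[of A]) (auto simp: measure_def)
qed

text \<open>Pressure is a limit over vanishing scales, yet covers of the fixed mesh
  \<open>\<epsilon>\<close> control it. Otherwise some ergodic measure would have free energy above
  both the claimed bound and \<open>P_perp_exp\<close>; it is almost expansive, so the Gibbs
  inequality at mesh \<open>\<epsilon>\<close> contradicts this.\<close>

lemma pressure_cov_lower:
 assumes perp: "P_perp_exp f \<phi> \<epsilon> < top_pressure f \<phi>" and n: "n>=(1 :: nat)" and c: "cov n \<epsilon> UNIV c"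
 shows "top_pressure f \<phi><=ereal ((ln 2+ln c)/n)"
proof (rule ccontr)
 assume "\<not> top_pressure f \<phi><=ereal ((ln 2+ln c)/n)"
 hence "max (ereal ((ln 2+ln c)/n)) (P_perp_exp f \<phi> \<epsilon>) < top_pressure f \<phi>" using perp by simp
 from dense[OF this] obtain b where b: "ereal ((ln 2+ln c)/n) < b" "P_perp_exp f \<phi> \<epsilon> < b" "b < top_pressure f \<phi>" by auto
 from dense[OF b(3)] obtain b' where b': "b < b'" "b' < top_pressure f \<phi>" by blast
 from b b' obtain r r' where r: "b = ereal r" "b' = ereal r'" by (cases b; cases b') auto
 from variational_lower[of r'] b' r obtain \<mu> where \<mu>: "invariant_measure f \<mu>" "ereal r'<=free_energy f \<phi> \<mu>" by auto
 have "ereal r < free_energy f \<phi> \<mu>" using b'(1)[unfolded r] \<mu>(2) by (rule less_le_trans)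
 from free_energy_witness[OF \<mu>(1) this] obtain \<eta> :: "'a=>'a set" where \<eta>: "simple_function \<mu> \<eta>" "r < hrate f \<mu> \<eta>+integral\<^sup>L \<mu> \<phi>" by blast
 from ergodic_witness[OF \<mu>(1) \<eta>] obtain m where m: "ergodic_measure f m" "r < hrate f m \<eta>+integral\<^sup>L m \<phi>" "ereal r < free_energy f \<phi> m" "simple_function m \<eta>" by blast
 have "P_perp_exp f \<phi> \<epsilon> < free_energy f \<phi> m" using b(2)[unfolded r] m(3) by (rule less_trans)
 from NE_null[OF m(1) this] obtain Z where Z: "Z\<in>sets borel" "NE f \<epsilon>\<subseteq>Z" "measure m Z = 0" by blast
 have mi: "invariant_measure f m" using m(1) by (simp add: ergodic_measure_def)
 from gibbs_cover[OF mi Z n c c m(4)] obtain \<sigma> where "n * (hrate f m \<eta>+integral\<^sup>L m \<phi>)<=ln 2+\<sigma> * ln c+(1-\<sigma>) * ln c" by blast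
 also have "\<dots> = ln 2+ln c" by (simp add: algebra_simps)
 finally have "hrate f m \<eta>+integral\<^sup>L m \<phi><=(ln 2+ln c)/n" using n by (simp add: field_simps)
 thus False using m(2) b(1) r by simp
qed

end


section \<open>Upper bounds for partition sums\<close>

lemma sum_lists_power:
 fixes h :: "'a=>real"
 assumes "finite E"
 shows "(SUM xs:{xs. set xs\<subseteq>E&length xs = k}. \<Prod>x\<leftarrow>xs. h x) = (SUM x:E. h x) ^ k"
proof (induction k)
 case 0
 have "{xs :: 'a list. set xs\<subseteq>E&length xs = 0} = {[]}" by auto
 thus ?case by simp
next
 case (Suc k)
 let ?L = "{xs. set xs\<subseteq>E&length xs = k}"
 have "{xs. set xs\<subseteq>E&length xs = Suc k} = (%(x,xs). x # xs) ` (E\<times>?L)" by (auto simp: length_Suc_conv image_iff)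
 moreover have "inj_on (%(x,xs). x # xs) (E\<times>?L)" by (auto simp: inj_on_def)
 ultimately have "(SUM xs:{xs. set xs\<subseteq>E&length xs = Suc k}. \<Prod>x\<leftarrow>xs. h x) = (\<Sum>(x,xs)\<in>E\<times>?L. h x * (\<Prod>x\<leftarrow>xs. h x))"
  by (simp add: sum.reindex case_prod_beta')
 also have "\<dots> = (SUM x:E. h x)*(SUM xs:?L. \<Prod>x\<leftarrow>xs. h x)" by (simp add: sum.cartesian_product[symmetric] sum_product)
 finally show ?case using Suc by simp
qed

lemma exp_sum_list: "exp (\<Sum>x\<leftarrow>xs. h x) = (\<Prod>x\<leftarrow>xs. exp (h x :: real))" by (induction xs) (auto simp: exp_add)

context compact_flow
begin

text \<open>Gluing times are set to 0 from the last segment on, so that they are bounded for all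
  indices, and Bowen distances are spelled out pointwise.\<close>

lemma W_spec_shadow:
 assumes "W_spec f G' \<delta>" "G'\<subseteq>orbit_segments"
 obtains \<tau> where "\<tau> > 0" "!!xs. set xs\<subseteq>G' ==> EX y \<theta>. (ALL i. 0<=\<theta> i&\<theta> i<=\<tau>) &
  (ALL j<length xs. ALL s:{0..snd (xs ! j)}. dist (f (s+((\<Sum>i<j. snd (xs ! i))+(\<Sum>i<j. \<theta> i))) y) (f s (fst (xs ! j))) < \<delta>)"
 using assms(1) unfolding W_spec_def
proof (elim exE conjE)
 fix \<tau> :: real and Tau :: "('a\<times>real) list=>nat=>real" assume \<tau>: "\<tau> > 0" and Tau: "ALL xs. set xs\<subseteq>G' -->
    (ALL i. i+1 < length xs --> Tau xs i\<in>{0..\<tau>}) &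
    (EX y. ALL j<length xs. bowen_dist f (snd (xs ! j)) (f ((\<Sum>i<j. snd (xs ! i))+(\<Sum>i<j. Tau xs i)) y) (fst (xs ! j)) < \<delta>)"
 show thesis
 proof (rule that[OF \<tau>])
  fix xs assume xs: "set xs\<subseteq>G'"
  have T1: "!!i. i+1 < length xs ==> 0<=Tau xs i&Tau xs i<=\<tau>" using Tau[rule_format,OF xs] by simp
  obtain y where y: "!!j. j < length xs ==> bowen_dist f (snd (xs ! j)) (f ((\<Sum>i<j. snd (xs ! i))+(\<Sum>i<j. Tau xs i)) y) (fst (xs ! j)) < \<delta>"
   using Tau[rule_format,OF xs,THEN conjunct2] by (elim exE) (rule that, drule spec, erule mp)
  define \<theta> where "\<theta> i = (if i+1 < length xs then Tau xs i else 0)" for i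
  have "dist (f (s+((\<Sum>i<j. snd (xs ! i))+(\<Sum>i<j. \<theta> i))) y) (f s (fst (xs ! j))) < \<delta>" if j: "j < length xs" and s: "s\<in>{0..snd (xs ! j)}" for j s
  proof -
   have "(\<Sum>i<j. \<theta> i) = (\<Sum>i<j. Tau xs i)" by (rule sum.cong) (use j in \<open>auto simp: \<theta>_def\<close>)
   moreover have "0<=snd (xs ! j)" using nth_mem[OF j] xs assms(2) by (auto simp: orbit_segments_def)
   ultimately show ?thesis using y[OF j] s by (simp add: bowen_dist_less f_add)
  qed
  moreover have "0<=\<theta> i&\<theta> i<=\<tau>" for i using T1 \<tau> by (auto simp: \<theta>_def)
  ultimately show "EX y \<theta>. (ALL i. 0<=\<theta> i&\<theta> i<=\<tau>) &
   (ALL j<length xs. ALL s:{0..snd (xs ! j)}. dist (f (s+((\<Sum>i<j. snd (xs ! i))+(\<Sum>i<j. \<theta> i))) y) (f s (fst (xs ! j))) < \<delta>)" by blast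
 qed
qed

end

locale nonuniform = flow_potential f \<phi> for f :: "real=>'a::metric_space=>'a" and \<phi> +
 fixes \<delta> \<epsilon> :: real and D P G S :: "('a\<times>real) set" and p g s :: "'a\<times>real=>real"
 assumes \<delta>: "\<delta> > 0" and \<epsilon>: "\<epsilon> > 40*\<delta>"
  and perp: "P_perp_exp f \<phi> \<epsilon> < top_pressure f \<phi>"
  and dec: "decomposition f D P G S p g s"
  and spec: "!!M. M>=0 ==> tail_W_spec f (G_M D p s M) \<delta>"
  and bowen: "bowen_property f \<phi> \<epsilon> G"
  and small: "pressure_C f ((orbit_segments-D)\<union>bracket f P\<union>bracket f S) \<phi> \<delta> \<epsilon> < top_pressure f \<phi>"
begin

definition Pr :: real where "Pr = real_of_ereal (top_pressure f \<phi>)"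

abbreviation "GM M == G_M D p s M"

text \<open>A cover for time 1 bounds the pressure from above, and the strict gap
  \<open>perp\<close> excludes minus infinity.\<close>

lemma top_pressure_real: "top_pressure f \<phi> = ereal Pr"
proof -
 obtain N where "cov 1 \<epsilon> UNIV N" using cov_bounded_time[of \<epsilon> 1] \<epsilon> \<delta> by (metis less_trans mult_pos_pos order_refl zero_le_one zero_less_numeral)
 hence "top_pressure f \<phi><=ereal ((ln 2+ln N)/1)" using pressure_cov_lower[OF perp,of 1 N] by simp
 thus ?thesis using perp unfolding Pr_def by (cases "top_pressure f \<phi>") auto
qed

lemma potential_bound: obtains b where "b > 0" "!!x t. 0<=t ==> \<bar>birk \<phi> x t\<bar><=b * t"
 using bounded_fun[OF \<phi>] birkhoff_abs_le[OF \<phi>] by metis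

lemma GM_D: "(x,t)\<in>GM M ==> (x,t)\<in>D&0<=p (x,t)&p (x,t)<=M&0<=s (x,t)&s (x,t)<=M&0<=g (x,t)
  & t = p (x,t)+g (x,t)+s (x,t)&(f (p (x,t)) x,g (x,t))\<in>G" using dec unfolding G_M_def decomposition_def by auto

lemma Phi_eps_upper: "0<=t ==> y\<in>bowen_ball f t x \<epsilon> ==> birk \<phi> y t<=Phi_eps f \<phi> \<epsilon> x t"
 unfolding Phi_eps_def
proof (rule cSup_upper)
 assume t: "0<=t"
 obtain b where "b > 0" "!!x t. 0<=t ==> \<bar>birk \<phi> x t\<bar><=b * t" using potential_bound by blast
 thus "bdd_above ((%y. birk \<phi> y t) ` bowen_ball f t x \<epsilon>)" using t by (intro bdd_aboveI[of _ "b * t"]) (auto simp: abs_le_iff)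
qed auto

text \<open>Lets constants valid on a bounded range of times enter exponential bounds, whatever the
  sign of the exponent.\<close>

lemma bounded_range_absorb:
 fixes T a N :: real assumes "N > 0" "0<=t" "t<=T"
 shows "N<=(N * exp (\<bar>a\<bar> * T)) * exp (a * t)"
proof -
 have "\<bar>a\<bar> * t<=\<bar>a\<bar> * T" using assms by (intro mult_left_mono) auto
 moreover have "- \<bar>a\<bar> * t<=a * t" using assms by (intro mult_right_mono) auto
 ultimately have "0<=\<bar>a\<bar> * T+a * t" by simp
 hence "1<=exp (\<bar>a\<bar> * T+a * t)" by simp
 hence "N * 1<=N * exp (\<bar>a\<bar> * T+a * t)" using assms by (intro mult_left_mono) auto
 thus ?thesis by (simp add: exp_add mult.assoc)
qed

text \<open>The strict inequality \<open>small\<close> leaves an exponential gap \<open>a\<close>. A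
  maximal \<open>\<delta>\<close>-separated set spans, and as \<open>\<delta>\<close> is below
  \<open>\<epsilon>\<close> the value \<open>Phi_eps\<close> bounds the Birkhoff integrals on the
  whole closed ball; doubling the radius gives mesh \<open>2*\<delta>\<close>.\<close>

lemma bad_segments_cover:
 obtains C a where "C > 0" "a > 0" "!!n :: nat. cov n (2*\<delta>) (slice ((orbit_segments-D)\<union>bracket f P\<union>bracket f S) n) (C * exp ((Pr-a) * n))"
proof -
 let ?C = "(orbit_segments-D)\<union>bracket f P\<union>bracket f S"
 from dense[OF small] obtain z where z: "pressure_C f ?C \<phi> \<delta> \<epsilon> < z" "z < top_pressure f \<phi>" by blast
 then obtain d where d: "z = ereal d" by (cases z) (auto simp: top_pressure_real)
 have dP: "d < Pr" using z d by (simp add: top_pressure_real)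
 from growth_rate_upper[OF z(1)[unfolded d pressure_C_def]] obtain T where T: "!!t. t>=T ==> Lambda f ?C \<phi> \<delta> \<epsilon> t<=ereal (exp (d * t))"
  unfolding eventually_at_top_linorder by blast
 have "2*\<delta> > 0" using \<delta> by simp
 from cov_bounded_time[OF this,of "\<bar>T\<bar>"] obtain N where N: "N > 0" "!!t. 0<=t ==> t<=\<bar>T\<bar> ==> cov t (2*\<delta>) UNIV N" by blast
 let ?K = "1+N * exp (\<bar>d\<bar>*\<bar>T\<bar>)"
 show thesis
 proof (rule that[of ?K "Pr-d"])
  show "?K > 0" using N by (intro add_pos_nonneg) auto
  fix n :: nat
  have "cov n (2*\<delta>) (slice ?C n) (?K * exp (d * n))"
  proof (cases "real n>=T")
   case True
   have "separated f n \<delta> {}" by (simp add: separated_def)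
   then obtain E where E: "E\<subseteq>slice ?C n" "finite E" "separated f n \<delta> E"
    "!!x. x\<in>slice ?C n ==> EX y:E. near (real n) \<delta> y x"
    by (rule maximal_separated[OF \<delta> of_nat_0_le_iff empty_subsetI[of "slice ?C n"]]) (rule that)
   have "cov n (2*\<delta>) (slice ?C n) (SUM x:E. exp (Phi_eps f \<phi> \<epsilon> x n))"
   proof (rule cov_of_spanning[OF E(2,4)])
    fix x y assume "!!s. s\<in>{0..real n} ==> dist (f s x) (f s y)<=\<delta>"
    hence "y\<in>bowen_ball f n x \<epsilon>" using \<delta> \<epsilon> by (fastforce simp: bowen_ball_iff)
    thus "birk \<phi> y n<=Phi_eps f \<phi> \<epsilon> x n" by (intro Phi_eps_upper) auto
   qed
   have "ereal (SUM x:E. exp (Phi_eps f \<phi> \<epsilon> x n))<=Lambda f ?C \<phi> \<delta> \<epsilon> n"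
    unfolding Lambda_def Lambda_gen_def using E by (intro Sup_upper) auto
   hence "ereal (SUM x:E. exp (Phi_eps f \<phi> \<epsilon> x n))<=ereal (exp (d * n))" using T[OF True] by (rule order_trans)
   hence "(SUM x:E. exp (Phi_eps f \<phi> \<epsilon> x n))<=exp (d * n)" by (simp only: ereal_less_eq)
   also have "exp (d * n)<=?K * exp (d * n)" using N(1) by (simp add: distrib_right)
   finally show ?thesis by (rule cov_mono[OF \<open>cov n (2 * \<delta>) (slice ?C n) (SUM x:E. exp (Phi_eps f \<phi> \<epsilon> x n))\<close> subset_refl])
  next
   case False
   have "N<=N * exp (\<bar>d\<bar>*\<bar>T\<bar>) * exp (d * n)" by (rule bounded_range_absorb) (use False N(1) in auto)
   also have "\<dots><=?K * exp (d * n)" by (simp add: distrib_right)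
   finally have le: "N<=?K * exp (d * n)" .
   have "cov n (2*\<delta>) UNIV N" using False by (intro N(2)) auto
   thus ?thesis by (rule cov_mono[OF _ subset_UNIV le])
  qed
  thus "cov n (2*\<delta>) (slice ?C n) (?K * exp ((Pr-(Pr-d)) * n))" by simp
 qed (use dP in simp)
qed

text \<open>Prefix and suffix last at most \<open>M\<close> each; on either of them both orbits
  contribute at most \<open>b * M\<close>, which makes four such terms beside the constant of
  \<open>G\<close>.\<close>

lemma bowen_GM:
 assumes "M>=0"
 obtains K where "K > 0" "!!x t y. (x,t)\<in>GM M ==> y\<in>bowen_ball f t x \<epsilon> ==> \<bar>birk \<phi> x t-birk \<phi> y t\<bar><=K"
proof -
 from bowen obtain K where K: "!!x t y. (x,t)\<in>G ==> y\<in>bowen_ball f t x \<epsilon> ==> \<bar>birk \<phi> x t-birk \<phi> y t\<bar><=K"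
  unfolding bowen_property_def by blast
 obtain b where b: "b > 0" "!!x t. 0<=t ==> \<bar>birk \<phi> x t\<bar><=b * t" using potential_bound by blast
 show thesis
 proof (rule that[of "\<bar>K\<bar>+4*(b * M)+1"])
  show "\<bar>K\<bar>+4*(b * M)+1 > 0" using b assms by (intro add_nonneg_pos add_nonneg_nonneg) auto
  fix x t y assume xt: "(x,t)\<in>GM M" and y: "y\<in>bowen_ball f t x \<epsilon>"
  define u v w where "u = p (x,t)" and "v = g (x,t)" and "w = s (x,t)"
  have uvw: "0<=u" "u<=M" "0<=w" "w<=M" "0<=v" "t = u+v+w" "(f u x,v)\<in>G" using GM_D[OF xt] by (auto simp: u_def v_def w_def)
  have split: "birk \<phi> z t = birk \<phi> z u+birk \<phi> (f u z) v+birk \<phi> (f (u+v) z) w" for z using uvw by (simp add: birkhoff_add[OF \<phi>])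
  have "f u y\<in>bowen_ball f v (f u x) \<epsilon>" using y uvw by (auto simp: bowen_ball_iff f_add[symmetric])
  from K[OF uvw(7) this] have "\<bar>birk \<phi> (f u x) v-birk \<phi> (f u y) v\<bar><=\<bar>K\<bar>" by simp
  moreover have bM: "\<bar>birk \<phi> z r\<bar><=b * M" if "0<=r" "r<=M" for z r
   using that b(1) by (intro order_trans[OF b(2)[OF that(1)]] mult_left_mono) auto
  note bM[OF uvw(1,2),of x] bM[OF uvw(1,2),of y] bM[OF uvw(3,4),of "f (u+v) x"] bM[OF uvw(3,4),of "f (u+v) y"]
  ultimately show "\<bar>birk \<phi> x t-birk \<phi> y t\<bar><=\<bar>K\<bar>+4*(b * M)+1" unfolding split[of x] split[of y] by linarith
 qed
qed

text \<open>Each segment loses at most the distortion \<open>K\<close>, each gap at most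
  \<open>b\<close> times its length.\<close>

lemma shadow_birkhoff:
 assumes b: "!!x t. 0<=t ==> \<bar>birk \<phi> x t\<bar><=b * t"
  and K: "!!x t y. (x,t)\<in>GM M ==> y\<in>bowen_ball f t x \<epsilon> ==> \<bar>birk \<phi> x t-birk \<phi> y t\<bar><=K"
  and xs: "set xs\<subseteq>GM M" and \<theta>: "!!i. 0<=\<theta> i" and "k<=length xs"
  and y: "!!j s. j < k ==> s\<in>{0..snd (xs ! j)} ==> dist (f (s+((\<Sum>i<j. snd (xs ! i))+(\<Sum>i<j. \<theta> i))) y) (f s (fst (xs ! j))) < \<epsilon>"
 shows "(\<Sum>i<k. birk \<phi> (fst (xs ! i)) (snd (xs ! i)))-K * k-b * (\<Sum>i<k. \<theta> i)
  <= birk \<phi> y ((\<Sum>i<k. snd (xs ! i))+(\<Sum>i<k. \<theta> i))" using assms(5,6)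
proof (induction k)
 case (Suc k)
 define u where "u = (\<Sum>i<k. snd (xs ! i))+(\<Sum>i<k. \<theta> i)"
 obtain x t where xt: "xs ! k = (x,t)" by fastforce
 have xtG: "(x,t)\<in>GM M" using nth_mem[of k xs] xs Suc.prems(1) xt by auto
 hence t: "0<=t" using GM_D[OF xtG] by linarith
 have "0<=snd (xs ! i)" if "i < k" for i
 proof -
  have "(fst (xs ! i),snd (xs ! i))\<in>GM M" using nth_mem[of i xs] xs Suc.prems(1) that by auto
  from GM_D[OF this] show ?thesis by linarith
 qed
 hence u: "0<=u" unfolding u_def using \<theta> by (intro add_nonneg_nonneg sum_nonneg) auto
 have "f u y\<in>bowen_ball f t x \<epsilon>"
 proof -
  have "dist (f s x) (f s (f u y)) < \<epsilon>" if "s\<in>{0..t}" for s using Suc.prems(2)[of k s] that by (simp add: xt u_def f_add[symmetric] dist_commute)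
  thus ?thesis using t by (simp add: bowen_ball_iff)
 qed
 from K[OF xtG this] have 1: "birk \<phi> x t-K<=birk \<phi> (f u y) t" by linarith
 have 2: "- (b * \<theta> k)<=birk \<phi> (f t (f u y)) (\<theta> k)" using b[OF \<theta>[of k],of "f t (f u y)"] by linarith
 have "birk \<phi> y (u+(t+\<theta> k)) = birk \<phi> y u+(birk \<phi> (f u y) t+birk \<phi> (f t (f u y)) (\<theta> k))"
  using u t \<theta>[of k] by (simp add: birkhoff_add[OF \<phi>])
 moreover have "(\<Sum>i<k. birk \<phi> (fst (xs ! i)) (snd (xs ! i)))-K * k-b * (\<Sum>i<k. \<theta> i)<=birk \<phi> y u"
  unfolding u_def by (rule Suc.IH) (use Suc.prems in auto)
 moreover have "(\<Sum>i<Suc k. snd (xs ! i))+(\<Sum>i<Suc k. \<theta> i) = u+(t+\<theta> k)" by (simp add: u_def xt)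
 ultimately show ?case using 1 2 by (simp add: xt algebra_simps)
qed simp

end


section \<open>Partition sums of good segments\<close>

context nonuniform
begin

lemma GM_orbit_segments: "GM M\<subseteq>orbit_segments" using dec unfolding G_M_def decomposition_def by auto

text \<open>The power \<open>W ^ k\<close> is a sum over words of \<open>k\<close> segments. Gluing
  turns words into orbits of length about \<open>k * (t+\<tau>)\<close>; after sorting into at most
  exponentially many classes these are separated, so the growth bound for separated sets applies. A
  \<open>k\<close>-th root leaves a constant independent of \<open>t\<close>, and the exponent
  \<open>c\<close> decreases to \<open>Pr\<close>.\<close>

lemma GM_separated_upper:
 assumes M: "M>=0"
 obtains C where "C > 0" "!!t E. 0<=t ==> finite E ==> E\<subseteq>slice (GM M) t ==> separated f t (5/2*\<delta>) E ==>
  (psum E t)<=C * exp (Pr * t)"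
proof -
 from spec[OF M] obtain T0 where T0: "T0 > 0" "W_spec f (GM M\<inter>UNIV\<times>{T0..}) \<delta>" unfolding tail_W_spec_def by blast
 obtain \<tau> where \<tau>: "\<tau> > 0" and shadow: "!!xs. set xs\<subseteq>GM M\<inter>UNIV\<times>{T0..} ==> EX y \<theta>. (ALL i. 0<=\<theta> i&\<theta> i<=\<tau>) &
  (ALL j<length xs. ALL s:{0..snd (xs ! j)}. dist (f (s+((\<Sum>i<j. snd (xs ! i))+(\<Sum>i<j. \<theta> i))) y) (f s (fst (xs ! j))) < \<delta>)"
  by (rule W_spec_shadow[OF T0(2)]) (use GM_orbit_segments in blast, rule that)
 obtain K where K: "K > 0" "!!x t y. (x,t)\<in>GM M ==> y\<in>bowen_ball f t x \<epsilon> ==> \<bar>birk \<phi> x t-birk \<phi> y t\<bar><=K"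
  by (rule bowen_GM[OF M]) (rule that)
 obtain b where b: "b > 0" "!!x t. 0<=t ==> \<bar>birk \<phi> x t\<bar><=b * t" using potential_bound by blast
 have "\<delta>/8 > 0" using \<delta> by simp
 from f_small_time[OF this] obtain \<kappa> where \<kappa>: "\<kappa> > 0" "!!x r. \<bar>r\<bar><=\<kappa> ==> dist (f r x) x < \<delta>/8" by blast
 have "5/2*\<delta> > 0" using \<delta> by simp
 from cov_bounded_time[OF this,of T0] obtain N where N: "N > 0" "!!t. 0<=t ==> t<=T0 ==> cov t (5/2*\<delta>) UNIV N" by blast
 define q where "q = \<lfloor>\<tau>/\<kappa>\<rfloor>+1"
 have q0: "0<=q" using \<tau> \<kappa> by (simp add: q_def)
 define A where "A = real_of_int (q+1) * exp (K+b * \<tau>)"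
 have A0: "A > 0" using q0 by (simp add: A_def)
 show thesis
 proof (rule that[of "A * exp (Pr * \<tau>)+N * exp (\<bar>Pr\<bar> * T0)"])
  show "A * exp (Pr * \<tau>)+N * exp (\<bar>Pr\<bar> * T0) > 0" using A0 N by (simp add: add_pos_pos)
  fix t E assume t: "0<=t" and E: "finite E" "E\<subseteq>slice (GM M) t" "separated f t (5/2*\<delta>) E"
  define W where "W = (psum E t)"
  have W0: "W>=0" unfolding W_def by (intro sum_nonneg) auto
  show "(psum E t)<=(A * exp (Pr * \<tau>)+N * exp (\<bar>Pr\<bar> * T0)) * exp (Pr * t)"
  proof (cases "t<=T0")
   case True
   have "W<=N" unfolding W_def by (rule cov_separated_le[OF N(2)]) (use t True E in auto)
   also have "\<dots><=N * exp (\<bar>Pr\<bar> * T0) * exp (Pr * t)" by (rule bounded_range_absorb) (use N t True in auto)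
   also have "\<dots><=(A * exp (Pr * \<tau>)+N * exp (\<bar>Pr\<bar> * T0)) * exp (Pr * t)" using A0 by (simp add: distrib_right)
   finally show ?thesis unfolding W_def .
  next
   case False
   \<comment> \<open>The growth bound is available for every \<open>c\<close> above the pressure,
     but only at large times; it is therefore an assumption here, met later by a large
     \<open>k\<close>.\<close>
   have iter: "W ^ k<=(A ^ k) * exp (c * (real k * (t+\<tau>)))"
    if U: "!!E. finite E ==> separated f (real k * (t+\<tau>)) (\<delta>/4) E ==> (psum E (real k * (t+\<tau>)))<=exp (c * (real k * (t+\<tau>)))" for k :: nat and c
   proof -
    define L where "L = real k * (t+\<tau>)"
    have L0: "0<=L" using t \<tau> by (simp add: L_def)
    define X where "X = {xs. set xs\<subseteq>E&length xs = k}"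
    have Xfin: "finite X" unfolding X_def by (rule finite_lists_length_eq[OF E(1)])
    define sg where "sg xs = map (%x. (x,t)) xs" for xs :: "'a list"
    have sgG: "set (sg xs)\<subseteq>GM M\<inter>UNIV\<times>{T0..}" if "xs\<in>X" for xs using that E(2) False by (auto simp: sg_def X_def slice_def)
    have "ALL xs. EX y \<theta>. xs\<in>X --> (ALL i. 0<=\<theta> i&\<theta> i<=\<tau>)&(ALL j<length (sg xs). ALL s:{0..snd (sg xs ! j)}.
     dist (f (s+((\<Sum>i<j. snd (sg xs ! i))+(\<Sum>i<j. \<theta> i))) y) (f s (fst (sg xs ! j))) < \<delta>)" using shadow[OF sgG] by meson
    then obtain Y \<theta> where Y: "!!xs i. xs\<in>X ==> 0<=\<theta> xs i&\<theta> xs i<=\<tau>"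
     "!!xs j s. xs\<in>X ==> j < length (sg xs) ==> s\<in>{0..snd (sg xs ! j)} ==>
     dist (f (s+((\<Sum>i<j. snd (sg xs ! i))+(\<Sum>i<j. \<theta> xs i))) (Y xs)) (f s (fst (sg xs ! j))) < \<delta>" by metis
    define \<sigma> where "\<sigma> xs j = (\<Sum>i<j. \<theta> xs i)" for xs j
    have sgl: "length (sg xs) = k" "!!j. j < k ==> sg xs ! j = (xs ! j,t)" if "xs\<in>X" for xs using that by (auto simp: sg_def X_def)
    have sums: "(\<Sum>i<j. snd (sg xs ! i)) = real j * t" if "xs\<in>X" "j<=k" for xs j
    proof -
     have "(\<Sum>i<j. snd (sg xs ! i)) = (\<Sum>i<j. t)" by (rule sum.cong) (use sgl(2)[OF that(1)] that(2) in auto)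
     thus ?thesis by simp
    qed
    have Yd: "dist (f (s+(real j * t+\<sigma> xs j)) (Y xs)) (f s (xs ! j)) < \<delta>" if "xs\<in>X" "j < k" "0<=s" "s<=t" for xs j s
     using Y(2)[OF that(1),of j s] that sgl[OF that(1)] sums[OF that(1),of j] by (simp add: \<sigma>_def)
    have \<sigma>b: "0<=\<sigma> xs j" "\<sigma> xs j<=real j * \<tau>" if "xs\<in>X" for xs j
     using Y(1)[OF that] sum_bounded_above[of "{..<j}" "\<theta> xs" \<tau>] by (auto simp: \<sigma>_def intro: sum_nonneg)
    have Ye: "dist (f (s+((\<Sum>i<j. snd (sg xs ! i))+(\<Sum>i<j. \<theta> xs i))) (Y xs)) (f s (fst (sg xs ! j))) < \<epsilon>"
     if "xs\<in>X" "j < k" "s\<in>{0..snd (sg xs ! j)}" for xs j s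
    proof -
     have "j < length (sg xs)" using that sgl(1) by simp
     from Y(2)[OF that(1) this that(3)] show ?thesis using \<delta> \<epsilon> by linarith
    qed
    have bk: "(\<Sum>x\<leftarrow>xs. birk \<phi> x t)<=birk \<phi> (Y xs) L+real k * (K+b * \<tau>)" if xs: "xs\<in>X" for xs
    proof -
     have "(\<Sum>i<k. birk \<phi> (fst (sg xs ! i)) (snd (sg xs ! i)))-K * k-b * (\<Sum>i<k. \<theta> xs i)
      <= birk \<phi> (Y xs) ((\<Sum>i<k. snd (sg xs ! i))+(\<Sum>i<k. \<theta> xs i))"
      by (rule shadow_birkhoff[OF b(2) K(2)]) (use sgG[OF xs] Y(1)[OF xs] Ye[OF xs] sgl[OF xs] in auto)
     moreover have "(\<Sum>i<k. birk \<phi> (fst (sg xs ! i)) (snd (sg xs ! i))) = (\<Sum>x\<leftarrow>xs. birk \<phi> x t)"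
      unfolding sum_list_sum_nth using xs sgl(2)[OF xs] by (intro sum.cong) (auto simp: X_def)
     ultimately have "(\<Sum>x\<leftarrow>xs. birk \<phi> x t)-K * k-b * \<sigma> xs k<=birk \<phi> (Y xs) (real k * t+\<sigma> xs k)"
      using sums[OF xs,of k] by (simp add: \<sigma>_def)
     moreover have "birk \<phi> (Y xs) L = birk \<phi> (Y xs) (real k * t+\<sigma> xs k)+birk \<phi> (f (real k * t+\<sigma> xs k) (Y xs)) (real k * \<tau> - \<sigma> xs k)"
      using \<sigma>b[OF xs,of k] t by (subst birkhoff_add[OF \<phi>, symmetric]) (auto simp: L_def algebra_simps)
     moreover have "\<bar>birk \<phi> (f (real k * t+\<sigma> xs k) (Y xs)) (real k * \<tau> - \<sigma> xs k)\<bar><=b * (real k * \<tau> - \<sigma> xs k)"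
      using \<sigma>b[OF xs,of k] by (intro b(2)) auto
     ultimately show ?thesis by (simp add: algebra_simps)
    qed
    \<comment> \<open>Words are classified by the increments of the rounded accumulated gluing time.
      Equal classes force equal rounded times at every stage, so the discrepancy stays at most
      \<open>\<kappa>\<close> and does not accumulate with \<open>j\<close>; each increment has
      \<open>q+1\<close> possible values.\<close>
    define cl where "cl xs = map (%j. \<lfloor>\<sigma> xs (Suc j)/\<kappa>\<rfloor> - \<lfloor>\<sigma> xs j/\<kappa>\<rfloor>) [0..<k]" for xs
    define V where "V = {l :: int list. set l\<subseteq>{0..q}&length l = k}"
    have Vfin: "finite V" unfolding V_def by (rule finite_lists_length_eq) auto
    have cardV: "card V = nat (q+1) ^ k" unfolding V_def by (subst card_lists_length_eq) auto
    have clV: "cl ` X\<subseteq>V"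
    proof
     fix l assume "l\<in>cl ` X"
     then obtain xs where xs: "xs\<in>X" "l = cl xs" by blast
     have "\<lfloor>\<sigma> xs (Suc j)/\<kappa>\<rfloor> - \<lfloor>\<sigma> xs j/\<kappa>\<rfloor>\<in>{0..q}" for j
     proof -
      have s: "\<sigma> xs (Suc j)/\<kappa> = \<sigma> xs j/\<kappa>+\<theta> xs j/\<kappa>" by (simp add: \<sigma>_def add_divide_distrib)
      have "0<=\<theta> xs j/\<kappa>" "\<theta> xs j/\<kappa><=\<tau>/\<kappa>" using Y(1)[OF xs(1)] \<kappa> by (auto intro: divide_right_mono)
      thus ?thesis unfolding s q_def by (simp, linarith)
     qed
     thus "l\<in>V" unfolding xs(2) V_def cl_def by auto
    qed
    have same: "\<bar>\<sigma> xs j-\<sigma> ys j\<bar><=\<kappa>" if "xs\<in>X" "ys\<in>X" "cl xs = cl ys" "j<=k" for xs ys j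
    proof -
     have "\<lfloor>\<sigma> xs j/\<kappa>\<rfloor> = \<lfloor>\<sigma> ys j/\<kappa>\<rfloor>" using that(4)
     proof (induction j)
      case (Suc j)
      have "\<lfloor>\<sigma> xs (Suc j)/\<kappa>\<rfloor> - \<lfloor>\<sigma> xs j/\<kappa>\<rfloor> = \<lfloor>\<sigma> ys (Suc j)/\<kappa>\<rfloor> - \<lfloor>\<sigma> ys j/\<kappa>\<rfloor>"
       using arg_cong[OF that(3),of "%l. l ! j"] Suc.prems by (simp add: cl_def)
      thus ?case using Suc by simp
     qed (simp add: \<sigma>_def)
     hence "\<bar>\<sigma> xs j/\<kappa> - \<sigma> ys j/\<kappa>\<bar><=1" by linarith
     hence "\<bar>\<sigma> xs j-\<sigma> ys j\<bar>/\<kappa><=1" using \<kappa>(1) by (simp add: diff_divide_distrib[symmetric] abs_divide)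
     thus ?thesis using \<kappa>(1) by simp
    qed
    have distinct: "xs = ys" if xy: "xs\<in>X" "ys\<in>X" "cl xs = cl ys" and cl: "!!r. r\<in>{0..L} ==> dist (f r (Y xs)) (f r (Y ys))<=\<delta>/4" for xs ys
    proof (rule nth_equalityI)
     show "length xs = length ys" using xy by (simp add: X_def)
     fix j assume "j < length xs"
     hence j: "j < k" using xy by (simp add: X_def)
     hence jE: "xs ! j\<in>E" "ys ! j\<in>E" using xy nth_mem[of j] by (auto simp: X_def)
     \<comment> \<open>Two shadowing errors \<open>\<delta>\<close>, the distance
       \<open>\<delta>/4\<close> of the glued orbits and \<open>\<delta>/8\<close> for the timing
       discrepancy stay below \<open>5/2*\<delta>\<close>.\<close>
     have "dist (f r (xs ! j)) (f r (ys ! j))<=5/2*\<delta>" if r: "r\<in>{0..t}" for r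
     proof -
      define u where "u = real j * t+\<sigma> xs j"
      define v where "v = real j * t+\<sigma> ys j"
      have "dist (f (r+u) (Y xs)) (f r (xs ! j)) < \<delta>" "dist (f (r+v) (Y ys)) (f r (ys ! j)) < \<delta>" unfolding u_def v_def using Yd xy j r by auto
      moreover have "r+u\<in>{0..L}"
      proof -
       have "real j * t+t<=real k * t" using mult_right_mono[of "real (Suc j)" "real k" t] j t by (simp add: algebra_simps)
       moreover have "real j * \<tau><=real k * \<tau>" using j \<tau> by (intro mult_right_mono) auto
       ultimately show ?thesis using \<sigma>b[OF xy(1),of j] r t unfolding u_def L_def by (auto simp: distrib_left)
      qed
      hence "dist (f (r+u) (Y xs)) (f (r+u) (Y ys))<=\<delta>/4" by (rule cl)
      moreover have "dist (f (r+v) (Y ys)) (f (r+u) (Y ys)) < \<delta>/8"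
      proof -
       have "\<bar>v-u\<bar><=\<kappa>" using same[OF xy(2,1) xy(3)[symmetric],of j] j unfolding u_def v_def by simp
       from \<kappa>(2)[OF this,of "f (r+u) (Y ys)"] show ?thesis by (simp add: f_add[symmetric] add.commute)
      qed
      ultimately show ?thesis using dist_triangle2[of "f r (xs ! j)" "f r (ys ! j)" "f (r+u) (Y ys)"]
        dist_triangle3[of "f r (xs ! j)" "f (r+u) (Y ys)" "f (r+u) (Y xs)"]
        dist_triangle3[of "f r (ys ! j)" "f (r+u) (Y ys)" "f (r+v) (Y ys)"] \<delta> by linarith
     qed
     thus "xs ! j = ys ! j" using E(3) jE t by (simp add: separated_iff)
    qed
    have cls: "(SUM xs:{xs\<in>X. cl xs = l}. exp (\<Sum>x\<leftarrow>xs. birk \<phi> x t))<=exp (c * L) * exp (real k * (K+b * \<tau>))" for l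
    proof -
     let ?X = "{xs\<in>X. cl xs = l}"
     have inj: "inj_on Y ?X"
     proof (rule inj_onI)
      fix xs ys assume "xs\<in>?X" "ys\<in>?X" "Y xs = Y ys"
      thus "xs = ys" using \<delta> by (intro distinct) simp_all
     qed
     have "separated f L (\<delta>/4) (Y ` ?X)" unfolding separated_iff[OF L0]
     proof (intro ballI impI)
      fix y z assume "y\<in>Y ` ?X" "z\<in>Y ` ?X" and yz: "near L (\<delta>/4) y z"
      then obtain xs ys where xy: "xs\<in>X" "ys\<in>X" "cl xs = l" "cl ys = l" "y = Y xs" "z = Y ys" by blast
      have "xs = ys" by (rule distinct[OF xy(1,2)]) (use xy yz in simp_all)
      thus "y = z" using xy by simp
     qed
     hence "(SUM y:Y ` ?X. exp (birk \<phi> y L))<=exp (c * L)" unfolding L_def using Xfin by (intro U) auto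
     hence "(SUM xs:?X. exp (birk \<phi> (Y xs) L))<=exp (c * L)" by (simp add: sum.reindex[OF inj])
     moreover have "(SUM xs:?X. exp (\<Sum>x\<leftarrow>xs. birk \<phi> x t))<=(SUM xs:?X. exp (birk \<phi> (Y xs) L) * exp (real k * (K+b * \<tau>)))"
      by (rule sum_mono) (use bk in \<open>auto simp: exp_add[symmetric]\<close>)
     moreover have "\<dots> = (SUM xs:?X. exp (birk \<phi> (Y xs) L)) * exp (real k * (K+b * \<tau>))" by (simp add: sum_distrib_right)
     ultimately show ?thesis using mult_right_mono[of _ _ "exp (real k * (K+b * \<tau>))"] by (smt (verit) exp_ge_zero)
    qed
    have "W ^ k = (SUM xs:X. exp (\<Sum>x\<leftarrow>xs. birk \<phi> x t))" unfolding W_def X_def exp_sum_list using sum_lists_power[OF E(1)] by metis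
    also have "\<dots> = (SUM l:V. SUM xs:{xs\<in>X. cl xs = l}. exp (\<Sum>x\<leftarrow>xs. birk \<phi> x t))"
     by (rule sum.group[OF Xfin Vfin clV,symmetric])
    also have "\<dots><=(SUM l:V. exp (c * L) * exp (real k * (K+b * \<tau>)))" by (rule sum_mono) (rule cls)
    also have "\<dots> = (A ^ k) * exp (c * L)" using q0 by (simp add: cardV A_def power_mult_distrib exp_of_nat_mult)
    finally show ?thesis unfolding L_def .
   qed
   have "W<=A * exp (c * (t+\<tau>))" if c: "c > Pr" for c
   proof -
    have "\<delta>/4 > 0" "top_pressure f \<phi> < ereal c" using \<delta> c by (auto simp: top_pressure_real)
    from separated_sum_upper[OF this(2,1)] obtain T where T: "!!t E. t>=T ==> finite E ==> separated f t (\<delta>/4) E ==> (psum E t)<=exp (c * t)"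
     unfolding eventually_at_top_linorder by blast
    obtain k :: nat where k: "k > \<bar>T\<bar>/(t+\<tau>)" using reals_Archimedean2 by blast
    have "t+\<tau> > 0" using t \<tau> by simp
    hence "T<=real k * (t+\<tau>)" using k by (simp add: divide_less_eq)
    hence "W ^ k<=(A ^ k) * exp (c * (real k * (t+\<tau>)))" by (intro iter T)
    also have "\<dots> = (A * exp (c * (t+\<tau>))) ^ k" by (simp add: power_mult_distrib exp_of_nat_mult[symmetric] mult.left_commute)
    finally have le: "W ^ k<=(A * exp (c * (t+\<tau>))) ^ k" .
    have "k > 0" using k \<open>t + \<tau> > 0\<close> by (cases k) (auto simp: divide_less_0_iff)
    then obtain k' where "k = Suc k'" by (cases k) auto
    thus ?thesis using le A0 power_le_imp_le_base[of W k'] by simp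
   qed
   note Wc = this
   have "W<=A * exp (Pr * (t+\<tau>))"
   proof (rule tendsto_lowerbound)
    show "((%c. A * exp (c * (t+\<tau>))) \<longlongrightarrow> A * exp (Pr * (t+\<tau>))) (at_right Pr)" by (intro tendsto_intros)
    show "\<forall>\<^sub>F c in at_right Pr. W<=A * exp (c * (t+\<tau>))" by (rule eventually_mono[OF eventually_at_right_less]) (rule Wc)
   qed simp
   also have "\<dots><=(A * exp (Pr * \<tau>)+N * exp (\<bar>Pr\<bar> * T0)) * exp (Pr * t)"
    using N by (simp add: distrib_left distrib_right exp_add mult.commute mult.left_commute)
   finally show ?thesis unfolding W_def .
  qed
 qed
qed

end


text \<open>Half of the decay, \<open>r = exp (- a/2)\<close>, pays for summability over both
  indices; the other half is a high power of \<open>r\<close> because \<open>i+k\<close> is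
  large.\<close>

lemma geometric_tail_product:
 fixes a \<alpha> K :: real
 assumes "a > 0" "\<alpha> > 0" "K > 0"
 obtains M :: nat where "M>=1" "!!n. (\<Sum>(i,k)\<in>{(i,k). i+k<=n&M<=i+k}. K * exp (- a * i) * exp (- a * k))<=\<alpha>"
proof -
 define r where "r = exp (- a/2)"
 have r: "0 < r" "r < 1" using assms(1) by (auto simp: r_def)
 have "\<alpha>*(1-r)\<^sup>2/K > 0" using assms r by simp
 from real_arch_pow_inv[OF this r(2)] obtain m where m: "r ^ m < \<alpha>*(1-r)\<^sup>2/K" by blast
 have rm: "K * r ^ Suc m * (1/(1-r)*(1/(1-r)))<=\<alpha>"
 proof -
  have "r ^ Suc m<=r ^ m" using r by (simp add: mult_left_le_one_le)
  hence "r ^ Suc m<=\<alpha>*(1-r)\<^sup>2/K" using m by simp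
  hence "r ^ Suc m * K<=\<alpha>*(1-r)\<^sup>2" using assms(3) by (simp add: pos_le_divide_eq)
  thus ?thesis using r by (simp add: pos_divide_le_eq power2_eq_square mult.commute)
 qed
 have geo: "(\<Sum>i\<le>n. r ^ i)<=1/(1-r)" for n using r by (simp add: sum_gp0 divide_right_mono)
 have ex: "exp (- a * real j) = r ^ j * r ^ j" for j unfolding r_def by (simp add: exp_of_nat_mult[symmetric] exp_add[symmetric])
 show thesis
 proof (rule that[of "Suc m"])
  fix n
  have "(\<Sum>(i,k)\<in>{(i,k). i+k<=n&Suc m<=i+k}. K * exp (- a * i) * exp (- a * k))
   <= (\<Sum>(i,k)\<in>{(i,k). i+k<=n&Suc m<=i+k}. K * r ^ Suc m * (r ^ i * r ^ k))"
  proof (rule sum_mono, clarify)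
   fix i k :: nat assume "Suc m<=i+k"
   hence "r ^ (i+k)<=r ^ Suc m" using r by (intro power_decreasing) auto
   hence "(K * (r ^ i * r ^ k)) * r ^ (i+k)<=(K * (r ^ i * r ^ k)) * r ^ Suc m" using r assms by (intro mult_left_mono) auto
   thus "K * exp (- a * i) * exp (- a * k)<=K * r ^ Suc m * (r ^ i * r ^ k)" unfolding ex by (simp add: power_add mult.commute mult.left_commute)
  qed
  also have "\<dots><=(\<Sum>(i,k)\<in>{..n}\<times>{..n}. K * r ^ Suc m * (r ^ i * r ^ k))" by (rule sum_mono2) (use r assms in auto)
  also have "\<dots> = K * r ^ Suc m * ((\<Sum>i\<le>n. r ^ i)*(\<Sum>k\<le>n. r ^ k))"
   by (simp only: sum_product, simp only: sum_distrib_left sum.cartesian_product[symmetric])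
  also have "\<dots><=K * r ^ Suc m * (1/(1-r)*(1/(1-r)))" using r assms by (intro mult_left_mono mult_mono geo) (auto intro: sum_nonneg)
  also note rm
  finally show "(\<Sum>(i,k)\<in>{(i,k). i+k<=n&Suc m<=i+k}. K * exp (- a * i) * exp (- a * k))<=\<alpha>" .
 qed simp
qed

section \<open>Covers of the whole space by decomposition of orbit segments\<close>

context nonuniform
begin

text \<open>The mesh \<open>5*\<delta>\<close> is twice the separation scale of
  \<open>GM_separated_upper\<close>; the Bowen property replaces the Birkhoff integrals over a ball
  by the value at its centre at the cost of a factor \<open>exp K\<close>.\<close>

lemma GM_cover:
 assumes M: "M>=0"
 obtains C where "C > 0" "!!t. 0<=t ==> cov t (5*\<delta>) (slice (GM M) t) (C * exp (Pr * t))"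
proof -
 obtain C where C: "C > 0" "!!t E. 0<=t ==> finite E ==> E\<subseteq>slice (GM M) t ==> separated f t (5/2*\<delta>) E ==>
  (psum E t)<=C * exp (Pr * t)" by (rule GM_separated_upper[OF M]) (rule that)
 obtain K where K: "K > 0" "!!x t y. (x,t)\<in>GM M ==> y\<in>bowen_ball f t x \<epsilon> ==> \<bar>birk \<phi> x t-birk \<phi> y t\<bar><=K"
  by (rule bowen_GM[OF M]) (rule that)
 show thesis
 proof (rule that[of "C * exp K"])
  fix t :: real assume t: "0<=t"
  have r: "5/2*\<delta> > 0" using \<delta> by simp
  have "separated f t (5/2*\<delta>) {}" by (simp add: separated_def)
  then obtain E where E: "E\<subseteq>slice (GM M) t" "finite E" "separated f t (5/2*\<delta>) E"
   "!!x. x\<in>slice (GM M) t ==> EX y:E. near t (5/2*\<delta>) y x" by (rule maximal_separated[OF r t empty_subsetI]) (rule that)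
  have "cov t (2*(5/2*\<delta>)) (slice (GM M) t) (SUM x:E. exp (birk \<phi> x t+K))"
  proof (rule cov_of_spanning[OF E(2,4)])
   fix x y assume x: "x\<in>E" and "!!s. s\<in>{0..t} ==> dist (f s x) (f s y)<=5/2*\<delta>"
   hence "y\<in>bowen_ball f t x \<epsilon>" using \<delta> \<epsilon> t by (fastforce simp: bowen_ball_iff)
   moreover have "(x,t)\<in>GM M" using x E(1) by (auto simp: slice_def)
   ultimately have "\<bar>birk \<phi> x t-birk \<phi> y t\<bar><=K" by (intro K(2))
   thus "birk \<phi> y t<=birk \<phi> x t+K" by linarith
  qed
  hence "cov t (5*\<delta>) (slice (GM M) t) (SUM x:E. exp (birk \<phi> x t+K))" by simp
  moreover have "(SUM x:E. exp (birk \<phi> x t+K))<=C * exp K * exp (Pr * t)"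
  proof -
   have "(SUM x:E. exp (birk \<phi> x t+K)) = (psum E t) * exp K" by (simp add: exp_add sum_distrib_right)
   also have "\<dots><=C * exp (Pr * t) * exp K" by (intro mult_right_mono C(2)[OF t E(2,1,3)]) simp
   finally show ?thesis by (simp add: mult_ac)
  qed
  ultimately show "cov t (5*\<delta>) (slice (GM M) t) (C * exp K * exp (Pr * t))" by (rule cov_mono[OF _ subset_refl])
 qed (use C in simp)
qed

text \<open>An orbit segment outside \<open>GM M\<close> spends a total time of at least about \<open>M\<close> in its prefix and suffix.\<close>
lemma segment_split:
 fixes M n :: nat
 shows "UNIV\<subseteq>slice (GM M) n\<union>slice ((orbit_segments-D)\<union>bracket f P\<union>bracket f S) n \<union>
  (\<Union>(i,k)\<in>{(i,k). i+k<=n&M<=i+k}. slice ((orbit_segments-D)\<union>bracket f P\<union>bracket f S) i \<inter>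
   f i -` (UNIV\<inter>f (real (n-i-k)) -` slice ((orbit_segments-D)\<union>bracket f P\<union>bracket f S) k))" (is "_\<subseteq>?R")
proof
 fix x
 show "x\<in>?R"
 proof (cases "(x,real n)\<in>D&(x,real n)\<notin>GM M")
  case False
  thus ?thesis by (auto simp: slice_def orbit_segments_def)
 next
  case True
  define u v where "u = p (x,real n)" and "v = s (x,real n)"
  have "\<forall>(x,t)\<in>D. p (x,t)>=0&g (x,t)>=0&s (x,t)>=0&t = p (x,t)+g (x,t)+s (x,t) &
    (x,p (x,t))\<in>P&(f (p (x,t)) x,g (x,t))\<in>G&(f (p (x,t)+g (x,t)) x,s (x,t))\<in>S"
   using dec unfolding decomposition_def by (elim conjE)
  from bspec[OF this conjunct1[OF True]] have *: "0<=u" "0<=g (x,real n)" "0<=v" "real n = u+g (x,real n)+v" "(x,u)\<in>P"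
   "(f (u+g (x,real n)) x,v)\<in>S" unfolding u_def v_def prod.case by blast+
  hence "u+g (x,real n) = real n-v" by linarith
  with * have uv: "0<=u" "0<=v" "u+v<=n" "(x,u)\<in>P" "(f (n-v) x,v)\<in>S" by auto
  \<comment> \<open>Integer parts of prefix and suffix lengths. The fractional remainder is restored
    at the right end of the prefix and at the left end of the suffix, within the unit margins of
    \<open>bracket\<close>.\<close>
  define i k where "i = nat \<lfloor>u\<rfloor>" and "k = nat \<lfloor>v\<rfloor>"
  have ik: "real i<=u" "u < real i+1" "real k<=v" "v < real k+1" using uv by (auto simp: i_def k_def)
  hence "real (i+k)<=n" using uv by simp
  hence le: "i+k<=n" by linarith
  have "M<=i+k"
  proof (rule ccontr)
   assume "\<not> M<=i+k"
   hence "real i+1<=M" "real k+1<=M" by linarith+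
   hence "u<=M" "v<=M" using ik by linarith+
   thus False using True by (simp add: G_M_def u_def v_def)
  qed
  moreover have "(x,real i)\<in>bracket f P" unfolding bracket_def
  proof (intro CollectI exI conjI refl bexI)
   show "(f (- 0) x,real i+0+(u-real i))\<in>P" using uv by simp
  qed (use ik in auto)
  moreover have "(f (real (n-k)) x,real k)\<in>bracket f S" unfolding bracket_def
  proof (intro CollectI exI conjI refl bexI)
   show "(f (- (v-real k)) (f (real (n-k)) x),real k+(v-real k)+0)\<in>S" using uv le by (simp add: f_add[symmetric] of_nat_diff)
  qed (use ik in auto)
  moreover have "f (real (n-i-k)) (f i x) = f (real (n-k)) x" using le by (simp add: f_add[symmetric] of_nat_diff)
  ultimately show ?thesis using le by (intro UnI2 UN_I[of "(i,k)"]) (simp_all only: slice_def vimage_eq mem_Collect_eq Int_iff Un_iff UNIV_I simp_thms prod.case)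
 qed
qed

text \<open>A segment outside \<open>GM M\<close> splits into prefix, middle part and suffix with
  \<open>i+k>=M\<close>, and the gap \<open>a\<close> makes the total weight of these splittings
  small. The middle part is strictly shorter than \<open>n\<close> since \<open>M>=1\<close>, so a
  bound at shorter times is all that is assumed; this makes the induction in
  \<open>cov_upper\<close> possible.\<close>

lemma GM_complement_cover:
 obtains C a where "C > 0" "a > 0" "!!\<alpha>. \<alpha> > 0 ==> EX M>=1. ALL n B. B > 0 --> (ALL j<n. cov (real j) (5*\<delta>) UNIV (B * exp (Pr * j))) -->
  cov n (5*\<delta>) (- slice (GM (real M)) n) (C * exp ((Pr-a) * n)+\<alpha> * B * exp (Pr * n))"
proof -
 let ?C = "(orbit_segments-D)\<union>bracket f P\<union>bracket f S"
 obtain C a where Ca: "C > 0" "a > 0" "!!n :: nat. cov n (2*\<delta>) (slice ?C n) (C * exp ((Pr-a) * n))" by (rule bad_segments_cover) (rule that)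
 have C5: "cov n (5*\<delta>) (slice ?C n) (C * exp ((Pr-a) * n))" for n :: nat using cov_mesh[OF Ca(3)] \<delta> by simp
 show thesis
 proof (rule that[OF Ca(1,2)])
  fix \<alpha> :: real assume "\<alpha> > 0"
  have "C * C > 0" using Ca by simp
  from geometric_tail_product[OF Ca(2) \<open>\<alpha> > 0\<close> this] obtain M :: nat where M: "M>=1"
   "!!n. (\<Sum>(i,k)\<in>{(i,k). i+k<=n&M<=i+k}. (C * C) * exp (- a * i) * exp (- a * k))<=\<alpha>" by blast
  have "cov n (5*\<delta>) (- slice (GM (real M)) n) (C * exp ((Pr-a) * n)+\<alpha> * B * exp (Pr * n))"
   if B: "B > 0" "ALL j<n. cov (real j) (5*\<delta>) UNIV (B * exp (Pr * j))" for n B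
  proof -
   let ?I = "{(i,k). i+k<=n&M<=i+k}"
   define c where "c i k = (C * C) * exp (- a * real i) * exp (- a * real k)*(B * exp (Pr * n))" for i k
   have fin: "finite ?I" by (rule finite_subset[of _ "{..n}\<times>{..n}"]) auto
   have piece: "cov n (5*\<delta>) (slice ?C i\<inter>f i -` (UNIV\<inter>f (real (n-i-k)) -` slice ?C k)) (c i k)"
    if ik: "i+k<=n" "M<=i+k" for i k :: nat
   proof -
    have "n-i-k < n" using ik M(1) by linarith
    hence "cov (real (n-i-k)) (5*\<delta>) UNIV (B * exp (Pr * real (n-i-k)))" using B(2) by blast
    from cov_concat[OF C5[of i] cov_concat[OF this C5[of k]]]
    have "cov (real i+(real (n-i-k)+real k)) (5*\<delta>) (slice ?C i\<inter>f i -` (UNIV\<inter>f (real (n-i-k)) -` slice ?C k))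
     ((C * exp ((Pr-a) * i))*((B * exp (Pr * real (n-i-k)))*(C * exp ((Pr-a) * k))))" by simp
    moreover have "real i+(real (n-i-k)+real k) = n" using ik by simp
    moreover have "(C * exp ((Pr-a) * i))*((B * exp (Pr * real (n-i-k)))*(C * exp ((Pr-a) * k))) = c i k"
    proof -
     have "exp ((Pr-a) * i)*(exp (Pr * real (n-i-k)) * exp ((Pr-a) * k)) = exp (- a * i) * exp (- a * k) * exp (Pr * n)"
      unfolding exp_add[symmetric] using ik by (simp add: of_nat_diff algebra_simps)
     thus ?thesis unfolding c_def by (simp add: mult_ac)
    qed
    ultimately show ?thesis by simp
   qed
   have "cov n (5*\<delta>) (\<Union>(i,k)\<in>?I. slice ?C i\<inter>f i -` (UNIV\<inter>f (real (n-i-k)) -` slice ?C k)) (\<Sum>(i,k)\<in>?I. c i k)"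
    unfolding case_prod_beta' by (rule cov_UN, rule fin[unfolded case_prod_beta'], rule piece) auto
   note cov_Un[OF C5[of n] this]
   moreover have "(\<Sum>(i,k)\<in>?I. c i k)<=\<alpha> * B * exp (Pr * n)" using mult_right_mono[OF M(2)[of n],of "B * exp (Pr * n)"] B(1)
    by (simp add: c_def sum_distrib_right case_prod_beta' mult.assoc)
   moreover have "- slice (GM M) n\<subseteq>slice ?C n\<union>(\<Union>(i,k)\<in>?I. slice ?C i\<inter>f i -` (UNIV\<inter>f (real (n-i-k)) -` slice ?C k))"
    using segment_split[of M n] by blast
   ultimately show ?thesis by (elim cov_mono) auto
  qed
  thus "EX M>=1. ALL n B. B > 0 --> (ALL j<n. cov (real j) (5*\<delta>) UNIV (B * exp (Pr * j))) -->
   cov n (5*\<delta>) (- slice (GM (real M)) n) (C * exp ((Pr-a) * n)+\<alpha> * B * exp (Pr * n))" using M(1) by blast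
 qed
qed

text \<open>Strong induction with \<open>\<alpha> = 1/2\<close>: the complement of
  \<open>GM M\<close> consumes half of the bound being proved, and \<open>B = 2*(C+C')\<close>
  leaves the other half for \<open>GM M\<close> and the bad segments.\<close>

theorem cov_upper:
 obtains B where "B > 0" "!!n :: nat. cov n (5*\<delta>) UNIV (B * exp (Pr * n))"
proof -
 obtain C a where Ca: "C > 0" "a > 0" "!!\<alpha>. \<alpha> > 0 ==> EX M>=1. ALL n B. B > 0 --> (ALL j<n. cov (real j) (5*\<delta>) UNIV (B * exp (Pr * j))) -->
  cov n (5*\<delta>) (- slice (GM (real M)) n) (C * exp ((Pr-a) * n)+\<alpha> * B * exp (Pr * n))" by (rule GM_complement_cover) (rule that)
 from Ca(3)[of "1/2"] obtain M :: nat where M: "!!n B. B > 0 ==> (ALL j<n. cov (real j) (5*\<delta>) UNIV (B * exp (Pr * j))) ==>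
  cov n (5*\<delta>) (- slice (GM (real M)) n) (C * exp ((Pr-a) * n)+1/2 * B * exp (Pr * n))" by auto
 obtain C' where C': "C' > 0" "!!t. 0<=t ==> cov t (5*\<delta>) (slice (GM (real M)) t) (C' * exp (Pr * t))"
  by (rule GM_cover[of "real M"]) (simp, rule that)
 define B where "B = 2*(C+C')"
 have B: "B > 0" using Ca C' by (simp add: B_def)
 show thesis
 proof (rule that[OF B])
  fix n :: nat
  show "cov n (5*\<delta>) UNIV (B * exp (Pr * n))"
  proof (induction n rule: less_induct)
   case (less n)
   from cov_Un[OF C'(2)[of n] M[OF B,of n]] less
   have "cov n (5*\<delta>) (slice (GM M) n\<union>- slice (GM M) n) (C' * exp (Pr * n)+(C * exp ((Pr-a) * n)+1/2 * B * exp (Pr * n)))" by simp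
   moreover have "C * exp ((Pr-a) * n)<=C * exp (Pr * n)" using Ca by (simp add: mult_right_mono)
   hence "C' * exp (Pr * n)+(C * exp ((Pr-a) * n)+1/2 * B * exp (Pr * n))<=B * exp (Pr * n)" by (simp add: B_def algebra_simps)
   ultimately show ?case by (elim cov_mono) auto
  qed
 qed
qed

text \<open>With the uniform constant \<open>B\<close> at hand, \<open>\<alpha>/(2 * B)\<close>
  makes the recursive term half of the target, and the exponential gap makes the remaining term the
  other half once \<open>n>=n0\<close>.\<close>

lemma GM_complement_small:
 assumes "\<alpha> > 0"
 obtains M n0 :: nat where "!!n :: nat. n>=n0 ==> cov n (5*\<delta>) (- slice (GM (real M)) n) (\<alpha> * exp (Pr * n))"
proof -
 obtain C a where Ca: "C > 0" "a > 0" "!!\<alpha>. \<alpha> > 0 ==> EX M>=1. ALL n B. B > 0 --> (ALL j<n. cov (real j) (5*\<delta>) UNIV (B * exp (Pr * j))) -->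
  cov n (5*\<delta>) (- slice (GM (real M)) n) (C * exp ((Pr-a) * n)+\<alpha> * B * exp (Pr * n))" by (rule GM_complement_cover) (rule that)
 obtain B where B: "B > 0" "!!n :: nat. cov n (5*\<delta>) UNIV (B * exp (Pr * n))" by (rule cov_upper) (rule that)
 have "\<alpha>/(2 * B) > 0" using assms B by simp
 from Ca(3)[OF this] obtain M :: nat where M0: "ALL n B'. B' > 0 --> (ALL j<n. cov (real j) (5*\<delta>) UNIV (B' * exp (Pr * j))) -->
  cov n (5*\<delta>) (- slice (GM (real M)) n) (C * exp ((Pr-a) * n)+\<alpha>/(2 * B) * B' * exp (Pr * n))" by (elim exE conjE)
 have M: "cov n (5*\<delta>) (- slice (GM (real M)) n) (C * exp ((Pr-a) * n)+\<alpha>/(2 * B) * B * exp (Pr * n))" for n :: nat by (rule M0[rule_format,OF B])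
 have "exp (- a) < 1" using Ca by simp
 moreover have "\<alpha>/(2 * C) > 0" using assms Ca by simp
 ultimately obtain n0 where n0: "exp (- a) ^ n0 < \<alpha>/(2 * C)" using real_arch_pow_inv by blast
 show thesis
 proof (rule that[of n0 M])
  fix n :: nat assume n: "n>=n0"
  have "exp (- a) ^ n<=exp (- a) ^ n0" using n Ca by (intro power_decreasing) auto
  hence "C * exp (- a) ^ n<=C * (\<alpha>/(2 * C))" using n0 Ca(1) by (intro mult_left_mono) auto
  hence "C * exp (- a) ^ n<=\<alpha>/2" using Ca(1) by simp
  hence "C * exp (- a) ^ n * exp (Pr * n)<=\<alpha>/2 * exp (Pr * n)" by (rule mult_right_mono) simp
  moreover have "C * exp ((Pr-a) * n) = C * exp (- a) ^ n * exp (Pr * n)" by (simp add: exp_of_nat_mult[symmetric] exp_add[symmetric] algebra_simps)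
  moreover have "\<alpha>/(2 * B) * B * exp (Pr * n) = \<alpha>/2 * exp (Pr * n)" "\<alpha> * exp (Pr * n) = \<alpha>/2 * exp (Pr * n)+\<alpha>/2 * exp (Pr * n)"
   using B(1) by simp_all
  ultimately have "C * exp ((Pr-a) * n)+\<alpha>/(2 * B) * B * exp (Pr * n)<=\<alpha> * exp (Pr * n)" by linarith
  thus "cov n (5*\<delta>) (- slice (GM (real M)) n) (\<alpha> * exp (Pr * n))" by (rule cov_mono[OF M subset_refl])
 qed
qed

end


section \<open>Existence of an equilibrium state\<close>

context nonuniform
begin

lemma cov_upper_mesh:
 obtains B where "B > 0" "!!n :: nat. cov n \<epsilon> UNIV (B * exp (Pr * n))"
proof -
 obtain B where B: "B > 0" "!!n :: nat. cov n (5*\<delta>) UNIV (B * exp (Pr * n))" by (rule cov_upper) (rule that)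
 show thesis by (rule that[OF B(1)]) (rule cov_mesh[OF B(2)], use \<epsilon> \<delta> in linarith)
qed

lemma NE_null_max:
 assumes "ergodic_measure f m" "ereal Pr<=free_energy f \<phi> m"
 obtains Z where "Z\<in>sets borel" "NE f \<epsilon>\<subseteq>Z" "measure m Z = 0"
 using NE_null[OF assms(1) less_le_trans[OF perp]] assms(2) top_pressure_real that by metis

text \<open>Taking covers of the same weight for both parts of the Gibbs inequality bounds
  \<open>n\<close> times the free energy seen by \<open>\<eta>\<close> by \<open>Pr * n\<close> plus
  a constant.\<close>

theorem free_energy_le:
 assumes "invariant_measure f \<nu>"
 shows "free_energy f \<phi> \<nu><=ereal Pr"
proof (rule ccontr)
 assume "\<not> free_energy f \<phi> \<nu><=ereal Pr"
 hence "ereal Pr < free_energy f \<phi> \<nu>" by simp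
 from free_energy_witness[OF assms this] obtain \<eta> :: "'a=>'a set" where \<eta>: "simple_function \<nu> \<eta>" "Pr < hrate f \<nu> \<eta>+integral\<^sup>L \<nu> \<phi>" by blast
 from ergodic_witness[OF assms \<eta>] obtain m where m: "ergodic_measure f m" "Pr < hrate f m \<eta>+integral\<^sup>L m \<phi>" "ereal Pr < free_energy f \<phi> m" "simple_function m \<eta>" by blast
 obtain Z where Z: "Z\<in>sets borel" "NE f \<epsilon>\<subseteq>Z" "measure m Z = 0" by (rule NE_null_max[OF m(1)]) (use m(3) in simp, rule that)
 have mi: "invariant_measure f m" using m(1) by (simp add: ergodic_measure_def)
 obtain B where B: "B > 0" "!!n :: nat. cov n \<epsilon> UNIV (B * exp (Pr * n))" by (rule cov_upper_mesh) (rule that)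
 have "hrate f m \<eta>+integral\<^sup>L m \<phi><=Pr"
 proof (rule linear_growth_le[where z = "ln 2+ln B"])
  fix n :: nat assume n: "n>=1"
  from gibbs_cover[OF mi Z n B(2) B(2) m(4)] obtain \<sigma> where
   "n * (hrate f m \<eta>+integral\<^sup>L m \<phi>)<=ln 2+\<sigma> * ln (B * exp (Pr * n))+(1-\<sigma>) * ln (B * exp (Pr * n))" by blast
  also have "\<dots> = ln 2+ln (B * exp (Pr * n))" by (simp add: algebra_simps)
  also have "ln (B * exp (Pr * n)) = ln B+Pr * n" using B(1) by (simp add: ln_mult)
  finally show "real n * (hrate f m \<eta>+integral\<^sup>L m \<phi>)<=real n * Pr+(ln 2+ln B)" by (simp add: mult.commute)
 qed
 thus False using m(2) by simp
qed

text \<open>In the Gibbs inequality the cells outside the cover of \<open>S\<close> are already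
  controlled by \<open>cov_upper_mesh\<close>; as \<open>\<sigma>\<close> is at least 1/2, a light
  cover of \<open>S\<close> would push the free energy below \<open>Pr\<close>.\<close>

lemma cover_lower:
 assumes m: "ergodic_measure f m" "ereal Pr<=free_energy f \<phi> m"
 obtains c where "c > 0" "!!n S w. n>=(1 :: nat) ==> measure m S>=1/2 ==> cov n \<epsilon> S w ==> c * exp (Pr * n)<=w"
proof -
 obtain Z where Z: "Z\<in>sets borel" "NE f \<epsilon>\<subseteq>Z" "measure m Z = 0" by (rule NE_null_max[OF m]) (rule that)
 have mi: "invariant_measure f m" using m(1) by (simp add: ergodic_measure_def)
 obtain B where B: "B > 0" "!!n :: nat. cov n \<epsilon> UNIV (B * exp (Pr * n))" by (rule cov_upper_mesh) (rule that)
 define d where "d = 1+ln 2+\<bar>ln B\<bar>"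
 show thesis
 proof (rule that[of "exp (ln B-2 * d)"])
  fix n :: nat and S w assume n: "n>=1" and S: "measure m S>=1/2" and w: "cov n \<epsilon> S w"
  \<comment> \<open>The defect \<open>1/n\<close> in the choice of \<open>\<eta>\<close> costs only
    1 after multiplication by \<open>n\<close>.\<close>
  have "ereal (Pr-1/n) < free_energy f \<phi> m" using n by (intro less_le_trans[OF _ m(2)]) simp
  from free_energy_witness[OF mi this] obtain \<eta> :: "'a=>'a set" where \<eta>: "simple_function m \<eta>" "Pr-1/n < hrate f m \<eta>+integral\<^sup>L m \<phi>" by blast
  from gibbs_cover[OF mi Z n w B(2) \<eta>(1)] obtain \<sigma> where \<sigma>: "measure m S<=\<sigma>" "\<sigma><=1" "\<sigma> > 0 ==> w > 0"
   "n * (hrate f m \<eta>+integral\<^sup>L m \<phi>)<=ln 2+\<sigma> * ln w+(1-\<sigma>) * ln (B * exp (Pr * n))" by blast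
  have s: "\<sigma>>=1/2" "w > 0" using \<sigma> S by auto
  have "n * (Pr-1/n)<=n * (hrate f m \<eta>+integral\<^sup>L m \<phi>)" using \<eta>(2) by (intro mult_left_mono) auto
  moreover have "n * (Pr-1/n) = n * Pr-1" using n by (simp add: right_diff_distrib)
  moreover have "ln (B * exp (Pr * n)) = ln B+Pr * n" using B(1) by (simp add: ln_mult)
  ultimately have "n * Pr-1<=ln 2+\<sigma> * ln w+(1-\<sigma>)*(ln B+Pr * n)" using \<sigma>(4) by simp
  hence "\<sigma>*(Pr * n+ln B-ln w)<=1+ln 2+ln B" by (simp add: algebra_simps)
  also have "\<dots><=d" by (simp add: d_def)
  also have "\<dots><=\<sigma>*(2 * d)"
  proof -
   have "d>=0" by (simp add: d_def)
   thus ?thesis using mult_right_mono[of 1 "\<sigma>*2" d] s by simp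
  qed
  finally have "Pr * n+ln B-ln w<=2 * d" using s by simp
  hence "exp (ln B-2 * d+Pr * n)<=exp (ln w)" by simp
  thus "exp (ln B-2 * d) * exp (Pr * n)<=w" using s by (simp add: exp_add)
 qed simp
qed

text \<open>The part outside \<open>GM M\<close> accounts for at most half of the weight, so the
  balls about \<open>V\<close> must provide the rest; radius \<open>13*\<delta>\<close> gives mesh
  \<open>26*\<delta>\<close>, below \<open>\<epsilon>\<close>. The constants depend on
  \<open>c\<close> alone, so one choice serves several measures and sets.\<close>

lemma GM_lower:
 assumes "c > 0"
 obtains M n0 :: nat and c' where "c' > 0" "n0>=1"
  "!!n S V. n>=n0 ==> ALL w. cov (real n) \<epsilon> S w --> c * exp (Pr * n)<=w ==> finite V ==> V\<subseteq>slice (GM (real M)) n ==>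
   ALL x:S\<inter>slice (GM (real M)) n. EX y:V. near (real n) (13*\<delta>) y x ==>
   c' * exp (Pr * n)<=(psum V n)"
proof -
 have "c/2 > 0" using assms by simp
 then obtain M n0 :: nat where M: "!!n :: nat. n>=n0 ==> cov n (5*\<delta>) (- slice (GM (real M)) n) (c/2 * exp (Pr * n))"
  by (rule GM_complement_small) (rule that)
 obtain K where K: "K > 0" "!!x t y. (x,t)\<in>GM (real M) ==> y\<in>bowen_ball f t x \<epsilon> ==> \<bar>birk \<phi> x t-birk \<phi> y t\<bar><=K"
  by (rule bowen_GM[of "real M"]) (simp, rule that)
 show thesis
 proof (rule that[of "c/2 * exp (- K)" "max 1 n0" M])
  fix n :: nat and S V
  assume n: "n>=max 1 n0" and S: "ALL w. cov (real n) \<epsilon> S w --> c * exp (Pr * n)<=w" and V: "finite V" "V\<subseteq>slice (GM (real M)) n"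
   "ALL x:S\<inter>slice (GM (real M)) n. EX y:V. near (real n) (13*\<delta>) y x"
  have "cov n (2*(13*\<delta>)) (S\<inter>slice (GM M) n) (SUM x:V. exp (birk \<phi> x n+K))"
  proof (rule cov_of_spanning[OF V(1) V(3)[rule_format]])
   fix x y assume x: "x\<in>V" and "!!s. s\<in>{0..real n} ==> dist (f s x) (f s y)<=13*\<delta>"
   hence "y\<in>bowen_ball f n x \<epsilon>" using \<delta> \<epsilon> by (fastforce simp: bowen_ball_iff)
   moreover have "(x,real n)\<in>GM M" using x V(2) by (auto simp: slice_def)
   ultimately have "\<bar>birk \<phi> x n-birk \<phi> y n\<bar><=K" by (intro K(2))
   thus "birk \<phi> y n<=birk \<phi> x n+K" by linarith
  qed
  hence "cov n \<epsilon> (S\<inter>slice (GM M) n) (SUM x:V. exp (birk \<phi> x n+K))" by (rule cov_mesh) (use \<epsilon> \<delta> in linarith)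
  moreover have "cov n \<epsilon> (- slice (GM M) n) (c/2 * exp (Pr * n))" by (rule cov_mesh[OF M]) (use \<epsilon> \<delta> n in auto)
  ultimately have "cov n \<epsilon> (S\<inter>slice (GM M) n\<union>- slice (GM M) n) ((SUM x:V. exp (birk \<phi> x n+K))+c/2 * exp (Pr * n))"
   by (rule cov_Un)
  hence "cov n \<epsilon> S ((SUM x:V. exp (birk \<phi> x n+K))+c/2 * exp (Pr * n))" by (rule cov_mono) auto
  from S[rule_format,OF this] have "c/2 * exp (Pr * n)<=(psum V n) * exp K" unfolding exp_add sum_distrib_right[symmetric] by linarith
  from mult_right_mono[OF this,of "exp (- K)"] have "c/2 * exp (Pr * n) * exp (- K)<=(psum V n) * exp K * exp (- K)" by simp
  moreover have "(psum V n) * exp K * exp (- K) = (psum V n)" by (simp add: mult.assoc mult_exp_exp)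
  moreover have "c/2 * exp (Pr * n) * exp (- K) = c/2 * exp (- K) * exp (Pr * n)" by simp
  ultimately show "c/2 * exp (- K) * exp (Pr * n)<=(psum V n)" by linarith
 qed (use assms in auto)
qed

text \<open>Maximal \<open>13*\<delta>\<close>-separated subsets of \<open>GM M\<close> have
  partition sums at least \<open>c * exp (Pr * n)\<close>; extended to maximal
  \<open>5*\<delta>\<close>-separated subsets of the space they keep this weight and become
  spanning. As only a constant factor is lost, the limit measure has free energy exactly
  \<open>Pr\<close>.\<close>

theorem reference_measure:
 obtains \<mu> :: "'a measure" and F :: "nat filter" and E :: "nat=>'a set" and n0 :: nat and w where
  "F<=sequentially" "F~=bot" "invariant_measure f \<mu>" "free_energy f \<phi> \<mu> = ereal Pr"
  "!!k. finite (E k)" "!!k. E k~={}" "!!k. separated f (real (n0+k)) (5*\<delta>) (E k)"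
  "!!k x. EX y:E k. near (real (n0+k)) (5*\<delta>) y x"
  "!!k x. w k x = exp (birk \<phi> x (real (n0+k)))/(psum (E k) (real (n0+k)))"
  "!!g :: 'a=>real. cts g ==> ((%k. SUM x:E k. w k x * avg g (n0+k+1) x) \<longlongrightarrow> integral\<^sup>L \<mu> g) F"
proof -
 obtain M n0 :: nat and c where c: "c > 0" "n0>=1" and V: "!!n S V. n>=n0 ==> ALL w. cov (real n) \<epsilon> S w --> 1/2 * exp (Pr * n)<=w ==> finite V ==> V\<subseteq>slice (GM (real M)) n ==>
   ALL x:S\<inter>slice (GM (real M)) n. EX y:V. near (real n) (13*\<delta>) y x ==>
   c * exp (Pr * n)<=(psum V n)" by (rule GM_lower[of "1/2"]) (simp, rule that)
 have r: "13*\<delta> > 0" "5*\<delta> > 0" using \<delta> by auto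
 have "EX E. finite E&separated f n (5*\<delta>) E&(ALL x. EX y:E. near (real n) (5*\<delta>) y x) &
  c * exp (Pr * n)<=(psum E n)" if n: "n>=n0" for n :: nat
 proof -
  have n1: "n>=1" using n c by simp
  have "separated f n (13*\<delta>) {}" by (simp add: separated_def)
  then obtain U where U: "U\<subseteq>slice (GM M) n" "finite U" "separated f n (13*\<delta>) U"
   "!!x. x\<in>slice (GM M) n ==> EX y:U. near (real n) (13*\<delta>) y x"
   by (rule maximal_separated[OF r(1) of_nat_0_le_iff empty_subsetI]) (rule that)
  \<comment> \<open>The factor 1/2 comes from the \<open>ln 2\<close> of the Gibbs
    inequality.\<close>
  have "1/2 * exp (Pr * n)<=w" if w: "cov n \<epsilon> UNIV w" for w
  proof -
   have "Pr<=(ln 2+ln w)/n" using pressure_cov_lower[OF perp n1 w] by (simp add: top_pressure_real)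
   hence "Pr * n<=ln 2+ln w" using n1 by (simp add: pos_le_divide_eq)
   also have "\<dots> = ln (2 * w)" using cov_UNIV_pos[OF w] by (simp add: ln_mult)
   finally have "exp (Pr * n)<=exp (ln (2 * w))" by simp
   thus ?thesis using cov_UNIV_pos[OF w] by simp
  qed
  hence lower: "c * exp (Pr * n)<=(psum U n)" by (intro V[OF n,of UNIV] U(1,2)) (use U(4) in auto)
  have "separated f n (5*\<delta>) U" using U(3) \<delta> unfolding separated_def by fastforce
  then obtain E where E: "U\<subseteq>E" "finite E" "separated f n (5*\<delta>) E" "!!x. x\<in>UNIV ==> EX y:E. near (real n) (5*\<delta>) y x"
   by (rule maximal_separated[OF r(2) of_nat_0_le_iff subset_UNIV]) (rule that)
  have "(psum U n)<=(psum E n)" using E by (intro sum_mono2) auto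
  thus ?thesis using E lower by (intro exI[of _ E]) auto
 qed
 hence "ALL k. EX E. finite E&separated f (real (n0+k)) (5*\<delta>) E&(ALL x. EX y:E. near (real (n0+k)) (5*\<delta>) y x) &
  c * exp (Pr * real (n0+k))<=(psum E (real (n0+k)))" using le_add1 by blast
 from choice[OF this] obtain E where E: "!!k. finite (E k)" "!!k. separated f (real (n0+k)) (5*\<delta>) (E k)"
  "!!k x. EX y:E k. near (real (n0+k)) (5*\<delta>) y x"
  "!!k. c * exp (Pr * real (n0+k))<=(psum (E k) (real (n0+k)))" by blast
 have ne: "E k~={}" for k using E(3)[of k] by blast
 have low: "Pr * real (n0+k)-(- ln c)<=ln (psum (E k) (real (n0+k)))" for k
 proof -
  have "ln (c * exp (Pr * real (n0+k)))<=ln (psum (E k) (real (n0+k)))" using E(4)[of k] c(1) by (intro ln_mono) auto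
  thus ?thesis using c(1) by (simp add: ln_mult)
 qed
 have tinf: "filterlim (%k. real (n0+k)) at_top sequentially" by (rule filterlim_at_top_mono[OF filterlim_real_sequentially]) simp
 have Nk: "n0+k+1 = nat \<lceil>real (n0+k)\<rceil>+1" for k by (simp del: of_nat_add)
 obtain \<mu> F where F: "F<=sequentially" "F~=bot" "invariant_measure f \<mu>"
  "!!g :: 'a=>real. cts g ==> ((%k. SUM x:E k. exp (birk \<phi> x (real (n0+k)))/(psum (E k) (real (n0+k))) * avg g (n0+k+1) x) \<longlongrightarrow> integral\<^sup>L \<mu> g) F"
  "ereal Pr<=free_energy f \<phi> \<mu>" by (rule misiurewicz[OF \<phi> r(2) E(1) ne E(2) of_nat_0_le_iff tinf low refl Nk]) (rule that)
 show thesis by (rule that[OF F(1-3) antisym[OF free_energy_le[OF F(3)] F(5)] E(1) ne E(2,3) refl F(4)])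
qed

corollary equilibrium_iff: "equilibrium_state f \<phi> \<mu> \<longleftrightarrow> invariant_measure f \<mu>&free_energy f \<phi> \<mu> = ereal Pr"
proof -
 obtain \<mu>0 where "invariant_measure f \<mu>0" "free_energy f \<phi> \<mu>0 = ereal Pr" by (rule reference_measure) (rule that)
 thus ?thesis using free_energy_le unfolding equilibrium_state_def by (metis antisym order_refl)
qed

end


section \<open>Uniqueness\<close>

lemma sum_Times:
 fixes g :: "'a=>real" and h :: "'b=>real"
 shows "(SUM x:A. g x)*(SUM y:B. h y) = (SUM z:A\<times>B. g (fst z) * h (snd z))" by (simp only: sum_product sum.cartesian_product case_prod_beta')

context nonuniform
begin

text \<open>Gluing a prefix, a segment near \<open>V1\<close>, a segment near \<open>V2\<close> and a suffix, and following the result by points of \<open>E\<close>: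
 a definite proportion of the weight of \<open>E\<close> makes the transition from \<open>V1\<close> to \<open>V2\<close> at a prescribed time.
 The constants do not depend on \<open>V1\<close>, \<open>V2\<close> and their length \<open>t\<close>.\<close>
lemma glue_lower:
 assumes M: "M>=0" and c: "c > 0"
 obtains \<kappa> \<xi> :: real and q R R0 n1 :: nat where "\<kappa> > 0" "\<xi> > 0" "R>=1"
  "!!n a b t U V1 V2 U' E h. n1<=a ==> n1<=b ==> n1<=t ==> n = a+2 * t+b+R0 ==>
   \<forall>(l,W)\<in>{(a,U),(t,V1),(t,V2),(b,U')}. finite W&W\<subseteq>slice (GM M) (real l)&separated f (real l) (13*\<delta>) W &
    c * exp (Pr * real l)<=(psum W (real l)) ==>
   finite E ==> separated f (real n) (5*\<delta>) E ==> ALL x. EX y:E. near (real n) (5*\<delta>) y x ==>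
   cts h ==> ALL x. 0<=h x ==>
   ALL x d. d<=q&(EX v:V1. near (real t) (13/2*\<delta>) v x) &
    (EX v:V2. near (real t) (13/2*\<delta>) v (f (t+d * \<kappa>) x)) --> 1<=h x ==>
   \<xi>*(psum E (real n))<=(SUM x:E. exp (birk \<phi> x (real n)) * birk h (f (real a) x) (real R))"
proof -
 from spec[OF M] obtain T0 where T0: "T0 > 0" "W_spec f (GM M\<inter>UNIV\<times>{T0..}) \<delta>" unfolding tail_W_spec_def by blast
 obtain \<tau> where \<tau>: "\<tau> > 0" and shadow: "!!xs. set xs\<subseteq>GM M\<inter>UNIV\<times>{T0..} ==> EX y \<theta>. (ALL i. 0<=\<theta> i&\<theta> i<=\<tau>) &
  (ALL j<length xs. ALL s:{0..snd (xs ! j)}. dist (f (s+((\<Sum>i<j. snd (xs ! i))+(\<Sum>i<j. \<theta> i))) y) (f s (fst (xs ! j))) < \<delta>)"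
  by (rule W_spec_shadow[OF T0(2)]) (use GM_orbit_segments in blast, rule that)
 obtain K where K: "K > 0" "!!x t y. (x,t)\<in>GM M ==> y\<in>bowen_ball f t x \<epsilon> ==> \<bar>birk \<phi> x t-birk \<phi> y t\<bar><=K"
  by (rule bowen_GM[OF M]) (rule that)
 obtain b0 where b0: "b0 > 0" "!!x t. 0<=t ==> \<bar>birk \<phi> x t\<bar><=b0 * t" using potential_bound by blast
 obtain B where B: "B > 0" "!!n :: nat. cov n (5*\<delta>) UNIV (B * exp (Pr * n))" by (rule cov_upper) (rule that)
 have "\<delta>/2 > 0" using \<delta> by simp
 from f_small_time[OF this] obtain \<kappa>0 where \<kappa>0: "\<kappa>0 > 0" "!!x r. \<bar>r\<bar><=\<kappa>0 ==> dist (f r x) x < \<delta>/2" by blast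
 \<comment> \<open>At most three gluing times precede a segment; rounding each of them to multiples
   of \<open>\<kappa>\<close> moves its starting time by at most \<open>\<kappa>0\<close>.\<close>
 define \<kappa> where "\<kappa> = \<kappa>0/3"
 have \<kappa>: "\<kappa> > 0" "3*\<kappa> = \<kappa>0" using \<kappa>0 by (auto simp: \<kappa>_def)
 define q where "q = nat \<lfloor>\<tau>/\<kappa>\<rfloor>"
 \<comment> \<open>\<open>R\<close> has room for the first gluing time and a stretch of length
   \<open>\<kappa>\<close> on which \<open>h\<close> is at least 1; \<open>R0\<close> accommodates
   four gluing times, so that the total length is prescribed.\<close>
 define R where "R = nat \<lceil>\<tau>+\<kappa>\<rceil>"
 define R0 where "R0 = nat \<lceil>4*\<tau>\<rceil>"
 define n1 where "n1 = nat \<lceil>T0\<rceil>"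
 have R: "\<tau>+\<kappa><=real R" and R0: "4*\<tau><=real R0" and n1: "T0<=real n1" unfolding R_def R0_def n1_def by linarith+
 define C where "C = real ((q+1) ^ 3) * exp (4 * K+b0 * real R0)"
 have C: "C > 0" unfolding C_def by (intro mult_pos_pos) auto
 \<comment> \<open>Collects \<open>\<kappa>\<close> for the time gained, \<open>C\<close> for
   distortion and gluing classes, \<open>c\<close> for each of the four sums, the length
   \<open>R0\<close> of the gaps, and \<open>B\<close> for the total weight of
   \<open>E\<close>.\<close>
 define \<xi> where "\<xi> = \<kappa>/C * c ^ 4 * exp (- (Pr * R0))/B"
 show thesis
 proof (rule that[of \<kappa> \<xi> R n1 R0 q])
  show "\<kappa> > 0" by fact
  show "\<xi> > 0" unfolding \<xi>_def using \<kappa> C c B by simp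
  show "R>=1" using R \<tau> \<kappa>(1) by (cases R) auto
  fix n a b t :: nat and U V1 V2 U' E :: "'a set" and h :: "'a=>real"
  assume len: "n1<=a" "n1<=b" "n1<=t" "n = a+2 * t+b+R0"
   and W: "\<forall>(l,W)\<in>{(a,U),(t,V1),(t,V2),(b,U')}. finite W&W\<subseteq>slice (GM M) (real l)&separated f (real l) (13*\<delta>) W &
    c * exp (Pr * real l)<=(psum W (real l))"
   and E: "finite E" "separated f (real n) (5*\<delta>) E" "ALL x. EX y:E. near (real n) (5*\<delta>) y x"
   and h: "cts h" "ALL x. 0<=h x"
   and h1: "ALL x d. d<=q&(EX v:V1. near (real t) (13/2*\<delta>) v x) &
    (EX v:V2. near (real t) (13/2*\<delta>) v (f (t+d * \<kappa>) x)) --> 1<=h x"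
  define lg where "lg j = [a,t,t,b] ! j" for j
  define Wj where "Wj j = [U,V1,V2,U'] ! j" for j
  have W4: "finite (Wj j)" "Wj j\<subseteq>slice (GM M) (real (lg j))" "separated f (real (lg j)) (13*\<delta>) (Wj j)"
    "c * exp (Pr * real (lg j))<=(SUM x:Wj j. exp (birk \<phi> x (real (lg j))))" "n1<=lg j" if "j < 4" for j
   using W len that by (auto simp: lg_def Wj_def less_Suc_eq numeral_eq_Suc)
  define Q where "Q = U\<times>V1\<times>V2\<times>U'"
  have finQ: "finite Q" using W unfolding Q_def by auto
  define pt where "pt z j = (case z of (u,x,y,v)=>[u,x,y,v] ! j)" for z :: "'a\<times>'a\<times>'a\<times>'a" and j
  have ptW: "pt z j\<in>Wj j" if "z\<in>Q" "j < 4" for z j using that by (auto simp: Q_def pt_def Wj_def less_Suc_eq numeral_eq_Suc)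
  define sg where "sg z = map (%j. (pt z j,real (lg j))) [0..<4]" for z
  have sgn: "length (sg z) = 4" "!!j. j < 4 ==> sg z ! j = (pt z j,real (lg j))" for z unfolding sg_def by (simp, subst nth_map) auto
  have sgG: "set (sg z)\<subseteq>GM M\<inter>UNIV\<times>{T0..}" if "z\<in>Q" for z
  proof
   fix w assume "w\<in>set (sg z)"
   then obtain j where j: "j < 4" "w = (pt z j,real (lg j))" by (auto simp: sg_def)
   have "T0<=real (lg j)" using W4(5)[OF j(1)] n1 by linarith
   thus "w\<in>GM M\<inter>UNIV\<times>{T0..}" using W4(2)[OF j(1)] ptW[OF that j(1)] j(2) by (auto simp: slice_def)
  qed
  have "ALL z. EX y \<theta>. z\<in>Q --> (ALL i. 0<=\<theta> i&\<theta> i<=\<tau>)&(ALL j<length (sg z). ALL s:{0..snd (sg z ! j)}.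
   dist (f (s+((\<Sum>i<j. snd (sg z ! i))+(\<Sum>i<j. \<theta> i))) y) (f s (fst (sg z ! j))) < \<delta>)" using shadow[OF sgG] by meson
  then obtain Y \<theta> where Y: "!!z i. z\<in>Q ==> 0<=\<theta> z i&\<theta> z i<=\<tau>"
   "!!z j s. z\<in>Q ==> j < length (sg z) ==> s\<in>{0..snd (sg z ! j)} ==>
   dist (f (s+((\<Sum>i<j. snd (sg z ! i))+(\<Sum>i<j. \<theta> z i))) (Y z)) (f s (fst (sg z ! j))) < \<delta>" by metis
  define u where "u z j = (\<Sum>i<j. real (lg i))+(\<Sum>i<j. \<theta> z i)" for z j
  have ueq: "(\<Sum>i<j. snd (sg z ! i))+(\<Sum>i<j. \<theta> z i) = u z j" if "j<=4" for z j
   unfolding u_def using sgn(2) that by (intro arg_cong2[where f = "(+)"] sum.cong) auto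
  have Yd: "dist (f (s+u z j) (Y z)) (f s (pt z j)) < \<delta>" if "z\<in>Q" "j < 4" "0<=s" "s<=lg j" for z j and s :: real
   using Y(2)[OF that(1),of j s] that sgn ueq[of j z] by simp
  have lsum: "(\<Sum>i<4. real (lg i)) = a+2 * t+b" by (simp add: lg_def numeral_eq_Suc)
  have \<theta>sum: "0<=(\<Sum>i<j. \<theta> z i)" "(\<Sum>i<j. \<theta> z i)<=j * \<tau>" if "z\<in>Q" for z j
   using Y(1)[OF that] sum_bounded_above[of "{..<j}" "\<theta> z" \<tau>] by (auto intro: sum_nonneg)
  have ub: "0<=u z j" "u z j+lg j<=n" if "z\<in>Q" "j < 4" for z j
  proof -
   show "0<=u z j" unfolding u_def using \<theta>sum(1)[OF that(1)] by (intro add_nonneg_nonneg) (auto intro: sum_nonneg)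
   have "(\<Sum>i<j. real (lg i))+lg j = (\<Sum>i<Suc j. real (lg i))" by simp
   also have "\<dots><=(\<Sum>i<4. real (lg i))" using that by (intro sum_mono2) auto
   finally have "(\<Sum>i<j. real (lg i))+lg j<=a+2 * t+b" using lsum by simp
   moreover have "j * \<tau><=4*\<tau>" using that \<tau> by simp
   ultimately show "u z j+lg j<=n" using \<theta>sum(2)[OF that(1),of j] R0 len(4) unfolding u_def by simp
  qed
  from E(3) have "ALL z. EX x:E. near (real n) (5*\<delta>) x (Y z)" by blast
  \<comment> \<open>The glued orbit is replaced by a point of \<open>E\<close> that follows it
    within \<open>5*\<delta>\<close>; with the shadowing error this makes
    \<open>6*\<delta>\<close>.\<close>
  then obtain X where X: "!!z. X z\<in>E" "!!z s. s\<in>{0..real n} ==> dist (f s (X z)) (f s (Y z))<=5*\<delta>" by metis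
  have Xd: "dist (f (s+u z j) (X z)) (f s (pt z j)) < 6*\<delta>" if "z\<in>Q" "j < 4" "0<=s" "s<=lg j" for z j and s :: real
  proof -
   have "dist (f (s+u z j) (X z)) (f (s+u z j) (Y z))<=5*\<delta>" by (rule X(2)) (use ub[OF that(1,2)] that in auto)
   thus ?thesis using Yd[OF that] dist_triangle[of "f (s+u z j) (X z)" "f s (pt z j)" "f (s+u z j) (Y z)"] by linarith
  qed
  have bk: "(\<Sum>j<4. birk \<phi> (pt z j) (lg j))<=birk \<phi> (X z) n+(4 * K+b0 * R0)" if z: "z\<in>Q" for z
  proof -
   have "(\<Sum>i<4. birk \<phi> (fst (sg z ! i)) (snd (sg z ! i)))-K * (4 :: nat)-b0*(\<Sum>i<4. \<theta> z i)
    <= birk \<phi> (X z) ((\<Sum>i<4. snd (sg z ! i))+(\<Sum>i<4. \<theta> z i))"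
   proof (rule shadow_birkhoff[OF b0(2) K(2)])
    fix j :: nat and s assume j: "j < 4" and s: "s\<in>{0..snd (sg z ! j)}"
    have "dist (f (s+u z j) (X z)) (f s (pt z j)) < \<epsilon>" using Xd[OF z j,where s = s] s sgn(2)[OF j,of z] \<delta> \<epsilon> by auto
    thus "dist (f (s+((\<Sum>i<j. snd (sg z ! i))+(\<Sum>i<j. \<theta> z i))) (X z)) (f s (fst (sg z ! j))) < \<epsilon>"
     using ueq[of j z] sgn(2)[OF j,of z] j by simp
   qed (use sgG[OF z] Y(1)[OF z] sgn in auto)
   moreover have "(\<Sum>i<4. birk \<phi> (fst (sg z ! i)) (snd (sg z ! i))) = (\<Sum>j<4. birk \<phi> (pt z j) (lg j))" by (rule sum.cong) (use sgn(2) in auto)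
   ultimately have "(\<Sum>j<4. birk \<phi> (pt z j) (lg j))-4 * K-b0*(\<Sum>i<4. \<theta> z i)<=birk \<phi> (X z) (u z 4)" using ueq[of 4 z] by simp
   moreover have u4: "u z 4 = a+2 * t+b+(\<Sum>i<4. \<theta> z i)" by (simp add: u_def lsum)
   have u4n: "0<=n-u z 4" using \<theta>sum(2)[OF z,of 4] R0 len(4) by (simp add: u4)
   have "birk \<phi> (X z) n = birk \<phi> (X z) (u z 4)+birk \<phi> (f (u z 4) (X z)) (n-u z 4)"
    using u4n \<theta>sum(1)[OF z,of 4] by (subst birkhoff_add[OF \<phi>, symmetric]) (auto simp: u4)
   moreover have "\<bar>birk \<phi> (f (u z 4) (X z)) (n-u z 4)\<bar><=b0*(n-u z 4)" by (rule b0(2)[OF u4n])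
   moreover have "b0*(\<Sum>i<4. \<theta> z i)+b0*(n-u z 4) = b0 * R0" unfolding u4 len(4) by (simp add: algebra_simps)
   ultimately show ?thesis by linarith
  qed
  define cl where "cl z = (nat \<lfloor>\<theta> z 0/\<kappa>\<rfloor>,nat \<lfloor>\<theta> z 1/\<kappa>\<rfloor>,nat \<lfloor>\<theta> z 2/\<kappa>\<rfloor>)" for z
  have flq: "nat \<lfloor>\<theta> z i/\<kappa>\<rfloor><=q" if "z\<in>Q" for z i
   unfolding q_def using Y(1)[OF that,of i] \<kappa>(1) by (intro nat_mono floor_mono divide_right_mono) auto
  define L where "L = {..q}\<times>{..q}\<times>{..q}"
  have clL: "cl z\<in>L" if "z\<in>Q" for z using flq[OF that] by (simp add: cl_def L_def)
  have finL: "finite L" by (simp add: L_def)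
  have cardL: "card L = (q+1) ^ 3" by (simp add: L_def card_cartesian_product numeral_eq_Suc)
  have same: "\<bar>u z j-u z' j\<bar><=\<kappa>0" if z: "z\<in>Q" "z'\<in>Q" "cl z = cl z'" "j < 4" for z z' j
  proof -
   have "\<bar>\<theta> z i-\<theta> z' i\<bar><=\<kappa>" if "i < 3" for i
   proof -
    have "nat \<lfloor>\<theta> z i/\<kappa>\<rfloor> = nat \<lfloor>\<theta> z' i/\<kappa>\<rfloor>" using z(3) that by (auto simp: cl_def less_Suc_eq numeral_eq_Suc)
    moreover have "0<=\<theta> z i/\<kappa>" "0<=\<theta> z' i/\<kappa>" using Y(1) z \<kappa>(1) by auto
    ultimately have "\<lfloor>\<theta> z i/\<kappa>\<rfloor> = \<lfloor>\<theta> z' i/\<kappa>\<rfloor>" by linarith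
    hence "\<bar>\<theta> z i/\<kappa> - \<theta> z' i/\<kappa>\<bar><=1" by linarith
    hence "\<bar>\<theta> z i-\<theta> z' i\<bar>/\<kappa><=1" using \<kappa>(1) by (simp add: diff_divide_distrib[symmetric] abs_divide)
    thus ?thesis using \<kappa>(1) by simp
   qed
   hence "(\<Sum>i<j. \<bar>\<theta> z i-\<theta> z' i\<bar>)<=(\<Sum>i<j. \<kappa>)" using z(4) by (intro sum_mono) auto
   moreover have "(\<Sum>i<j. \<kappa>)<=\<kappa>0" using mult_right_mono[of "real j" 3 \<kappa>] z(4) \<kappa> by simp
   moreover have "\<bar>u z j-u z' j\<bar><=(\<Sum>i<j. \<bar>\<theta> z i-\<theta> z' i\<bar>)" unfolding u_def by (simp add: sum_subtractf[symmetric])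
   ultimately show ?thesis by linarith
  qed
  have inj: "inj_on (%z. (X z,cl z)) Q"
  proof (rule inj_onI)
   fix z z' assume z: "z\<in>Q" "z'\<in>Q" and eq: "(X z,cl z) = (X z',cl z')"
   have "pt z j = pt z' j" if j: "j < 4" for j
   proof -
    \<comment> \<open>Twice \<open>6*\<delta>\<close>, and \<open>\<delta>/2\<close> for the timing
      discrepancy: here separation at \<open>13*\<delta>\<close> is used.\<close>
    have "dist (f s (pt z j)) (f s (pt z' j))<=13*\<delta>" if s: "s\<in>{0..real (lg j)}" for s
    proof -
     have "\<bar>u z' j-u z j\<bar><=\<kappa>0" using same[OF z(2,1) _ j] eq by simp
     from \<kappa>0(2)[OF this,of "f (s+u z j) (X z)"] have "dist (f (s+u z' j) (X z)) (f (s+u z j) (X z)) < \<delta>/2"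
      by (simp add: f_add[symmetric] add.commute)
     moreover have "dist (f (s+u z j) (X z)) (f s (pt z j)) < 6*\<delta>" "dist (f (s+u z' j) (X z)) (f s (pt z' j)) < 6*\<delta>"
      using Xd[OF z(1) j,where s = s] Xd[OF z(2) j,where s = s] s eq by auto
     ultimately show ?thesis using dist_triangle3[of "f s (pt z j)" "f s (pt z' j)" "f (s+u z j) (X z)"]
       dist_triangle3[of "f (s+u z j) (X z)" "f s (pt z' j)" "f (s+u z' j) (X z)"] \<delta> by linarith
    qed
    thus ?thesis using W4(3)[OF j] ptW[OF z(1) j] ptW[OF z(2) j] by (simp add: separated_iff)
   qed
   from this[of 0] this[of 1] this[of 2] this[of 3] show "z = z'" by (cases z; cases z') (auto simp: pt_def)
  qed
  have hgood: "\<kappa><=birk h (f a (X z)) R" if z: "z\<in>Q" for z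
  proof -
   let ?r = "\<theta> z 0"
   have r: "0<=?r" "?r+\<kappa><=R" using Y(1)[OF z,of 0] R by auto
   have u1: "u z 1 = a+?r" "u z 2 = a+?r+(t+\<theta> z 1)" by (simp_all add: u_def lg_def numeral_eq_Suc)
   \<comment> \<open>The rounded delay between the two middle segments. Replacing the true delay by
     \<open>d * \<kappa>\<close> and moving the start by up to \<open>\<kappa>\<close> stay together
     within the allowance \<open>\<kappa>0\<close>.\<close>
   define d where "d = nat \<lfloor>\<theta> z 1/\<kappa>\<rfloor>"
   have "0<=\<theta> z 1/\<kappa>" using Y(1)[OF z,of 1] \<kappa>(1) by simp
   hence "real d<=\<theta> z 1/\<kappa>" "\<theta> z 1/\<kappa><=real d+1" unfolding d_def by linarith+
   hence d: "\<bar>\<theta> z 1-d * \<kappa>\<bar><=\<kappa>" using \<kappa>(1) by (auto simp: field_simps abs_le_iff)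
   have close: "dist (f s (pt z j)) (f s' (X z))<=13/2*\<delta>" if "j < 4" "0<=s" "s<=lg j" "\<bar>s'-(s+u z j)\<bar><=\<kappa>0" for s s' :: real and j
   proof -
    from \<kappa>0(2)[OF that(4),of "f (s+u z j) (X z)"] have "dist (f s' (X z)) (f (s+u z j) (X z)) < \<delta>/2" by (simp add: f_add[symmetric])
    thus ?thesis using Xd[OF z that(1-3)] dist_triangle3[of "f s (pt z j)" "f s' (X z)" "f (s+u z j) (X z)"] by (simp add: dist_commute)
   qed
   have one: "1<=h (f s (f a (X z)))" if s: "?r<=s" "s<=?r+\<kappa>" for s
   proof (rule h1[rule_format,of d], intro conjI)
    show "d<=q" unfolding d_def by (rule flq[OF z])
    show "EX v:V1. ALL s':{0..real t}. dist (f s' v) (f s' (f s (f a (X z))))<=13/2*\<delta>"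
    proof (intro bexI[of _ "pt z 1"] ballI)
     fix s' assume "s'\<in>{0..real t}"
     hence "dist (f s' (pt z 1)) (f (s'+(s+a)) (X z))<=13/2*\<delta>"
      using s \<kappa> by (intro close) (auto simp: u1 lg_def abs_le_iff simp del: One_nat_def)
     thus "dist (f s' (pt z 1)) (f s' (f s (f a (X z))))<=13/2*\<delta>" by (simp add: f_add)
    qed (use ptW[OF z,of 1] in \<open>simp add: Wj_def\<close>)
    show "EX v:V2. ALL s':{0..real t}. dist (f s' v) (f s' (f (t+d * \<kappa>) (f s (f a (X z)))))<=13/2*\<delta>"
    proof (intro bexI[of _ "pt z 2"] ballI)
     fix s' assume "s'\<in>{0..real t}"
     hence "dist (f s' (pt z 2)) (f (s'+(t+d * \<kappa>+(s+a))) (X z))<=13/2*\<delta>"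
      using s \<kappa> d by (intro close) (auto simp: u1 lg_def abs_le_iff simp del: One_nat_def)
     thus "dist (f s' (pt z 2)) (f s' (f (t+d * \<kappa>) (f s (f a (X z)))))<=13/2*\<delta>" by (simp add: f_add)
    qed (use ptW[OF z,of 2] in \<open>simp add: Wj_def\<close>)
   qed
   let ?g = "%s. h (f s (f a (X z)))"
   have gi: "?g integrable_on {x..y}" for x y by (rule birkhoff_integrable[OF h(1)])
   have "\<kappa> = integral {?r..?r+\<kappa>} (%s. 1 :: real)" using \<kappa>(1) by simp
   also have "\<dots><=integral {?r..?r+\<kappa>} ?g" by (rule integral_le) (use gi one in auto)
   also have "\<dots><=integral {0..real R} ?g" by (rule integral_subset_le) (use r gi h(2) in auto)
   finally show ?thesis by (simp add: birkhoff_int_def)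
  qed
  let ?e = "%x. exp (birk \<phi> x n)"
  have "(SUM z:Q. exp (\<Sum>j<4. birk \<phi> (pt z j) (lg j)))<=(SUM z:Q. ?e (X z) * exp (4 * K+b0 * R0))"
   by (rule sum_mono) (use bk in \<open>simp add: exp_add[symmetric]\<close>)
  also have "\<dots> = (SUM w:(%z. (X z,cl z)) ` Q. ?e (fst w)) * exp (4 * K+b0 * R0)" by (simp add: sum.reindex[OF inj] sum_distrib_right)
  also have "(SUM w:(%z. (X z,cl z)) ` Q. ?e (fst w))<=(SUM w:X ` Q\<times>L. ?e (fst w))" by (rule sum_mono2) (use finQ clL finL in auto)
  also have "\<dots> = (SUM x:X ` Q. SUM l:L. ?e x)" by (simp only: sum.cartesian_product case_prod_beta')
  also have "\<dots> = (SUM x:X ` Q. ?e x) * real ((q+1) ^ 3)" unfolding sum_distrib_right by (rule sum.cong) (simp_all only: sum_constant cardL mult.commute)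
  finally have 1: "(SUM z:Q. exp (\<Sum>j<4. birk \<phi> (pt z j) (lg j)))<=(SUM x:X ` Q. ?e x) * C" by (simp add: C_def mult.assoc)
  have "c ^ 4 * exp (Pr * (a+2 * t+b)) = (c * exp (Pr * a))*((c * exp (Pr * t))*((c * exp (Pr * t))*(c * exp (Pr * b))))"
   by (simp add: exp_add[symmetric] algebra_simps numeral_eq_Suc)
  also have "\<dots><=(psum U a)*((psum V1 t) *
    ((psum V2 t)*(psum U' b)))" using W c by (intro mult_mono mult_nonneg_nonneg sum_nonneg) auto
  also have "\<dots> = (SUM z:Q. exp (\<Sum>j<4. birk \<phi> (pt z j) (lg j)))"
   unfolding Q_def sum_Times by (intro sum.cong) (auto simp: pt_def lg_def numeral_eq_Suc exp_add)
  finally have 2: "c ^ 4 * exp (Pr * (a+2 * t+b))<=(SUM x:X ` Q. ?e x) * C" using 1 by linarith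
  have "(SUM x:E. ?e x)<=B * exp (Pr * n)" by (rule cov_separated_le[OF B(2) E(1) subset_UNIV E(2)]) simp
  hence "\<xi>*(SUM x:E. ?e x)<=\<xi>*(B * exp (Pr * n))" using \<open>\<xi> > 0\<close> by (intro mult_left_mono) auto
  also have "\<dots> = \<kappa>/C * (c ^ 4 * exp (Pr * (a+2 * t+b)))"
  proof -
   have "exp (- (Pr * R0)) * exp (Pr * n) = exp (Pr * (a+2 * t+b))" unfolding exp_add[symmetric] len(4) by (simp add: algebra_simps)
   thus ?thesis unfolding \<xi>_def using B(1) by (simp add: mult.assoc)
  qed
  also have "\<dots><=\<kappa>/C * ((SUM x:X ` Q. ?e x) * C)" using 2 \<kappa>(1) C by (intro mult_left_mono) auto
  also have "\<dots> = (SUM x:X ` Q. ?e x * \<kappa>)" using C by (simp add: sum_distrib_left mult.commute)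
  also have "\<dots><=(SUM x:X ` Q. ?e x * birk h (f a x) R)" using hgood by (intro sum_mono mult_left_mono) auto
  also have "\<dots><=(SUM x:E. ?e x * birk h (f a x) R)"
   using X(1) E(1) h by (intro sum_mono2) (auto intro!: mult_nonneg_nonneg Henstock_Kurzweil_Integration.integral_nonneg birkhoff_integrable simp: birkhoff_int_def)
  finally show "\<xi>*(SUM x:E. ?e x)<=(SUM x:E. ?e x * birk h (f a x) R)" .
 qed
qed

end


section \<open>Separating distinct ergodic measures\<close>

context compact_flow
begin

text \<open>\<open>A\<close> is the set where the lower limit of the averages along \<open>r\<close>
  exceeds \<open>c\<close>, for a function \<open>g\<close> whose two integrals lie on different
  sides of \<open>c\<close>. The margins \<open>1/Suc j\<close> make it exactly invariant, since a
  time shift changes the averages by a vanishing amount.\<close>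

lemma ergodic_separation:
 assumes m1: "ergodic_measure f m1" and m2: "ergodic_measure f m2" and ne: "m1~=m2"
 obtains A where "A\<in>sets borel" "!!t. f t -` A = A" "measure m1 A = 1" "measure m2 A = 0"
proof -
 interpret m1: compact_inv_flow f m1 using m1 by (intro compact_inv_flowI) (simp add: ergodic_measure_def)
 interpret m2: compact_inv_flow f m2 using m2 by (intro compact_inv_flowI) (simp add: ergodic_measure_def)
 have "EX g :: 'a=>real. cts g&integral\<^sup>L m1 g~=integral\<^sup>L m2 g"
 proof (rule ccontr)
  assume "\<not> ?thesis"
  hence "m1 = m2" by (intro finite_measure_eqI_continuous m1.sets_eq m2.sets_eq m1.finite_measure_axioms m2.finite_measure_axioms) blast
  with ne show False ..
 qed
 then obtain g0 :: "'a=>real" where g0: "cts g0" "integral\<^sup>L m1 g0~=integral\<^sup>L m2 g0" by blast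
 have "EX g :: 'a=>real. cts g&integral\<^sup>L m2 g < integral\<^sup>L m1 g"
 proof (cases "integral\<^sup>L m2 g0 < integral\<^sup>L m1 g0")
  case False
  thus ?thesis using g0 by (intro exI[of _ "%x. - g0 x"]) (auto intro!: continuous_intros)
 qed (use g0 in blast)
 then obtain g :: "'a=>real" where g: "cts g" "integral\<^sup>L m2 g < integral\<^sup>L m1 g" by blast
 from dense[OF g(2)] obtain c where c: "integral\<^sup>L m2 g < c" "c < integral\<^sup>L m1 g" by blast
 from bounded_fun[OF g(1)] obtain B where B: "B > 0" "!!x. \<bar>g x\<bar><=B" by blast
 obtain r :: "nat=>nat" where r: "strict_mono r" "AE x in m1. ALL j :: nat. convergent (%k. avg g (r k) x)"
  by (rule m1.averages_converge_ae[of "%_. g"]) (rule g(1), rule that)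
 have cavg: "cts (avg g n)" for n by (rule avg_continuous[OF g(1)])
 define A where "A = {x. EX j K. ALL k>=K. c+1/Suc j<=avg g (r k) x}"
 have Ab: "A\<in>sets borel"
 proof -
  have "A = (\<Union>j. \<Union>K. \<Inter>k\<in>{K..}. {x. c+1/Suc j<=avg g (r k) x})" by (auto simp: A_def)
  moreover have "(\<Inter>k\<in>{K..}. {x. c+1/Suc j<=avg g (r k) x})\<in>sets borel" for j K
   by (intro borel_closed closed_INT ballI closed_Collect_le continuous_on_const cavg)
  ultimately show ?thesis by auto
 qed
 have rk: "real k<=real (r k)" for k using seq_suble[OF r(1),of k] by simp
 have sub: "A\<subseteq>f t -` A" for t
 proof
  fix x assume "x\<in>A"
  then obtain j K where jK: "!!k. k>=K ==> c+1/Suc j<=avg g (r k) x" unfolding A_def by blast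
  obtain K' :: nat where K': "2 * B * \<bar>t\<bar>*(2 * Suc j) < K'" using reals_Archimedean2 by blast
  \<comment> \<open>Half of the margin \<open>1/Suc j\<close> is given up to the effect of the time
    shift.\<close>
  have "c+1/Suc (2 * j+1)<=avg g (r k) (f t x)" if k: "k>=max K (max K' 1)" for k
  proof -
   have r0: "real (r k) > 0" using rk[of k] k by simp
   have "real K'<=r k" using rk[of k] k by simp
   hence "2 * B * \<bar>t\<bar>*(2 * Suc j)<=r k" using K' by linarith
   hence "2 * B * \<bar>t\<bar>/r k<=1/(2 * Suc j)" using r0 by (simp add: pos_divide_le_eq pos_le_divide_eq mult.commute)
   moreover have "\<bar>birk g (f t x) (r k)-birk g x (r k)\<bar>/r k<=2 * B * \<bar>t\<bar>/r k"
    by (intro divide_right_mono birkhoff_flow_close[OF g(1) B(2)]) auto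
   moreover have "avg g (r k) (f t x)-avg g (r k) x = (birk g (f t x) (r k)-birk g x (r k))/r k" by (simp add: avg_def diff_divide_distrib)
   hence "\<bar>avg g (r k) (f t x)-avg g (r k) x\<bar> = \<bar>birk g (f t x) (r k)-birk g x (r k)\<bar>/r k" by (simp add: abs_divide)
   moreover have "1/real (Suc j) = 1/(2 * Suc j)+1/Suc (2 * j+1)" by (simp add: field_simps)
   ultimately show ?thesis using jK[of k] k by linarith
  qed
  thus "x\<in>f t -` A" unfolding A_def by blast
 qed
 have inv: "f t -` A = A" for t
 proof
  show "f t -` A\<subseteq>A" using sub[of "- t"] by (auto dest!: subsetD)
 qed (rule sub)
 have A1: "measure m1 A = 0 \<or> measure m1 A = 1" and A2: "measure m2 A = 0 \<or> measure m2 A = 1"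
  using bspec[OF conjunct2[OF m1[unfolded ergodic_measure_def]],of A] bspec[OF conjunct2[OF m2[unfolded ergodic_measure_def]],of A] Ab inv by auto
 have "measure m1 A = 1"
 proof (rule ccontr)
  assume "measure m1 A~=1"
  hence "AE x in m1. x\<notin>A" using A1 Ab by (intro AE_not_in) (auto simp: null_sets_def m1.emeasure_eq_measure)
  hence le: "AE x in m1. lim (%k. avg g (r k) x)<=c" using r(2)
  proof eventually_elim
   case (elim x)
   show ?case
   proof (rule ccontr)
    assume "\<not> lim (%k. avg g (r k) x)<=c"
    hence "lim (%k. avg g (r k) x)-c > 0" by simp
    from nat_approx_posE[OF this] obtain j where j: "1/Suc j < lim (%k. avg g (r k) x)-c" by blast
    have "(%k. avg g (r k) x) \<longlonglongrightarrow> lim (%k. avg g (r k) x)" using elim(2) by (simp add: convergent_LIMSEQ_iff)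
    hence "\<forall>\<^sub>F k in sequentially. c+1/Suc j < avg g (r k) x" by (rule order_tendstoD) (use j in linarith)
    hence "x\<in>A" unfolding A_def eventually_sequentially by (auto intro: less_imp_le)
    thus False using elim(1) by simp
   qed
  qed
  have conv: "AE x in m1. (%k. avg g (r k) x) \<longlonglongrightarrow> lim (%k. avg g (r k) x)"
   using r(2) by eventually_elim (simp add: convergent_LIMSEQ_iff)
  have lm: "(%x. lim (%k. avg g (r k) x))\<in>borel_measurable m1" by (rule borel_measurable_lim_metric) (intro m1.continuous_measurable cavg)
  have am: "avg g (r k)\<in>borel_measurable m1" for k by (intro m1.continuous_measurable cavg)
  have ib: "integrable m1 (%_. B)" by simp
  have bd: "AE x in m1. norm (avg g (r k) x)<=B" for k using avg_abs_le[OF g(1) B(2)] by simp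
  have ii: "integrable m1 (%x. lim (%k. avg g (r k) x))" "(%k. (LINT x|m1. avg g (r k) x)) \<longlonglongrightarrow> (LINT x|m1. lim (%k. avg g (r k) x))"
   by (rule integrable_dominated_convergence[OF lm am ib conv bd], rule integral_dominated_convergence[OF lm am ib conv bd])
  have "\<forall>\<^sub>F k in sequentially. (LINT x|m1. avg g (r k) x) = integral\<^sup>L m1 g"
  proof (rule eventually_sequentiallyI[of 1])
   fix k :: nat assume "k>=1"
   hence "r k>=1" using rk[of k] by simp
   thus "(LINT x|m1. avg g (r k) x) = integral\<^sup>L m1 g" using m1.integral_avg[OF g(1),of UNIV "r k"] by simp
  qed
  from tendsto_unique[OF _ ii(2) tendsto_eventually[OF this]] have "(LINT x|m1. lim (%k. avg g (r k) x)) = integral\<^sup>L m1 g" by simp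
  moreover have "(LINT x|m1. lim (%k. avg g (r k) x))<=(LINT x|m1. c)" by (rule integral_mono_AE[OF ii(1) _ le]) simp
  ultimately show False using c(2) m1.prob_space by simp
 qed
 moreover have "measure m2 A = 0"
 proof (rule ccontr)
  assume "measure m2 A~=0"
  hence one: "measure m2 A = 1" using A2 by simp
  define F where "F K = (\<Inter>k\<in>{K..}. {x. c<=avg g (r k) x})" for K
  have Fb: "F K\<in>sets borel" for K unfolding F_def by (intro borel_closed closed_INT ballI closed_Collect_le continuous_on_const cavg)
  have "(%K. measure m2 (F K)) \<longlonglongrightarrow> measure m2 (\<Union>K. F K)"
   by (rule m2.finite_Lim_measure_incseq) (use Fb in \<open>auto simp: incseq_def F_def\<close>)
  moreover have "A\<subseteq>(\<Union>K. F K)"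
  proof
   fix x assume "x\<in>A"
   then obtain j K where jK: "!!k. k>=K ==> c+1/Suc j<=avg g (r k) x" unfolding A_def by blast
   have "(0 :: real)<=1/Suc j" by simp
   hence "c<=avg g (r k) x" if "k>=K" for k using jK[OF that] by linarith
   thus "x\<in>(\<Union>K. F K)" unfolding F_def by blast
  qed
  hence "measure m2 A<=measure m2 (\<Union>K. F K)" by (rule m2.finite_measure_mono) (use Fb in auto)
  hence "measure m2 (\<Union>K. F K) = 1" using one m2.prob_le_1[of "\<Union>K. F K"] by linarith
  ultimately have lim1: "(%K. measure m2 (F K)) \<longlonglongrightarrow> 1" by simp
  \<comment> \<open>If \<open>A\<close> had full measure, the averages would be at least
    \<open>c\<close> on sets \<open>F K\<close> increasing to full measure, which forces the
    integral of \<open>g\<close> up to \<open>c\<close>.\<close>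
  have ge: "c * measure m2 (F K)-B * (1-measure m2 (F K))<=integral\<^sup>L m2 g" if K: "K>=1" for K
  proof -
   have "(LINT x|m2. c * ind (F K) x-B * ind (- F K) x)<=(LINT x|m2. avg g (r K) x)"
   proof (rule integral_mono)
    fix x
    have "- B<=avg g (r K) x" using avg_abs_le[OF g(1) B(2),of "r K" x] by linarith
    thus "c * ind (F K) x-B * ind (- F K) x<=avg g (r K) x" by (auto simp: F_def indicator_def)
    show "integrable m2 (%x. c * ind (F K) x-B * ind (- F K) x)"
     using Fb by (intro Bochner_Integration.integrable_diff integrable_mult_right integrable_real_indicator) (auto simp: m2.emeasure_eq_measure)
   qed (rule m2.integrable_continuous[OF cavg])
   moreover have "r K>=1" using rk[of K] K by simp
   moreover have "(LINT x|m2. c * ind (F K) x-B * ind (- F K) x) = c * measure m2 (F K)-B * measure m2 (- F K)"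
    using Fb[of K] by (subst Bochner_Integration.integral_diff) (auto simp: m2.emeasure_eq_measure)
   moreover have "measure m2 (- F K) = 1-measure m2 (F K)" using m2.prob_compl[of "F K"] Fb[of K] by (simp add: Compl_eq_Diff_UNIV)
   ultimately show ?thesis using m2.integral_avg[OF g(1),of UNIV "r K"] by simp
  qed
  have "(%K. c * measure m2 (F K)-B * (1-measure m2 (F K))) \<longlonglongrightarrow> c * 1-B * (1-1)" by (intro tendsto_intros lim1)
  hence "c * 1-B * (1-1)<=integral\<^sup>L m2 g" by (rule Lim_bounded) (use ge in blast)
  thus False using c(1) by simp
 qed
 ultimately show thesis using that Ab inv by blast
qed

text \<open>Points of a large set of \<open>m\<close>-measure are separated from \<open>K\<close> within a bounded time, since a point that is never
 separated from some point of \<open>K\<close> is non-expansive.\<close>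
lemma uniform_separation:
 assumes m: "invariant_measure f m" and Z: "Z\<in>sets borel" "NE f \<epsilon>\<subseteq>Z" "measure m Z = 0"
  and A: "A\<in>sets borel" "!!t. f t -` A = A" "measure m A = 1" and K: "compact K" "K\<inter>A = {}"
 obtains J and N :: nat where "J\<in>sets borel" "measure m J>=1/2"
  "!!x y. x\<in>J ==> y\<in>K ==> EX s. \<bar>s\<bar><=real N&\<epsilon> < dist (f s x) (f s y)"
proof -
 interpret compact_inv_flow f m by (rule compact_inv_flowI[OF m])
 have "(1/4 :: real) > 0" by simp
 from borel_inner_regular[OF comp sets_eq prob_space_axioms A(1) this] obtain L where L: "compact L" "L\<subseteq>A" "measure m (A-L) < 1/4" by blast
 have Lb: "L\<in>sets borel" using compact_imp_closed[OF L(1)] by (rule borel_closed)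
 have "measure m (A-L) = measure m A-measure m L" by (rule finite_measure_Diff) (use A Lb L in auto)
 hence mL: "measure m L > 3/4" using L(3) A(3) by simp
 \<comment> \<open>Points of \<open>L\<close> that some point of \<open>K\<close> accompanies within
   \<open>\<epsilon>\<close> over the whole window; as projections of compact sets these are closed,
   and they decrease with \<open>N\<close>.\<close>
 define C where "C N = fst ` ((L\<times>K)\<inter>(\<Inter>s\<in>{- real N..real N}. {z. dist (f s (fst z)) (f s (snd z))<=\<epsilon>}))" for N :: nat
 have Ccl: "closed (C N)" for N
 proof -
  have "closed (\<Inter>s\<in>{- real N..real N}. {z. dist (f s (fst z)) (f s (snd z))<=\<epsilon>})"
   by (intro closed_INT ballI closed_Collect_le continuous_intros f_continuous_compose)
  hence "compact ((L\<times>K)\<inter>(\<Inter>s\<in>{- real N..real N}. {z. dist (f s (fst z)) (f s (snd z))<=\<epsilon>}))"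
   by (intro compact_Int_closed compact_Times L(1) K(1))
  thus ?thesis unfolding C_def by (intro compact_imp_closed compact_continuous_image continuous_intros)
 qed
 have Cb: "C N\<in>sets borel" for N using Ccl by (rule borel_closed)
 have Cmono: "C N'\<subseteq>C N" if "N<=N'" for N N' unfolding C_def using that by (intro image_mono Int_mono subset_refl INT_anti_mono) auto
 have "(\<Inter>N. C N)\<subseteq>Z"
 proof
  fix x assume x: "x\<in>(\<Inter>N. C N)"
  define F where "F N = {y. ALL s:{- real N..real N}. dist (f s x) (f s y)<=\<epsilon>}" for N :: nat
  have xL: "x\<in>L" using x by (auto simp: C_def)
  have ex: "EX y:K. y\<in>F N" for N
  proof -
   have "x\<in>C N" using x by blast
   then obtain y where "y\<in>K" "!!s. s\<in>{- real N..real N} ==> dist (f s x) (f s y)<=\<epsilon>" unfolding C_def by auto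
   thus ?thesis unfolding F_def by blast
  qed
  \<comment> \<open>Compactness of \<open>K\<close> yields one companion for all windows. It is not
    on the orbit of \<open>x\<close>, because \<open>A\<close> is invariant and disjoint from
    \<open>K\<close>.\<close>
  have "K\<inter>(\<Inter>N\<in>UNIV. F N)~={}"
  proof (rule compact_imp_fip_image[OF K(1)])
   show "closed (F N)" for N unfolding F_def by (rule closed_bowen)
   fix I :: "nat set" assume I: "finite I"
   obtain y where y: "y\<in>K" "y\<in>F (Max (insert 0 I))" using ex by blast
   have "y\<in>F N" if "N\<in>I" for N
   proof -
    have "N<=Max (insert 0 I)" using I that by simp
    thus ?thesis using y(2) unfolding F_def by auto
   qed
   thus "K\<inter>(\<Inter>N\<in>I. F N)~={}" using y(1) by blast
  qed
  then obtain y where y: "y\<in>K" "!!N. y\<in>F N" by blast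
  have "dist (f s x) (f s y)<=\<epsilon>" for s
  proof -
   obtain N :: nat where "\<bar>s\<bar><=real N" using real_arch_simple by blast
   thus ?thesis using y(2)[of N] by (auto simp: F_def abs_le_iff)
  qed
  hence "y\<in>Gamma_eps f \<epsilon> x" by (simp add: Gamma_eps_def)
  moreover have "y\<notin>range (%t. f t x)"
  proof
   assume "y\<in>range (%t. f t x)"
   then obtain t where t: "y = f t x" by blast
   have "x\<in>f t -` A" using xL L(2) A(2)[of t] by blast
   thus False using y(1) K(2) t by blast
  qed
  ultimately have "x\<in>NE f \<epsilon>" unfolding NE_def by blast
  thus "x\<in>Z" using Z(2) by blast
 qed
 hence "measure m (\<Inter>N. C N)<=measure m Z" by (rule finite_measure_mono) (use Z in auto)
 hence "measure m (\<Inter>N. C N) = 0" using Z(3) by (simp add: measure_le_0_iff)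
 moreover have "(%N. measure m (C N)) \<longlonglongrightarrow> measure m (\<Inter>N. C N)"
  by (rule finite_Lim_measure_decseq) (use Cb Cmono in \<open>auto simp: decseq_def\<close>)
 ultimately have "(%N. measure m (C N)) \<longlonglongrightarrow> 0" by simp
 hence "\<forall>\<^sub>F N in sequentially. measure m (C N) < 1/4" by (rule order_tendstoD) simp
 then obtain N where N: "measure m (C N) < 1/4" unfolding eventually_sequentially by blast
 show thesis
 proof (rule that[of "L-C N" N])
  have "C N\<subseteq>L" unfolding C_def by auto
  hence "measure m (L-C N) = measure m L-measure m (C N)" by (intro finite_measure_Diff) (use Lb Cb in auto)
  thus "measure m (L-C N)>=1/2" using N mL by linarith
  show "L-C N\<in>sets borel" using Lb Cb by auto
  fix x y assume x: "x\<in>L-C N" and y: "y\<in>K"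
  show "EX s. \<bar>s\<bar><=real N&\<epsilon> < dist (f s x) (f s y)"
  proof (rule ccontr)
   assume "\<not> ?thesis"
   hence "!!s. s\<in>{- real N..real N} ==> dist (f s x) (f s y)<=\<epsilon>" by (force simp: abs_le_iff not_less)
   hence "x\<in>C N" unfolding C_def using x y by (intro image_eqI[of _ _ "(x,y)"]) auto
   thus False using x by blast
  qed
 qed
qed

end

section \<open>Ergodic components of equilibrium states\<close>

context nonuniform
begin

text \<open>Countably many functions \<open>\<eta> j\<close> nearly attain the free energy of
  \<open>\<mu>\<close>. Each \<open>u j\<close> is at most \<open>Pr\<close> with integral above
  \<open>Pr-1/Suc j\<close>, so a fixed deficit of all of them at once is possible only on a null
  set. Working with the \<open>u j\<close> avoids the question whether the free energy of
  \<open>\<nu> x\<close> is measurable in \<open>x\<close>.\<close>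

lemma equilibrium_decomposition:
 assumes \<mu>: "invariant_measure f \<mu>" "free_energy f \<phi> \<mu> = ereal Pr"
 obtains \<nu> :: "'a=>'a measure" where "AE x in \<mu>. ergodic_measure f (\<nu> x)&free_energy f \<phi> (\<nu> x) = ereal Pr"
  "!!g :: 'a=>real. cts g ==> integrable \<mu> (%x. integral\<^sup>L (\<nu> x) g)"
  "!!g :: 'a=>real. cts g ==> (LINT x|\<mu>. g x) = (LINT x|\<mu>. integral\<^sup>L (\<nu> x) g)"
proof -
 interpret compact_inv_flow f \<mu> by (rule compact_inv_flowI[OF \<mu>(1)])
 obtain \<nu> :: "'a=>'a measure" where \<nu>: "!!x. invariant_measure f (\<nu> x)" "AE x in \<mu>. ergodic_measure f (\<nu> x)"
  "!!g :: 'a=>real. cts g ==> integrable \<mu> (%x. integral\<^sup>L (\<nu> x) g)"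
  "!!g :: 'a=>real. cts g ==> (LINT x|\<mu>. g x) = (LINT x|\<mu>. integral\<^sup>L (\<nu> x) g)"
  "!!c :: 'a=>'a set. simple_function \<mu> c ==> integrable \<mu> (%x. hrate f (\<nu> x) c)"
  "!!c :: 'a=>'a set. simple_function \<mu> c ==> hrate f \<mu> c<=(LINT x|\<mu>. hrate f (\<nu> x) c)"
  by (rule entropy_decomposition) (rule that)
 have "\<exists>\<eta> :: 'a=>'a set. simple_function \<mu> \<eta>&Pr-1/Suc j < hrate f \<mu> \<eta>+integral\<^sup>L \<mu> \<phi>" for j
 proof -
  have "ereal (Pr-1/Suc j) < free_energy f \<phi> \<mu>" by (simp add: \<mu>(2))
  from free_energy_witness[OF \<mu>(1) this] show ?thesis by blast
 qed
 then obtain \<eta> :: "nat=>'a=>'a set" where \<eta>: "!!j. simple_function \<mu> (\<eta> j)" "!!j. Pr-1/Suc j < hrate f \<mu> (\<eta> j)+integral\<^sup>L \<mu> \<phi>" by metis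
 define u where "u j x = hrate f (\<nu> x) (\<eta> j)+integral\<^sup>L (\<nu> x) \<phi>" for j x
 have ui: "integrable \<mu> (u j)" for j unfolding u_def by (intro Bochner_Integration.integrable_add \<nu>(3,5) \<phi> \<eta>)
 have uint: "Pr-1/Suc j < (LINT x|\<mu>. u j x)" for j
 proof -
  have "(LINT x|\<mu>. u j x) = (LINT x|\<mu>. hrate f (\<nu> x) (\<eta> j))+(LINT x|\<mu>. integral\<^sup>L (\<nu> x) \<phi>)"
   unfolding u_def by (intro Bochner_Integration.integral_add \<nu>(3,5) \<phi> \<eta>)
  thus ?thesis using \<eta>(2)[of j] \<nu>(6)[OF \<eta>(1),of j] \<nu>(4)[OF \<phi>] by linarith
 qed
 have uF: "ereal (u j x)<=free_energy f \<phi> (\<nu> x)" for j x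
 proof -
  interpret x: compact_inv_flow f "\<nu> x" by (rule compact_inv_flowI[OF \<nu>(1)])
  have "simple_function (\<nu> x) (\<eta> j)" using \<eta>(1)[of j] by (simp add: simple_function_def)
  from x.hrate_le_ks[OF this] show ?thesis unfolding free_energy_def u_def by (cases "ks_entropy f (\<nu> x)") auto
 qed
 have uP: "u j x<=Pr" for j x using order_trans[OF uF free_energy_le[OF \<nu>(1)]] by simp
 have "AE x in \<mu>. \<not> (ALL j. u j x<=Pr-1/Suc i)" for i
 proof -
  define S where "S = {x. ALL j. u j x<=Pr-1/Suc i}"
  have um: "u j\<in>borel_measurable \<mu>" for j using ui by (rule borel_measurable_integrable)
  have "{x\<in>space \<mu>. ALL j. u j x<=Pr-1/Suc i}\<in>sets \<mu>" using um by measurable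
  hence Sb: "S\<in>sets \<mu>" by (simp add: S_def)
  have "measure \<mu> S * (1/Suc i)<=1/Suc j" for j
  proof -
   have "(LINT x|\<mu>. u j x)<=(LINT x|\<mu>. Pr-1/Suc i * ind S x)"
   proof (rule integral_mono[OF ui])
    show "integrable \<mu> (%x. Pr-1/Suc i * ind S x)"
     using Sb by (intro Bochner_Integration.integrable_diff integrable_mult_right integrable_real_indicator) (auto simp: emeasure_eq_measure)
    show "u j x<=Pr-1/Suc i * ind S x" for x using uP[of j x] by (cases "x\<in>S") (auto simp: S_def)
   qed
   also have "\<dots> = Pr-1/Suc i * measure \<mu> S" using Sb prob_space by (subst Bochner_Integration.integral_diff) (auto simp: emeasure_eq_measure)
   finally show ?thesis using uint[of j] by simp
  qed
  hence "measure \<mu> S * (1/Suc i)<=0" by (intro LIMSEQ_le_const[OF LIMSEQ_Suc[OF lim_1_over_n]] exI[of _ 0]) auto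
  hence "measure \<mu> S = 0" by (simp add: divide_le_0_iff measure_le_0_iff)
  hence "AE x in \<mu>. x\<notin>S" using Sb by (intro AE_not_in) (auto simp: null_sets_def emeasure_eq_measure)
  thus ?thesis by (simp add: S_def)
 qed
 hence "AE x in \<mu>. ALL i. \<not> (ALL j. u j x<=Pr-1/Suc i)" by (simp add: AE_all_countable)
 hence "AE x in \<mu>. ergodic_measure f (\<nu> x)&free_energy f \<phi> (\<nu> x) = ereal Pr" using \<nu>(2)
 proof eventually_elim
  case (elim x)
  have "ereal Pr<=free_energy f \<phi> (\<nu> x)"
  proof (rule ccontr)
   assume "\<not> ereal Pr<=free_energy f \<phi> (\<nu> x)"
   then obtain r where r: "free_energy f \<phi> (\<nu> x) = ereal r" "r < Pr" using uF[of 0 x] by (cases "free_energy f \<phi> (\<nu> x)") auto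
   then obtain i where i: "1/Suc i < Pr-r" using nat_approx_posE[of "Pr-r"] by auto
   obtain j where "Pr-1/Suc i < u j x" using elim(1) not_le by blast
   moreover have "u j x<=r" using uF[of j x] r by simp
   ultimately show False using i by linarith
  qed
  thus ?case using elim(2) free_energy_le[OF \<nu>(1)] by (simp add: antisym)
 qed
 thus thesis by (rule that[OF _ \<nu>(3,4)])
qed

end


section \<open>Uniqueness through transitions between invariant sets\<close>

context nonuniform
begin

text \<open>Transitions are counted in the reference measure and not in \<open>m1\<close> or
  \<open>m2\<close>, because gluing gives lower bounds for exactly the weights whose limit it is.
  The measures \<open>m1\<close> and \<open>m2\<close> only supply \<open>V1\<close> and
  \<open>V2\<close>, while the compact cores of \<open>A\<close> and its complement are chosen for
  \<open>\<mu>\<close>.\<close>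

theorem ergodic_equilibrium_unique:
 assumes m1: "ergodic_measure f m1" "free_energy f \<phi> m1 = ereal Pr"
  and m2: "ergodic_measure f m2" "free_energy f \<phi> m2 = ereal Pr"
 shows "m1 = m2"
proof (rule ccontr)
 assume ne: "m1~=m2"
 have inv: "invariant_measure f m1" "invariant_measure f m2" using m1 m2 by (auto simp: ergodic_measure_def)
 interpret m1: compact_inv_flow f m1 by (rule compact_inv_flowI[OF inv(1)])
 interpret m2: compact_inv_flow f m2 by (rule compact_inv_flowI[OF inv(2)])
 obtain c1 where c1: "c1 > 0" "!!n S w. n>=(1 :: nat) ==> measure m1 S>=1/2 ==> cov n \<epsilon> S w ==> c1 * exp (Pr * n)<=w"
  by (rule cover_lower[OF m1(1) eq_refl[OF m1(2)[symmetric]]]) (rule that)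
 obtain c2 where c2: "c2 > 0" "!!n S w. n>=(1 :: nat) ==> measure m2 S>=1/2 ==> cov n \<epsilon> S w ==> c2 * exp (Pr * n)<=w"
  by (rule cover_lower[OF m2(1) eq_refl[OF m2(2)[symmetric]]]) (rule that)
 \<comment> \<open>One constant for both measures, so that the same \<open>M\<close>, and with it
   the same gluing constants, apply to segments of either kind.\<close>
 define c where "c = min c1 c2"
 have c: "c > 0" using c1 c2 by (simp add: c_def)
 have cl: "ALL w. cov (real n) \<epsilon> S w --> c * exp (Pr * n)<=w" if "n>=1" "measure m1 S>=1/2 \<or> measure m2 S>=1/2" for n :: nat and S
 proof (intro allI impI)
  fix w assume w: "cov (real n) \<epsilon> S w"
  have "c * exp (Pr * n)<=c1 * exp (Pr * n)" "c * exp (Pr * n)<=c2 * exp (Pr * n)" by (auto simp: c_def intro!: mult_right_mono)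
  thus "c * exp (Pr * n)<=w" using that(2) c1(2)[OF that(1) _ w] c2(2)[OF that(1) _ w] by linarith
 qed
 obtain M n0 :: nat and c' where c': "c' > 0" "n0>=1" and V: "!!n S V. n>=n0 ==> ALL w. cov (real n) \<epsilon> S w --> c * exp (Pr * n)<=w ==> finite V ==> V\<subseteq>slice (GM (real M)) n ==>
   ALL x:S\<inter>slice (GM (real M)) n. EX y:V. near (real n) (13*\<delta>) y x ==>
   c' * exp (Pr * n)<=(psum V n)" by (rule GM_lower[OF c]) (rule that)
 have r: "13*\<delta> > 0" using \<delta> by simp
 have sel: "EX W. W\<subseteq>S&finite W&W\<subseteq>slice (GM (real M)) (real l)&separated f (real l) (13*\<delta>) W &
   c' * exp (Pr * real l)<=(psum W (real l))"
  if l: "l>=n0" and S: "measure m1 S>=1/2 \<or> measure m2 S>=1/2" for l S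
 proof -
  have "separated f l (13*\<delta>) {}" by (simp add: separated_def)
  then obtain W where W: "W\<subseteq>S\<inter>slice (GM M) l" "finite W" "separated f l (13*\<delta>) W"
   "!!x. x\<in>S\<inter>slice (GM M) l ==> EX y:W. near (real l) (13*\<delta>) y x"
   by (rule maximal_separated[OF r of_nat_0_le_iff empty_subsetI]) (rule that)
  have "c' * exp (Pr * real l)<=(psum W (real l))" by (rule V[OF l cl[OF _ S] W(2)]) (use l c'(2) W(1,4) in auto)
  thus ?thesis using W by blast
 qed
 obtain \<kappa> \<xi> :: real and q R R0 n1 :: nat where \<kappa>: "\<kappa> > 0" "\<xi> > 0" "R>=1" and glue: "!!n a b t U V1 V2 U' E h. n1<=a ==> n1<=b ==> n1<=t ==> n = a+2 * t+b+R0 ==>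
   \<forall>(l,W)\<in>{(a,U),(t,V1),(t,V2),(b,U')}. finite W&W\<subseteq>slice (GM (real M)) (real l)&separated f (real l) (13*\<delta>) W &
    c' * exp (Pr * real l)<=(psum W (real l)) ==>
   finite E ==> separated f (real n) (5*\<delta>) E ==> ALL x. EX y:E. near (real n) (5*\<delta>) y x ==>
   cts h ==> ALL x. 0<=h x ==>
   ALL x d. d<=q&(EX v:V1. near (real t) (13/2*\<delta>) v x) &
    (EX v:V2. near (real t) (13/2*\<delta>) v (f (t+d * \<kappa>) x)) --> 1<=h x ==>
   \<xi>*(psum E (real n))<=(SUM x:E. exp (birk \<phi> x (real n)) * birk h (f (real a) x) (real R))"
  by (rule glue_lower[of "real M",OF _ c'(1)]) (simp, rule that)
 obtain \<mu> :: "'a measure" and F :: "nat filter" and E :: "nat=>'a set" and k0 :: nat and w where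
  F: "F<=sequentially" "F~=bot" and \<mu>: "invariant_measure f \<mu>" "free_energy f \<phi> \<mu> = ereal Pr" and
  E: "!!k. finite (E k)" "!!k. E k~={}" "!!k. separated f (real (k0+k)) (5*\<delta>) (E k)"
  "!!k x. EX y:E k. near (real (k0+k)) (5*\<delta>) y x" and
  w: "!!k x. w k x = exp (birk \<phi> x (real (k0+k)))/(psum (E k) (real (k0+k)))" and
  lim: "!!g :: 'a=>real. cts g ==> ((%k. SUM x:E k. w k x * avg g (k0+k+1) x) \<longlongrightarrow> integral\<^sup>L \<mu> g) F"
  by (rule reference_measure) (rule that)
 interpret \<mu>: compact_inv_flow f \<mu> by (rule compact_inv_flowI[OF \<mu>(1)])
 \<comment> \<open>Each of the \<open>q+1\<close> delays contributes a set of measure below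
   \<open>2*\<eta>\<close>, in total at most \<open>\<xi>/(4 * R)\<close>, half of the lower bound
   that gluing will give.\<close>
 define \<eta> where "\<eta> = \<xi>/(8 * real R * real (q+1))"
 have \<eta>: "\<eta> > 0" unfolding \<eta>_def using \<kappa> by (intro divide_pos_pos mult_pos_pos) (auto simp del: of_nat_add)
 obtain A where A: "A\<in>sets borel" "!!t. f t -` A = A" "measure m1 A = 1" "measure m2 A = 0" by (rule ergodic_separation[OF m1(1) m2(1) ne]) (rule that)
 have Ac: "- A\<in>sets borel" "!!t. f t -` (- A) = - A" "measure m2 (- A) = 1" using A m2.prob_compl[of A] by (auto simp: Compl_eq_Diff_UNIV vimage_Diff)
 obtain K1 where K1: "compact K1" "K1\<subseteq>A" "measure \<mu> (A-K1) < \<eta>" by (rule borel_inner_regular[OF comp \<mu>.sets_eq \<mu>.prob_space_axioms A(1) \<eta>]) (rule that)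
 obtain K2 where K2: "compact K2" "K2\<subseteq>- A" "measure \<mu> (- A-K2) < \<eta>" by (rule borel_inner_regular[OF comp \<mu>.sets_eq \<mu>.prob_space_axioms Ac(1) \<eta>]) (rule that)
 have Kb: "K1\<in>sets borel" "K2\<in>sets borel" using K1 K2 compact_imp_closed by (auto intro: borel_closed)
 obtain Z1 where Z1: "Z1\<in>sets borel" "NE f \<epsilon>\<subseteq>Z1" "measure m1 Z1 = 0" by (rule NE_null_max[OF m1(1) eq_refl[OF m1(2)[symmetric]]]) (rule that)
 obtain Z2 where Z2: "Z2\<in>sets borel" "NE f \<epsilon>\<subseteq>Z2" "measure m2 Z2 = 0" by (rule NE_null_max[OF m2(1) eq_refl[OF m2(2)[symmetric]]]) (rule that)
 have K12: "K2\<inter>A = {}" "K1\<inter>- A = {}" using K1 K2 by auto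
 obtain J1 N1 where J1: "J1\<in>sets borel" "measure m1 J1>=1/2" "!!x y. x\<in>J1 ==> y\<in>K2 ==> EX s. \<bar>s\<bar><=real N1&\<epsilon> < dist (f s x) (f s y)"
  by (rule uniform_separation[OF inv(1) Z1 A(1,2,3) K2(1) K12(1)]) (rule that)
 obtain J2 N2 where J2: "J2\<in>sets borel" "measure m2 J2>=1/2" "!!x y. x\<in>J2 ==> y\<in>K1 ==> EX s. \<bar>s\<bar><=real N2&\<epsilon> < dist (f s x) (f s y)"
  by (rule uniform_separation[OF inv(2) Z2 Ac K1(1) K12(2)]) (rule that)
 define T where "T = N1+N2+n0+n1"
 \<comment> \<open>Separation is observed around the midpoint \<open>T\<close> of a segment of
   length \<open>t\<close>, so separating times up to \<open>T\<close> in either direction stay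
   inside the segment.\<close>
 define t where "t = 2 * T"
 have tn: "t>=n0" "t>=n1" by (auto simp: t_def T_def)
 have "measure m1 (f (real T) -` J1)>=1/2" "measure m2 (f (real T) -` J2)>=1/2" using J1(1,2) J2(1,2) by (simp_all add: m1.prob_flow m2.prob_flow)
 with sel[OF tn(1),of "f T -` J1"] sel[OF tn(1),of "f T -` J2"] obtain V1 V2 where
  V1: "V1\<subseteq>f (real T) -` J1" "finite V1&V1\<subseteq>slice (GM (real M)) (real t)&separated f (real t) (13*\<delta>) V1 &
   c' * exp (Pr * real t)<=(psum V1 (real t))" and
  V2: "V2\<subseteq>f (real T) -` J2" "finite V2&V2\<subseteq>slice (GM (real M)) (real t)&separated f (real t) (13*\<delta>) V2 &
   c' * exp (Pr * real t)<=(psum V2 (real t))" by blast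
 define nb where "nb V = (\<Union>v\<in>V. {x. near (real t) (13/2*\<delta>) v x})" for V
 have nbc: "closed (nb V)" if "finite V" for V unfolding nb_def by (intro closed_UN that ballI closed_bowen)
 have avoid: "f T x\<notin>K" if "x\<in>nb V" and VJ: "V\<subseteq>f (real T) -` J" and J: "!!x y. x\<in>J ==> y\<in>K ==> EX s. \<bar>s\<bar><=real N&\<epsilon> < dist (f s x) (f s y)" and "N<=T"
  for x V J K and N :: nat
 proof
  assume xK: "f T x\<in>K"
  from that(1) obtain v where v: "v\<in>V" "!!s. s\<in>{0..real t} ==> dist (f s v) (f s x)<=13/2*\<delta>" by (auto simp: nb_def)
  have "f T v\<in>J" using v(1) VJ by auto
  from J[OF this xK] obtain s where s: "\<bar>s\<bar><=real N" "\<epsilon> < dist (f s (f T v)) (f s (f T x))" by blast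
  have "s+T\<in>{0..real t}" using s(1) \<open>N <= T\<close> by (auto simp: t_def abs_le_iff)
  from v(2)[OF this] show False using s(2) \<delta> \<epsilon> by (simp add: f_add)
 qed
 \<comment> \<open>A point near \<open>V1\<close> is not in \<open>K2\<close> at time
   \<open>T\<close>, where it would be closer to a point of \<open>J1\<close> than separation
   allows. Outside \<open>A\<close> it is thus in the small set \<open>- A-K2\<close> at that
   time.\<close>
 have B1: "measure \<mu> (nb V1-A) < \<eta>"
 proof -
  have "nb V1-A\<subseteq>f T -` (- A-K2)" using avoid[OF _ V1(1) J1(3)] Ac(2)[of T] by (auto simp: T_def)
  hence "measure \<mu> (nb V1-A)<=measure \<mu> (f T -` (- A-K2))"
   using measurable_sets[OF \<mu>.flow_measurable,of "- A-K2" T] Ac(1) Kb by (intro \<mu>.finite_measure_mono) auto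
  also have "\<dots> = measure \<mu> (- A-K2)" using Ac(1) Kb by (intro \<mu>.prob_flow) auto
  finally show ?thesis using K2(3) by linarith
 qed
 have B2: "measure \<mu> (nb V2\<inter>A) < \<eta>"
 proof -
  have "nb V2\<inter>A\<subseteq>f T -` (A-K1)" using avoid[OF _ V2(1) J2(3)] A(2)[of T] by (auto simp: T_def)
  hence "measure \<mu> (nb V2\<inter>A)<=measure \<mu> (f T -` (A-K1))"
   using measurable_sets[OF \<mu>.flow_measurable,of "A-K1" T] A(1) Kb by (intro \<mu>.finite_measure_mono) auto
  also have "\<dots> = measure \<mu> (A-K1)" using A(1) Kb by (intro \<mu>.prob_flow) auto
  finally show ?thesis using K1(3) by linarith
 qed
 define AA where "AA d = nb V1\<inter>f (t+d * \<kappa>) -` nb V2" for d :: nat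
 have AAc: "closed (AA d)" for d unfolding AA_def using V1(2) V2(2) by (intro closed_Int nbc closed_vimage f_continuous) auto
 \<comment> \<open>A transition either begins outside \<open>A\<close> near \<open>V1\<close> or, by
   invariance of \<open>A\<close>, ends inside \<open>A\<close> near \<open>V2\<close>; both events
   are small.\<close>
 have AAm: "measure \<mu> (AA d) < 2*\<eta>" for d
 proof -
  let ?r = "t+d * \<kappa>"
  have nbb: "nb V1\<in>sets borel" "nb V2\<in>sets borel" using nbc V1(2) V2(2) by (auto intro!: borel_closed)
  have fb: "f ?r -` (nb V2\<inter>A)\<in>sets \<mu>" using measurable_sets[OF \<mu>.flow_measurable,of "nb V2\<inter>A" ?r] nbb A(1) by simp
  have "AA d\<subseteq>(nb V1-A)\<union>f ?r -` (nb V2\<inter>A)" using A(2)[of ?r] unfolding AA_def by blast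
  hence "measure \<mu> (AA d)<=measure \<mu> ((nb V1-A)\<union>f ?r -` (nb V2\<inter>A))" using nbb A(1) fb by (intro \<mu>.finite_measure_mono) auto
  also have "\<dots><=measure \<mu> (nb V1-A)+measure \<mu> (f ?r -` (nb V2\<inter>A))" by (rule measure_Un_le) (use nbb A(1) fb in auto)
  also have "measure \<mu> (f ?r -` (nb V2\<inter>A)) = measure \<mu> (nb V2\<inter>A)" using nbb A(1) by (intro \<mu>.prob_flow) auto
  finally show ?thesis using B1 B2 by linarith
 qed
 \<comment> \<open>The limit defining \<open>\<mu>\<close> tests continuous functions only, so the
   closed sets \<open>AA d\<close> are majorised by continuous functions of nearly the same
   integral.\<close>
 have "EX h :: 'a=>real. cts h&(ALL x. 0<=h x)&(ALL x:AA d. 1<=h x)&integral\<^sup>L \<mu> h < 2*\<eta>" for d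
 proof -
  obtain h :: "nat=>'a=>real" where h: "!!n. cts (h n)" "!!n x. 0<=h n x" "!!n x. h n x<=1"
   "!!n x. ind (AA d) x<=h n x" "!!x. (%n. h n x) \<longlonglongrightarrow> ind (AA d) x" by (rule closed_indicator_limit[OF AAc[of d]]) (rule that)
  have "AA d\<in>sets borel" using AAc by (rule borel_closed)
  from measure_closed_limit[OF \<mu>.sets_eq \<mu>.finite_measure_axioms h(1,2,3,5) this]
  have "\<forall>\<^sub>F n in sequentially. integral\<^sup>L \<mu> (h n) < 2*\<eta>" by (rule order_tendstoD) (rule AAm)
  then obtain n where n: "integral\<^sup>L \<mu> (h n) < 2*\<eta>" unfolding eventually_sequentially by blast
  have "1<=h n x" if "x\<in>AA d" for x using h(4)[of x n] that by simp
  thus ?thesis using h(1,2) n by blast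
 qed
 hence "EX hd :: nat=>'a=>real. ALL d. cts (hd d)&(ALL x. 0<=hd d x)&(ALL x:AA d. 1<=hd d x)&integral\<^sup>L \<mu> (hd d) < 2*\<eta>"
  by (intro choice allI)
 then obtain hd :: "nat=>'a=>real" where hd: "ALL d. cts (hd d)&(ALL x. 0<=hd d x)&(ALL x:AA d. 1<=hd d x)&integral\<^sup>L \<mu> (hd d) < 2*\<eta>" by (rule exE)
 define h where "h x = (\<Sum>d\<le>q. hd d x)" for x
 have hc: "cts h" unfolding h_def using hd by (intro continuous_on_sum) auto
 have h0: "ALL x. 0<=h x" unfolding h_def using hd by (intro allI sum_nonneg) auto
 have h1: "ALL x d. d<=q&(EX v:V1. near (real t) (13/2*\<delta>) v x) &
    (EX v:V2. near (real t) (13/2*\<delta>) v (f (t+d * \<kappa>) x)) --> 1<=h x"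
 proof (intro allI impI, elim conjE)
  fix x d assume d: "d<=q" and v: "EX v:V1. near (real t) (13/2*\<delta>) v x"
    "EX v:V2. near (real t) (13/2*\<delta>) v (f (t+d * \<kappa>) x)"
  have "x\<in>AA d" unfolding AA_def nb_def using v by blast
  hence "1<=hd d x" using hd by blast
  also have "\<dots><=h x" unfolding h_def by (rule member_le_sum) (use d hd in auto)
  finally show "1<=h x" .
 qed
 have hint: "integral\<^sup>L \<mu> h < \<xi>/(2 * R)"
 proof -
  have "integral\<^sup>L \<mu> h = (\<Sum>d\<le>q. integral\<^sup>L \<mu> (hd d))" unfolding h_def
   by (rule Bochner_Integration.integral_sum) (use hd \<mu>.integrable_continuous in blast)
  also have "\<dots><=(\<Sum>d\<le>q. 2*\<eta>)" by (rule sum_mono) (use hd in \<open>auto intro: less_imp_le\<close>)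
  also have "\<dots> = \<xi>/(4 * R)"
  proof -
   have "X * (2*(\<xi>/(8 * Y * X))) = \<xi>/(4 * Y)" if "X~=0" "Y~=0" for X Y :: real using that by (simp add: field_simps)
   from this[of "real (q+1)" "real R"] show ?thesis using \<kappa>(3) by (simp add: \<eta>_def)
  qed
  also have "\<dots> < \<xi>/(2 * R)" using \<kappa> by (intro divide_strict_left_mono) auto
  finally show ?thesis .
 qed
 have "ALL l. EX W. l>=n0 --> finite W&W\<subseteq>slice (GM (real M)) (real l)&separated f (real l) (13*\<delta>) W &
   c' * exp (Pr * real l)<=(psum W (real l))"
 proof
  fix l
  have "measure m1 UNIV>=1/2" using m1.prob_space by simp
  thus "EX W. l>=n0 --> finite W&W\<subseteq>slice (GM (real M)) (real l)&separated f (real l) (13*\<delta>) W &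
   c' * exp (Pr * real l)<=(psum W (real l))" using sel[of l UNIV] by blast
 qed
 from choice[OF this] obtain U where U: "!!l. l>=n0 ==> finite (U l)&U l\<subseteq>slice (GM (real M)) (real l)&separated f (real l) (13*\<delta>) (U l) &
   c' * exp (Pr * real l)<=(SUM x:U l. exp (birk \<phi> x (real l)))" by blast
 define n2 where "n2 = n0+n1"
 define D' where "D' = 2 * n2+2 * t+R0"
 have low: "\<xi>/(2 * R)<=(SUM x:E k. w k x * avg h (k0+k+1) x)" if k: "k>=2 * D'+2 * R+1" for k
 proof -
  define n where "n = k0+k"
  have n: "n>=2 * D'+2 * R+1" using k by (simp add: n_def)
  \<comment> \<open>The number of disjoint time slots of length \<open>R\<close> in which the
    transition may be placed. The prefix lengths \<open>n2+j * R\<close> run through them, and the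
    suffix length is adjusted to keep the total equal to \<open>n\<close>.\<close>
  define Nj where "Nj = (n-D') div R"
  let ?e = "%x. exp (birk \<phi> x (real n))"
  define W where "W = (SUM x:E k. ?e x)"
  have W0: "W > 0" unfolding W_def using E(1,2) by (intro sum_pos) auto
  have NjR: "Nj * R<=n-D'" unfolding Nj_def by simp
  have slot: "\<xi> * W<=(SUM x:E k. ?e x * birk h (f (real (n2+j * R)) x) R)" if j: "j < Nj" for j
  proof -
   have "(j+1) * R<=Nj * R" using j by (intro mult_le_mono1) simp
   hence jR: "j * R+R+D'<=n" using NjR n by simp
   define b where "b = n-(n2+j * R)-2 * t-R0"
   have b: "n2<=b" "n = (n2+j * R)+2 * t+b+R0" using jR unfolding b_def D'_def by linarith+
   show ?thesis unfolding W_def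
   proof (rule glue[OF _ _ tn(2) b(2) _ E(1) _ _ hc h0 h1])
    show "\<forall>(l,W)\<in>{(n2+j * R,U (n2+j * R)),(t,V1),(t,V2),(b,U b)}. finite W&W\<subseteq>slice (GM (real M)) (real l)&separated f (real l) (13*\<delta>) W &
     c' * exp (Pr * real l)<=(psum W (real l))" using V1(2) V2(2) U[of "n2+j * R"] U[of b] b(1) unfolding n2_def by simp
    show "separated f (real n) (5*\<delta>) (E k)" "ALL x. EX y:E k. near (real n) (5*\<delta>) y x" using E(3,4)[of k] unfolding n_def by auto
   qed (use b(1) in \<open>auto simp: n2_def\<close>)
  qed
  have tele: "(\<Sum>j<J. birk h (f (real (n2+j * R)) x) R) = birk h (f (real n2) x) (real (J * R))" for J x
  proof (induction J)
   case (Suc J)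
   have "birk h (f (real n2) x) (real (J * R)+real R) = birk h (f (real n2) x) (real (J * R))+birk h (f (real (J * R)) (f (real n2) x)) (real R)"
    by (rule birkhoff_add[OF hc]) auto
   moreover have "f (real (J * R)) (f (real n2) x) = f (real (n2+J * R)) x" by (simp add: f_add[symmetric] add.commute)
   ultimately show ?case using Suc by (simp add: algebra_simps)
  qed simp
  have bh0: "0<=birk h x r" for x r unfolding birkhoff_int_def using h0 by (intro Henstock_Kurzweil_Integration.integral_nonneg birkhoff_integrable[OF hc]) auto
  have up: "(\<Sum>j<Nj. birk h (f (real (n2+j * R)) x) R)<=birk h x (real (n+1))" for x
  proof -
   have le: "n2+Nj * R<=n+1" using NjR n unfolding D'_def by simp
   hence "real (n+1) = real n2+(real (Nj * R)+real (n+1-(n2+Nj * R)))" by simp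
   hence "birk h x (real (n+1)) = birk h x (real n2)+(birk h (f (real n2) x) (real (Nj * R))
    + birk h (f (real (Nj * R)) (f (real n2) x)) (real (n+1-(n2+Nj * R))))" by (simp only: birkhoff_add[OF hc] of_nat_0_le_iff add_nonneg_nonneg)
   thus ?thesis unfolding tele using bh0[of x "real n2"] bh0[of "f (real (Nj * R)) (f (real n2) x)" "real (n+1-(n2+Nj * R))"] by linarith
  qed
  have "Nj * (\<xi> * W) = (\<Sum>j<Nj. \<xi> * W)" by simp
  also have "\<dots><=(\<Sum>j<Nj. SUM x:E k. ?e x * birk h (f (real (n2+j * R)) x) R)" by (rule sum_mono) (use slot in auto)
  also have "\<dots> = (SUM x:E k. ?e x * (\<Sum>j<Nj. birk h (f (real (n2+j * R)) x) R))" by (subst sum.swap) (simp add: sum_distrib_left)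
  also have "\<dots><=(SUM x:E k. ?e x * birk h x (real (n+1)))" by (intro sum_mono mult_left_mono up) auto
  finally have key: "Nj * (\<xi> * W)<=(SUM x:E k. ?e x * birk h x (real (n+1)))" .
  have "(SUM x:E k. w k x * avg h (k0+k+1) x) = (SUM x:E k. ?e x * birk h x (real (n+1)))/(W * (n+1))"
   unfolding w sum_divide_distrib avg_def n_def W_def by (intro sum.cong refl) simp
  moreover have "Nj * (\<xi> * W)/(W * (n+1))<=(SUM x:E k. ?e x * birk h x (real (n+1)))/(W * (n+1))" using W0 by (intro divide_right_mono key) auto
  moreover have "Nj * (\<xi> * W)/(W * (n+1)) = \<xi>*(Nj/(n+1))" using W0 by simp
  \<comment> \<open>The condition on \<open>k\<close> lets the slots fill at least half of the
    averaging interval.\<close>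
  moreover have "1/(2 * R)<=Nj/(n+1)"
  proof -
   have "(n-D') mod R < R" using \<kappa>(3) by simp
   moreover have "n-D' = Nj * R+(n-D') mod R" unfolding Nj_def by simp
   ultimately have "n+1<=2*(Nj * R)" using n by linarith
   hence "n+1<=Nj * (2 * R)" by simp
   hence "real (n+1)<=real (Nj * (2 * R))" by (simp only: of_nat_le_iff)
   thus ?thesis using \<kappa>(3) by (simp add: pos_divide_le_eq pos_le_divide_eq field_simps)
  qed
  hence "\<xi>*(1/(2 * R))<=\<xi>*(Nj/(n+1))" using \<kappa> by (intro mult_left_mono) auto
  ultimately show ?thesis by simp
 qed
 have "\<xi>/(2 * R)<=integral\<^sup>L \<mu> h" by (rule tendsto_lowerbound[OF lim[OF hc] _ F(2)]) (intro filter_leD[OF F(1)] eventually_sequentiallyI low)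
 thus False using hint by simp
qed

text \<open>Almost all components of an equilibrium state are ergodic equilibrium states, hence one
  and the same measure, and their mixture equals it.\<close>

corollary equilibrium_unique: "\<exists>!\<mu>. equilibrium_state f \<phi> \<mu>"
proof -
 obtain \<mu>0 :: "'a measure" where \<mu>0: "invariant_measure f \<mu>0" "free_energy f \<phi> \<mu>0 = ereal Pr" by (rule reference_measure) (rule that)
 have erg: "EX m. ergodic_measure f m&free_energy f \<phi> m = ereal Pr&\<mu> = m" if \<mu>: "invariant_measure f \<mu>" "free_energy f \<phi> \<mu> = ereal Pr" for \<mu>
 proof -
  interpret compact_inv_flow f \<mu> by (rule compact_inv_flowI[OF \<mu>(1)])
  obtain \<nu> :: "'a=>'a measure" where \<nu>: "AE x in \<mu>. ergodic_measure f (\<nu> x)&free_energy f \<phi> (\<nu> x) = ereal Pr"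
   "!!g :: 'a=>real. cts g ==> integrable \<mu> (%x. integral\<^sup>L (\<nu> x) g)"
   "!!g :: 'a=>real. cts g ==> (LINT x|\<mu>. g x) = (LINT x|\<mu>. integral\<^sup>L (\<nu> x) g)"
   by (rule equilibrium_decomposition[OF \<mu>]) (rule that)
  have "EX x. ergodic_measure f (\<nu> x)&free_energy f \<phi> (\<nu> x) = ereal Pr"
  proof (rule ccontr)
   assume none: "\<not> ?thesis"
   have "AE x in \<mu>. False" using \<nu>(1) by eventually_elim (use none in blast)
   thus False by (simp add: AE_False)
  qed
  then obtain x0 where x0: "ergodic_measure f (\<nu> x0)" "free_energy f \<phi> (\<nu> x0) = ereal Pr" by blast
  interpret x: compact_inv_flow f "\<nu> x0" using x0(1) by (intro compact_inv_flowI) (simp add: ergodic_measure_def)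
  have eq: "AE x in \<mu>. \<nu> x = \<nu> x0" using \<nu>(1) by eventually_elim (rule ergodic_equilibrium_unique, use x0 in auto)
  have "\<mu> = \<nu> x0"
  proof (rule finite_measure_eqI_continuous)
   fix g :: "'a=>real" assume g: "cts g"
   have "AE x in \<mu>. integral\<^sup>L (\<nu> x) g = integral\<^sup>L (\<nu> x0) g" using eq by eventually_elim simp
   hence "(LINT x|\<mu>. integral\<^sup>L (\<nu> x) g) = (LINT x|\<mu>. integral\<^sup>L (\<nu> x0) g)"
    by (rule integral_cong_AE[OF borel_measurable_integrable[OF \<nu>(2)[OF g]] borel_measurable_const])
   thus "integral\<^sup>L \<mu> g = integral\<^sup>L (\<nu> x0) g" using \<nu>(3)[OF g] prob_space by simp
  qed (simp_all add: finite_measure_axioms x.finite_measure_axioms)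
  thus ?thesis using x0 by blast
 qed
 show ?thesis
 proof (rule ex1I[of _ \<mu>0])
  show "equilibrium_state f \<phi> \<mu>0" using \<mu>0 by (simp add: equilibrium_iff)
  fix \<mu> assume "equilibrium_state f \<phi> \<mu>"
  hence "invariant_measure f \<mu>" "free_energy f \<phi> \<mu> = ereal Pr" by (auto simp: equilibrium_iff)
  from erg[OF this] erg[OF \<mu>0] show "\<mu> = \<mu>0" using ergodic_equilibrium_unique by blast
 qed
qed

end

theorem theorem2p8:
  fixes f :: "real \<Rightarrow> 'a::metric_space \<Rightarrow> 'a"
    and \<phi> :: "'a \<Rightarrow> real"
    and \<delta> \<epsilon> :: real
    and D P G S :: "('a \<times> real) set"
    and p g s :: "'a \<times> real \<Rightarrow> real"
  assumes "compact (UNIV :: 'a set)"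
    and "continuous_flow f"
    and "continuous_on UNIV \<phi>"
    and "\<delta> > 0" and "\<epsilon> > 40 * \<delta>"
    and "P_perp_exp f \<phi> \<epsilon> < top_pressure f \<phi>"
    and "decomposition f D P G S p g s"
    and "\<forall>M\<ge>0. tail_W_spec f (G_M D p s M) \<delta>"
    and "bowen_property f \<phi> \<epsilon> G"
    and "pressure_C f ((orbit_segments - D) \<union> bracket f P \<union> bracket f S) \<phi> \<delta> \<epsilon>
           < top_pressure f \<phi>"
  shows "\<exists>!\<mu>. equilibrium_state f \<phi> \<mu>"
proof -
  interpret nonuniform f \<phi> \<delta> \<epsilon> D P G S p g s
    by unfold_locales (use assms in auto)
  show ?thesis by (rule equilibrium_unique)
qed

end
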